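(* Let $s=k+\theta$ where $k\in\mathbb{N}$ and $\theta\in(0,1)$, and let $p\in(1,\infty)$. Let $U$ and $V$ be two nonempty open sets in $\mathbb{R}^n$. Let $T:U\to V$ be a Lipschitz continuous $k$-smooth map on $U$ such that the partial derivatives up to and including order $k$ of all the components of $T$ are Lipschitz continuous on $U$ as well. Then: 1. For each compact $K\subseteq V$ the linear map $T^*:W^{s,p}_K(V)\to W^{s,p}_{T^{-1}(K)}(U)$, $u\mapsto u\circ T$, is well defined and bounded. 2. If we further assume that $V$ is Lipschitz (and so $U$ is Lipschitz), the linear map $T^*:W^{s,p}(V)\to W^{s,p}(U)$, $u\mapsto u\circ T$, is well defined and bounded.
   Context: A Lipschitz domain is a nonempty bounded open set in $\mathbb{R}^n$ with Lipschitz continuous boundary. $\mathbb{N}$ denotes the positive integers. $BC^k(\Omega)$ is the set of $f\in C^k(\Omega)$ with $\partial^\alpha f$ bounded on $\Omega$ for all $|\alpha|\le k$. A bijective map $T:U\to V$ between open subsets of $\mathbb{R}^n$ is $k$-smooth if all components of $T$ belong to $BC^k(U)$ and all components of $T^{-1}$ belong to $BC^k(V)$. For nonempty open $\Omega\subseteq\mathbb{R}^n$: $\|u\|_{W^{k,p}(\Omega)}=\sum_{|\nu|\le k}\|\partial^\nu u\|_{L^p(\Omega)}$, and for $s=k+\theta$, $\theta\in(0,1)$, $\|u\|_{W^{s,p}(\Omega)}=\|u\|_{W^{k,p}(\Omega)}+\sum_{|\nu|=k}\big(\iint_{\Omega\times\Omega}\frac{|\partial^\nu u(x)-\partial^\nu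 u(y)|^p}{|x-y|^{n+\theta p}}dx\,dy\big)^{1/p}$; $W^{s,p}(\Omega)$ is the set of $u\in L^p(\Omega)$ with finite norm, and $W^{s,p}_K(\Omega)$ is the subspace of those $u$ with support in the compact set $K\subseteq\Omega$, with the same norm. *)

theory Defs
  imports "HOL-Analysis.Analysis"
begin

section \<open>Classical derivatives\<close>

text \<open>Multi-indices are functions on the coordinate type. The index type carries no order, so an
  enumeration of the coordinates is fixed by choice; \<open>\<partial>\<^sup>\<nu>\<close> is the composition of the powers of the
  coordinate derivatives in that order. The order is irrelevant for functions of class \<open>C\<^sup>k\<close>
  with \<open>|\<nu>| \<le> k\<close>.\<close>

definition mi_order :: "('n::finite \<Rightarrow> nat) \<Rightarrow> nat" where
  "mi_order \<nu> = (\<Sum>i\<in>UNIV. \<nu> i)"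

definition coords :: "'n::finite list" where
  "coords = (SOME is. distinct is \<and> set is = UNIV)"

definition partial_deriv :: "'n::finite \<Rightarrow> (real^'n \<Rightarrow> real) \<Rightarrow> real^'n \<Rightarrow> real" where
  "partial_deriv i f x = frechet_derivative f (at x) (axis i 1)"

definition mi_deriv :: "('n::finite \<Rightarrow> nat) \<Rightarrow> (real^'n \<Rightarrow> real) \<Rightarrow> real^'n \<Rightarrow> real" where
  "mi_deriv \<nu> f = foldr (\<lambda>i. partial_deriv i ^^ \<nu> i) coords f"

lemma finite_mi_order_le: "finite {\<nu>::'n::finite \<Rightarrow> nat. mi_order \<nu> \<le> k}"
proof (rule finite_subset)
  have le: "\<nu> i \<le> mi_order \<nu>" for \<nu> :: "'n \<Rightarrow> nat" and i
    unfolding mi_order_def by (rule member_le_sum) simp_all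
  show "{\<nu>::'n \<Rightarrow> nat. mi_order \<nu> \<le> k} \<subseteq> UNIV \<rightarrow>\<^sub>E {..k}"
  proof
    fix \<nu> :: "'n \<Rightarrow> nat"
    assume "\<nu> \<in> {\<nu>. mi_order \<nu> \<le> k}"
    then have "mi_order \<nu> \<le> k"
      by simp
    then show "\<nu> \<in> UNIV \<rightarrow>\<^sub>E {..k}"
      using le[of \<nu>] order_trans by (intro PiE_I) (blast, simp)
  qed
  show "finite ((UNIV :: 'n set) \<rightarrow>\<^sub>E {..k})"
    by (rule finite_PiE) simp_all
qed

text \<open>The predicates below are used for open sets only, so derivatives on \<open>\<Omega>\<close> do not depend on the
  values of the function outside \<open>\<Omega>\<close>.\<close>

primrec Ck_on :: "nat \<Rightarrow> (real^'n::finite) set \<Rightarrow> (real^'n \<Rightarrow> real) \<Rightarrow> bool" where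
  "Ck_on 0 \<Omega> f \<longleftrightarrow> continuous_on \<Omega> f"
| "Ck_on (Suc k) \<Omega> f \<longleftrightarrow> f differentiable_on \<Omega> \<and> (\<forall>i. Ck_on k \<Omega> (partial_deriv i f))"

definition BCk_on :: "nat \<Rightarrow> (real^'n::finite) set \<Rightarrow> (real^'n \<Rightarrow> real) \<Rightarrow> bool" where
  "BCk_on k \<Omega> f \<longleftrightarrow> Ck_on k \<Omega> f \<and> (\<forall>\<nu>. mi_order \<nu> \<le> k \<longrightarrow> bounded (mi_deriv \<nu> f ` \<Omega>))"

definition k_smooth ::
  "nat \<Rightarrow> (real^'n::finite) set \<Rightarrow> (real^'n) set \<Rightarrow> (real^'n \<Rightarrow> real^'n) \<Rightarrow> bool" where
  "k_smooth k U V T \<longleftrightarrow> bij_betw T U V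
     \<and> (\<forall>j. BCk_on k U (\<lambda>x. T x $ j))
     \<and> (\<forall>j. BCk_on k V (\<lambda>y. inv_into U T y $ j))"


section \<open>Lipschitz domains\<close>

text \<open>Near each boundary point the set is the strict epigraph of a Lipschitz function. The rotated
  coordinate system is given by its last axis, the unit vector \<open>e\<close>; the function lives on
  the hyperplane orthogonal to \<open>e\<close>.\<close>

definition lipschitz_boundary :: "(real^'n::finite) set \<Rightarrow> bool" where
  "lipschitz_boundary \<Omega> \<longleftrightarrow> (\<forall>x\<in>frontier \<Omega>. \<exists>r>0. \<exists>e \<gamma> L. norm e = 1
     \<and> L-lipschitz_on {z. z \<bullet> e = 0} \<gamma>
     \<and> \<Omega> \<inter> ball x r = {y \<in> ball x r. \<gamma> (y - (y \<bullet> e) *\<^sub>R e) < y \<bullet> e})"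

definition lipschitz_domain :: "(real^'n::finite) set \<Rightarrow> bool" where
  "lipschitz_domain \<Omega> \<longleftrightarrow> \<Omega> \<noteq> {} \<and> bounded \<Omega> \<and> open \<Omega> \<and> lipschitz_boundary \<Omega>"


section \<open>Lebesgue spaces and weak derivatives\<close>

text \<open>Elements of function spaces on \<open>\<Omega>\<close> are represented by total functions of which only the values
  on \<open>\<Omega>\<close> matter, identified up to equality almost everywhere on \<open>\<Omega>\<close>.\<close>

definition AE_eq_on :: "(real^'n::finite) set \<Rightarrow> (real^'n \<Rightarrow> real) \<Rightarrow> (real^'n \<Rightarrow> real) \<Rightarrow> bool" where
  "AE_eq_on \<Omega> u v \<longleftrightarrow> (AE x in lebesgue_on \<Omega>. u x = v x)"

definition ennreal_powr :: "ennreal \<Rightarrow> real \<Rightarrow> ennreal" where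
  "ennreal_powr x r = (if x = \<infinity> then \<infinity> else ennreal (enn2real x powr r))"

definition Lp_norm :: "real \<Rightarrow> (real^'n::finite) set \<Rightarrow> (real^'n \<Rightarrow> real) \<Rightarrow> ennreal" where
  "Lp_norm p \<Omega> f = ennreal_powr (\<integral>\<^sup>+ x. ennreal (\<bar>f x\<bar> powr p) \<partial>lebesgue_on \<Omega>) (1 / p)"

definition Lp_space :: "real \<Rightarrow> (real^'n::finite) set \<Rightarrow> (real^'n \<Rightarrow> real) set" where
  "Lp_space p \<Omega> = {f \<in> borel_measurable (lebesgue_on \<Omega>). Lp_norm p \<Omega> f < \<infinity>}"

definition L1_loc :: "(real^'n::finite) set \<Rightarrow> (real^'n \<Rightarrow> real) set" where
  "L1_loc \<Omega> = {f. \<forall>K. compact K \<and> K \<subseteq> \<Omega> \<longrightarrow> integrable (lebesgue_on K) f}"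

definition test_fun :: "(real^'n::finite) set \<Rightarrow> (real^'n \<Rightarrow> real) set" where
  "test_fun \<Omega> = {\<phi>. (\<forall>m. Ck_on m UNIV \<phi>)
     \<and> compact (closure {x. \<phi> x \<noteq> 0}) \<and> closure {x. \<phi> x \<noteq> 0} \<subseteq> \<Omega>}"

definition has_weak_deriv ::
  "(real^'n::finite) set \<Rightarrow> ('n \<Rightarrow> nat) \<Rightarrow> (real^'n \<Rightarrow> real) \<Rightarrow> (real^'n \<Rightarrow> real) \<Rightarrow> bool" where
  "has_weak_deriv \<Omega> \<nu> u g \<longleftrightarrow> u \<in> L1_loc \<Omega> \<and> g \<in> L1_loc \<Omega>
     \<and> (\<forall>\<phi>\<in>test_fun \<Omega>. (LINT x|lebesgue_on \<Omega>. u x * mi_deriv \<nu> \<phi> x)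
          = (-1) ^ mi_order \<nu> * (LINT x|lebesgue_on \<Omega>. g x * \<phi> x))"

text \<open>Weak derivatives are unique up to null sets; a representative is chosen.\<close>

definition weak_deriv ::
  "(real^'n::finite) set \<Rightarrow> ('n \<Rightarrow> nat) \<Rightarrow> (real^'n \<Rightarrow> real) \<Rightarrow> (real^'n \<Rightarrow> real)" where
  "weak_deriv \<Omega> \<nu> u = (SOME g. has_weak_deriv \<Omega> \<nu> u g)"


section \<open>Sobolev-Slobodeckij spaces\<close>

text \<open>The norm is infinite if some derivative of order at most \<open>k\<close> is not (represented by) a
  locally integrable function.\<close>

definition sobolev_norm_int ::
  "nat \<Rightarrow> real \<Rightarrow> (real^'n::finite) set \<Rightarrow> (real^'n \<Rightarrow> real) \<Rightarrow> ennreal" where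
  "sobolev_norm_int k p \<Omega> u =
     (if \<forall>\<nu>. mi_order \<nu> \<le> k \<longrightarrow> (\<exists>g. has_weak_deriv \<Omega> \<nu> u g)
      then \<Sum>\<nu> | mi_order \<nu> \<le> k. Lp_norm p \<Omega> (weak_deriv \<Omega> \<nu> u) else \<infinity>)"

text \<open>The integrand is \<open>0\<close> on the diagonal, a null set, by the convention \<open>x / 0 = 0\<close>.\<close>

definition slobodeckij_seminorm ::
  "real \<Rightarrow> real \<Rightarrow> (real^'n::finite) set \<Rightarrow> (real^'n \<Rightarrow> real) \<Rightarrow> ennreal" where
  "slobodeckij_seminorm \<theta> p \<Omega> f = ennreal_powr
     (\<integral>\<^sup>+ (x, y). ennreal (\<bar>f x - f y\<bar> powr p / norm (x - y) powr (real CARD('n) + \<theta> * p))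
        \<partial>(lebesgue_on \<Omega> \<Otimes>\<^sub>M lebesgue_on \<Omega>)) (1 / p)"

text \<open>For real \<open>s \<ge> 0\<close>, with \<open>k\<close> the integral and \<open>\<theta>\<close> the fractional part of \<open>s\<close>.\<close>

definition sobolev_norm ::
  "real \<Rightarrow> real \<Rightarrow> (real^'n::finite) set \<Rightarrow> (real^'n \<Rightarrow> real) \<Rightarrow> ennreal" where
  "sobolev_norm s p \<Omega> u = (let k = nat \<lfloor>s\<rfloor>; \<theta> = frac s in
     sobolev_norm_int k p \<Omega> u +
     (if \<theta> = 0 then 0
      else \<Sum>\<nu> | mi_order \<nu> = k. slobodeckij_seminorm \<theta> p \<Omega> (weak_deriv \<Omega> \<nu> u)))"

definition sobolev_space ::
  "real \<Rightarrow> real \<Rightarrow> (real^'n::finite) set \<Rightarrow> (real^'n \<Rightarrow> real) set" where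
  "sobolev_space s p \<Omega> = {u \<in> Lp_space p \<Omega>. sobolev_norm s p \<Omega> u < \<infinity>}"

text \<open>The support of a class of functions: the complement in \<open>\<Omega>\<close> of the largest open set on which
  the class vanishes.\<close>

definition ess_support :: "(real^'n::finite) set \<Rightarrow> (real^'n \<Rightarrow> real) \<Rightarrow> (real^'n) set" where
  "ess_support \<Omega> u = \<Omega> - \<Union>{W. open W \<and> W \<subseteq> \<Omega> \<and> AE_eq_on W u (\<lambda>_. 0)}"

definition sobolev_space_supp ::
  "real \<Rightarrow> real \<Rightarrow> (real^'n::finite) set \<Rightarrow> (real^'n) set \<Rightarrow> (real^'n \<Rightarrow> real) set" where
  "sobolev_space_supp s p \<Omega> K = {u \<in> sobolev_space s p \<Omega>. ess_support \<Omega> u \<subseteq> K}"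

text \<open>\<open>A\<close>, given on representatives, induces a well-defined bounded linear map from the classes of
  functions on \<open>\<Omega>\<close> belonging to \<open>X\<close> to those on \<open>\<Omega>'\<close> belonging to \<open>Y\<close>.\<close>

definition well_defined_bounded_linear ::
  "(real^'n::finite) set \<Rightarrow> (real^'n \<Rightarrow> real) set \<Rightarrow> ((real^'n \<Rightarrow> real) \<Rightarrow> ennreal) \<Rightarrow>
   (real^'n) set \<Rightarrow> (real^'n \<Rightarrow> real) set \<Rightarrow> ((real^'n \<Rightarrow> real) \<Rightarrow> ennreal) \<Rightarrow>
   ((real^'n \<Rightarrow> real) \<Rightarrow> (real^'n \<Rightarrow> real)) \<Rightarrow> bool" where
  "well_defined_bounded_linear \<Omega> X normX \<Omega>' Y normY A \<longleftrightarrow>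
     (\<forall>u\<in>X. A u \<in> Y)
     \<and> (\<forall>u\<in>X. \<forall>v\<in>X. AE_eq_on \<Omega> u v \<longrightarrow> AE_eq_on \<Omega>' (A u) (A v))
     \<and> (\<forall>u\<in>X. \<forall>v\<in>X. \<forall>a b. AE_eq_on \<Omega>' (A (\<lambda>x. a * u x + b * v x)) (\<lambda>x. a * A u x + b * A v x))
     \<and> (\<exists>C::real. \<forall>u\<in>X. normY (A u) \<le> ennreal C * normX u)"

end

theory Submission
  imports Defs
begin

text \<open>By the chain rule, a derivative of \<open>u \<circ> T\<close> of order at most \<open>k\<close> is a sum of terms
  \<open>(\<partial>\<^sup>\<beta> u \<circ> T) P\<close> with \<open>|\<beta>| \<le> k\<close>, where \<open>P\<close> is a polynomial in derivatives of \<open>T\<close>. Each differentiation of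
  such a term costs one derivative of its coefficient. Since all derivatives of \<open>T\<close> up to order \<open>k\<close> are
  bounded and Lipschitz, the coefficients that occur are bounded and Lipschitz as well
  (\<open>weak_deriv_comp\<close>). For weak derivatives the chain rule is obtained by approximation:
  mollification yields \<open>C\<^sup>1\<close> functions that converge to \<open>u\<close> together with their first derivatives in \<open>L\<^sup>1\<close>
  on compact sets (\<open>approximate_by_C1\<close>), and composition with \<open>T\<close> preserves this convergence because
  the preimage of a set under \<open>T\<close> has at most \<open>J\<close> times its volume (\<open>distr_T_le\<close>).

  It remains to bound \<open>(f \<circ> T) P\<close> in terms of \<open>f\<close>. The \<open>L\<^sup>p\<close> norm is bounded by change of variables. For
  the Gagliardo integral, the factor \<open>f \<circ> T\<close> uses only that \<open>T\<close> is Lipschitz (\<open>Gag_comp_le\<close>). The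
  factor \<open>P\<close> produces the additional integrand \<open>|f y|\<^sup>p |P x - P y|\<^sup>p / |x - y|\<^sup>n\<^sup>+\<^sup>\<theta>\<^sup>p\<close>, which is controlled by
  the \<open>L\<^sup>p\<close> norm of \<open>f\<close> because \<open>|P x - P y|\<close> is at most a multiple of \<open>min 1 |x - y|\<close>
  (\<open>Gag_mult_le\<close>).

  These estimates need the Gagliardo integrals of all derivatives \<open>\<partial>\<^sup>\<beta> u\<close> with \<open>|\<beta>| \<le> k\<close>, whereas the norm
  of \<open>u\<close> contains only those with \<open>|\<beta>| = k\<close>. For \<open>|\<beta>| < k\<close> they are supplied by an embedding of
  \<open>W\<^sup>1\<^sup>,\<^sup>p(V)\<close> into \<open>W\<^sup>\<theta>\<^sup>,\<^sup>p(V)\<close>. It fails on general open sets, and this is the reason for the two cases of the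
  theorem. The Gagliardo integral is the integral of \<open>|z|\<^sup>-\<^sup>n\<^sup>-\<^sup>\<theta>\<^sup>p\<close> times the \<open>p\<close>-th power of the \<open>L\<^sup>p\<close> norm of
  \<open>u(\<cdot> + z) - u\<close>, and for small \<open>z\<close> this norm is at most a multiple of \<open>|z|\<close> times that of the gradient,
  provided that \<open>x\<close> and \<open>x + z\<close> can be joined in \<open>V\<close> by a path made of few segments whose lengths are
  at most a multiple of \<open>|z|\<close>. If \<open>u\<close> has compact support, then a single segment suffices
  (\<open>Gag_embedding_compact_support\<close>); in a Lipschitz domain there are two segments that meet above
  \<open>x\<close> and \<open>x + z\<close> (\<open>Gag_embedding_lipschitz_domain\<close>).

  Finally, \<open>U\<close> is a Lipschitz domain if \<open>V\<close> is one: a Lipschitz boundary is characterised by a uniform cone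
  condition, and cones are pulled back through \<open>T\<close>, since its derivative is Lipschitz and its
  inverse has a bounded derivative (\<open>upward_cone_pullback\<close>).\<close>

section \<open>Partial derivatives\<close>

lemma partial_deriv_eqI:
  fixes f :: "real^'n::finite \<Rightarrow> real"
  assumes "(f has_derivative D) (at x)"
  shows "partial_deriv i f x = D (axis i 1)"
  using frechet_derivative_at[OF assms] by (simp add: partial_deriv_def)

lemma partial_deriv_cong_open:
  fixes f :: "real^'n::finite \<Rightarrow> real"
  assumes "open \<Omega>" "x \<in> \<Omega>" "\<And>y. y \<in> \<Omega> \<Longrightarrow> f y = g y"
  shows "partial_deriv i f x = partial_deriv i g x"
proof -
  have "(f has_derivative D) (at x) \<longleftrightarrow> (g has_derivative D) (at x)" for D
    using has_derivative_transform_within_open[of f D x UNIV \<Omega> g]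
      has_derivative_transform_within_open[of g D x UNIV \<Omega> f] assms by auto
  then show ?thesis
    by (simp add: partial_deriv_def frechet_derivative_def)
qed

lemma differentiable_on_cong_open:
  fixes f :: "real^'n::finite \<Rightarrow> real"
  assumes "open \<Omega>" "\<And>y. y \<in> \<Omega> \<Longrightarrow> f y = g y" "f differentiable_on \<Omega>"
  shows "g differentiable_on \<Omega>"
  using assms unfolding differentiable_on_def differentiable_def
  by (metis has_derivative_transform)

lemma has_derivative_partial_deriv:
  fixes f :: "real^'n::finite \<Rightarrow> real"
  assumes "f differentiable (at x)"
  shows "(f has_derivative (\<lambda>h. \<Sum>i\<in>UNIV. h $ i * partial_deriv i f x)) (at x)"
proof -
  let ?D = "frechet_derivative f (at x)"
  have D: "(f has_derivative ?D) (at x)"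
    using assms frechet_derivative_works by blast
  then have lin: "linear ?D"
    by (rule has_derivative_linear)
  have "?D h = (\<Sum>i\<in>UNIV. h $ i * partial_deriv i f x)" for h
  proof -
    have "?D h = ?D (\<Sum>i\<in>UNIV. h $ i *\<^sub>R axis i 1)"
      by (simp add: basis_expansion flip: scalar_mult_eq_scaleR)
    also have "\<dots> = (\<Sum>i\<in>UNIV. h $ i * partial_deriv i f x)"
      by (simp add: linear_sum[OF lin] linear_cmul[OF lin] partial_deriv_def)
    finally show ?thesis .
  qed
  then have "?D = (\<lambda>h. \<Sum>i\<in>UNIV. h $ i * partial_deriv i f x)"
    by blast
  with D show ?thesis
    by simp
qed

lemma has_real_derivative_along_axis:
  fixes f :: "real^'n::finite \<Rightarrow> real"
  assumes "f differentiable (at (y + s *\<^sub>R axis i 1))"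
  shows "((\<lambda>s. f (y + s *\<^sub>R axis i 1)) has_real_derivative
           partial_deriv i f (y + s *\<^sub>R axis i 1)) (at s)"
proof -
  let ?D = "frechet_derivative f (at (y + s *\<^sub>R axis i 1))"
  have D: "(f has_derivative ?D) (at (y + s *\<^sub>R axis i 1))"
    using assms frechet_derivative_works by blast
  have "((\<lambda>s. f (y + s *\<^sub>R axis i 1)) has_derivative (\<lambda>t. ?D (t *\<^sub>R axis i 1))) (at s)"
    using D by (intro has_derivative_compose[of "\<lambda>s. y + s *\<^sub>R axis i 1" _ s UNIV f]) (auto intro!: derivative_eq_intros)
  moreover have "?D (t *\<^sub>R axis i 1) = partial_deriv i f (y + s *\<^sub>R axis i 1) * t" for t
    by (simp add: partial_deriv_def linear_cmul[OF has_derivative_linear[OF D]])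
  ultimately show ?thesis
    by (simp add: has_field_derivative_def)
qed

lemma partial_deriv_add:
  assumes "f differentiable (at x)" "g differentiable (at x)"
  shows "partial_deriv i (\<lambda>x. f x + g x) x = partial_deriv i f x + partial_deriv i g x"
proof -
  have "((\<lambda>x. f x + g x) has_derivative
     (\<lambda>h. frechet_derivative f (at x) h + frechet_derivative g (at x) h)) (at x)"
    using assms frechet_derivative_works by (intro has_derivative_add) blast+
  from partial_deriv_eqI[OF this, of i] show ?thesis
    by (simp add: partial_deriv_def)
qed

lemma partial_deriv_mult:
  assumes "f differentiable (at x)" "g differentiable (at x)"
  shows "partial_deriv i (\<lambda>x. f x * g x) x
    = partial_deriv i f x * g x + f x * partial_deriv i g x"
proof -
  have "((\<lambda>x. f x * g x) has_derivative
     (\<lambda>h. f x * frechet_derivative g (at x) h + frechet_derivative f (at x) h * g x)) (at x)"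
    using assms frechet_derivative_works by (intro has_derivative_mult) blast+
  from partial_deriv_eqI[OF this, of i] show ?thesis
    by (simp add: partial_deriv_def)
qed

lemma differentiable_on_open_at:
  "open \<Omega> \<Longrightarrow> f differentiable_on \<Omega> \<Longrightarrow> x \<in> \<Omega> \<Longrightarrow> f differentiable (at x)"
  by (metis differentiable_on_eq_differentiable_at)

subsection \<open>Symmetry of second derivatives\<close>

text \<open>The second difference of \<open>f\<close> over a square of side \<open>h\<close> is symmetric in the two
  directions, and two applications of the mean value theorem express it through a value of either
  mixed derivative near the corner.\<close>

lemma second_difference_eq_mixed_deriv:
  fixes f :: "real^'n::finite \<Rightarrow> real"
  assumes "0 < h"
    and d1: "\<And>s t. 0 \<le> s \<Longrightarrow> s \<le> h \<Longrightarrow> 0 \<le> t \<Longrightarrow> t \<le> h \<Longrightarrow>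
      f differentiable (at (x + s *\<^sub>R axis i 1 + t *\<^sub>R axis j 1))"
    and d2: "\<And>s t. 0 \<le> s \<Longrightarrow> s \<le> h \<Longrightarrow> 0 \<le> t \<Longrightarrow> t \<le> h \<Longrightarrow>
      partial_deriv i f differentiable (at (x + s *\<^sub>R axis i 1 + t *\<^sub>R axis j 1))"
  obtains s t where "0 < s" "s < h" "0 < t" "t < h"
    "f (x + h *\<^sub>R axis i 1 + h *\<^sub>R axis j 1) - f (x + h *\<^sub>R axis i 1) - f (x + h *\<^sub>R axis j 1) + f x
      = h\<^sup>2 * partial_deriv j (partial_deriv i f) (x + s *\<^sub>R axis i 1 + t *\<^sub>R axis j 1)"
proof -
  let ?a = "axis i 1 :: real^'n" and ?b = "axis j 1 :: real^'n"
  let ?\<phi> = "\<lambda>s. f (x + h *\<^sub>R ?b + s *\<^sub>R ?a) - f (x + s *\<^sub>R ?a)"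
  have "DERIV ?\<phi> s :> partial_deriv i f (x + h *\<^sub>R ?b + s *\<^sub>R ?a) - partial_deriv i f (x + s *\<^sub>R ?a)"
    if "0 \<le> s" "s \<le> h" for s
  proof (intro DERIV_diff has_real_derivative_along_axis)
    show "f differentiable (at (x + h *\<^sub>R ?b + s *\<^sub>R ?a))"
      using d1[of s h] that \<open>0 < h\<close> by (simp add: algebra_simps)
    show "f differentiable (at (x + s *\<^sub>R ?a))"
      using d1[of s 0] that \<open>0 < h\<close> by simp
  qed
  from MVT2[OF \<open>0 < h\<close> this] obtain s where s: "0 < s" "s < h"
    and 1: "?\<phi> h - ?\<phi> 0 = h * (partial_deriv i f (x + h *\<^sub>R ?b + s *\<^sub>R ?a) - partial_deriv i f (x + s *\<^sub>R ?a))"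
    by auto
  have "DERIV (\<lambda>t. partial_deriv i f (x + s *\<^sub>R ?a + t *\<^sub>R ?b)) t :>
      partial_deriv j (partial_deriv i f) (x + s *\<^sub>R ?a + t *\<^sub>R ?b)" if "0 \<le> t" "t \<le> h" for t
    using d2[of s t] that s by (intro has_real_derivative_along_axis) simp
  from MVT2[OF \<open>0 < h\<close> this] obtain t where t: "0 < t" "t < h"
    and 2: "partial_deriv i f (x + s *\<^sub>R ?a + h *\<^sub>R ?b) - partial_deriv i f (x + s *\<^sub>R ?a + 0 *\<^sub>R ?b)
      = h * partial_deriv j (partial_deriv i f) (x + s *\<^sub>R ?a + t *\<^sub>R ?b)"
    by auto
  have "f (x + h *\<^sub>R ?a + h *\<^sub>R ?b) - f (x + h *\<^sub>R ?a) - f (x + h *\<^sub>R ?b) + f x = ?\<phi> h - ?\<phi> 0"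
    by (simp add: algebra_simps)
  also have "\<dots> = h\<^sup>2 * partial_deriv j (partial_deriv i f) (x + s *\<^sub>R ?a + t *\<^sub>R ?b)"
    unfolding 1 using 2 by (simp add: algebra_simps power2_eq_square)
  finally show ?thesis
    using that s t by blast
qed

lemma partial_deriv_commute:
  fixes f :: "real^'n::finite \<Rightarrow> real"
  assumes "open \<Omega>" and f: "Ck_on 2 \<Omega> f" and "x \<in> \<Omega>"
  shows "partial_deriv i (partial_deriv j f) x = partial_deriv j (partial_deriv i f) x"
proof (rule ccontr)
  let ?ij = "partial_deriv i (partial_deriv j f)" and ?ji = "partial_deriv j (partial_deriv i f)"
  assume "?ij x \<noteq> ?ji x"
  then have pos: "\<bar>?ij x - ?ji x\<bar> / 2 > 0" (is "?e > 0")
    by simp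
  have d: "f differentiable_on \<Omega>" "\<And>i. partial_deriv i f differentiable_on \<Omega>"
    and c: "\<And>i j. continuous_on \<Omega> (partial_deriv i (partial_deriv j f))"
    using f by (auto simp: numeral_2_eq_2)
  note diff = differentiable_on_open_at[OF \<open>open \<Omega>\<close> d(1)] differentiable_on_open_at[OF \<open>open \<Omega>\<close> d(2)]
  have "isCont ?ij x" "isCont ?ji x"
    using c \<open>open \<Omega>\<close> \<open>x \<in> \<Omega>\<close> by (metis continuous_on_eq_continuous_at)+
  then obtain d1 d2 where "d1 > 0" "d2 > 0"
    and d1: "\<And>y. dist y x < d1 \<Longrightarrow> dist (?ij y) (?ij x) < ?e"
    and d2: "\<And>y. dist y x < d2 \<Longrightarrow> dist (?ji y) (?ji x) < ?e"
    using pos unfolding continuous_at_eps_delta by metis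
  obtain d0 where "d0 > 0" and d0: "ball x d0 \<subseteq> \<Omega>"
    using \<open>open \<Omega>\<close> \<open>x \<in> \<Omega>\<close> open_contains_ball by blast
  define h where "h = min d0 (min d1 d2) / 3"
  have h: "0 < h" "2 * h < d0" "2 * h < d1" "2 * h < d2"
    using \<open>d0 > 0\<close> \<open>d1 > 0\<close> \<open>d2 > 0\<close> by (auto simp: h_def min_def field_simps)
  have near: "dist (x + s *\<^sub>R axis i' 1 + t *\<^sub>R axis j' 1) x \<le> 2 * h"
    if "0 \<le> s" "s \<le> h" "0 \<le> t" "t \<le> h" for s t and i' j' :: 'n
  proof -
    have "dist (x + s *\<^sub>R axis i' 1 + t *\<^sub>R axis j' 1) x = norm (s *\<^sub>R axis i' 1 + t *\<^sub>R axis j' 1 :: real^'n)"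
      by (simp add: dist_norm)
    also have "\<dots> \<le> s + t"
      using that norm_triangle_ineq[of "s *\<^sub>R axis i' 1" "t *\<^sub>R axis j' 1 :: real^'n"]
      by simp
    finally show ?thesis
      using that by simp
  qed
  then have in\<Omega>: "x + s *\<^sub>R axis i' 1 + t *\<^sub>R axis j' 1 \<in> \<Omega>"
    if "0 \<le> s" "s \<le> h" "0 \<le> t" "t \<le> h" for s t and i' j' :: 'n
  proof -
    have "dist (x + s *\<^sub>R axis i' 1 + t *\<^sub>R axis j' 1) x < d0"
      using near[OF that, of i' j'] h by linarith
    then show ?thesis
      using d0 by (auto simp: dist_commute)
  qed
  let ?\<Delta> = "f (x + h *\<^sub>R axis i 1 + h *\<^sub>R axis j 1) - f (x + h *\<^sub>R axis i 1) - f (x + h *\<^sub>R axis j 1) + f x"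
  obtain s t where st: "0 < s" "s < h" "0 < t" "t < h"
    and 1: "?\<Delta> = h\<^sup>2 * ?ji (x + s *\<^sub>R axis i 1 + t *\<^sub>R axis j 1)"
    by (rule second_difference_eq_mixed_deriv[of h f x i j]) (use h in\<Omega> diff in auto)
  obtain s' t' where st': "0 < s'" "s' < h" "0 < t'" "t' < h"
    and 2: "f (x + h *\<^sub>R axis j 1 + h *\<^sub>R axis i 1) - f (x + h *\<^sub>R axis j 1) - f (x + h *\<^sub>R axis i 1) + f x
       = h\<^sup>2 * ?ij (x + s' *\<^sub>R axis j 1 + t' *\<^sub>R axis i 1)"
    by (rule second_difference_eq_mixed_deriv[of h f x j i]) (use h in\<Omega> diff in auto)
  have "h\<^sup>2 * ?ij (x + s' *\<^sub>R axis j 1 + t' *\<^sub>R axis i 1) = ?\<Delta>"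
    unfolding 2[symmetric] by (simp add: algebra_simps)
  then have "?ij (x + s' *\<^sub>R axis j 1 + t' *\<^sub>R axis i 1) = ?ji (x + s *\<^sub>R axis i 1 + t *\<^sub>R axis j 1)"
    using 1 h by simp
  moreover have "dist (?ij (x + s' *\<^sub>R axis j 1 + t' *\<^sub>R axis i 1)) (?ij x) < ?e"
    using near[of s' t' j i] st' h by (intro d1) simp
  moreover have "dist (?ji (x + s *\<^sub>R axis i 1 + t *\<^sub>R axis j 1)) (?ji x) < ?e"
    using near[of s t i j] st h by (intro d2) simp
  ultimately show False
    by (simp add: dist_real_def abs_if field_simps split: if_splits)
qed

subsection \<open>Iterated partial derivatives\<close>

abbreviation pderivs :: "'n::finite list \<Rightarrow> (real^'n \<Rightarrow> real) \<Rightarrow> real^'n \<Rightarrow> real" where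
  "pderivs \<equiv> foldr partial_deriv"

lemma Ck_on_SucD: "Ck_on (Suc m) \<Omega> f \<Longrightarrow> Ck_on m \<Omega> f"
proof (induction m arbitrary: f)
  case 0
  then show ?case
    by (simp add: differentiable_imp_continuous_on)
next
  case (Suc m)
  then show ?case
    by (metis Ck_on.simps(2))
qed

lemma Ck_on_mono: "Ck_on m \<Omega> f \<Longrightarrow> l \<le> m \<Longrightarrow> Ck_on l \<Omega> f"
  by (induction m) (use Ck_on_SucD le_Suc_eq in blast)+

lemma Ck_on_pderivs: "Ck_on (length xs + m) \<Omega> f \<Longrightarrow> Ck_on m \<Omega> (pderivs xs f)"
proof (induction xs arbitrary: m)
  case (Cons i xs)
  from Cons.IH[of "Suc m"] Cons.prems have "Ck_on (Suc m) \<Omega> (pderivs xs f)"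
    by (simp del: Ck_on.simps)
  then show ?case
    by simp
qed simp

lemma pderivs_move_front:
  assumes "open \<Omega>" "Ck_on (length ys + length zs + 1) \<Omega> f" "x \<in> \<Omega>"
  shows "pderivs (ys @ a # zs) f x = pderivs (a # ys @ zs) f x"
  using assms(2,3)
proof (induction ys arbitrary: x)
  case (Cons b ys)
  have C: "Ck_on 2 \<Omega> (pderivs (ys @ zs) f)"
    using Cons.prems by (intro Ck_on_pderivs) (simp add: numeral_2_eq_2)
  have "pderivs ((b # ys) @ a # zs) f x = partial_deriv b (pderivs (ys @ a # zs) f) x"
    by simp
  also have "\<dots> = partial_deriv b (partial_deriv a (pderivs (ys @ zs) f)) x"
  proof (rule partial_deriv_cong_open[OF \<open>open \<Omega>\<close> \<open>x \<in> \<Omega>\<close>])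
    fix y assume "y \<in> \<Omega>"
    then show "pderivs (ys @ a # zs) f y = partial_deriv a (pderivs (ys @ zs) f) y"
      using Cons.IH[of y] Cons.prems Ck_on_SucD[of "length ys + length zs + 1" \<Omega> f] by simp
  qed
  also have "\<dots> = partial_deriv a (partial_deriv b (pderivs (ys @ zs) f)) x"
    by (rule partial_deriv_commute[OF \<open>open \<Omega>\<close> C \<open>x \<in> \<Omega>\<close>])
  finally show ?case
    by simp
qed simp

text \<open>An iterated derivative depends only on how often each coordinate occurs. This makes the order
  of the coordinates chosen for \<open>mi_deriv\<close> irrelevant and allows induction on the order of a multi-index.\<close>

lemma pderivs_perm:
  assumes "open \<Omega>" "mset xs = mset ys" "Ck_on (length xs) \<Omega> f" "x \<in> \<Omega>"
  shows "pderivs xs f x = pderivs ys f x"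
  using assms(2-4)
proof (induction xs arbitrary: ys x)
  case (Cons a xs)
  have "a \<in> set ys"
    using mset_eq_setD[OF Cons.prems(1)] by auto
  then obtain ys1 ys2 where ys: "ys = ys1 @ a # ys2"
    using split_list[of a ys] by blast
  then have eq: "mset xs = mset (ys1 @ ys2)"
    using Cons.prems by simp
  then have len: "length xs = length ys1 + length ys2"
    by (metis length_append size_mset)
  have "pderivs (a # xs) f x = partial_deriv a (pderivs xs f) x"
    by simp
  also have "\<dots> = partial_deriv a (pderivs (ys1 @ ys2) f) x"
    using Cons.prems Cons.IH[OF eq] Ck_on_SucD[of "length xs" \<Omega> f]
    by (intro partial_deriv_cong_open[OF \<open>open \<Omega>\<close> \<open>x \<in> \<Omega>\<close>]) simp
  also have "\<dots> = pderivs ys f x"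
    using Cons.prems pderivs_move_front[OF \<open>open \<Omega>\<close>, of ys1 ys2 f x a] len ys by simp
  finally show ?case .
qed simp

text \<open>The coordinates to be differentiated, in the order used by \<open>mi_deriv\<close>; a multi-index is thus
  turned into a word, on which partial derivatives act one letter at a time.\<close>

definition mi_list :: "('n::finite \<Rightarrow> nat) \<Rightarrow> 'n list" where
  "mi_list \<nu> = concat (map (\<lambda>i. replicate (\<nu> i) i) coords)"

definition mi_unit :: "'n \<Rightarrow> 'n \<Rightarrow> nat" where
  "mi_unit i j = (if j = i then 1 else 0)"

lemma coords: "distinct (coords :: 'n::finite list)" "set (coords :: 'n list) = UNIV"
proof -
  have "\<exists>is :: 'n list. distinct is \<and> set is = UNIV"
    using finite_distinct_list[of "UNIV :: 'n set"] by auto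
  then have "distinct (coords :: 'n list) \<and> set (coords :: 'n list) = UNIV"
    unfolding coords_def by (rule someI_ex)
  then show "distinct (coords :: 'n::finite list)" "set (coords :: 'n list) = UNIV"
    by auto
qed

lemma mi_deriv_eq_pderivs: "mi_deriv \<nu> f = pderivs (mi_list \<nu>) f"
proof -
  have rep: "pderivs (replicate m i) g = (partial_deriv i ^^ m) g" for m i and g :: "real^'a::finite \<Rightarrow> real"
    by (induction m) auto
  have "foldr (\<lambda>i. partial_deriv i ^^ \<nu> i) xs f = pderivs (concat (map (\<lambda>i. replicate (\<nu> i) i) xs)) f" for xs
    by (induction xs) (auto simp: rep)
  then show ?thesis
    by (simp add: mi_deriv_def mi_list_def)
qed

lemma count_mi_list: "count (mset (mi_list \<nu>)) i = \<nu> i"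
proof -
  have "count (mset (concat (map (\<lambda>i. replicate (\<nu> i) i) xs))) i = (if i \<in> set xs then \<nu> i else 0)"
    if "distinct xs" for xs
    using that by (induction xs) auto
  from this[OF coords(1)] show ?thesis
    by (simp add: mi_list_def coords)
qed

lemma length_mi_list: "length (mi_list \<nu>) = mi_order \<nu>"
  by (simp add: mi_list_def mi_order_def length_concat comp_def coords sum_list_distinct_conv_sum_set)

lemma mi_order_unit [simp]: "mi_order (mi_unit i) = 1"
  by (simp add: mi_order_def mi_unit_def)

lemma mi_order_add [simp]: "mi_order (\<lambda>j. \<nu> j + \<mu> j) = mi_order \<nu> + mi_order \<mu>"
  by (simp add: mi_order_def sum.distrib)

lemma mi_order_0: "mi_order \<nu> = 0 \<longleftrightarrow> \<nu> = (\<lambda>_. 0)"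
  by (auto simp: mi_order_def)

lemma mi_order_Suc_cases:
  assumes "mi_order \<nu> = Suc m"
  obtains i \<mu> where "mi_order \<mu> = m" "\<nu> = (\<lambda>j. \<mu> j + mi_unit i j)"
proof -
  obtain i where "\<nu> i > 0"
    using assms mi_order_0[of \<nu>] by fastforce
  let ?\<mu> = "\<lambda>j. \<nu> j - mi_unit i j"
  have eq: "\<nu> = (\<lambda>j. ?\<mu> j + mi_unit i j)"
    using \<open>\<nu> i > 0\<close> by (auto simp: mi_unit_def)
  have "mi_order (\<lambda>j. ?\<mu> j + mi_unit i j) = mi_order ?\<mu> + 1"
    unfolding mi_order_add by simp
  with assms have "mi_order ?\<mu> = m"
    unfolding eq[symmetric] by simp
  with eq that show thesis
    by blast
qed

lemma mi_list_zero [simp]: "mi_list (\<lambda>_. 0) = []"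
  by (simp add: mi_list_def)

lemma mi_deriv_zero [simp]: "mi_deriv (\<lambda>_. 0) f = f"
  by (simp add: mi_deriv_eq_pderivs)

lemma mset_mi_list_add_unit: "mset (mi_list (\<lambda>j. \<nu> j + mi_unit i j)) = add_mset i (mset (mi_list \<nu>))"
  by (rule multiset_eqI) (simp add: count_mi_list mi_unit_def)

lemma mi_list_unit: "mi_list (mi_unit i) = [i]"
proof -
  have "mset (mi_list (mi_unit i)) = {#i#}"
    using mset_mi_list_add_unit[of "\<lambda>_. 0" i] by simp
  then show ?thesis
    by simp
qed

lemma mi_deriv_unit: "mi_deriv (mi_unit i) f = partial_deriv i f"
  by (simp add: mi_deriv_eq_pderivs mi_list_unit)

lemma mi_deriv_add_unit:
  assumes "open \<Omega>" "Ck_on (Suc (mi_order \<nu>)) \<Omega> f" "x \<in> \<Omega>"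
  shows "mi_deriv (\<lambda>j. \<nu> j + mi_unit i j) f x = mi_deriv \<nu> (partial_deriv i f) x"
proof -
  have "pderivs (mi_list (\<lambda>j. \<nu> j + mi_unit i j)) f x = pderivs (mi_list \<nu> @ [i]) f x"
    using assms by (intro pderivs_perm[of \<Omega>]) (simp_all add: mset_mi_list_add_unit length_mi_list)
  then show ?thesis
    by (simp add: mi_deriv_eq_pderivs)
qed

subsection \<open>Functions with bounded Lipschitz derivatives\<close>

text \<open>The coefficients of the chain rule: differentiable functions all of whose derivatives up to
  order \<open>m\<close> are bounded and Lipschitz.\<close>

primrec bdd_lip_deriv :: "nat \<Rightarrow> (real^'n::finite) set \<Rightarrow> (real^'n \<Rightarrow> real) \<Rightarrow> bool" where
  "bdd_lip_deriv 0 \<Omega> f \<longleftrightarrow> bounded (f ` \<Omega>) \<and> (\<exists>L. L-lipschitz_on \<Omega> f)"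
| "bdd_lip_deriv (Suc m) \<Omega> f \<longleftrightarrow> bounded (f ` \<Omega>) \<and> (\<exists>L. L-lipschitz_on \<Omega> f)
     \<and> f differentiable_on \<Omega> \<and> (\<forall>i. bdd_lip_deriv m \<Omega> (partial_deriv i f))"

lemma bdd_lip_deriv_SucD: "bdd_lip_deriv (Suc m) \<Omega> f \<Longrightarrow> bdd_lip_deriv m \<Omega> f"
proof (induction m arbitrary: f)
  case (Suc m)
  then show ?case
    by (metis bdd_lip_deriv.simps(2))
qed simp

lemma bdd_lip_deriv_mono: "bdd_lip_deriv m \<Omega> f \<Longrightarrow> l \<le> m \<Longrightarrow> bdd_lip_deriv l \<Omega> f"
  by (induction m) (use bdd_lip_deriv_SucD le_Suc_eq in blast)+

lemma bdd_lip_deriv_cong: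
  assumes "open \<Omega>" "\<And>x. x \<in> \<Omega> \<Longrightarrow> f x = g x" "bdd_lip_deriv m \<Omega> f"
  shows "bdd_lip_deriv m \<Omega> g"
  using assms(2,3)
proof (induction m arbitrary: f g)
  case 0
  then show ?case
    by (auto cong: image_cong simp: lipschitz_on_def)
next
  case (Suc m)
  have "bdd_lip_deriv m \<Omega> (partial_deriv i g)" for i
  proof (rule Suc.IH)
    show "partial_deriv i f x = partial_deriv i g x" if "x \<in> \<Omega>" for x
      using that Suc.prems(1) by (rule partial_deriv_cong_open[OF \<open>open \<Omega>\<close>])
  qed (use Suc.prems(2) in simp)
  then show ?case
    using Suc.prems differentiable_on_cong_open[OF \<open>open \<Omega>\<close>]
    by (auto cong: image_cong simp: lipschitz_on_def)
qed

lemma bdd_lip_add: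
  assumes "bounded (f ` \<Omega>) \<and> (\<exists>L. L-lipschitz_on \<Omega> f)" "bounded (g ` \<Omega>) \<and> (\<exists>L. L-lipschitz_on \<Omega> g)"
  shows "bounded ((\<lambda>x. f x + g x :: real) ` \<Omega>) \<and> (\<exists>L. L-lipschitz_on \<Omega> (\<lambda>x. f x + g x))"
  using assms bounded_plus_comp[of f \<Omega> g] lipschitz_on_add by blast

lemma bdd_lip_mult:
  fixes f g :: "'a::metric_space \<Rightarrow> real"
  assumes "bounded (f ` \<Omega>) \<and> (\<exists>L. L-lipschitz_on \<Omega> f)" "bounded (g ` \<Omega>) \<and> (\<exists>L. L-lipschitz_on \<Omega> g)"
  shows "bounded ((\<lambda>x. f x * g x) ` \<Omega>) \<and> (\<exists>L. L-lipschitz_on \<Omega> (\<lambda>x. f x * g x))"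
proof -
  obtain B C L M where B: "\<And>x. x \<in> \<Omega> \<Longrightarrow> \<bar>f x\<bar> \<le> B" and C: "\<And>x. x \<in> \<Omega> \<Longrightarrow> \<bar>g x\<bar> \<le> C"
    and L: "L-lipschitz_on \<Omega> f" and M: "M-lipschitz_on \<Omega> g"
    using assms by (fastforce simp: bounded_iff)
  have L0: "L \<ge> 0" "M \<ge> 0"
    using L M by (auto simp: lipschitz_on_def)
  have "\<bar>f x * g x\<bar> \<le> \<bar>B\<bar> * \<bar>C\<bar>" if "x \<in> \<Omega>" for x
    unfolding abs_mult using B[OF that] C[OF that] by (intro mult_mono) auto
  then have 1: "bounded ((\<lambda>x. f x * g x) ` \<Omega>)"
    by (auto simp: bounded_iff)
  have "(\<bar>B\<bar> * M + \<bar>C\<bar> * L)-lipschitz_on \<Omega> (\<lambda>x. f x * g x)"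
  proof (rule lipschitz_onI)
    fix x y assume xy: "x \<in> \<Omega>" "y \<in> \<Omega>"
    have "f x * g x - f y * g y = f x * (g x - g y) + g y * (f x - f y)"
      by (simp add: algebra_simps)
    then have "dist (f x * g x) (f y * g y) \<le> \<bar>f x\<bar> * dist (g x) (g y) + \<bar>g y\<bar> * dist (f x) (f y)"
      by (metis abs_mult abs_triangle_ineq dist_real_def)
    also have "\<dots> \<le> \<bar>B\<bar> * (M * dist x y) + \<bar>C\<bar> * (L * dist x y)"
      using B[OF xy(1)] C[OF xy(2)] lipschitz_onD[OF L xy] lipschitz_onD[OF M xy]
      by (intro add_mono mult_mono) auto
    finally show "dist (f x * g x) (f y * g y) \<le> (\<bar>B\<bar> * M + \<bar>C\<bar> * L) * dist x y"
      by (simp add: algebra_simps)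
  qed (use L0 in simp)
  with 1 show ?thesis
    by blast
qed

lemma bdd_lip_deriv_add:
  assumes "open \<Omega>" "bdd_lip_deriv m \<Omega> f" "bdd_lip_deriv m \<Omega> g"
  shows "bdd_lip_deriv m \<Omega> (\<lambda>x. f x + g x)"
  using assms(2,3)
proof (induction m arbitrary: f g)
  case 0
  then show ?case
    using bdd_lip_add[of f \<Omega> g] by simp
next
  case (Suc m)
  have "bdd_lip_deriv m \<Omega> (partial_deriv i (\<lambda>x. f x + g x))" for i
  proof (rule bdd_lip_deriv_cong[OF \<open>open \<Omega>\<close>])
    show "bdd_lip_deriv m \<Omega> (\<lambda>x. partial_deriv i f x + partial_deriv i g x)"
      using Suc by simp
    show "partial_deriv i f x + partial_deriv i g x = partial_deriv i (\<lambda>x. f x + g x) x"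
      if "x \<in> \<Omega>" for x
      using Suc.prems that differentiable_on_open_at[OF \<open>open \<Omega>\<close>]
      by (intro partial_deriv_add[symmetric]) auto
  qed
  then show ?case
    using Suc.prems bdd_lip_add[of f \<Omega> g] by (auto intro: derivative_intros)
qed

lemma bdd_lip_deriv_mult:
  assumes "open \<Omega>" "bdd_lip_deriv m \<Omega> f" "bdd_lip_deriv m \<Omega> g"
  shows "bdd_lip_deriv m \<Omega> (\<lambda>x. f x * g x)"
  using assms(2,3)
proof (induction m arbitrary: f g)
  case 0
  then show ?case
    using bdd_lip_mult[of f \<Omega> g] by simp
next
  case (Suc m)
  have "bdd_lip_deriv m \<Omega> (partial_deriv i (\<lambda>x. f x * g x))" for i
  proof (rule bdd_lip_deriv_cong[OF \<open>open \<Omega>\<close>])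
    show "bdd_lip_deriv m \<Omega> (\<lambda>x. partial_deriv i f x * g x + f x * partial_deriv i g x)"
      using Suc.prems by (intro bdd_lip_deriv_add[OF \<open>open \<Omega>\<close>] Suc.IH)
        (auto dest: bdd_lip_deriv_SucD simp del: bdd_lip_deriv.simps(2), auto)
    show "partial_deriv i f x * g x + f x * partial_deriv i g x = partial_deriv i (\<lambda>x. f x * g x) x"
      if "x \<in> \<Omega>" for x
      using Suc.prems that differentiable_on_open_at[OF \<open>open \<Omega>\<close>]
      by (intro partial_deriv_mult[symmetric]) auto
  qed
  then show ?case
    using Suc.prems bdd_lip_mult[of f \<Omega> g] by (auto intro: derivative_intros)
qed

lemma bdd_lip_deriv_const:
  fixes \<Omega> :: "(real^'n::finite) set"
  shows "bdd_lip_deriv m \<Omega> (\<lambda>_. c)"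
proof -
  have "partial_deriv i (\<lambda>_. c) = (\<lambda>_. 0)" for i :: 'n and c
    by (auto simp: partial_deriv_def)
  moreover have "bounded ((\<lambda>_. c) ` \<Omega>) \<and> (\<exists>L. L-lipschitz_on \<Omega> (\<lambda>_. c))" for c :: real
    by (auto simp: bounded_iff intro!: lipschitz_intros)
  ultimately show ?thesis
    by (induction m arbitrary: c) auto
qed

text \<open>The recursion in \<open>bdd_lip_deriv\<close> may differentiate in any order, a multi-index only in one. The
  symmetry of mixed derivatives reconciles the two.\<close>

lemma bdd_lip_deriv_if_mi_deriv:
  assumes "open \<Omega>" "Ck_on m \<Omega> f"
    and "\<And>\<nu>. mi_order \<nu> \<le> m \<Longrightarrow> bounded (mi_deriv \<nu> f ` \<Omega>)"
    and "\<And>\<nu>. mi_order \<nu> \<le> m \<Longrightarrow> \<exists>L. L-lipschitz_on \<Omega> (mi_deriv \<nu> f)"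
  shows "bdd_lip_deriv m \<Omega> f"
  using assms(2-4)
proof (induction m arbitrary: f)
  case 0
  then show ?case
    using 0(2)[of "\<lambda>_. 0"] 0(3)[of "\<lambda>_. 0"] by (simp add: mi_order_def)
next
  case (Suc m)
  have "bdd_lip_deriv m \<Omega> (partial_deriv i f)" for i
  proof (rule Suc.IH)
    fix \<nu> :: "'a \<Rightarrow> nat" assume \<nu>: "mi_order \<nu> \<le> m"
    let ?\<mu> = "\<lambda>j. \<nu> j + mi_unit i j"
    have eq: "mi_deriv ?\<mu> f x = mi_deriv \<nu> (partial_deriv i f) x" if "x \<in> \<Omega>" for x
      using Suc.prems(1) \<nu> that Ck_on_mono[of "Suc m" \<Omega> f "Suc (mi_order \<nu>)"]
      by (intro mi_deriv_add_unit[OF \<open>open \<Omega>\<close>]) simp_all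
    have ord: "mi_order ?\<mu> \<le> Suc m"
      using \<nu> by simp
    show "bounded (mi_deriv \<nu> (partial_deriv i f) ` \<Omega>)"
      using Suc.prems(2)[OF ord] eq by (simp cong: image_cong)
    show "\<exists>L. L-lipschitz_on \<Omega> (mi_deriv \<nu> (partial_deriv i f))"
      using Suc.prems(3)[OF ord] eq by (simp add: lipschitz_on_def)
  qed (use Suc.prems in simp)
  then show ?case
    using Suc.prems(1) Suc.prems(2)[of "\<lambda>_. 0"] Suc.prems(3)[of "\<lambda>_. 0"] by (simp add: mi_order_def)
qed


section \<open>Test functions and mollifiers\<close>

subsection \<open>A smooth function with compact support\<close>

text \<open>The function \<open>exp (- 1 / t)\<close>, continued by zero to the left of the origin, is smooth. With the additional powers of
  \<open>t\<close> the family is closed under differentiation up to linear combinations, so that no formula for higher derivatives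
  is needed.\<close>

definition exp_tail :: "nat \<Rightarrow> real \<Rightarrow> real" where
  "exp_tail m t = (if t > 0 then exp (- 1 / t) / t ^ m else 0)"

lemma power_div_fact_le_exp:
  fixes x :: real
  assumes "0 \<le> x"
  shows "x ^ n / fact n \<le> exp x"
proof -
  have "(\<Sum>i\<in>{n}. x ^ i /\<^sub>R fact i) \<le> (\<Sum>i. x ^ i /\<^sub>R fact i)"
    using assms by (intro sum_le_suminf summable_exp_generic) auto
  then show ?thesis
    by (simp add: exp_def field_simps)
qed

text \<open>The exponential beats every power. A quadratic bound is enough for the derivative at the origin to be
  zero.\<close>

lemma abs_exp_tail_le: "\<bar>exp_tail m t\<bar> \<le> fact (m + 2) * t\<^sup>2"
proof (cases "t > 0")
  case True
  have "(1 / t) ^ (m + 2) / fact (m + 2) \<le> exp (1 / t)"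
    using True by (intro power_div_fact_le_exp) simp
  then have "1 \<le> exp (1 / t) * (fact (m + 2) * t ^ (m + 2))"
    using True by (simp add: power_divide divide_simps mult_ac del: fact_Suc)
  then have "exp (- (1 / t)) \<le> exp (- (1 / t)) * (exp (1 / t) * (fact (m + 2) * t ^ (m + 2)))"
    using mult_left_mono[OF _ exp_ge_zero[of "- (1 / t)"]] by fastforce
  also have "\<dots> = fact (m + 2) * t ^ (m + 2)"
    by (simp only: mult.assoc[symmetric] flip: exp_add) simp
  finally have "exp (- 1 / t) \<le> (fact (m + 2) * t\<^sup>2) * t ^ m"
    by (simp add: power_add power2_eq_square mult_ac del: fact_Suc)
  then have "exp (- 1 / t) / t ^ m \<le> fact (m + 2) * t\<^sup>2"
    using True by (subst pos_divide_le_eq) auto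
  with True show ?thesis
    by (simp add: exp_tail_def)
qed (simp add: exp_tail_def)

lemma has_real_derivative_quadratic_bound:
  fixes f :: "real \<Rightarrow> real"
  assumes "f 0 = 0" "\<And>t. \<bar>f t\<bar> \<le> C * t\<^sup>2"
  shows "(f has_real_derivative 0) (at 0)"
proof -
  have "((\<lambda>t. f t / t) \<longlongrightarrow> 0) (at 0)"
  proof (rule tendsto_rabs_zero_cancel, rule tendsto_sandwich)
    show "\<forall>\<^sub>F t in at 0. 0 \<le> \<bar>f t / t\<bar>"
      by simp
    show "\<forall>\<^sub>F t in at 0. \<bar>f t / t\<bar> \<le> C * \<bar>t\<bar>"
    proof (rule eventually_mono[OF eventually_neq_at_within[of 0]])
      fix t :: real assume "t \<noteq> 0"
      then show "\<bar>f t / t\<bar> \<le> C * \<bar>t\<bar>"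
        using assms(2)[of t] by (simp add: field_simps power2_eq_square)
    qed
    show "((\<lambda>t. C * \<bar>t\<bar>) \<longlongrightarrow> 0) (at 0)"
      by (auto intro!: tendsto_eq_intros)
  qed auto
  then show ?thesis
    using assms(1) by (simp add: has_field_derivative_iff)
qed

lemma exp_tail_deriv:
  "(exp_tail m has_real_derivative exp_tail (m + 2) t - real m * exp_tail (m + 1) t) (at t)"
proof -
  consider "t > 0" | "t < 0" | "t = 0"
    by linarith
  then show ?thesis
  proof cases
    case 1
    have A: "((\<lambda>t. exp (- 1 / t)) has_real_derivative exp (- 1 / t) / t\<^sup>2) (at t)"
      using 1 by (auto intro!: derivative_eq_intros simp: power2_eq_square)
    have B: "((\<lambda>t. t ^ m) has_real_derivative real m * t ^ (m - 1)) (at t)"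
      by (auto intro!: derivative_eq_intros)
    have "(exp (- 1 / t) / t\<^sup>2 * t ^ m - exp (- 1 / t) * (real m * t ^ (m - 1))) / (t ^ m * t ^ m)
        = exp_tail (m + 2) t - real m * exp_tail (m + 1) t"
      using 1 by (cases m) (auto simp: exp_tail_def field_simps power2_eq_square)
    with DERIV_divide[OF A B] 1
    have "((\<lambda>t. exp (- 1 / t) / t ^ m) has_real_derivative exp_tail (m + 2) t - real m * exp_tail (m + 1) t) (at t)"
      by simp
    then show ?thesis
      by (rule has_field_derivative_transform_within_open[where S = "{0<..}"])
        (use 1 in \<open>auto simp: exp_tail_def\<close>)
  next
    case 2
    have "((\<lambda>_. 0) has_real_derivative exp_tail (m + 2) t - real m * exp_tail (m + 1) t) (at t)"
      using 2 by (auto simp: exp_tail_def)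
    then show ?thesis
      by (rule has_field_derivative_transform_within_open[where S = "{..<0}"])
        (use 2 in \<open>auto simp: exp_tail_def\<close>)
  next
    case 3
    have "(exp_tail m has_real_derivative 0) (at 0)"
      by (rule has_real_derivative_quadratic_bound[OF _ abs_exp_tail_le]) (simp add: exp_tail_def)
    with 3 show ?thesis
      by (simp add: exp_tail_def)
  qed
qed

text \<open>The span of products of coordinates with functions \<open>exp_tail m (r\<^sup>2 - |x|\<^sup>2)\<close>. It contains the
  standard bump function on the ball of radius \<open>r\<close> and is closed under directional derivatives, hence consists of
  smooth functions.\<close>

inductive bump_class :: "real \<Rightarrow> (real^'n::finite \<Rightarrow> real) \<Rightarrow> bool" for r where
  base: "bump_class r (\<lambda>x. exp_tail m (r\<^sup>2 - x \<bullet> x))"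
| coord: "bump_class r f \<Longrightarrow> bump_class r (\<lambda>x. x $ i * f x)"
| scale: "bump_class r f \<Longrightarrow> bump_class r (\<lambda>x. c * f x)"
| add: "bump_class r f \<Longrightarrow> bump_class r g \<Longrightarrow> bump_class r (\<lambda>x. f x + g x)"

lemma bump_class_derivative:
  assumes "bump_class r f"
  shows "\<exists>D. (\<forall>x. (f has_derivative D x) (at x)) \<and> (\<forall>h. bump_class r (\<lambda>x. D x h))"
  using assms
proof induction
  case (base m)
  let ?E = "\<lambda>k x. exp_tail k (r\<^sup>2 - x \<bullet> x)"
  have "((\<lambda>x::real^'a. ?E m x) has_derivative
      (\<lambda>h. (?E (m + 2) x - real m * ?E (m + 1) x) * (- (2 * (x \<bullet> h))))) (at x)" for x :: "real^'a"
  proof (rule has_derivative_compose[of "\<lambda>x. r\<^sup>2 - x \<bullet> x" "\<lambda>h. - (2 * (x \<bullet> h))" x UNIV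
        "exp_tail m" "(*) (?E (m + 2) x - real m * ?E (m + 1) x)"])
    show "((\<lambda>x::real^'a. r\<^sup>2 - x \<bullet> x) has_derivative (\<lambda>h. - (2 * (x \<bullet> h)))) (at x)"
      by (auto intro!: derivative_eq_intros simp: inner_commute)
    show "(exp_tail m has_derivative (*) (?E (m + 2) x - real m * ?E (m + 1) x)) (at (r\<^sup>2 - x \<bullet> x))"
      using exp_tail_deriv by (simp add: has_field_derivative_def)
  qed
  moreover have "bump_class r (\<lambda>x. (?E (m + 2) x - real m * ?E (m + 1) x) * (- (2 * (x \<bullet> h))))" for h :: "real^'a"
  proof -
    have c: "bump_class r (\<lambda>x. (\<Sum>i\<in>I. (c * h $ i) * (x $ i * f x)))" if "bump_class r f" for c I f
      using finite[of I]
    proof (induction I rule: finite_induct)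
      case empty
      then show ?case
        using bump_class.scale[OF that, of 0] by simp
    next
      case (insert i I)
      then show ?case
        by (simp add: bump_class.add bump_class.scale bump_class.coord that)
    qed
    have "bump_class r (\<lambda>x. (\<Sum>i\<in>UNIV. (- 2 * h $ i) * (x $ i * ?E (m + 2) x))
        + (\<Sum>i\<in>UNIV. (2 * real m * h $ i) * (x $ i * ?E (m + 1) x)))"
      by (intro bump_class.add c bump_class.base)
    also have "(\<lambda>x. (\<Sum>i\<in>UNIV. (- 2 * h $ i) * (x $ i * ?E (m + 2) x))
        + (\<Sum>i\<in>UNIV. (2 * real m * h $ i) * (x $ i * ?E (m + 1) x)))
      = (\<lambda>x. (?E (m + 2) x - real m * ?E (m + 1) x) * (- (2 * (x \<bullet> h))))"
      by (simp add: inner_vec_def[of _ h] sum_distrib_left sum_distrib_right sum_negf sum_subtractf sum.distrib algebra_simps)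
    finally show ?thesis .
  qed
  ultimately show ?case
    by (intro exI[of _ "\<lambda>x h. (?E (m + 2) x - real m * ?E (m + 1) x) * (- (2 * (x \<bullet> h)))"]) auto
next
  case (coord f i)
  then obtain D where D: "\<And>x. (f has_derivative D x) (at x)" "\<And>h. bump_class r (\<lambda>x. D x h)"
    by blast
  have "((\<lambda>x. x $ i * f x) has_derivative (\<lambda>h. x $ i * D x h + h $ i * f x)) (at x)" for x
    by (intro has_derivative_mult D(1) bounded_linear.has_derivative[OF bounded_linear_vec_nth] has_derivative_ident)
  moreover have "bump_class r (\<lambda>x. x $ i * D x h + h $ i * f x)" for h
    by (intro bump_class.intros D(2) coord.hyps)
  ultimately show ?case
    by (intro exI[of _ "\<lambda>x h. x $ i * D x h + h $ i * f x"]) auto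
next
  case (scale f c)
  then obtain D where D: "\<And>x. (f has_derivative D x) (at x)" "\<And>h. bump_class r (\<lambda>x. D x h)"
    by blast
  show ?case
    using D by (intro exI[of _ "\<lambda>x h. c * D x h"]) (auto intro: bump_class.scale has_derivative_mult_right)
next
  case (add f g)
  then obtain D E where "\<And>x. (f has_derivative D x) (at x)" "\<And>h. bump_class r (\<lambda>x. D x h)"
    "\<And>x. (g has_derivative E x) (at x)" "\<And>h. bump_class r (\<lambda>x. E x h)"
    by blast
  then show ?case
    by (intro exI[of _ "\<lambda>x h. D x h + E x h"]) (auto intro: bump_class.add has_derivative_add)
qed

lemma bump_class_Ck: "bump_class r f \<Longrightarrow> Ck_on m UNIV f"
proof (induction m arbitrary: f)
  case 0
  then show ?case
    using bump_class_derivative[OF 0]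
    by (auto simp: continuous_on_eq_continuous_at intro!: has_derivative_continuous)
next
  case (Suc m)
  obtain D where D: "\<And>x. (f has_derivative D x) (at x)" "\<And>h. bump_class r (\<lambda>x. D x h)"
    using bump_class_derivative[OF Suc.prems] by blast
  have "partial_deriv i f = (\<lambda>x. D x (axis i 1))" for i
    using partial_deriv_eqI[OF D(1)] by blast
  then show ?case
    using D Suc.IH by (auto simp: differentiable_on_def differentiable_def intro: has_derivative_at_withinI)
qed

lemma bump_class_zero: "bump_class r f \<Longrightarrow> r > 0 \<Longrightarrow> norm x \<ge> r \<Longrightarrow> f x = 0"
proof (induction rule: bump_class.induct)
  case (base m)
  then have "r\<^sup>2 \<le> x \<bullet> x"
    by (simp add: power_mono flip: power2_norm_eq_inner)
  then show ?case
    by (simp add: exp_tail_def)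
qed auto

lemma Ck_on_UNIV_continuous: "(\<forall>m. Ck_on m UNIV f) \<Longrightarrow> continuous_on UNIV f"
  by (metis Ck_on.simps(1))

lemma Ck_on_UNIV_partial: "(\<forall>m. Ck_on m UNIV f) \<Longrightarrow> (\<forall>m. Ck_on m UNIV (partial_deriv i f))"
  by (metis Ck_on.simps(2))

lemma Ck_on_UNIV_differentiable: "(\<forall>m. Ck_on m UNIV f) \<Longrightarrow> f differentiable (at x)"
  by (metis Ck_on.simps(2) UNIV_I differentiable_on_def)

lemma continuous_compact_support_integrable:
  fixes f :: "'a::euclidean_space \<Rightarrow> real"
  assumes "continuous_on UNIV f" "compact C" "\<And>x. x \<notin> C \<Longrightarrow> f x = 0"
  shows "integrable lborel f"
proof -
  have "integrable lborel (\<lambda>x. indicator C x *\<^sub>R f x)"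
    using assms by (intro borel_integrable_compact) (auto intro: continuous_on_subset)
  also have "(\<lambda>x. indicator C x *\<^sub>R f x) = f"
  proof
    show "indicator C x *\<^sub>R f x = f x" for x
      using assms(3)[of x] by (cases "x \<in> C") auto
  qed
  finally show ?thesis .
qed

lemma continuous_compact_support_bounded:
  fixes f :: "'a::metric_space \<Rightarrow> real"
  assumes "continuous_on UNIV f" "compact C" "\<And>x. x \<notin> C \<Longrightarrow> f x = 0"
  obtains B where "B > 0" "\<And>x. \<bar>f x\<bar> \<le> B"
proof -
  have "bounded (f ` C)"
    using assms by (meson compact_continuous_image compact_imp_bounded continuous_on_subset subset_UNIV)
  then obtain B where "B > 0" and B: "\<And>x. x \<in> C \<Longrightarrow> \<bar>f x\<bar> \<le> B"
    by (auto simp: bounded_pos)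
  have "\<bar>f x\<bar> \<le> B" for x
    using B[of x] assms(3)[of x] \<open>B > 0\<close> by (cases "x \<in> C") auto
  with \<open>B > 0\<close> that show thesis
    by blast
qed

lemma mollifier_exists:
  assumes "0 < r"
  obtains \<eta> :: "real^'n::finite \<Rightarrow> real" where "\<forall>m. Ck_on m UNIV \<eta>" "\<And>x. 0 \<le> \<eta> x"
    "\<And>x. r \<le> norm x \<Longrightarrow> \<eta> x = 0" "integral\<^sup>L lborel \<eta> = 1"
proof -
  \<comment> \<open>The standard bump function, to be divided by its integral.\<close>
  define b :: "real^'n \<Rightarrow> real" where "b x = exp_tail 0 (r\<^sup>2 - x \<bullet> x)" for x
  have b: "bump_class r b"
    unfolding b_def by (rule bump_class.base)
  have nonneg: "0 \<le> b x" for x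
    by (simp add: b_def exp_tail_def)
  have cont: "continuous_on UNIV b"
    using bump_class_Ck[OF b, of 0] by simp
  have int: "integrable lborel b"
    using bump_class_zero[OF b \<open>0 < r\<close>]
    by (intro continuous_compact_support_integrable[OF cont compact_cball[of 0 r]]) (simp add: not_le)
  have "\<not> (AE x in lborel. b x = 0)"
  proof
    assume ae: "AE x in lborel. b x = 0"
    have "b x > 0" if "x \<in> ball 0 r" for x
    proof -
      have "x \<bullet> x < r\<^sup>2"
        using that \<open>0 < r\<close> by (simp add: power_strict_mono flip: power2_norm_eq_inner)
      then show ?thesis
        by (simp add: b_def exp_tail_def)
    qed
    then have "x \<notin> ball 0 r" if "b x = 0" for x
      using that by force
    then have "AE x in lborel. x \<notin> ball (0::real^'n) r"
      using AE_mp[OF ae, of "\<lambda>x. x \<notin> ball 0 r"] by simp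
    then have "emeasure lborel (ball (0::real^'n) r) = 0"
      by (subst (asm) AE_iff_measurable[of "ball 0 r"]) auto
    then show False
      using \<open>0 < r\<close> unit_ball_vol_pos[of "real CARD('n)"] by (simp add: emeasure_ball)
  qed
  then have "integral\<^sup>L lborel b \<noteq> 0"
    using integral_nonneg_eq_0_iff_AE[OF int] nonneg by auto
  moreover have "integral\<^sup>L lborel b \<ge> 0"
    using nonneg by simp
  ultimately have pos: "integral\<^sup>L lborel b > 0"
    by simp
  let ?\<eta> = "\<lambda>x. 1 / integral\<^sup>L lborel b * b x"
  have "bump_class r ?\<eta>"
    by (rule bump_class.scale[OF b])
  then show thesis
    using that[of ?\<eta>] bump_class_Ck bump_class_zero[OF b \<open>0 < r\<close>] nonneg pos by auto
qed

subsection \<open>Test functions\<close>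

lemma Ck_on_reflect:
  "Ck_on m UNIV f \<Longrightarrow> Ck_on m UNIV (\<lambda>y. c * f (x - y))"
proof (induction m arbitrary: f c)
  case 0
  then show ?case
    by (auto intro!: continuous_intros continuous_on_compose2[of UNIV f])
next
  case (Suc m)
  have D: "((\<lambda>y. c * f (x - y)) has_derivative (\<lambda>h. c * frechet_derivative f (at (x - y)) (- h))) (at y)" for y
  proof (rule has_derivative_mult_right, rule has_derivative_compose[of "\<lambda>y. x - y" _ y UNIV f])
    show "(f has_derivative frechet_derivative f (at (x - y))) (at (x - y))"
      using Suc.prems frechet_derivative_works by (auto simp: differentiable_on_def)
  qed (auto intro!: derivative_eq_intros)
  have "partial_deriv i (\<lambda>y. c * f (x - y)) = (\<lambda>y. (- c) * partial_deriv i f (x - y))" for i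
  proof
    fix y
    have "linear (frechet_derivative f (at (x - y)))"
      using Suc.prems by (intro linear_frechet_derivative) (auto simp: differentiable_on_def)
    then show "partial_deriv i (\<lambda>y. c * f (x - y)) y = (- c) * partial_deriv i f (x - y)"
      by (simp add: partial_deriv_eqI[OF D] linear_neg partial_deriv_def)
  qed
  moreover have "(\<lambda>y. c * f (x - y)) differentiable_on UNIV"
    unfolding differentiable_on_def differentiable_def using D by (auto intro!: exI)
  moreover have "Ck_on m UNIV (\<lambda>y. (- c) * partial_deriv i f (x - y))" for i
    using Suc.prems by (intro Suc.IH) simp
  ultimately show ?case
    by (simp only: Ck_on.simps) blast
qed

lemma partial_deriv_reflect:
  assumes "f differentiable (at (x - y))"
  shows "partial_deriv i (\<lambda>y. f (x - y)) y = - partial_deriv i f (x - y)"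
proof -
  have lin: "linear (frechet_derivative f (at (x - y)))"
    by (rule linear_frechet_derivative[OF assms])
  have "((\<lambda>y. f (x - y)) has_derivative (\<lambda>h. frechet_derivative f (at (x - y)) (- h))) (at y)"
  proof (rule has_derivative_compose[of "\<lambda>y. x - y" _ y UNIV f])
    show "(f has_derivative frechet_derivative f (at (x - y))) (at (x - y))"
      using assms frechet_derivative_works by blast
  qed (auto intro!: derivative_eq_intros)
  from partial_deriv_eqI[OF this] show ?thesis
    by (simp add: linear_neg[OF lin] partial_deriv_def)
qed

lemma partial_deriv_zero_outside:
  fixes f :: "real^'n::finite \<Rightarrow> real"
  assumes "closed C" "\<And>x. x \<notin> C \<Longrightarrow> f x = 0" "x \<notin> C"
  shows "partial_deriv i f x = 0"
proof -
  have "partial_deriv i f x = partial_deriv i (\<lambda>_. 0) x"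
    using assms by (intro partial_deriv_cong_open[of "- C"]) auto
  then show ?thesis
    by (simp add: partial_deriv_def)
qed

lemma test_funI:
  assumes "\<forall>m. Ck_on m UNIV \<phi>" "compact C" "C \<subseteq> \<Omega>" "\<And>x. x \<notin> C \<Longrightarrow> \<phi> x = 0"
  shows "\<phi> \<in> test_fun \<Omega>"
proof -
  have sub: "closure {x. \<phi> x \<noteq> 0} \<subseteq> C"
    using assms by (intro closure_minimal) (auto simp: compact_imp_closed)
  have "compact (C \<inter> closure {x. \<phi> x \<noteq> 0})"
    using \<open>compact C\<close> by (intro compact_Int_closed) auto
  then have "compact (closure {x. \<phi> x \<noteq> 0})"
    using sub by (simp add: Int_absorb1)
  with sub assms show ?thesis
    by (auto simp: test_fun_def)
qed

lemma test_funE: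
  assumes "\<phi> \<in> test_fun \<Omega>"
  obtains C where "\<forall>m. Ck_on m UNIV \<phi>" "compact C" "C \<subseteq> \<Omega>" "\<And>x. x \<notin> C \<Longrightarrow> \<phi> x = 0"
    "\<And>i x. x \<notin> C \<Longrightarrow> partial_deriv i \<phi> x = 0"
proof -
  let ?C = "closure {x. \<phi> x \<noteq> 0}"
  have zero: "\<phi> x = 0" if "x \<notin> ?C" for x
    using that closure_subset[of "{x. \<phi> x \<noteq> 0}"] by blast
  show thesis
  proof (rule that[of ?C])
    show "\<forall>m. Ck_on m UNIV \<phi>" "compact ?C" "?C \<subseteq> \<Omega>"
      using assms unfolding test_fun_def by blast+
    show "\<phi> x = 0" if "x \<notin> ?C" for x
      by (rule zero[OF that])
    show "partial_deriv i \<phi> x = 0" if "x \<notin> ?C" for i x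
      by (rule partial_deriv_zero_outside[OF closed_closure zero that])
  qed
qed

lemma test_fun_partial_deriv:
  assumes "\<phi> \<in> test_fun \<Omega>"
  shows "partial_deriv i \<phi> \<in> test_fun \<Omega>"
  using assms by (elim test_funE) (metis Ck_on_UNIV_partial test_funI)

lemma test_fun_mono: "\<Omega> \<subseteq> \<Omega>' \<Longrightarrow> \<phi> \<in> test_fun \<Omega> \<Longrightarrow> \<phi> \<in> test_fun \<Omega>'"
  by (auto simp: test_fun_def)

subsection \<open>Elementary properties of weak derivatives\<close>

lemma has_weak_deriv_unit_iff:
  "has_weak_deriv \<Omega> (mi_unit i) u g \<longleftrightarrow> u \<in> L1_loc \<Omega> \<and> g \<in> L1_loc \<Omega>
     \<and> (\<forall>\<phi>\<in>test_fun \<Omega>. (LINT x|lebesgue_on \<Omega>. u x * partial_deriv i \<phi> x)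
          = - (LINT x|lebesgue_on \<Omega>. g x * \<phi> x))"
  by (simp add: has_weak_deriv_def mi_deriv_unit)

lemma has_weak_deriv_zero: "u \<in> L1_loc \<Omega> \<Longrightarrow> has_weak_deriv \<Omega> (\<lambda>_. 0) u u"
  by (simp add: has_weak_deriv_def mi_order_def)

lemma mi_deriv_test_fun_add_unit:
  assumes "\<phi> \<in> test_fun \<Omega>"
  shows "mi_deriv (\<lambda>j. \<nu> j + mi_unit i j) \<phi> = mi_deriv \<nu> (partial_deriv i \<phi>)"
proof
  have "\<forall>m. Ck_on m UNIV \<phi>"
    using assms by (auto simp: test_fun_def)
  then show "mi_deriv (\<lambda>j. \<nu> j + mi_unit i j) \<phi> x = mi_deriv \<nu> (partial_deriv i \<phi>) x" for x
    by (intro mi_deriv_add_unit[of UNIV]) (simp_all del: Ck_on.simps)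
qed

lemma has_weak_deriv_add_unit:
  assumes "has_weak_deriv \<Omega> \<nu> u v" "has_weak_deriv \<Omega> (mi_unit i) v w"
  shows "has_weak_deriv \<Omega> (\<lambda>j. \<nu> j + mi_unit i j) u w"
  unfolding has_weak_deriv_def
proof (intro conjI ballI)
  fix \<phi> assume \<phi>: "\<phi> \<in> test_fun \<Omega>"
  have "(LINT x|lebesgue_on \<Omega>. u x * mi_deriv (\<lambda>j. \<nu> j + mi_unit i j) \<phi> x)
      = (- 1) ^ mi_order \<nu> * (LINT x|lebesgue_on \<Omega>. v x * partial_deriv i \<phi> x)"
    using assms(1) test_fun_partial_deriv[OF \<phi>]
    by (simp add: mi_deriv_test_fun_add_unit[OF \<phi>] has_weak_deriv_def)
  also have "\<dots> = (- 1) ^ mi_order (\<lambda>j. \<nu> j + mi_unit i j) * (LINT x|lebesgue_on \<Omega>. w x * \<phi> x)"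
    using assms(2) \<phi> by (simp add: has_weak_deriv_unit_iff)
  finally show "(LINT x|lebesgue_on \<Omega>. u x * mi_deriv (\<lambda>j. \<nu> j + mi_unit i j) \<phi> x)
      = (- 1) ^ mi_order (\<lambda>j. \<nu> j + mi_unit i j) * (LINT x|lebesgue_on \<Omega>. w x * \<phi> x)" .
qed (use assms in \<open>auto simp: has_weak_deriv_def\<close>)

text \<open>The first identity is tested with \<open>\<partial>\<^sub>i \<phi>\<close> and the second one with \<open>\<phi>\<close>; their left-hand sides agree.\<close>

lemma has_weak_deriv_step:
  assumes "has_weak_deriv \<Omega> \<nu> u v" "has_weak_deriv \<Omega> (\<lambda>j. \<nu> j + mi_unit i j) u w"
  shows "has_weak_deriv \<Omega> (mi_unit i) v w"
  unfolding has_weak_deriv_unit_iff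
proof (intro conjI ballI)
  fix \<phi> assume \<phi>: "\<phi> \<in> test_fun \<Omega>"
  have "(- 1) ^ mi_order \<nu> * (LINT x|lebesgue_on \<Omega>. v x * partial_deriv i \<phi> x)
      = (LINT x|lebesgue_on \<Omega>. u x * mi_deriv (\<lambda>j. \<nu> j + mi_unit i j) \<phi> x)"
    using assms(1) test_fun_partial_deriv[OF \<phi>]
    by (simp add: mi_deriv_test_fun_add_unit[OF \<phi>] has_weak_deriv_def)
  also have "\<dots> = (- 1) ^ mi_order \<nu> * (- (LINT x|lebesgue_on \<Omega>. w x * \<phi> x))"
    using assms(2) \<phi> by (simp add: has_weak_deriv_def)
  finally show "(LINT x|lebesgue_on \<Omega>. v x * partial_deriv i \<phi> x) = - (LINT x|lebesgue_on \<Omega>. w x * \<phi> x)"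
    by (subst (asm) mult_cancel_left) simp
qed (use assms in \<open>auto simp: has_weak_deriv_def\<close>)

section \<open>Mollification\<close>

subsection \<open>Continuity of translations in \<open>L\<^sup>1\<close>\<close>

lemma lborel_shift:
  fixes u :: "'a::euclidean_space \<Rightarrow> real"
  assumes "integrable lborel u"
  shows "integrable lborel (\<lambda>x. u (x + z))" "(LINT x|lborel. u (x + z)) = integral\<^sup>L lborel u"
proof -
  have "integrable (distr lborel borel ((+) z)) u"
    using assms by (simp add: lborel_distr_plus)
  then show "integrable lborel (\<lambda>x. u (x + z))"
    by (subst (asm) integrable_distr_eq) (use assms in \<open>auto simp: add.commute\<close>)
  have "integral\<^sup>L (distr lborel borel ((+) z)) u = (LINT x|lborel. u (x + z))"
    by (subst integral_distr) (use assms in \<open>auto simp: add.commute\<close>)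
  then show "(LINT x|lborel. u (x + z)) = integral\<^sup>L lborel u"
    by (simp add: lborel_distr_plus)
qed

lemma lborel_distr_reflect: "distr lborel borel (\<lambda>y. a - y) = (lborel :: 'a::euclidean_space measure)"
  using lborel_affine[of "-1" a] by (simp add: density_1)

lemma lborel_reflect:
  fixes u :: "'a::euclidean_space \<Rightarrow> real"
  assumes "integrable lborel u"
  shows "integrable lborel (\<lambda>x. u (a - x))" "(LINT x|lborel. u (a - x)) = integral\<^sup>L lborel u"
proof -
  have "integrable (distr lborel borel (\<lambda>y. a - y)) u"
    using assms by (simp add: lborel_distr_reflect)
  then show "integrable lborel (\<lambda>x. u (a - x))"
    by (subst (asm) integrable_distr_eq) (use assms in auto)
  have "integral\<^sup>L (distr lborel borel (\<lambda>y. a - y)) u = (LINT x|lborel. u (a - x))"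
    by (subst integral_distr) (use assms in auto)
  then show "(LINT x|lborel. u (a - x)) = integral\<^sup>L lborel u"
    by (simp add: lborel_distr_reflect)
qed

definition shift_dist :: "('a::euclidean_space \<Rightarrow> real) \<Rightarrow> 'a \<Rightarrow> real" where
  "shift_dist u z = (LINT x|lborel. \<bar>u (x + z) - u x\<bar>)"

lemma shift_dist_triangle:
  assumes "integrable lborel u" "integrable lborel v"
  shows "shift_dist u z \<le> shift_dist v z + 2 * (LINT x|lborel. \<bar>u x - v x\<bar>)"
proof -
  note [simp] = assms lborel_shift(1)[OF assms(1)] lborel_shift(1)[OF assms(2)]
  have "shift_dist u z \<le> (LINT x|lborel. \<bar>v (x + z) - v x\<bar> + \<bar>u (x + z) - v (x + z)\<bar> + \<bar>u x - v x\<bar>)"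
    unfolding shift_dist_def by (intro integral_mono) auto
  also have "\<dots> = shift_dist v z + (LINT x|lborel. \<bar>u (x + z) - v (x + z)\<bar>) + (LINT x|lborel. \<bar>u x - v x\<bar>)"
    by (simp add: shift_dist_def)
  also have "(LINT x|lborel. \<bar>u (x + z) - v (x + z)\<bar>) = (LINT x|lborel. \<bar>u x - v x\<bar>)"
    by (rule lborel_shift(2)) simp
  finally show ?thesis
    by simp
qed

lemma shift_dist_nonneg [simp]: "0 \<le> shift_dist u z"
  by (simp add: shift_dist_def)

text \<open>The integrable functions whose translations are continuous at zero form a closed subset of \<open>L\<^sup>1\<close>,
  because translations are isometries.\<close>

lemma shift_dist_tendsto_approx:
  assumes u: "integrable lborel u" and "z \<longlonglongrightarrow> 0"
    and approx: "\<And>e. e > 0 \<Longrightarrow> \<exists>v. integrable lborel v \<and> (LINT x|lborel. \<bar>u x - v x\<bar>) < e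
      \<and> (\<lambda>n. shift_dist v (z n)) \<longlonglongrightarrow> 0"
  shows "(\<lambda>n. shift_dist u (z n)) \<longlonglongrightarrow> 0"
proof (rule order_tendstoI)
  fix e :: real assume "e > 0"
  then obtain v where v: "integrable lborel v" "(LINT x|lborel. \<bar>u x - v x\<bar>) < e / 4"
    "(\<lambda>n. shift_dist v (z n)) \<longlonglongrightarrow> 0"
    using approx[of "e / 4"] by auto
  have "\<forall>\<^sub>F n in sequentially. shift_dist v (z n) < e / 2"
    using v(3) \<open>e > 0\<close> by (intro order_tendstoD) auto
  then show "\<forall>\<^sub>F n in sequentially. shift_dist u (z n) < e"
  proof eventually_elim
    case (elim n)
    then show ?case
      using shift_dist_triangle[OF u v(1), of "z n"] v(2) by simp
  qed
next
  fix e :: real assume "e < 0"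
  then show "\<forall>\<^sub>F n in sequentially. e < shift_dist u (z n)"
    by (intro always_eventually allI) (rule less_le_trans[OF _ shift_dist_nonneg])
qed

text \<open>Integrating \<open>|a - b| = a + b - 2 a b\<close>, for \<open>a\<close> and \<open>b\<close> in \<open>{0, 1}\<close>, reduces the claim to the overlap of \<open>W\<close>
  with its translates. The overlap converges by dominated convergence: a point of an open set stays in it under
  small translations.\<close>

lemma shift_dist_indicator_open:
  fixes z :: "nat \<Rightarrow> 'a::euclidean_space"
  assumes "open W" "emeasure lborel W < \<infinity>" "z \<longlonglongrightarrow> 0"
  shows "(\<lambda>n. shift_dist (indicator W) (z n)) \<longlonglongrightarrow> 0"
proof -
  let ?i = "indicator W :: 'a \<Rightarrow> real"
  have W: "W \<in> sets borel"
    using \<open>open W\<close> by simp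
  have int: "integrable lborel ?i"
    using assms(2) W by (intro integrable_real_indicator) auto
  note int' = lborel_shift[OF int]
  have prod: "integrable lborel (\<lambda>x. ?i x * ?i (x + y))" for y
    using borel_measurable_integrable[OF int] borel_measurable_integrable[OF int'(1)[of y]]
    by (intro Bochner_Integration.integrable_bound[OF int] borel_measurable_times AE_I2)
      (simp_all split: split_indicator)
  have "shift_dist ?i y = 2 * (LINT x|lborel. ?i x) - 2 * (LINT x|lborel. ?i x * ?i (x + y))" for y
  proof -
    have "shift_dist ?i y = (LINT x|lborel. ?i x + ?i (x + y) - 2 * (?i x * ?i (x + y)))"
      unfolding shift_dist_def by (intro Bochner_Integration.integral_cong) (auto simp: indicator_def)
    also have "\<dots> = (LINT x|lborel. ?i x) + (LINT x|lborel. ?i (x + y)) - 2 * (LINT x|lborel. ?i x * ?i (x + y))"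
      using int int' prod by simp
    finally show ?thesis
      using int'(2) by simp
  qed
  moreover have "(\<lambda>n. LINT x|lborel. ?i x * ?i (x + z n)) \<longlonglongrightarrow> (LINT x|lborel. ?i x)"
  proof (rule integral_dominated_convergence[where w = ?i])
    show "AE x in lborel. (\<lambda>n. ?i x * ?i (x + z n)) \<longlonglongrightarrow> ?i x"
    proof (rule AE_I2)
      fix x :: 'a
      show "(\<lambda>n. ?i x * ?i (x + z n)) \<longlonglongrightarrow> ?i x"
      proof (cases "x \<in> W")
        case True
        have "(\<lambda>n. x + z n) \<longlonglongrightarrow> x + 0"
          using assms(3) by (intro tendsto_intros)
        then have "\<forall>\<^sub>F n in sequentially. x + z n \<in> W"
          using True \<open>open W\<close> by (intro topological_tendstoD) auto
        then have "\<forall>\<^sub>F n in sequentially. ?i x * ?i (x + z n) = ?i x"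
          by eventually_elim (simp add: True)
        then show ?thesis
          by (rule tendsto_eventually)
      qed simp
    qed
  qed (use int prod W in \<open>auto simp: indicator_def\<close>)
  then have "(\<lambda>n. 2 * (LINT x|lborel. ?i x) - 2 * (LINT x|lborel. ?i x * ?i (x + z n)))
     \<longlonglongrightarrow> 2 * (LINT x|lborel. ?i x) - 2 * (LINT x|lborel. ?i x)"
    by (intro tendsto_intros)
  ultimately show ?thesis
    by simp
qed

lemma shift_dist_scale: "shift_dist (\<lambda>x. u x * c) z = shift_dist u z * \<bar>c\<bar>"
  unfolding shift_dist_def by (simp add: abs_mult flip: left_diff_distrib)

text \<open>By density: measurable sets of finite measure are approximated by open sets, and integrable functions by
  simple functions.\<close>

lemma shift_dist_tendsto_0:
  fixes u :: "'a::euclidean_space \<Rightarrow> real"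
  assumes "integrable lborel u" "z \<longlonglongrightarrow> 0"
  shows "(\<lambda>n. shift_dist u (z n)) \<longlonglongrightarrow> 0"
  using assms(1)
proof (induction u rule: integrable_induct)
  case (base A c)
  have A: "A \<in> sets borel" "emeasure lborel A < \<infinity>"
    using base by auto
  have intA: "integrable lborel (indicator A :: 'a \<Rightarrow> real)"
    using A by (intro integrable_real_indicator) auto
  have "(\<lambda>n. shift_dist (indicator A) (z n)) \<longlonglongrightarrow> 0"
  proof (rule shift_dist_tendsto_approx[OF intA \<open>z \<longlonglongrightarrow> 0\<close>])
    fix e :: real assume "e > 0"
    obtain W where W: "open W" "A \<subseteq> W" "emeasure lborel (W - A) < e"
      using outer_regular_lborel[OF A(1) \<open>e > 0\<close>] by blast
    have WA: "W - A \<in> sets borel"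
      using W A by auto
    have "emeasure lborel W = emeasure lborel A + emeasure lborel (W - A)"
      using W A WA by (subst plus_emeasure) (auto intro: arg_cong[where f = "emeasure lborel"])
    then have fin: "emeasure lborel W < \<infinity>"
      using A(2) order_less_trans[OF W(3) ennreal_less_top] by simp
    have "(LINT x|lborel. \<bar>indicator A x - indicator W x\<bar> :: real) = measure lborel (W - A)"
    proof -
      have "(LINT x|lborel. \<bar>indicator A x - indicator W x\<bar> :: real) = (LINT x|lborel. indicator (W - A) x)"
        using W(2) by (intro Bochner_Integration.integral_cong) (auto simp: indicator_def)
      then show ?thesis
        by simp
    qed
    also have "\<dots> < e"
      using W(3) \<open>e > 0\<close> by (metis enn2real_ennreal enn2real_less_iff ennreal_less_top less_imp_le measure_def order_less_trans)
    finally show "\<exists>v. integrable lborel v \<and> (LINT x|lborel. \<bar>indicator A x - v x\<bar>) < e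
        \<and> (\<lambda>n. shift_dist v (z n)) \<longlonglongrightarrow> 0"
      using shift_dist_indicator_open[OF W(1) fin \<open>z \<longlonglongrightarrow> 0\<close>] W(1) fin
      by (intro exI[of _ "indicator W"]) auto
  qed
  then have "(\<lambda>n. shift_dist (indicator A) (z n) * \<bar>c\<bar>) \<longlonglongrightarrow> 0 * \<bar>c\<bar>"
    by (intro tendsto_intros)
  then show ?case
    by (simp add: shift_dist_scale)
next
  case (add f g)
  have int: "integrable lborel (\<lambda>x. f x + g x)"
    using add by simp
  have le: "shift_dist (\<lambda>x. f x + g x) y \<le> shift_dist f y + shift_dist g y" for y
  proof -
    note [simp] = add.hyps lborel_shift(1)[OF add.hyps(1)] lborel_shift(1)[OF add.hyps(2)]
    have "shift_dist (\<lambda>x. f x + g x) y \<le> (LINT x|lborel. \<bar>f (x + y) - f x\<bar> + \<bar>g (x + y) - g x\<bar>)"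
      unfolding shift_dist_def by (intro integral_mono) auto
    also have "\<dots> = shift_dist f y + shift_dist g y"
      by (simp add: shift_dist_def)
    finally show ?thesis .
  qed
  have "(\<lambda>n. shift_dist f (z n) + shift_dist g (z n)) \<longlonglongrightarrow> 0 + 0"
    using add.IH by (intro tendsto_intros)
  then have lim0: "(\<lambda>n. shift_dist f (z n) + shift_dist g (z n)) \<longlonglongrightarrow> 0"
    by simp
  show ?case
  proof (rule real_tendsto_sandwich[OF _ _ tendsto_const lim0])
    show "\<forall>\<^sub>F n in sequentially. 0 \<le> shift_dist (\<lambda>x. f x + g x) (z n)"
      by simp
    show "\<forall>\<^sub>F n in sequentially. shift_dist (\<lambda>x. f x + g x) (z n) \<le> shift_dist f (z n) + shift_dist g (z n)"
      using le by (intro always_eventually allI)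
  qed
next
  case (lim f s)
  show ?case
  proof (rule shift_dist_tendsto_approx[OF \<open>integrable lborel f\<close> \<open>z \<longlonglongrightarrow> 0\<close>])
    fix e :: real assume "e > 0"
    have "(\<lambda>i. LINT x|lborel. \<bar>f x - s i x\<bar>) \<longlonglongrightarrow> (LINT x|(lborel :: 'a measure). (0::real))"
    proof (rule integral_dominated_convergence[where w = "\<lambda>x. 3 * \<bar>f x\<bar>"])
      show "AE x in lborel. (\<lambda>i. \<bar>f x - s i x\<bar>) \<longlonglongrightarrow> 0"
      proof (rule AE_I2)
        fix x :: 'a
        have "(\<lambda>i. f x - s i x) \<longlonglongrightarrow> f x - f x"
          using lim.hyps(2) by (intro tendsto_intros) simp
        then show "(\<lambda>i. \<bar>f x - s i x\<bar>) \<longlonglongrightarrow> 0"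
          by (intro tendsto_rabs_zero) simp
      qed
      show "AE x in lborel. norm \<bar>f x - s i x\<bar> \<le> 3 * \<bar>f x\<bar>" for i
      proof (rule AE_I2)
        fix x :: 'a
        have "\<bar>s i x\<bar> \<le> 2 * \<bar>f x\<bar>"
          using lim.hyps(3)[of x i] by simp
        then show "norm \<bar>f x - s i x\<bar> \<le> 3 * \<bar>f x\<bar>"
          by simp
      qed
    qed (use lim in auto)
    then have "\<forall>\<^sub>F i in sequentially. (LINT x|lborel. \<bar>f x - s i x\<bar>) < e"
      using \<open>e > 0\<close> by (intro order_tendstoD(2)) auto
    then obtain i where "(LINT x|lborel. \<bar>f x - s i x\<bar>) < e"
      by (auto simp: eventually_sequentially)
    then show "\<exists>v. integrable lborel v \<and> (LINT x|lborel. \<bar>f x - v x\<bar>) < e \<and> (\<lambda>n. shift_dist v (z n)) \<longlonglongrightarrow> 0"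
      using lim by blast
  qed
qed

lemma shift_dist_small:
  fixes u :: "'a::euclidean_space \<Rightarrow> real"
  assumes "integrable lborel u" "e > 0"
  obtains d where "d > 0" "\<And>z. norm z < d \<Longrightarrow> shift_dist u z < e"
proof -
  have "\<exists>d>0. \<forall>z. norm z < d \<longrightarrow> shift_dist u z < e"
  proof (rule ccontr)
    assume "\<not> ?thesis"
    then have "\<exists>z. norm z < 1 / real (Suc n) \<and> e \<le> shift_dist u z" for n
      by (metis not_le divide_pos_pos of_nat_0_less_iff zero_less_Suc zero_less_one)
    then obtain z where z: "\<And>n. norm (z n) < 1 / real (Suc n)" "\<And>n. e \<le> shift_dist u (z n)"
      by metis
    have "z \<longlonglongrightarrow> 0"
      by (rule tendsto_norm_zero_cancel, rule tendsto_sandwich[OF _ _ tendsto_const LIMSEQ_inverse_real_of_nat])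
        (auto intro!: always_eventually less_imp_le[OF z(1)] simp: inverse_eq_divide[symmetric] simp del: of_nat_Suc,
         use z(1) in \<open>auto simp: inverse_eq_divide less_imp_le\<close>)
    from shift_dist_tendsto_0[OF assms(1) this] have "e \<le> 0"
      by (rule LIMSEQ_le_const) (use z(2) in auto)
    with \<open>e > 0\<close> show False
      by simp
  qed
  with that show thesis
    by blast
qed


subsection \<open>Differentiation of convolutions\<close>

lemma onorm_partial_deriv_le:
  fixes c :: "'n::finite \<Rightarrow> real"
  assumes "\<And>i. \<bar>c i\<bar> \<le> B"
  shows "onorm (\<lambda>h :: real^'n. \<Sum>i\<in>UNIV. h $ i * c i) \<le> real CARD('n) * B"
proof (rule onorm_le)
  fix h :: "real^'n"
  have "norm (\<Sum>i\<in>UNIV. h $ i * c i) \<le> (\<Sum>i\<in>UNIV. \<bar>h $ i * c i\<bar>)"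
    by simp
  also have "\<dots> \<le> (\<Sum>i\<in>(UNIV::'n set). norm h * B)"
    using assms component_le_norm_cart by (intro sum_mono) (auto simp: abs_mult intro!: mult_mono)
  finally show "norm (\<Sum>i\<in>UNIV. h $ i * c i) \<le> real CARD('n) * B * norm h"
    by (simp add: mult_ac)
qed

lemma lipschitz_if_bounded_partials:
  fixes f :: "real^'n::finite \<Rightarrow> real"
  assumes "\<And>x. f differentiable (at x)" "\<And>i x. \<bar>partial_deriv i f x\<bar> \<le> B"
  shows "\<bar>f x - f y\<bar> \<le> real CARD('n) * B * norm (x - y)"
proof -
  have "norm (f x - f y) \<le> real CARD('n) * B * norm (x - y)"
  proof (rule differentiable_bound[of UNIV])
    show "(f has_derivative (\<lambda>h. \<Sum>i\<in>UNIV. h $ i * partial_deriv i f z)) (at z)" for z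
      by (rule has_derivative_partial_deriv[OF assms(1)])
    show "onorm (\<lambda>h. \<Sum>i\<in>UNIV. h $ i * partial_deriv i f z) \<le> real CARD('n) * B" for z
      by (rule onorm_partial_deriv_le[OF assms(2)])
  qed auto
  then show ?thesis
    by simp
qed

text \<open>Unlike a mere Taylor expansion with error \<open>o(h)\<close> at each point, this bound is uniform in \<open>x\<close>. It can be integrated
  against any integrable function, which differentiates convolutions.\<close>

lemma quadratic_remainder:
  fixes f :: "real^'n::finite \<Rightarrow> real"
  assumes "\<And>x. f differentiable (at x)" "\<And>i x. partial_deriv i f differentiable (at x)"
    and B: "\<And>i j x. \<bar>partial_deriv i (partial_deriv j f) x\<bar> \<le> B"
  shows "\<bar>f (x + h) - f x - (\<Sum>i\<in>UNIV. h $ i * partial_deriv i f x)\<bar>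
     \<le> (real CARD('n) * real CARD('n) * B) * (norm h)\<^sup>2"
proof -
  let ?f' = "\<lambda>x h. \<Sum>i\<in>UNIV. h $ i * partial_deriv i f x"
  have "0 \<le> B"
    using B[of undefined undefined undefined] by linarith
  have "norm (f (x + h) - f x - ?f' x ((x + h) - x))
      \<le> norm ((x + h) - x) * (real CARD('n) * (real CARD('n) * B * norm h))"
  proof (rule differentiable_bound_linearization[where S = "cball x (norm h)"])
    show "x + t *\<^sub>R (x + h - x) \<in> cball x (norm h)" if "t \<in> {0..1}" for t
      using that by (auto simp: dist_norm mult_left_le_one_le)
    show "(f has_derivative ?f' y) (at y within cball x (norm h))" for y
      by (rule has_derivative_at_withinI[OF has_derivative_partial_deriv[OF assms(1)]])
    show "onorm (?f' y - ?f' x) \<le> real CARD('n) * (real CARD('n) * B * norm h)"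
      if "y \<in> cball x (norm h)" for y
    proof -
      have "?f' y - ?f' x = (\<lambda>h. \<Sum>i\<in>UNIV. h $ i * (partial_deriv i f y - partial_deriv i f x))"
        by (simp add: fun_eq_iff right_diff_distrib sum_subtractf)
      moreover have "\<bar>partial_deriv i f y - partial_deriv i f x\<bar> \<le> real CARD('n) * B * norm h" for i
      proof -
        have "\<bar>partial_deriv i f y - partial_deriv i f x\<bar> \<le> real CARD('n) * B * norm (y - x)"
          by (rule lipschitz_if_bounded_partials[OF assms(2) B])
        also have "\<dots> \<le> real CARD('n) * B * norm h"
          using that \<open>0 \<le> B\<close> by (intro mult_left_mono) (auto simp: dist_norm norm_minus_commute)
        finally show ?thesis .
      qed
      ultimately show ?thesis
        using onorm_partial_deriv_le[of "\<lambda>i. partial_deriv i f y - partial_deriv i f x"] by simp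
    qed
  qed simp
  then show ?thesis
    by (simp add: power2_eq_square mult_ac)
qed

lemma has_derivative_if_quadratic_remainder:
  fixes F :: "'a::real_normed_vector \<Rightarrow> real"
  assumes "bounded_linear D" "\<And>h. \<bar>F (x + h) - F x - D h\<bar> \<le> C * (norm h)\<^sup>2"
  shows "(F has_derivative D) (at x)"
proof -
  have "((\<lambda>h. norm (F (x + h) - F x - D h) / norm h) \<longlongrightarrow> 0) (at 0)"
  proof (rule real_tendsto_sandwich[OF _ _ tendsto_const])
    show "\<forall>\<^sub>F h in at 0. norm (F (x + h) - F x - D h) / norm h \<le> C * norm h"
    proof (rule eventually_mono[OF eventually_neq_at_within[of 0]])
      fix h :: 'a assume "h \<noteq> 0"
      then show "norm (F (x + h) - F x - D h) / norm h \<le> C * norm h"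
        using assms(2)[of h] by (simp add: field_simps power2_eq_square)
    qed
    show "((\<lambda>h. C * norm h) \<longlongrightarrow> 0) (at 0)"
      by (auto intro!: tendsto_eq_intros)
  qed auto
  then show ?thesis
    using assms(1) by (simp add: has_derivative_at)
qed

locale smooth_kernel =
  fixes \<eta> :: "real^'n::finite \<Rightarrow> real" and r :: real
  assumes smooth: "\<forall>m. Ck_on m UNIV \<eta>"
    and support: "norm x \<ge> r \<Longrightarrow> \<eta> x = 0"
begin

lemma support_cball: "x \<notin> cball 0 r \<Longrightarrow> \<eta> x = 0"
  using support by simp

text \<open>The radius is enlarged because the derivative is known to vanish only in the open complement of the ball that carries
  the kernel.\<close>

lemma partial_deriv_kernel: "smooth_kernel (partial_deriv i \<eta>) (r + 1)"
proof
  show "\<forall>m. Ck_on m UNIV (partial_deriv i \<eta>)"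
    by (rule Ck_on_UNIV_partial[OF smooth])
  show "partial_deriv i \<eta> x = 0" if "r + 1 \<le> norm x" for x
    using that by (intro partial_deriv_zero_outside[of "cball 0 r"] support_cball) auto
qed

lemma bounded_kernel: obtains B where "\<And>x. \<bar>\<eta> x\<bar> \<le> B"
  using continuous_compact_support_bounded[OF Ck_on_UNIV_continuous[OF smooth] compact_cball support_cball]
  by blast

lemma measurable_kernel [measurable]: "\<eta> \<in> borel_measurable borel"
  by (rule borel_measurable_continuous_onI[OF Ck_on_UNIV_continuous[OF smooth]])

lemma differentiable_kernel: "\<eta> differentiable (at x)"
  by (rule Ck_on_UNIV_differentiable[OF smooth])

lemma integrable_times:
  assumes "integrable lborel u"
  shows "integrable lborel (\<lambda>y. u y * \<eta> (x - y))"
proof -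
  obtain B where B: "\<And>x. \<bar>\<eta> x\<bar> \<le> B"
    using bounded_kernel by blast
  note [measurable] = borel_measurable_integrable[OF assms]
  have "integrable lborel (\<lambda>x. B * u x)"
    using assms by simp
  then show ?thesis
  proof (rule Bochner_Integration.integrable_bound)
    show "AE y in lborel. norm (u y * \<eta> (x - y)) \<le> norm (B * u y)"
    proof (rule AE_I2)
      fix y
      have "\<bar>\<eta> (x - y)\<bar> \<le> \<bar>B\<bar>"
        using B[of "x - y"] by simp
      then show "norm (u y * \<eta> (x - y)) \<le> norm (B * u y)"
        by (simp add: abs_mult mult.commute[of "\<bar>u y\<bar>"] mult_right_mono)
    qed
  qed measurable
qed

lemma bounded_partials: obtains B where "\<And>i x. \<bar>partial_deriv i \<eta> x\<bar> \<le> B"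
proof -
  have "\<forall>i. \<exists>B. \<forall>x. \<bar>partial_deriv i \<eta> x\<bar> \<le> B"
  proof
    show "\<exists>B. \<forall>x. \<bar>partial_deriv i \<eta> x\<bar> \<le> B" for i
      by (rule smooth_kernel.bounded_kernel[OF partial_deriv_kernel[of i]]) blast
  qed
  then obtain B where B: "\<And>i x. \<bar>partial_deriv i \<eta> x\<bar> \<le> B i"
    by metis
  have "\<bar>partial_deriv i \<eta> x\<bar> \<le> (\<Sum>i\<in>UNIV. \<bar>B i\<bar>)" for i x
    using B[of i x] member_le_sum[of i UNIV "\<lambda>i. \<bar>B i\<bar>"] by auto
  then show thesis
    by (rule that)
qed

lemma convolution_continuous:
  assumes "integrable lborel u"
  shows "continuous_on UNIV (\<lambda>x. LINT y|lborel. u y * \<eta> (x - y))"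
proof -
  obtain B where B: "\<And>i x. \<bar>partial_deriv i \<eta> x\<bar> \<le> B"
    using bounded_partials by blast
  let ?N = "real CARD('n) * B"
  have "0 \<le> B"
    using B[of undefined undefined] by linarith
  have *: "\<bar>(LINT y|lborel. u y * \<eta> (x - y)) - (LINT y|lborel. u y * \<eta> (x' - y))\<bar>
     \<le> (?N * (LINT y|lborel. \<bar>u y\<bar>)) * dist x x'" for x x'
  proof -
    have "\<bar>(LINT y|lborel. u y * \<eta> (x - y)) - (LINT y|lborel. u y * \<eta> (x' - y))\<bar>
       = \<bar>LINT y|lborel. u y * \<eta> (x - y) - u y * \<eta> (x' - y)\<bar>"
      by (simp add: integrable_times[OF assms])
    also have "\<dots> \<le> (LINT y|lborel. \<bar>u y * \<eta> (x - y) - u y * \<eta> (x' - y)\<bar>)"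
      by (rule integral_abs_bound)
    also have "\<dots> \<le> (LINT y|lborel. (?N * dist x x') * \<bar>u y\<bar>)"
    proof (rule integral_mono)
      fix y
      have "\<bar>\<eta> (x - y) - \<eta> (x' - y)\<bar> \<le> ?N * dist x x'"
        using lipschitz_if_bounded_partials[OF differentiable_kernel B, of "x - y" "x' - y"]
        by (simp add: dist_norm)
      then show "\<bar>u y * \<eta> (x - y) - u y * \<eta> (x' - y)\<bar> \<le> (?N * dist x x') * \<bar>u y\<bar>"
        using mult_left_mono[of "\<bar>\<eta> (x - y) - \<eta> (x' - y)\<bar>" "?N * dist x x'" "\<bar>u y\<bar>"]
        by (simp add: mult_ac flip: abs_mult right_diff_distrib)
    qed (use assms integrable_times[OF assms] in auto)
    finally show ?thesis
      by (simp add: mult_ac)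
  qed
  have "(?N * (LINT y|lborel. \<bar>u y\<bar>))-lipschitz_on UNIV (\<lambda>x. LINT y|lborel. u y * \<eta> (x - y))"
    using * \<open>0 \<le> B\<close> by (intro lipschitz_onI) (auto simp: dist_real_def)
  then show ?thesis
    by (rule lipschitz_on_continuous_on)
qed

lemma convolution_has_derivative:
  assumes u: "integrable lborel u"
  shows "((\<lambda>x. LINT y|lborel. u y * \<eta> (x - y)) has_derivative
     (\<lambda>h. \<Sum>i\<in>UNIV. h $ i * (LINT y|lborel. u y * partial_deriv i \<eta> (x - y)))) (at x)"
proof -
  have "\<forall>j. \<exists>B. \<forall>i x. \<bar>partial_deriv i (partial_deriv j \<eta>) x\<bar> \<le> B"
  proof
    show "\<exists>B. \<forall>i x. \<bar>partial_deriv i (partial_deriv j \<eta>) x\<bar> \<le> B" for j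
      by (rule smooth_kernel.bounded_partials[OF partial_deriv_kernel[of j]]) blast
  qed
  then obtain B where B: "\<And>i j x. \<bar>partial_deriv i (partial_deriv j \<eta>) x\<bar> \<le> B j"
    by metis
  let ?B = "\<Sum>i\<in>UNIV. \<bar>B i\<bar>"
  have B': "\<bar>partial_deriv i (partial_deriv j \<eta>) x\<bar> \<le> ?B" for i j x
    using B[of i j x] member_le_sum[of j UNIV "\<lambda>i. \<bar>B i\<bar>"] by auto
  let ?M = "real CARD('n) * real CARD('n) * ?B"
  note dk = smooth_kernel.differentiable_kernel[OF partial_deriv_kernel]
  note ik = smooth_kernel.integrable_times[OF partial_deriv_kernel u]
  let ?F = "\<lambda>x. LINT y|lborel. u y * \<eta> (x - y)"
  let ?D = "\<lambda>h. \<Sum>i\<in>UNIV. h $ i * (LINT y|lborel. u y * partial_deriv i \<eta> (x - y))"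
  have "\<bar>?F (x + h) - ?F x - ?D h\<bar> \<le> (?M * (LINT y|lborel. \<bar>u y\<bar>)) * (norm h)\<^sup>2" for h
  proof -
    let ?R = "\<lambda>y. \<eta> (x + h - y) - \<eta> (x - y) - (\<Sum>i\<in>UNIV. h $ i * partial_deriv i \<eta> (x - y))"
    have eq: "u y * ?R y = u y * \<eta> (x + h - y) - u y * \<eta> (x - y)
         - (\<Sum>i\<in>UNIV. h $ i * (u y * partial_deriv i \<eta> (x - y)))" for y
      by (simp add: right_diff_distrib sum_distrib_left mult_ac)
    have int: "integrable lborel (\<lambda>y. u y * ?R y)"
      unfolding eq using integrable_times[OF u] ik by auto
    have 1: "?F (x + h) - ?F x - ?D h = (LINT y|lborel. u y * ?R y)"
      unfolding eq using integrable_times[OF u] ik by simp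
    have 2: "\<bar>LINT y|lborel. u y * ?R y\<bar> \<le> (LINT y|lborel. \<bar>u y * ?R y\<bar>)"
      by (rule integral_abs_bound)
    have 3: "(LINT y|lborel. \<bar>u y * ?R y\<bar>) \<le> (LINT y|lborel. (?M * (norm h)\<^sup>2) * \<bar>u y\<bar>)"
    proof (rule integral_mono)
      fix y
      have "\<bar>?R y\<bar> \<le> ?M * (norm h)\<^sup>2"
        using quadratic_remainder[OF differentiable_kernel dk B', of "x - y" h] by (simp add: algebra_simps)
      then show "\<bar>u y * ?R y\<bar> \<le> (?M * (norm h)\<^sup>2) * \<bar>u y\<bar>"
        using mult_left_mono[of "\<bar>?R y\<bar>" "?M * (norm h)\<^sup>2" "\<bar>u y\<bar>"] by (simp only: abs_mult mult_ac)
    qed (use u int in auto)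
    show ?thesis
      unfolding 1 using order_trans[OF 2 3] by (simp add: mult_ac)
  qed
  moreover have "bounded_linear ?D"
    by (intro bounded_linear_sum bounded_linear_mult_left[THEN bounded_linear_compose] bounded_linear_vec_nth)
  ultimately show ?thesis
    by (intro has_derivative_if_quadratic_remainder[where C = "?M * (LINT y|lborel. \<bar>u y\<bar>)"]) auto
qed

text \<open>Convolution with a probability density averages the translates of \<open>u\<close>, which are close
  to \<open>u\<close>.\<close>

lemma convolution_L1_dist:
  assumes u: "integrable lborel u" and nonneg: "\<And>x. 0 \<le> \<eta> x" and one: "integral\<^sup>L lborel \<eta> = 1"
    and e: "\<And>z. norm z < r \<Longrightarrow> shift_dist u z \<le> e"
  shows "(\<integral>\<^sup>+x. ennreal \<bar>u x - (LINT y|lborel. u y * \<eta> (x - y))\<bar> \<partial>lborel) \<le> ennreal e"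
proof -
  note [measurable] = borel_measurable_integrable[OF u]
  have int\<eta>: "integrable lborel \<eta>"
    using one not_integrable_integral_eq by fastforce
  have 1: "ennreal \<bar>u x - (LINT y|lborel. u y * \<eta> (x - y))\<bar>
      \<le> (\<integral>\<^sup>+z. ennreal (\<bar>u (x - z) - u x\<bar> * \<eta> z) \<partial>lborel)" for x
  proof -
    have int: "integrable lborel (\<lambda>z. u (x - z) * \<eta> z)"
      using lborel_reflect(1)[OF integrable_times[OF u, of x], of x] by simp
    have int2: "integrable lborel (\<lambda>z. (u (x - z) - u x) * \<eta> z)"
      unfolding left_diff_distrib using int int\<eta> by auto
    have "(LINT y|lborel. u y * \<eta> (x - y)) = (LINT z|lborel. u (x - z) * \<eta> z)"
      using lborel_reflect(2)[OF integrable_times[OF u, of x], of x] by simp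
    then have "(LINT y|lborel. u y * \<eta> (x - y)) - u x = (LINT z|lborel. (u (x - z) - u x) * \<eta> z)"
      using int int\<eta> one by (simp add: left_diff_distrib)
    then have "ennreal \<bar>u x - (LINT y|lborel. u y * \<eta> (x - y))\<bar>
        = ennreal (norm (LINT z|lborel. (u (x - z) - u x) * \<eta> z))"
      by (simp only: real_norm_def flip: abs_minus_commute[of _ "u x"])
    also have "\<dots> \<le> (\<integral>\<^sup>+z. ennreal (norm ((u (x - z) - u x) * \<eta> z)) \<partial>lborel)"
      using int2 by (rule integral_norm_bound_ennreal)
    finally show ?thesis
      using nonneg by (simp add: abs_mult)
  qed
  have 2: "(\<integral>\<^sup>+x. ennreal (\<bar>u (x - z) - u x\<bar> * \<eta> z) \<partial>lborel) \<le> ennreal e * ennreal (\<eta> z)" for z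
  proof (cases "norm z < r")
    case True
    have "(\<integral>\<^sup>+x. ennreal (\<bar>u (x - z) - u x\<bar> * \<eta> z) \<partial>lborel)
        = (\<integral>\<^sup>+x. ennreal \<bar>u (x - z) - u x\<bar> \<partial>lborel) * ennreal (\<eta> z)"
      using nonneg by (simp add: ennreal_mult' nn_integral_multc)
    also have "(\<integral>\<^sup>+x. ennreal \<bar>u (x - z) - u x\<bar> \<partial>lborel) = ennreal (shift_dist u (- z))"
      unfolding shift_dist_def using u lborel_shift(1)[OF u, of "- z"]
      by (subst nn_integral_eq_integral) auto
    finally show ?thesis
      using e[of "- z"] True by (simp add: mult_right_mono ennreal_leI)
  qed (simp add: support)
  have "(\<integral>\<^sup>+x. ennreal \<bar>u x - (LINT y|lborel. u y * \<eta> (x - y))\<bar> \<partial>lborel)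
     \<le> (\<integral>\<^sup>+x. \<integral>\<^sup>+z. ennreal (\<bar>u (x - z) - u x\<bar> * \<eta> z) \<partial>lborel \<partial>lborel)"
    by (intro nn_integral_mono 1)
  also have "\<dots> = (\<integral>\<^sup>+z. \<integral>\<^sup>+x. ennreal (\<bar>u (x - z) - u x\<bar> * \<eta> z) \<partial>lborel \<partial>lborel)"
    by (rule lborel_pair.Fubini'[symmetric]) simp
  also have "\<dots> \<le> (\<integral>\<^sup>+z. ennreal e * ennreal (\<eta> z) \<partial>lborel)"
    by (intro nn_integral_mono 2)
  also have "\<dots> = ennreal e * ennreal (integral\<^sup>L lborel \<eta>)"
    using int\<eta> nonneg by (subst nn_integral_cmult) (auto simp: nn_integral_eq_integral)
  finally show ?thesis
    by (simp add: one)
qed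

end

subsection \<open>Locally integrable functions\<close>

lemma integrable_lebesgue_on_iff:
  fixes f :: "'a::euclidean_space \<Rightarrow> real"
  assumes "S \<in> sets lebesgue"
  shows "integrable (lebesgue_on S) f \<longleftrightarrow> integrable lebesgue (\<lambda>x. indicator S x * f x)"
  using assms by (simp add: integrable_restrict_space)

lemma integral_lebesgue_on_eq:
  fixes f :: "'a::euclidean_space \<Rightarrow> real"
  assumes "S \<in> sets lebesgue"
  shows "integral\<^sup>L (lebesgue_on S) f = (LINT x|lebesgue. indicator S x * f x)"
  using assms by (simp add: integral_restrict_space)

lemma AE_lebesgue_on_iff:
  assumes "S \<in> sets lebesgue"
  shows "(AE x in lebesgue_on S. P x) \<longleftrightarrow> (AE x in lebesgue. x \<in> S \<longrightarrow> P x)"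
  using assms by (simp add: AE_restrict_space_iff)

lemma nn_integral_lebesgue_on_eq:
  assumes "S \<in> sets lebesgue"
  shows "(\<integral>\<^sup>+x. f x \<partial>lebesgue_on S) = (\<integral>\<^sup>+x. f x * indicator S x \<partial>lebesgue)"
  using assms by (simp add: nn_integral_restrict_space)

lemma lebesgue_on_mult_continuous_integrable:
  fixes g \<psi> :: "'a::euclidean_space \<Rightarrow> real"
  assumes "integrable (lebesgue_on C) g" "compact C" "continuous_on C \<psi>"
  shows "integrable (lebesgue_on C) (\<lambda>x. g x * \<psi> x)"
proof -
  obtain B where B: "\<And>x. x \<in> C \<Longrightarrow> \<bar>\<psi> x\<bar> \<le> B"
    using compact_imp_bounded[OF compact_continuous_image[OF assms(3,2)]] by (auto simp: bounded_iff)
  have C: "C \<in> sets lebesgue"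
    using \<open>compact C\<close> by (simp add: compact_imp_closed lebesgue_closedin)
  have [measurable]: "\<psi> \<in> borel_measurable (lebesgue_on C)" "g \<in> borel_measurable (lebesgue_on C)"
    using continuous_imp_measurable_on_sets_lebesgue[OF assms(3) C] assms(1) by auto
  have "integrable (lebesgue_on C) (\<lambda>x. B * g x)"
    using assms(1) by simp
  then show ?thesis
  proof (rule Bochner_Integration.integrable_bound)
    show "AE x in lebesgue_on C. norm (g x * \<psi> x) \<le> norm (B * g x)"
    proof (rule AE_I2)
      fix x assume "x \<in> space (lebesgue_on C)"
      then have "\<bar>\<psi> x\<bar> \<le> \<bar>B\<bar>"
        using B by (force simp: space_restrict_space)
      then show "norm (g x * \<psi> x) \<le> norm (B * g x)"
        by (simp add: abs_mult mult_right_mono mult.commute[of "\<bar>g x\<bar>"])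
    qed
  qed measurable
qed

lemma compact_sets_lebesgue: "compact (C :: 'a::euclidean_space set) \<Longrightarrow> C \<in> sets lebesgue"
  by (simp add: compact_imp_closed lebesgue_closedin)

lemma L1_loc_mult:
  assumes "g \<in> L1_loc \<Omega>" "continuous_on \<Omega> \<psi>"
  shows "(\<lambda>x. g x * \<psi> x) \<in> L1_loc \<Omega>"
  unfolding L1_loc_def mem_Collect_eq
proof (intro allI impI)
  fix K assume K: "compact K \<and> K \<subseteq> \<Omega>"
  then show "integrable (lebesgue_on K) (\<lambda>x. g x * \<psi> x)"
    using assms by (intro lebesgue_on_mult_continuous_integrable)
      (auto simp: L1_loc_def intro: continuous_on_subset)
qed

lemma L1_loc_add:
  assumes "f \<in> L1_loc \<Omega>" "g \<in> L1_loc \<Omega>"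
  shows "(\<lambda>x. f x + g x) \<in> L1_loc \<Omega>"
  using assms unfolding L1_loc_def by auto

lemma L1_loc_diff:
  assumes "f \<in> L1_loc \<Omega>" "g \<in> L1_loc \<Omega>"
  shows "(\<lambda>x. f x - g x) \<in> L1_loc \<Omega>"
  using assms unfolding L1_loc_def by auto

lemma L1_loc_integrable_times:
  assumes "g \<in> L1_loc \<Omega>" "\<Omega> \<in> sets lebesgue" "compact C" "C \<subseteq> \<Omega>" "continuous_on C \<psi>"
    and "\<And>x. x \<in> \<Omega> - C \<Longrightarrow> \<psi> x = 0"
  shows "integrable (lebesgue_on \<Omega>) (\<lambda>x. g x * \<psi> x)"
proof -
  have "integrable (lebesgue_on C) (\<lambda>x. g x * \<psi> x)"
    using assms by (intro lebesgue_on_mult_continuous_integrable) (auto simp: L1_loc_def)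
  then have "integrable lebesgue (\<lambda>x. indicator C x * (g x * \<psi> x))"
    using compact_sets_lebesgue[OF \<open>compact C\<close>] by (simp add: integrable_lebesgue_on_iff)
  also have "(\<lambda>x. indicator C x * (g x * \<psi> x)) = (\<lambda>x. indicator \<Omega> x * (g x * \<psi> x))"
    using assms(4,6) by (auto simp: fun_eq_iff indicator_def)
  finally show ?thesis
    using assms(2) by (simp add: integrable_lebesgue_on_iff)
qed

lemma test_fun_integrable_times:
  assumes "g \<in> L1_loc \<Omega>" "open \<Omega>" "\<phi> \<in> test_fun \<Omega>"
  shows "integrable (lebesgue_on \<Omega>) (\<lambda>x. g x * \<phi> x)"
proof -
  obtain C where C: "\<forall>m. Ck_on m UNIV \<phi>" "compact C" "C \<subseteq> \<Omega>" "\<And>x. x \<notin> C \<Longrightarrow> \<phi> x = 0"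
    by (rule test_funE[OF assms(3)], rule that) blast+
  then show ?thesis
    using assms by (intro L1_loc_integrable_times[of g \<Omega> C])
      (auto intro: continuous_on_subset[OF Ck_on_UNIV_continuous[OF C(1)]])
qed

lemma compact_exhaustion:
  fixes \<Omega> :: "'a::euclidean_space set"
  assumes "open \<Omega>"
  shows "\<exists>C :: nat \<Rightarrow> _. (\<forall>n. compact (C n)) \<and> (\<forall>n. C n \<subseteq> \<Omega>) \<and> \<Union> (range C) = \<Omega>
    \<and> (\<forall>K. compact K \<longrightarrow> K \<subseteq> \<Omega> \<longrightarrow> (\<exists>N. \<forall>n\<ge>N. K \<subseteq> C n))"
proof (rule open_Union_compact_subsets[OF assms])
  fix C :: "nat \<Rightarrow> 'a set"
  assume "\<And>n. compact (C n)" "\<And>n. C n \<subseteq> \<Omega>" "\<Union> (range C) = \<Omega>"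
    "\<And>K. compact K \<Longrightarrow> K \<subseteq> \<Omega> \<Longrightarrow> \<exists>N. \<forall>n\<ge>N. K \<subseteq> C n"
  then show ?thesis
    by (intro exI[of _ C]) simp
qed

lemma L1_loc_measurable:
  assumes "open \<Omega>" "g \<in> L1_loc \<Omega>"
  shows "g \<in> borel_measurable (lebesgue_on \<Omega>)"
proof -
  obtain C :: "nat \<Rightarrow> _" where C: "\<And>n. compact (C n)" "\<And>n. C n \<subseteq> \<Omega>" "\<Union> (range C) = \<Omega>"
    "\<And>K. compact K \<Longrightarrow> K \<subseteq> \<Omega> \<Longrightarrow> \<exists>N. \<forall>n\<ge>N. K \<subseteq> C n"
    using compact_exhaustion[OF \<open>open \<Omega>\<close>] by blast
  have "(\<lambda>x. indicator \<Omega> x * g x) \<in> borel_measurable lebesgue"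
  proof (rule borel_measurable_LIMSEQ_real)
    fix x
    show "(\<lambda>n. indicator (C n) x * g x) \<longlonglongrightarrow> indicator \<Omega> x * g x"
    proof (cases "x \<in> \<Omega>")
      case True
      then obtain N where "\<And>n. n \<ge> N \<Longrightarrow> {x} \<subseteq> C n"
        using C(4)[of "{x}"] by auto
      then have "indicator (C n) x * g x = indicator \<Omega> x * g x" if "n \<ge> N" for n
        using True that by simp
      then have "\<forall>\<^sub>F n in sequentially. indicator (C n) x * g x = indicator \<Omega> x * g x"
        by (rule eventually_sequentiallyI)
      then show ?thesis
        by (rule tendsto_eventually)
    next
      case False
      then have "indicator (C n) x = (0::real)" for n
        using C(2) by (auto simp: indicator_def)
      with False show ?thesis
        by simp
    qed
  next
    fix n
    have "integrable (lebesgue_on (C n)) g"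
      using assms(2) C(1,2) by (simp add: L1_loc_def)
    then show "(\<lambda>x. indicator (C n) x * g x) \<in> borel_measurable lebesgue"
      using compact_sets_lebesgue[OF C(1)] by (simp add: integrable_lebesgue_on_iff)
  qed
  then show ?thesis
    using \<open>open \<Omega>\<close> by (subst borel_measurable_restrict_space_iff) auto
qed

text \<open>Convolutions are taken of integrable Borel functions on the whole space. The function \<open>v\<close> replaces \<open>u\<close> there: it
  agrees with \<open>u\<close> on \<open>K\<close> and is indistinguishable from \<open>u\<close> by test functions supported in \<open>K\<close>.\<close>

lemma L1_loc_cutoff:
  assumes "u \<in> L1_loc \<Omega>" "\<Omega> \<in> sets lebesgue" "compact K" "K \<subseteq> \<Omega>"
  obtains v where "integrable lborel v" "AE x in lebesgue. x \<in> K \<longrightarrow> v x = u x"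
    "\<And>\<psi>. continuous_on UNIV \<psi> \<Longrightarrow> (\<And>x. x \<notin> K \<Longrightarrow> \<psi> x = 0) \<Longrightarrow>
      (LINT x|lebesgue_on \<Omega>. u x * \<psi> x) = (LINT x|lborel. v x * \<psi> x)"
proof -
  let ?w = "\<lambda>x. indicator K x * u x"
  have "integrable (lebesgue_on K) u"
    using assms by (auto simp: L1_loc_def)
  then have int: "integrable lebesgue ?w"
    using compact_sets_lebesgue[OF \<open>compact K\<close>] by (simp add: integrable_lebesgue_on_iff)
  then obtain v where v: "v \<in> borel_measurable lborel" "AE x in lborel. ?w x = v x"
    using completion_ex_borel_measurable_real[of ?w lborel] borel_measurable_integrable by blast
  have ae: "AE x in lebesgue. ?w x = v x"
    using v(2) by (rule AE_completion)
  have vl: "v \<in> borel_measurable lebesgue"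
    using v(1) by (rule measurable_completion)
  have "integrable lebesgue v"
    using int ae vl borel_measurable_integrable[OF int] by (subst (asm) integrable_cong_AE) auto
  then have "integrable lborel v"
    using v(1) by (simp add: integrable_completion)
  moreover have "AE x in lebesgue. x \<in> K \<longrightarrow> v x = u x"
    using ae by eventually_elim auto
  moreover have "(LINT x|lebesgue_on \<Omega>. u x * \<psi> x) = (LINT x|lborel. v x * \<psi> x)"
    if \<psi>: "continuous_on UNIV \<psi>" "\<And>x. x \<notin> K \<Longrightarrow> \<psi> x = 0" for \<psi>
  proof -
    have m: "\<psi> \<in> borel_measurable borel"
      using \<psi>(1) by (rule borel_measurable_continuous_onI)
    then have ml: "\<psi> \<in> borel_measurable lebesgue"
      by (intro measurable_completion) simp
    have "(LINT x|lebesgue_on \<Omega>. u x * \<psi> x) = (LINT x|lebesgue. indicator \<Omega> x * (u x * \<psi> x))"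
      by (rule integral_lebesgue_on_eq[OF assms(2)])
    also have "(\<lambda>x. indicator \<Omega> x * (u x * \<psi> x)) = (\<lambda>x. ?w x * \<psi> x)"
      using \<psi>(2) \<open>K \<subseteq> \<Omega>\<close> by (auto simp: fun_eq_iff indicator_def)
    also have "(LINT x|lebesgue. ?w x * \<psi> x) = (LINT x|lebesgue. v x * \<psi> x)"
    proof (rule integral_cong_AE)
      show "AE x in lebesgue. ?w x * \<psi> x = v x * \<psi> x"
        using ae by eventually_elim simp
    qed (use borel_measurable_integrable[OF int] vl ml in \<open>auto intro!: borel_measurable_times\<close>)
    also have "\<dots> = (LINT x|lborel. v x * \<psi> x)"
      using v(1) m by (intro integral_completion) simp
    finally show ?thesis .
  qed
  ultimately show thesis
    by (rule that)
qed

subsection \<open>Approximation of weakly differentiable functions\<close>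

lemma compact_neighbourhood:
  fixes K :: "'a::euclidean_space set"
  assumes "open \<Omega>" "compact K" "K \<subseteq> \<Omega>"
  obtains r K' where "r > 0" "compact K'" "K' \<subseteq> \<Omega>" "\<And>x. x \<in> K \<Longrightarrow> cball x r \<subseteq> K'"
proof -
  obtain r where r: "r > 0" "(\<Union>x\<in>K. cball x r) \<subseteq> \<Omega>"
    using compact_subset_open_imp_cball_epsilon_subset[OF assms(2,1,3)] by blast
  let ?K' = "{x + y |x y. x \<in> K \<and> y \<in> cball 0 r}"
  have sub: "?K' \<subseteq> (\<Union>x\<in>K. cball x r)"
    by (auto simp: dist_norm intro!: bexI)
  have "cball x r \<subseteq> ?K'" if "x \<in> K" for x
  proof
    fix y assume "y \<in> cball x r"
    then have "y = x + (y - x)" "y - x \<in> cball 0 r"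
      by (auto simp: dist_norm norm_minus_commute)
    with that show "y \<in> ?K'"
      by blast
  qed
  moreover have "compact ?K'"
    using compact_sums[OF \<open>compact K\<close> compact_cball[of 0 r]] by simp
  ultimately show thesis
    using that[of r ?K'] r order_trans[OF sub r(2)] by simp
qed

lemma nn_integral_on_compact_le:
  assumes "compact K" "AE x in lebesgue. x \<in> K \<longrightarrow> v x = u x" "\<And>x. x \<in> K \<Longrightarrow> F x = G x"
  shows "(\<integral>\<^sup>+x. ennreal \<bar>u x - F x\<bar> \<partial>lebesgue_on K) \<le> (\<integral>\<^sup>+x. ennreal \<bar>v x - G x\<bar> \<partial>lborel)"
proof -
  have "(\<integral>\<^sup>+x. ennreal \<bar>u x - F x\<bar> \<partial>lebesgue_on K)
     = (\<integral>\<^sup>+x. ennreal \<bar>u x - F x\<bar> * indicator K x \<partial>lebesgue)"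
    by (rule nn_integral_lebesgue_on_eq[OF compact_sets_lebesgue[OF \<open>compact K\<close>]])
  also have "\<dots> \<le> (\<integral>\<^sup>+x. ennreal \<bar>v x - G x\<bar> \<partial>lebesgue)"
    using assms(2) by (intro nn_integral_mono_AE) (auto elim!: eventually_mono simp: assms(3) indicator_def)
  finally show ?thesis
    by (simp add: nn_integral_completion)
qed

lemma reflected_kernel_test_fun:
  assumes "smooth_kernel \<eta> r" "cball x r \<subseteq> \<Omega>"
  shows "(\<lambda>y. \<eta> (x - y)) \<in> test_fun \<Omega>"
proof (rule test_funI[of _ "cball x r"])
  show "\<forall>m. Ck_on m UNIV (\<lambda>y. \<eta> (x - y))"
    using assms(1) Ck_on_reflect[of _ \<eta> 1 x] by (simp add: smooth_kernel_def)
  show "\<eta> (x - y) = 0" if "y \<notin> cball x r" for y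
    using that smooth_kernel.support[OF assms(1)] by (simp add: dist_norm)
qed (use assms in auto)

text \<open>Mollification commutes with weak derivatives where the translated kernel is a test function of \<open>\<Omega>\<close>, in
  particular on \<open>K\<close> if the kernel has small support. So both the function and its derivatives are approximated
  by averages of their translates.\<close>

theorem approximate_by_C1:
  fixes \<Omega> :: "(real^'n::finite) set"
  assumes "open \<Omega>" and weak: "\<And>i. has_weak_deriv \<Omega> (mi_unit i) u (g i)"
    and K: "compact K" "K \<subseteq> \<Omega>" and "e > 0"
  obtains f where "\<And>x. f differentiable (at x)" "\<And>i. continuous_on UNIV (partial_deriv i f)"
    "(\<integral>\<^sup>+x. ennreal \<bar>u x - f x\<bar> \<partial>lebesgue_on K) \<le> ennreal e"
    "\<And>i. (\<integral>\<^sup>+x. ennreal \<bar>g i x - partial_deriv i f x\<bar> \<partial>lebesgue_on K) \<le> ennreal e"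
proof -
  have \<Omega>: "\<Omega> \<in> sets lebesgue"
    using \<open>open \<Omega>\<close> by simp
  obtain r0 K' where r0: "r0 > 0" and K': "compact K'" "K' \<subseteq> \<Omega>"
    and ball: "\<And>x. x \<in> K \<Longrightarrow> cball x r0 \<subseteq> K'"
    by (rule compact_neighbourhood[OF \<open>open \<Omega>\<close> K], rule that) blast+
  then have KK': "K \<subseteq> K'"
    by force
  have loc: "u \<in> L1_loc \<Omega>" "\<And>i. g i \<in> L1_loc \<Omega>"
    using weak by (auto simp: has_weak_deriv_def)
  obtain v where v: "integrable lborel v" "AE x in lebesgue. x \<in> K' \<longrightarrow> v x = u x"
    "\<And>\<psi>. continuous_on UNIV \<psi> \<Longrightarrow> (\<And>x. x \<notin> K' \<Longrightarrow> \<psi> x = 0) \<Longrightarrow>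
      (LINT x|lebesgue_on \<Omega>. u x * \<psi> x) = (LINT x|lborel. v x * \<psi> x)"
    using L1_loc_cutoff[OF loc(1) \<Omega> K'] by blast
  have "\<forall>i. \<exists>w. integrable lborel w \<and> (AE x in lebesgue. x \<in> K' \<longrightarrow> w x = g i x) \<and>
    (\<forall>\<psi>. continuous_on UNIV \<psi> \<longrightarrow> (\<forall>x. x \<notin> K' \<longrightarrow> \<psi> x = 0) \<longrightarrow>
      (LINT x|lebesgue_on \<Omega>. g i x * \<psi> x) = (LINT x|lborel. w x * \<psi> x))"
  proof
    fix i
    obtain w where "integrable lborel w" "AE x in lebesgue. x \<in> K' \<longrightarrow> w x = g i x"
      "\<And>\<psi>. continuous_on UNIV \<psi> \<Longrightarrow> (\<And>x. x \<notin> K' \<Longrightarrow> \<psi> x = 0) \<Longrightarrow>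
        (LINT x|lebesgue_on \<Omega>. g i x * \<psi> x) = (LINT x|lborel. w x * \<psi> x)"
      by (rule L1_loc_cutoff[OF loc(2)[of i] \<Omega> K'], rule that) blast+
    then show "\<exists>w. integrable lborel w \<and> (AE x in lebesgue. x \<in> K' \<longrightarrow> w x = g i x) \<and>
      (\<forall>\<psi>. continuous_on UNIV \<psi> \<longrightarrow> (\<forall>x. x \<notin> K' \<longrightarrow> \<psi> x = 0) \<longrightarrow>
        (LINT x|lebesgue_on \<Omega>. g i x * \<psi> x) = (LINT x|lborel. w x * \<psi> x))"
      by blast
  qed
  from choice[OF this] obtain w where W: "\<forall>i. integrable lborel (w i) \<and> (AE x in lebesgue. x \<in> K' \<longrightarrow> w i x = g i x) \<and>
    (\<forall>\<psi>. continuous_on UNIV \<psi> \<longrightarrow> (\<forall>x. x \<notin> K' \<longrightarrow> \<psi> x = 0) \<longrightarrow>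
      (LINT x|lebesgue_on \<Omega>. g i x * \<psi> x) = (LINT x|lborel. w i x * \<psi> x))"
    by blast
  then have w: "\<And>i. integrable lborel (w i)" "\<And>i. AE x in lebesgue. x \<in> K' \<longrightarrow> w i x = g i x"
    "\<And>i \<psi>. continuous_on UNIV \<psi> \<Longrightarrow> (\<And>x. x \<notin> K' \<Longrightarrow> \<psi> x = 0) \<Longrightarrow>
      (LINT x|lebesgue_on \<Omega>. g i x * \<psi> x) = (LINT x|lborel. w i x * \<psi> x)"
    by blast+
  obtain d0 where d0: "d0 > 0" "\<And>z. norm z < d0 \<Longrightarrow> shift_dist v z < e"
    using shift_dist_small[OF v(1) \<open>e > 0\<close>] by blast
  have "\<forall>i. \<exists>d>0. \<forall>z. norm z < d \<longrightarrow> shift_dist (w i) z < e"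
    using shift_dist_small[OF w(1) \<open>e > 0\<close>] by metis
  then obtain d where d: "\<And>i. d i > 0" "\<And>i z. norm z < d i \<Longrightarrow> shift_dist (w i) z < e"
    by metis
  \<comment> \<open>The translated kernels are to be supported in \<open>K'\<close>, and the \<open>1 + n\<close> functions are all to be
    close to their translates.\<close>
  define r where "r = min r0 (min d0 (Min (range d)))"
  have "Min (range d) > 0"
    using d(1) by simp
  then have r: "r > 0" "r \<le> r0" "r \<le> d0" "\<And>i. r \<le> d i"
    using r0 d0(1) by (auto simp: r_def min_le_iff_disj)
  obtain \<eta> :: "real^'n \<Rightarrow> real" where \<eta>: "\<forall>m. Ck_on m UNIV \<eta>" "\<And>x. 0 \<le> \<eta> x"
    "\<And>x. r \<le> norm x \<Longrightarrow> \<eta> x = 0" "integral\<^sup>L lborel \<eta> = 1"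
    using mollifier_exists[OF \<open>r > 0\<close>] by blast
  interpret smooth_kernel \<eta> r
    using \<eta> by unfold_locales
  let ?f = "\<lambda>x. LINT y|lborel. v y * \<eta> (x - y)"
  have pd: "partial_deriv i ?f x = (LINT y|lborel. v y * partial_deriv i \<eta> (x - y))" for i x
    by (simp add: partial_deriv_eqI[OF convolution_has_derivative[OF v(1)]] axis_def if_distribR
        if_distrib[of "\<lambda>c. c * _"] cong: if_cong)
  have pdK: "partial_deriv i ?f x = (LINT y|lborel. w i y * \<eta> (x - y))" if "x \<in> K" for i x
  proof -
    have sub: "cball x r \<subseteq> K'"
      using ball[OF that] r(2) by (meson order_trans subset_cball)
    let ?\<phi> = "\<lambda>y. \<eta> (x - y)"
    have \<phi>: "?\<phi> \<in> test_fun \<Omega>" "?\<phi> \<in> test_fun K'"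
      using sub K'(2) smooth_kernel_axioms by (auto intro!: reflected_kernel_test_fun)
    have p\<phi>: "partial_deriv i ?\<phi> = (\<lambda>y. - partial_deriv i \<eta> (x - y))"
      using partial_deriv_reflect[OF differentiable_kernel] by blast
    have cont: "continuous_on UNIV ?\<phi>" "continuous_on UNIV (partial_deriv i ?\<phi>)"
      using Ck_on_UNIV_continuous \<phi>(1) test_fun_partial_deriv[OF \<phi>(1), of i] by (auto simp: test_fun_def)
    have zero: "?\<phi> y = 0" "partial_deriv i ?\<phi> y = 0" if "y \<notin> K'" for y
    proof -
      obtain C where "C \<subseteq> K'" "\<And>x. x \<notin> C \<Longrightarrow> ?\<phi> x = 0"
        "\<And>i x. x \<notin> C \<Longrightarrow> partial_deriv i ?\<phi> x = 0"
        by (rule test_funE[OF \<phi>(2)], rule that) blast+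
      with that show "?\<phi> y = 0" "partial_deriv i ?\<phi> y = 0"
        by blast+
    qed
    have "(LINT y|lborel. v y * partial_deriv i ?\<phi> y) = (LINT y|lebesgue_on \<Omega>. u y * partial_deriv i ?\<phi> y)"
      using v(3)[OF cont(2) zero(2)] by simp
    also have "\<dots> = - (LINT y|lebesgue_on \<Omega>. g i y * ?\<phi> y)"
      using weak[of i] \<phi>(1) by (simp add: has_weak_deriv_unit_iff)
    also have "(LINT y|lebesgue_on \<Omega>. g i y * ?\<phi> y) = (LINT y|lborel. w i y * ?\<phi> y)"
      by (rule w(3)[OF cont(1) zero(1)])
    finally show ?thesis
      unfolding pd p\<phi> by simp
  qed
  show thesis
  proof (rule that[of ?f])
    show "?f differentiable (at x)" for x
      using convolution_has_derivative[OF v(1)] by (auto simp: differentiable_def)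
    show "continuous_on UNIV (partial_deriv i ?f)" for i
      unfolding pd[abs_def] by (rule smooth_kernel.convolution_continuous[OF partial_deriv_kernel v(1)])
    have "(\<integral>\<^sup>+x. ennreal \<bar>u x - ?f x\<bar> \<partial>lebesgue_on K) \<le> (\<integral>\<^sup>+x. ennreal \<bar>v x - ?f x\<bar> \<partial>lborel)"
      using v(2) KK' by (intro nn_integral_on_compact_le[OF K(1)]) (auto elim!: eventually_mono)
    also have "\<dots> \<le> ennreal e"
      using d0(2) r(3) by (intro convolution_L1_dist[OF v(1) \<eta>(2,4)] less_imp_le) auto
    finally show "(\<integral>\<^sup>+x. ennreal \<bar>u x - ?f x\<bar> \<partial>lebesgue_on K) \<le> ennreal e" .
    show "(\<integral>\<^sup>+x. ennreal \<bar>g i x - partial_deriv i ?f x\<bar> \<partial>lebesgue_on K) \<le> ennreal e" for i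
    proof -
      have "(\<integral>\<^sup>+x. ennreal \<bar>g i x - partial_deriv i ?f x\<bar> \<partial>lebesgue_on K)
         \<le> (\<integral>\<^sup>+x. ennreal \<bar>w i x - (LINT y|lborel. w i y * \<eta> (x - y))\<bar> \<partial>lborel)"
        using w(2)[of i] KK' by (intro nn_integral_on_compact_le[OF K(1)] pdK) (auto elim!: eventually_mono)
      also have "\<dots> \<le> ennreal e"
        using d(2) r(4)[of i] by (intro convolution_L1_dist[OF w(1) \<eta>(2,4)] less_imp_le) auto
      finally show ?thesis .
    qed
  qed
qed

subsection \<open>Uniqueness of weak derivatives\<close>

lemma AE_on_if_AE_on_compact:
  fixes \<Omega> :: "'a::euclidean_space set"
  assumes "open \<Omega>" "\<And>K. compact K \<Longrightarrow> K \<subseteq> \<Omega> \<Longrightarrow> AE x in lebesgue. x \<in> K \<longrightarrow> P x"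
  shows "AE x in lebesgue_on \<Omega>. P x"
proof -
  obtain C :: "nat \<Rightarrow> _" where C: "\<And>n. compact (C n)" "\<And>n. C n \<subseteq> \<Omega>" "\<Union> (range C) = \<Omega>"
    using compact_exhaustion[OF \<open>open \<Omega>\<close>] by blast
  then have "\<forall>n. AE x in lebesgue. x \<in> C n \<longrightarrow> P x"
    using assms(2) by blast
  then have "AE x in lebesgue. \<forall>n. x \<in> C n \<longrightarrow> P x"
    by (subst AE_all_countable)
  then have "AE x in lebesgue. x \<in> \<Omega> \<longrightarrow> P x"
    by (rule eventually_mono) (use C(3) in blast)
  then show ?thesis
    using \<open>open \<Omega>\<close> by (simp add: AE_lebesgue_on_iff)
qed

text \<open>The mollifications of \<open>u\<close> are integrals against test functions and vanish on \<open>K\<close>, but they also converge to \<open>u\<close> in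
  \<open>L\<^sup>1\<close> on \<open>K\<close>.\<close>

theorem AE_zero_if_integrals_zero:
  fixes \<Omega> :: "(real^'n::finite) set"
  assumes "open \<Omega>" "u \<in> L1_loc \<Omega>" and zero: "\<And>\<phi>. \<phi> \<in> test_fun \<Omega> \<Longrightarrow> (LINT x|lebesgue_on \<Omega>. u x * \<phi> x) = 0"
  shows "AE_eq_on \<Omega> u (\<lambda>_. 0)"
  unfolding AE_eq_on_def
proof (rule AE_on_if_AE_on_compact[OF \<open>open \<Omega>\<close>])
  fix K assume K: "compact K" "K \<subseteq> \<Omega>"
  have \<Omega>: "\<Omega> \<in> sets lebesgue"
    using \<open>open \<Omega>\<close> by simp
  obtain r0 K' where r0: "r0 > 0" and K': "compact K'" "K' \<subseteq> \<Omega>"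
    and ball: "\<And>x. x \<in> K \<Longrightarrow> cball x r0 \<subseteq> K'"
    by (rule compact_neighbourhood[OF \<open>open \<Omega>\<close> K], rule that) blast+
  then have KK': "K \<subseteq> K'"
    by force
  obtain v where v: "integrable lborel v" "AE x in lebesgue. x \<in> K' \<longrightarrow> v x = u x"
    "\<And>\<psi>. continuous_on UNIV \<psi> \<Longrightarrow> (\<And>x. x \<notin> K' \<Longrightarrow> \<psi> x = 0) \<Longrightarrow>
      (LINT x|lebesgue_on \<Omega>. u x * \<psi> x) = (LINT x|lborel. v x * \<psi> x)"
    using L1_loc_cutoff[OF assms(2) \<Omega> K'] by blast
  have "(\<integral>\<^sup>+x. ennreal \<bar>u x - 0\<bar> \<partial>lebesgue_on K) \<le> 0"
  proof (rule ennreal_le_epsilon)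
    fix e :: real assume "e > 0"
    obtain d where d: "d > 0" "\<And>z. norm z < d \<Longrightarrow> shift_dist v z < e"
      using shift_dist_small[OF v(1) \<open>e > 0\<close>] by blast
    define r where "r = min r0 d"
    have r: "r > 0" "r \<le> r0" "r \<le> d"
      using r0 d(1) by (auto simp: r_def)
    obtain \<eta> :: "real^'n \<Rightarrow> real" where \<eta>: "\<forall>m. Ck_on m UNIV \<eta>" "\<And>x. 0 \<le> \<eta> x"
      "\<And>x. r \<le> norm x \<Longrightarrow> \<eta> x = 0" "integral\<^sup>L lborel \<eta> = 1"
      using mollifier_exists[OF \<open>r > 0\<close>] by blast
    interpret smooth_kernel \<eta> r
      using \<eta> by unfold_locales
    have "(LINT y|lborel. v y * \<eta> (x - y)) = 0" if "x \<in> K" for x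
    proof -
      have sub: "cball x r \<subseteq> K'"
        using ball[OF that] r(2) by (meson order_trans subset_cball)
      have \<phi>: "(\<lambda>y. \<eta> (x - y)) \<in> test_fun \<Omega>" "(\<lambda>y. \<eta> (x - y)) \<in> test_fun K'"
        using sub K'(2) smooth_kernel_axioms by (auto intro!: reflected_kernel_test_fun)
      have "(LINT y|lborel. v y * \<eta> (x - y)) = (LINT y|lebesgue_on \<Omega>. u y * \<eta> (x - y))"
      proof (rule v(3)[symmetric])
        show "continuous_on UNIV (\<lambda>y. \<eta> (x - y))"
          using Ck_on_UNIV_continuous \<phi>(1) by (auto simp: test_fun_def)
        show "\<eta> (x - y) = 0" if "y \<notin> K'" for y
          using that by (auto intro: test_funE[OF \<phi>(2)])
      qed
      then show ?thesis
        using zero[OF \<phi>(1)] by simp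
    qed
    then have "(\<integral>\<^sup>+x. ennreal \<bar>u x - 0\<bar> \<partial>lebesgue_on K)
        \<le> (\<integral>\<^sup>+x. ennreal \<bar>v x - (LINT y|lborel. v y * \<eta> (x - y))\<bar> \<partial>lborel)"
      using v(2) KK' by (intro nn_integral_on_compact_le[OF K(1)]) (auto elim!: eventually_mono)
    also have "\<dots> \<le> ennreal e"
      using d(2) r(3) by (intro convolution_L1_dist[OF v(1) \<eta>(2,4)] less_imp_le) auto
    finally show "(\<integral>\<^sup>+x. ennreal \<bar>u x - 0\<bar> \<partial>lebesgue_on K) \<le> 0 + ennreal e"
      by simp
  qed
  moreover have "u \<in> borel_measurable (lebesgue_on K)"
    using assms(2) K by (auto simp: L1_loc_def)
  ultimately have "AE x in lebesgue_on K. ennreal \<bar>u x\<bar> = 0"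
    by (subst nn_integral_0_iff_AE[symmetric]) auto
  then show "AE x in lebesgue. x \<in> K \<longrightarrow> u x = 0"
    using compact_sets_lebesgue[OF K(1)] by (simp add: AE_lebesgue_on_iff)
qed

theorem has_weak_deriv_unique:
  assumes "open \<Omega>" "has_weak_deriv \<Omega> \<nu> u g" "has_weak_deriv \<Omega> \<nu> u h"
  shows "AE_eq_on \<Omega> g h"
proof -
  have gh: "g \<in> L1_loc \<Omega>" "h \<in> L1_loc \<Omega>"
    using assms by (auto simp: has_weak_deriv_def)
  have "AE_eq_on \<Omega> (\<lambda>x. g x - h x) (\<lambda>_. 0)"
  proof (rule AE_zero_if_integrals_zero[OF \<open>open \<Omega>\<close> L1_loc_diff[OF gh]])
    fix \<phi> assume \<phi>: "\<phi> \<in> test_fun \<Omega>"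
    have "(LINT x|lebesgue_on \<Omega>. g x * \<phi> x) = (LINT x|lebesgue_on \<Omega>. h x * \<phi> x)"
      using assms(2,3) \<phi> by (auto simp: has_weak_deriv_def)
    then show "(LINT x|lebesgue_on \<Omega>. (g x - h x) * \<phi> x) = 0"
      using gh \<phi> \<open>open \<Omega>\<close> by (simp add: left_diff_distrib test_fun_integrable_times)
  qed
  then show ?thesis
    by (simp add: AE_eq_on_def)
qed

subsection \<open>Integration by parts\<close>

text \<open>The difference quotients of \<open>F\<close> have integral zero by translation invariance. They converge to the derivative and
  are dominated thanks to the mean value theorem.\<close>

lemma integral_partial_deriv_zero:
  fixes F :: "real^'n::finite \<Rightarrow> real"
  assumes diff: "\<And>x. F differentiable (at x)" and cont: "continuous_on UNIV (partial_deriv i F)"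
    and C: "compact C" "\<And>x. x \<notin> C \<Longrightarrow> F x = 0"
  shows "(LINT x|lborel. partial_deriv i F x) = 0"
proof -
  let ?a = "axis i 1 :: real^'n"
  have contF: "continuous_on UNIV F"
    using diff by (intro differentiable_imp_continuous_on) (auto simp: differentiable_on_def differentiable_at_withinI)
  have intF: "integrable lborel F"
    by (rule continuous_compact_support_integrable[OF contF C])
  have zero: "partial_deriv i F x = 0" if "x \<notin> C" for x
    using partial_deriv_zero_outside[of C F x i] C that by (simp add: compact_imp_closed)
  obtain B where B: "B > 0" "\<And>x. \<bar>partial_deriv i F x\<bar> \<le> B"
    using continuous_compact_support_bounded[OF cont C(1) zero] by blast
  let ?C' = "{x + y |x y. x \<in> C \<and> y \<in> cball 0 1}"
  have C': "compact ?C'"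
    using compact_sums[OF \<open>compact C\<close> compact_cball[of 0 1]] by simp
  define h where "h n = inverse (real (Suc n))" for n
  have h: "0 < h n" "h n \<le> 1" for n
    by (auto simp: h_def inverse_le_1_iff)
  let ?q = "\<lambda>n x. (F (x + h n *\<^sub>R ?a) - F x) / h n"
  have q0: "(LINT x|lborel. ?q n x) = 0" for n
    using intF lborel_shift[OF intF, of "h n *\<^sub>R ?a"] by simp
  have "(\<lambda>n. LINT x|lborel. ?q n x) \<longlonglongrightarrow> (LINT x|lborel. partial_deriv i F x)"
  proof (rule integral_dominated_convergence[where w = "\<lambda>x. indicator ?C' x * B"])
    show "partial_deriv i F \<in> borel_measurable lborel"
      using borel_measurable_continuous_onI[OF cont] by simp
    show "?q n \<in> borel_measurable lborel" for n
      using borel_measurable_integrable[OF intF] borel_measurable_integrable[OF lborel_shift(1)[OF intF]]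
      by auto
    have "emeasure lborel ?C' < \<infinity>"
      by (rule emeasure_bounded_finite[OF compact_imp_bounded[OF C']])
    then show "integrable lborel (\<lambda>x. indicator ?C' x * B)"
      using C' by (intro integrable_mult_left) (auto intro!: integrable_real_indicator borel_compact)
    show "AE x in lborel. (\<lambda>n. ?q n x) \<longlonglongrightarrow> partial_deriv i F x"
    proof (rule AE_I2)
      fix x
      have "((\<lambda>s. F (x + s *\<^sub>R ?a)) has_real_derivative partial_deriv i F (x + 0 *\<^sub>R ?a)) (at 0)"
        by (rule has_real_derivative_along_axis[OF diff])
      then have "((\<lambda>s. (F (x + s *\<^sub>R ?a) - F x) / s) \<longlongrightarrow> partial_deriv i F x) (at 0)"
        by (simp add: has_field_derivative_iff)
      moreover have "filterlim h (at 0) sequentially"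
        unfolding filterlim_at using LIMSEQ_inverse_real_of_nat h(1)
        by (auto simp: h_def[abs_def] intro!: always_eventually)
      ultimately show "(\<lambda>n. ?q n x) \<longlonglongrightarrow> partial_deriv i F x"
        by (rule filterlim_compose)
    qed
    show "AE x in lborel. norm (?q n x) \<le> indicator ?C' x * B" for n
    proof (rule AE_I2)
      fix x
      have "DERIV (\<lambda>s. F (x + s *\<^sub>R ?a)) s :> partial_deriv i F (x + s *\<^sub>R ?a)" for s
        by (rule has_real_derivative_along_axis[OF diff])
      then obtain s where "0 < s" "s < h n" and s: "F (x + h n *\<^sub>R ?a) - F (x + 0 *\<^sub>R ?a) = (h n - 0) * partial_deriv i F (x + s *\<^sub>R ?a)"
        using MVT2[OF h(1)[of n], of "\<lambda>s. F (x + s *\<^sub>R ?a)" "\<lambda>s. partial_deriv i F (x + s *\<^sub>R ?a)"] by blast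
      then have q: "?q n x = partial_deriv i F (x + s *\<^sub>R ?a)"
        using h(1)[of n] by simp
      show "norm (?q n x) \<le> indicator ?C' x * B"
      proof (cases "x \<in> ?C'")
        case True
        then show ?thesis
          using B(2) by (simp add: q)
      next
        case False
        have "x + s *\<^sub>R ?a \<notin> C"
        proof
          assume "x + s *\<^sub>R ?a \<in> C"
          moreover have "x = (x + s *\<^sub>R ?a) + (- s *\<^sub>R ?a)" "- s *\<^sub>R ?a \<in> cball 0 1"
            using \<open>0 < s\<close> \<open>s < h n\<close> h(2)[of n] by auto
          ultimately have "x \<in> ?C'"
            by blast
          with False show False ..
        qed
        then show ?thesis
          using B(1) by (simp add: q zero)
      qed
    qed
  qed
  then show ?thesis
    unfolding q0 by (simp add: LIMSEQ_const_iff)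
qed


section \<open>Change of variables\<close>

subsection \<open>Volume of images under locally Lipschitz maps\<close>

lemma emeasure_lebesgue_ball_scale:
  fixes c c' :: "'a::euclidean_space"
  assumes "0 \<le> B" "0 \<le> r"
  shows "emeasure lebesgue (ball c' (B * r)) = ennreal (B ^ DIM('a)) * emeasure lebesgue (ball c r)"
  using assms by (simp add: emeasure_ball power_mult_distrib mult_ac flip: ennreal_mult)

text \<open>By the Vitali covering theorem, \<open>W\<close> is a countable disjoint union of balls up to a null set. The image of a ball
  lies in a ball whose radius is larger by the factor \<open>B\<close>, and differentiable maps preserve null sets. This
  gives the one inequality of the change of variables formula that is needed, with no Jacobian determinant.\<close>

lemma emeasure_image_open_le:
  fixes S :: "'a::euclidean_space \<Rightarrow> 'a"
  assumes "open W" and diff: "S differentiable_on W" and inj: "inj_on S W" and "0 \<le> B"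
    and lip: "\<And>x r. r > 0 \<Longrightarrow> ball x r \<subseteq> W \<Longrightarrow> S ` ball x r \<subseteq> ball (S x) (B * r)"
  shows "emeasure lebesgue (S ` W) \<le> ennreal (B ^ DIM('a)) * emeasure lebesgue W"
proof -
  let ?K = "{(x, r). r > 0 \<and> ball x r \<subseteq> W}"
  let ?b = "\<lambda>i :: 'a \<times> real. ball (fst i) (snd i)"
  have "\<exists>i. i \<in> ?K \<and> x \<in> ?b i \<and> snd i < d" if "x \<in> W" "d > 0" for x d
  proof -
    obtain e where e: "e > 0" "ball x e \<subseteq> W"
      using \<open>open W\<close> \<open>x \<in> W\<close> open_contains_ball by blast
    then have "ball x (min e (d / 2)) \<subseteq> W"
      by auto
    with e that show ?thesis
      by (intro exI[of _ "(x, min e (d / 2))"]) auto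
  qed
  then obtain C where C: "countable C" "C \<subseteq> ?K"
    "pairwise (\<lambda>i j. disjnt (?b i) (?b j)) C" "negligible (W - (\<Union>i\<in>C. ?b i))"
    by (rule Vitali_covering_theorem_balls)
  have sub: "?b i \<subseteq> W" "snd i > 0" if "i \<in> C" for i
  proof -
    have "i \<in> ?K"
      using C(2) that by blast
    then show "?b i \<subseteq> W" "snd i > 0"
      by (simp_all add: case_prod_beta)
  qed
  have disj: "disjoint_family_on ?b C"
    using C(3) by (auto simp: disjoint_family_on_def pairwise_def disjnt_def)
  have disjS: "disjoint_family_on (\<lambda>i. S ` ?b i) C"
  proof (unfold disjoint_family_on_def, intro ballI impI)
    fix i j assume ij: "i \<in> C" "j \<in> C" "i \<noteq> j"
    then have "S ` ?b i \<inter> S ` ?b j = S ` (?b i \<inter> ?b j)"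
      using sub by (intro inj_on_image_Int[OF inj, symmetric]) auto
    also have "?b i \<inter> ?b j = {}"
      using disj ij by (auto simp: disjoint_family_on_def)
    finally show "S ` ?b i \<inter> S ` ?b j = {}"
      by simp
  qed
  have measS: "S ` ?b i \<in> sets lebesgue" if "i \<in> C" for i
    by (intro differentiable_image_in_sets_lebesgue differentiable_on_subset[OF diff sub(1)[OF that]]) auto
  have neg: "negligible (S ` (W - (\<Union>i\<in>C. ?b i)))"
    using C(4) by (intro negligible_differentiable_image_negligible differentiable_on_subset[OF diff]) auto
  have "S ` W = (\<Union>i\<in>C. S ` ?b i) \<union> S ` (W - (\<Union>i\<in>C. ?b i))"
    using sub(1) by blast
  then have "emeasure lebesgue (S ` W) = emeasure lebesgue (\<Union>i\<in>C. S ` ?b i)"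
    using neg measS C(1) by (simp only:) (intro emeasure_Un_null_set sets.countable_UN', auto simp: negligible_iff_null_sets)
  also have "\<dots> = (\<integral>\<^sup>+i. emeasure lebesgue (S ` ?b i) \<partial>count_space C)"
    using measS C(1) disjS by (intro emeasure_UN_countable) auto
  also have "\<dots> \<le> (\<integral>\<^sup>+i. ennreal (B ^ DIM('a)) * emeasure lebesgue (?b i) \<partial>count_space C)"
  proof (intro nn_integral_mono)
    fix i assume "i \<in> space (count_space C)"
    then have i: "i \<in> C"
      by simp
    have "emeasure lebesgue (S ` ?b i) \<le> emeasure lebesgue (ball (S (fst i)) (B * snd i))"
      using lip sub[OF i] by (intro emeasure_mono) auto
    also have "\<dots> = ennreal (B ^ DIM('a)) * emeasure lebesgue (?b i)"
      using sub(2)[OF i] \<open>0 \<le> B\<close> by (intro emeasure_lebesgue_ball_scale) auto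
    finally show "emeasure lebesgue (S ` ?b i) \<le> ennreal (B ^ DIM('a)) * emeasure lebesgue (?b i)" .
  qed
  also have "\<dots> = ennreal (B ^ DIM('a)) * (\<integral>\<^sup>+i. emeasure lebesgue (?b i) \<partial>count_space C)"
    by (rule nn_integral_cmult) simp
  also have "(\<integral>\<^sup>+i. emeasure lebesgue (?b i) \<partial>count_space C) = emeasure lebesgue (\<Union>i\<in>C. ?b i)"
    using C(1) disj by (intro emeasure_UN_countable[symmetric]) auto
  also have "ennreal (B ^ DIM('a)) * \<dots> \<le> ennreal (B ^ DIM('a)) * emeasure lebesgue W"
    using sub \<open>open W\<close> by (intro mult_left_mono emeasure_mono) auto
  finally show ?thesis .
qed

text \<open>Outer regularity of Lebesgue measure reduces the claim to open sets.\<close>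

lemma emeasure_image_le:
  fixes S :: "'a::euclidean_space \<Rightarrow> 'a"
  assumes "open V" and diff: "S differentiable_on V" and inj: "inj_on S V" and "0 \<le> B"
    and lip: "\<And>x r. r > 0 \<Longrightarrow> ball x r \<subseteq> V \<Longrightarrow> S ` ball x r \<subseteq> ball (S x) (B * r)"
    and E: "E \<in> sets lebesgue" "E \<subseteq> V"
  shows "emeasure lebesgue (S ` E) \<le> ennreal (B ^ DIM('a)) * emeasure lebesgue E"
proof -
  let ?J = "B ^ DIM('a)"
  have "emeasure lebesgue (S ` E) \<le> ennreal ?J * emeasure lebesgue E + ennreal e" if "e > 0" for e :: real
  proof -
    define d where "d = e / (?J + 1)"
    have J: "?J \<ge> 0"
      using \<open>0 \<le> B\<close> by simp
    then have "d > 0"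
      using \<open>e > 0\<close> by (simp add: d_def)
    obtain W' where W': "open W'" "E \<subseteq> W'" "W' - E \<in> lmeasurable" "emeasure lebesgue (W' - E) < ennreal d"
      by (rule sets_lebesgue_outer_open[OF E(1) \<open>d > 0\<close>])
    let ?W = "W' \<inter> V"
    have W: "open ?W" "E \<subseteq> ?W" "?W \<subseteq> V"
      using W' E(2) \<open>open V\<close> by auto
    have "emeasure lebesgue ?W \<le> emeasure lebesgue (E \<union> (W' - E))"
      using W' E by (intro emeasure_mono) (auto simp: sets.Un)
    also have "\<dots> \<le> emeasure lebesgue E + emeasure lebesgue (W' - E)"
      using W' E by (intro emeasure_subadditive) auto
    also have "\<dots> \<le> emeasure lebesgue E + ennreal d"
      using W'(4) by (intro add_left_mono) simp
    finally have eW: "emeasure lebesgue ?W \<le> emeasure lebesgue E + ennreal d" .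
    have "S ` ?W \<in> sets lebesgue"
      by (rule differentiable_image_in_sets_lebesgue)
        (use W in \<open>auto intro: differentiable_on_subset[OF diff]\<close>)
    then have "emeasure lebesgue (S ` E) \<le> emeasure lebesgue (S ` ?W)"
      using W by (intro emeasure_mono) auto
    also have "\<dots> \<le> ennreal ?J * emeasure lebesgue ?W"
      using W diff inj lip \<open>0 \<le> B\<close>
      by (intro emeasure_image_open_le) (auto intro: differentiable_on_subset inj_on_subset)
    also have "\<dots> \<le> ennreal ?J * (emeasure lebesgue E + ennreal d)"
      using eW by (rule mult_left_mono) simp
    also have "\<dots> = ennreal ?J * emeasure lebesgue E + ennreal (?J * d)"
      using J \<open>d > 0\<close> by (simp add: distrib_left ennreal_mult)
    also have "\<dots> \<le> ennreal ?J * emeasure lebesgue E + ennreal e"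
      using J \<open>e > 0\<close> by (intro add_left_mono ennreal_leI) (simp add: d_def field_simps)
    finally show ?thesis .
  qed
  then show ?thesis
    by (rule ennreal_le_epsilon)
qed

subsection \<open>Composition with a diffeomorphism\<close>

lemma has_derivative_cart:
  fixes F :: "real^'n::finite \<Rightarrow> real^'m::finite"
  assumes "\<And>j. (\<lambda>x. F x $ j) differentiable (at x)"
  shows "(F has_derivative (\<lambda>h. \<chi> j. \<Sum>i\<in>UNIV. h $ i * partial_deriv i (\<lambda>x. F x $ j) x)) (at x)"
  using has_derivative_partial_deriv[OF assms]
  by (subst has_derivative_componentwise_within) (auto simp: Basis_vec_def inner_axis)

lemma partial_deriv_compose:
  fixes F :: "real^'n::finite \<Rightarrow> real^'m::finite" and f :: "real^'m \<Rightarrow> real"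
  assumes F: "\<And>j. (\<lambda>x. F x $ j) differentiable (at x)" and f: "f differentiable (at (F x))"
  shows "(\<lambda>x. f (F x)) differentiable (at x)"
    "partial_deriv i (\<lambda>x. f (F x)) x = (\<Sum>j\<in>UNIV. partial_deriv j f (F x) * partial_deriv i (\<lambda>x. F x $ j) x)"
proof -
  have D: "((\<lambda>x. f (F x)) has_derivative (\<lambda>h. \<Sum>j\<in>UNIV.
      (\<chi> j. \<Sum>i\<in>UNIV. h $ i * partial_deriv i (\<lambda>x. F x $ j) x) $ j * partial_deriv j f (F x))) (at x)"
    by (rule has_derivative_compose[OF has_derivative_cart[OF F] has_derivative_partial_deriv[OF f]])
  then show "(\<lambda>x. f (F x)) differentiable (at x)"
    by (auto simp: differentiable_def)
  show "partial_deriv i (\<lambda>x. f (F x)) x = (\<Sum>j\<in>UNIV. partial_deriv j f (F x) * partial_deriv i (\<lambda>x. F x $ j) x)"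
    unfolding partial_deriv_eqI[OF D]
    by (simp add: axis_def if_distribR if_distrib[of "\<lambda>c. c * _"] mult.commute cong: if_cong)
qed

text \<open>Only \<open>T\<close> is Lipschitz on its whole domain. Since \<open>V\<close> need not be convex, the bound on the derivative of the inverse
  \<open>S\<close> makes \<open>S\<close> Lipschitz only on the balls contained in \<open>V\<close>, which is all that volume estimates require.\<close>

locale lipschitz_diffeo =
  fixes U V :: "(real^'n::finite) set" and T S :: "real^'n \<Rightarrow> real^'n" and k :: nat and L B :: real
  assumes open_U: "open U" and open_V: "open V"
    and T_in: "\<And>x. x \<in> U \<Longrightarrow> T x \<in> V" and S_in: "\<And>y. y \<in> V \<Longrightarrow> S y \<in> U"
    and S_T: "\<And>x. x \<in> U \<Longrightarrow> S (T x) = x" and T_S: "\<And>y. y \<in> V \<Longrightarrow> T (S y) = y"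
    and k_pos: "k \<ge> 1"
    and T_bdd_lip: "\<And>j. bdd_lip_deriv k U (\<lambda>x. T x $ j)"
    and T_lipschitz: "\<And>x y. x \<in> U \<Longrightarrow> y \<in> U \<Longrightarrow> norm (T x - T y) \<le> L * norm (x - y)" and L_pos: "L > 0"
    and S_diff: "\<And>j. (\<lambda>y. S y $ j) differentiable_on V"
    and S_bound: "\<And>i j y. y \<in> V \<Longrightarrow> \<bar>partial_deriv i (\<lambda>y. S y $ j) y\<bar> \<le> B" and B_pos: "B > 0"
begin

text \<open>A bound for the operator norm of the derivative of \<open>S\<close>, from the bound \<open>B\<close> for its entries.\<close>

definition Bn :: real where "Bn = real CARD('n) * (real CARD('n) * B)"

lemma Bn_pos: "Bn > 0"
  using B_pos by (simp add: Bn_def)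

definition DS :: "real^'n \<Rightarrow> real^'n \<Rightarrow> real^'n" where
  "DS y h = (\<chi> j. \<Sum>i\<in>UNIV. h $ i * partial_deriv i (\<lambda>y. S y $ j) y)"

definition DT :: "real^'n \<Rightarrow> real^'n \<Rightarrow> real^'n" where
  "DT x h = (\<chi> j. \<Sum>i\<in>UNIV. h $ i * partial_deriv i (\<lambda>x. T x $ j) x)"

lemma T_comp_diff_on: "(\<lambda>x. T x $ j) differentiable_on U"
  using T_bdd_lip[of j] k_pos by (cases k) auto

lemma T_comp_diff: "x \<in> U \<Longrightarrow> (\<lambda>x. T x $ j) differentiable (at x)"
  using T_comp_diff_on open_U differentiable_on_open_at by blast

lemma T_has_derivative: "x \<in> U \<Longrightarrow> (T has_derivative DT x) (at x)"
  unfolding DT_def by (intro has_derivative_cart T_comp_diff)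

lemma S_has_derivative: "y \<in> V \<Longrightarrow> (S has_derivative DS y) (at y)"
  unfolding DS_def using S_diff open_V differentiable_on_open_at by (intro has_derivative_cart) blast

lemma norm_cart_le: "norm (z :: real^'n) \<le> (\<Sum>j\<in>UNIV. \<bar>z $ j\<bar>)"
  by (rule norm_le_l1_cart)

lemma norm_DS_le: "y \<in> V \<Longrightarrow> norm (DS y h) \<le> Bn * norm h"
proof -
  assume y: "y \<in> V"
  have "\<bar>DS y h $ j\<bar> \<le> real CARD('n) * B * norm h" for j
  proof -
    have "\<bar>DS y h $ j\<bar> \<le> (\<Sum>i\<in>UNIV. \<bar>h $ i * partial_deriv i (\<lambda>y. S y $ j) y\<bar>)"
      by (simp add: DS_def)
    also have "\<dots> \<le> (\<Sum>i\<in>(UNIV::'n set). norm h * B)"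
      using S_bound[OF y] by (intro sum_mono) (auto simp: abs_mult component_le_norm_cart intro!: mult_mono)
    finally show ?thesis
      by (simp add: mult_ac)
  qed
  then have "(\<Sum>j\<in>UNIV. \<bar>DS y h $ j\<bar>) \<le> (\<Sum>j\<in>(UNIV::'n set). real CARD('n) * B * norm h)"
    by (intro sum_mono)
  then show ?thesis
    using norm_cart_le[of "DS y h"] by (simp add: Bn_def mult_ac)
qed

lemma S_differentiable_on: "S differentiable_on V"
  unfolding differentiable_on_def differentiable_def
  using S_has_derivative has_derivative_at_withinI by blast

lemma T_differentiable_on: "T differentiable_on U"
  unfolding differentiable_on_def differentiable_def
  using T_has_derivative has_derivative_at_withinI by blast

lemma S_continuous_on: "continuous_on V S"
  by (rule differentiable_imp_continuous_on[OF S_differentiable_on])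

lemma T_continuous_on: "continuous_on U T"
  by (rule differentiable_imp_continuous_on[OF T_differentiable_on])

lemma S_image_ball: "ball y r \<subseteq> V \<Longrightarrow> r > 0 \<Longrightarrow> S ` ball y r \<subseteq> ball (S y) (Bn * r)"
proof
  fix x assume V: "ball y r \<subseteq> V" and "r > 0" and "x \<in> S ` ball y r"
  then obtain z where z: "x = S z" "z \<in> ball y r"
    by blast
  have "norm (S y - S z) \<le> Bn * norm (y - z)"
  proof (rule differentiable_bound[of "ball y r" S DS])
    show "(S has_derivative DS w) (at w within ball y r)" if "w \<in> ball y r" for w
      using that V S_has_derivative has_derivative_at_withinI by blast
    show "onorm (DS w) \<le> Bn" if "w \<in> ball y r" for w
      using that V norm_DS_le by (intro onorm_le) blast
  qed (use z \<open>r > 0\<close> in auto)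
  also have "\<dots> < Bn * r"
    using z(2) Bn_pos by (simp add: dist_norm)
  finally show "x \<in> ball (S y) (Bn * r)"
    by (simp add: z dist_norm)
qed

lemma S_inj: "inj_on S V"
  using T_S by (metis inj_on_inverseI)

definition J :: ennreal where "J = ennreal (Bn ^ CARD('n))"

lemma J_finite: "J < top"
  by (simp add: J_def)

lemma emeasure_S_image_le:
  "E \<in> sets lebesgue \<Longrightarrow> E \<subseteq> V \<Longrightarrow> emeasure lebesgue (S ` E) \<le> J * emeasure lebesgue E"
  using emeasure_image_le[OF open_V S_differentiable_on S_inj _ S_image_ball] Bn_pos by (simp add: J_def)

lemma vimage_T: "A \<subseteq> V \<Longrightarrow> T -` A \<inter> U = S ` A"
  using S_T T_S S_in by force

lemma T_measurable [measurable]: "T \<in> lebesgue_on U \<rightarrow>\<^sub>M lebesgue_on V"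
proof (rule measurableI)
  fix A assume "A \<in> sets (lebesgue_on V)"
  then have A: "A \<in> sets lebesgue" "A \<subseteq> V"
    using open_V by (auto simp: sets_restrict_space_iff)
  then have "S ` A \<in> sets lebesgue"
    by (intro differentiable_image_in_sets_lebesgue) (auto intro: differentiable_on_subset[OF S_differentiable_on])
  then show "T -` A \<inter> space (lebesgue_on U) \<in> sets (lebesgue_on U)"
    using A open_U vimage_T[of A] by (simp add: sets_restrict_space_iff) (metis inf_le2)
qed (use T_in in \<open>auto simp: space_restrict_space\<close>)

text \<open>The change of variables as an inequality of measures: the preimage of \<open>A\<close> under \<open>T\<close> is the image of \<open>A\<close> under \<open>S\<close>.\<close>

lemma distr_T_le: "distr (lebesgue_on U) (lebesgue_on V) T \<le> scale_measure J (lebesgue_on V)"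
proof (rule le_measure[THEN iffD2])
  show "\<forall>A\<in>sets (distr (lebesgue_on U) (lebesgue_on V) T).
      emeasure (distr (lebesgue_on U) (lebesgue_on V) T) A \<le> emeasure (scale_measure J (lebesgue_on V)) A"
  proof
    fix A assume "A \<in> sets (distr (lebesgue_on U) (lebesgue_on V) T)"
    then have A': "A \<in> sets (lebesgue_on V)"
      by simp
    then have A: "A \<in> sets lebesgue" "A \<subseteq> V"
      using open_V by (auto simp: sets_restrict_space_iff)
    have "emeasure (distr (lebesgue_on U) (lebesgue_on V) T) A = emeasure (lebesgue_on U) (S ` A)"
      using A' vimage_T[OF A(2)] by (simp add: emeasure_distr space_restrict_space)
    also have "\<dots> = emeasure lebesgue (S ` A)"
      using A S_in open_U by (intro emeasure_restrict_space) auto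
    also have "\<dots> \<le> J * emeasure lebesgue A"
      by (rule emeasure_S_image_le[OF A])
    also have "emeasure lebesgue A = emeasure (lebesgue_on V) A"
      using A open_V by (intro emeasure_restrict_space[symmetric]) auto
    finally show "emeasure (distr (lebesgue_on U) (lebesgue_on V) T) A \<le> emeasure (scale_measure J (lebesgue_on V)) A"
      by simp
  qed
qed simp

lemma nn_integral_comp_le:
  assumes [measurable]: "f \<in> borel_measurable (lebesgue_on V)"
  shows "(\<integral>\<^sup>+x. f (T x) \<partial>lebesgue_on U) \<le> J * (\<integral>\<^sup>+y. f y \<partial>lebesgue_on V)"
proof -
  have "(\<integral>\<^sup>+x. f (T x) \<partial>lebesgue_on U) = (\<integral>\<^sup>+y. f y \<partial>distr (lebesgue_on U) (lebesgue_on V) T)"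
    by (simp add: nn_integral_distr)
  also have "\<dots> \<le> (\<integral>\<^sup>+y. f y \<partial>scale_measure J (lebesgue_on V))"
    by (rule nn_integral_mono_measure[OF _ distr_T_le]) simp
  also have "\<dots> = J * (\<integral>\<^sup>+y. f y \<partial>lebesgue_on V)"
    by (simp add: nn_integral_scale_measure)
  finally show ?thesis .
qed

lemma AE_comp:
  assumes "AE y in lebesgue_on V. P y"
  shows "AE x in lebesgue_on U. P (T x)"
proof -
  obtain N where N: "{y \<in> space (lebesgue_on V). \<not> P y} \<subseteq> N" "emeasure (lebesgue_on V) N = 0" "N \<in> sets (lebesgue_on V)"
    by (rule AE_E[OF assms])
  have NV: "N \<in> sets lebesgue" "N \<subseteq> V"
    using N(3) open_V by (auto simp: sets_restrict_space_iff)
  have "emeasure lebesgue (S ` N) \<le> J * emeasure lebesgue N"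
    by (rule emeasure_S_image_le[OF NV])
  also have "emeasure lebesgue N = emeasure (lebesgue_on V) N"
    using NV open_V by (intro emeasure_restrict_space[symmetric]) auto
  finally have 0: "emeasure lebesgue (S ` N) = 0"
    using N(2) by simp
  have "S ` N \<in> sets lebesgue"
    using NV by (intro differentiable_image_in_sets_lebesgue) (auto intro: differentiable_on_subset[OF S_differentiable_on])
  with 0 have "S ` N \<in> null_sets lebesgue"
    by (intro null_setsI)
  then have "AE x in lebesgue. x \<notin> S ` N"
    by (rule AE_not_in)
  then have "AE x in lebesgue. x \<in> U \<longrightarrow> P (T x)"
  proof (rule eventually_mono)
    fix x assume "x \<notin> S ` N"
    show "x \<in> U \<longrightarrow> P (T x)"
    proof
      assume "x \<in> U"
      then have "T x \<notin> N"
        using \<open>x \<notin> S ` N\<close> S_T by force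
      with N(1) T_in[OF \<open>x \<in> U\<close>] show "P (T x)"
        by (auto simp: space_restrict_space)
    qed
  qed
  then show ?thesis
    using open_U by (simp add: AE_lebesgue_on_iff)
qed

lemma T_image_compact: "compact C \<Longrightarrow> C \<subseteq> U \<Longrightarrow> compact (T ` C) \<and> T ` C \<subseteq> V"
  using T_in continuous_on_subset[OF T_continuous_on] by (auto intro!: compact_continuous_image)

lemma nn_integral_comp_compact_le:
  assumes w: "w \<in> borel_measurable (lebesgue_on V)" and C: "compact C" "C \<subseteq> U"
  shows "(\<integral>\<^sup>+x. ennreal \<bar>w (T x)\<bar> \<partial>lebesgue_on C) \<le> J * (\<integral>\<^sup>+y. ennreal \<bar>w y\<bar> \<partial>lebesgue_on (T ` C))"
proof -
  note [measurable] = w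
  have TC: "T ` C \<in> sets lebesgue" "T ` C \<subseteq> V"
    using T_image_compact[OF C] compact_sets_lebesgue by auto
  then have [measurable]: "T ` C \<in> sets (lebesgue_on V)"
    using open_V by (simp add: sets_restrict_space_iff)
  have "(\<integral>\<^sup>+x. ennreal \<bar>w (T x)\<bar> \<partial>lebesgue_on C) \<le> (\<integral>\<^sup>+x. ennreal \<bar>w (T x)\<bar> * indicator (T ` C) (T x) \<partial>lebesgue_on U)"
    using C open_U by (simp add: nn_integral_lebesgue_on_eq compact_sets_lebesgue)
      (intro nn_integral_mono, auto simp: indicator_def)
  also have "\<dots> \<le> J * (\<integral>\<^sup>+y. ennreal \<bar>w y\<bar> * indicator (T ` C) y \<partial>lebesgue_on V)"
    by (rule nn_integral_comp_le) measurable
  also have "(\<integral>\<^sup>+y. ennreal \<bar>w y\<bar> * indicator (T ` C) y \<partial>lebesgue_on V) = (\<integral>\<^sup>+y. ennreal \<bar>w y\<bar> \<partial>lebesgue_on (T ` C))"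
    using TC open_V by (simp add: nn_integral_lebesgue_on_eq)
      (intro nn_integral_cong, auto simp: indicator_def)
  finally show ?thesis .
qed

lemma L1_loc_comp:
  assumes "u \<in> L1_loc V"
  shows "(\<lambda>x. u (T x)) \<in> L1_loc U"
  unfolding L1_loc_def mem_Collect_eq
proof (intro allI impI, elim conjE)
  fix C assume C: "compact C" "C \<subseteq> U"
  have meas: "u \<in> borel_measurable (lebesgue_on V)"
    using L1_loc_measurable[OF open_V assms] .
  then have "(\<lambda>x. u (T x)) \<in> borel_measurable (lebesgue_on U)"
    by measurable
  then have "(\<lambda>x. u (T x)) \<in> borel_measurable (lebesgue_on C)"
    using C by (rule_tac measurable_restrict_mono)
  moreover have "(\<integral>\<^sup>+x. ennreal (norm (u (T x))) \<partial>lebesgue_on C) < \<infinity>"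
  proof -
    have "integrable (lebesgue_on (T ` C)) u"
      using assms T_image_compact[OF C] by (auto simp: L1_loc_def)
    then have "(\<integral>\<^sup>+y. ennreal \<bar>u y\<bar> \<partial>lebesgue_on (T ` C)) < top"
      by (simp add: integrable_iff_bounded)
    then have "J * (\<integral>\<^sup>+y. ennreal \<bar>u y\<bar> \<partial>lebesgue_on (T ` C)) < top"
      using J_finite by (simp add: ennreal_mult_less_top)
    then show ?thesis
      using nn_integral_comp_compact_le[OF meas C] by (auto intro: order_le_less_trans)
  qed
  ultimately show "integrable (lebesgue_on C) (\<lambda>x. u (T x))"
    by (simp add: integrable_iff_bounded)
qed

end

section \<open>The chain rule for weak derivatives\<close>

lemma has_weak_deriv_add:
  assumes "open \<Omega>" "has_weak_deriv \<Omega> (mi_unit i) u g" "has_weak_deriv \<Omega> (mi_unit i) v h"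
  shows "has_weak_deriv \<Omega> (mi_unit i) (\<lambda>x. u x + v x) (\<lambda>x. g x + h x)"
  using assms by (auto simp: has_weak_deriv_unit_iff L1_loc_add distrib_right
      test_fun_integrable_times test_fun_partial_deriv)

lemma continuous_L1_loc:
  assumes "continuous_on \<Omega> f"
  shows "f \<in> L1_loc \<Omega>"
proof -
  have "(\<lambda>_. 1) \<in> L1_loc \<Omega>"
    by (auto simp: L1_loc_def intro!: finite_measure.integrable_const finite_measure_lebesgue_on lmeasurable_compact)
  from L1_loc_mult[OF this assms] show ?thesis
    by simp
qed

lemma continuous_extend_zero:
  fixes f :: "'a::t2_space \<Rightarrow> real"
  assumes "open U" "compact C" "C \<subseteq> U" "continuous_on U f" "\<And>x. x \<notin> C \<Longrightarrow> f x = 0"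
  shows "continuous_on UNIV f"
proof -
  have "continuous_on (- C) f"
    using assms(5) by (subst continuous_on_cong[OF refl, of _ _ "\<lambda>_. 0"]) auto
  then have "continuous_on (U \<union> - C) f"
    using assms by (intro continuous_on_open_Un) (auto simp: compact_imp_closed)
  moreover have "U \<union> - C = UNIV"
    using assms(3) by auto
  ultimately show ?thesis
    by simp
qed

text \<open>Integration by parts against a test function, for a \<open>C\<^sup>1\<close> function on an open set.\<close>

lemma integral_C1_test_fun:
  fixes h :: "real^'n::finite \<Rightarrow> real"
  assumes "open U" and \<phi>: "\<phi> \<in> test_fun U" and h: "\<And>x. x \<in> U \<Longrightarrow> h differentiable (at x)"
    "continuous_on U (partial_deriv i h)"
  shows "(LINT x|lebesgue_on U. partial_deriv i h x * \<phi> x + h x * partial_deriv i \<phi> x) = 0"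
proof -
  obtain C where \<phi>_smooth: "\<forall>m. Ck_on m UNIV \<phi>" and C: "compact C" "C \<subseteq> U"
    and zero: "\<And>x. x \<notin> C \<Longrightarrow> \<phi> x = 0" "\<And>i x. x \<notin> C \<Longrightarrow> partial_deriv i \<phi> x = 0"
    by (rule test_funE[OF \<phi>]) blast
  let ?G = "\<lambda>x. h x * \<phi> x"
  let ?D = "\<lambda>x. partial_deriv i h x * \<phi> x + h x * partial_deriv i \<phi> x"
  have \<phi>_diff: "\<phi> differentiable (at x)" for x
    by (rule Ck_on_UNIV_differentiable[OF \<phi>_smooth])
  have G_zero: "?G x = 0" if "x \<notin> C" for x
    using zero(1)[OF that] by simp
  have G_diff: "?G differentiable (at x)" for x
  proof (cases "x \<in> U")
    case True
    then show ?thesis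
      using h(1) \<phi>_diff by (intro differentiable_mult)
  next
    case False
    have "(?G has_derivative (\<lambda>_. 0)) (at x)"
    proof (rule has_derivative_transform_within_open)
      show "((\<lambda>_. 0) has_derivative (\<lambda>_. 0)) (at x)"
        by (rule has_derivative_const)
      show "open (- C)" "x \<in> - C"
        using C False by (auto simp: compact_imp_closed)
      show "0 = ?G y" if "y \<in> - C" for y
        using G_zero[of y] that by simp
    qed
    then show ?thesis
      by (auto simp: differentiable_def)
  qed
  have pG: "partial_deriv i ?G = ?D"
  proof
    fix x
    show "partial_deriv i ?G x = ?D x"
    proof (cases "x \<in> C")
      case True
      then show ?thesis
        using C h(1) \<phi>_diff by (intro partial_deriv_mult) auto
    next
      case False
      then show ?thesis
        using partial_deriv_zero_outside[of C ?G x i] C G_zero zero by (simp add: compact_imp_closed)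
    qed
  qed
  have conth: "continuous_on U h"
    using h(1) by (intro differentiable_imp_continuous_on) (auto simp: differentiable_on_def differentiable_at_withinI)
  have cont\<phi>: "continuous_on U \<phi>" "continuous_on U (partial_deriv i \<phi>)"
    using continuous_on_subset[OF Ck_on_UNIV_continuous[OF \<phi>_smooth]]
      continuous_on_subset[OF Ck_on_UNIV_continuous[OF Ck_on_UNIV_partial[OF \<phi>_smooth]]] by auto
  have cont: "continuous_on UNIV (partial_deriv i ?G)"
    unfolding pG using conth cont\<phi> h(2) zero \<open>open U\<close> C
    by (intro continuous_extend_zero[of U C]) (auto intro!: continuous_intros)
  have "(LINT x|lebesgue_on U. ?D x) = (LINT x|lebesgue. indicator U x * ?D x)"
    using \<open>open U\<close> by (intro integral_lebesgue_on_eq) simp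
  also have "(\<lambda>x. indicator U x * ?D x) = ?D"
  proof
    fix x
    show "indicator U x * ?D x = ?D x"
    proof (cases "x \<in> U")
      case False
      then have "x \<notin> C"
        using C(2) by blast
      then show ?thesis
        by (simp add: zero)
    qed simp
  qed
  also have "(LINT x|lebesgue. ?D x) = (LINT x|lborel. ?D x)"
    using borel_measurable_continuous_onI[OF cont] by (intro integral_completion) (simp add: pG)
  also have "\<dots> = 0"
    using integral_partial_deriv_zero[OF G_diff cont C(1) G_zero] by (simp add: pG)
  finally show ?thesis .
qed

context lipschitz_diffeo
begin

lemma T_partial_continuous: "continuous_on U (partial_deriv i (\<lambda>x. T x $ j))"
proof -
  have "bdd_lip_deriv (k - 1) U (partial_deriv i (\<lambda>x. T x $ j))"
    using T_bdd_lip[of j] k_pos by (cases k) auto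
  then have "\<exists>L. L-lipschitz_on U (partial_deriv i (\<lambda>x. T x $ j))"
    by (cases "k - 1") auto
  then show ?thesis
    using lipschitz_on_continuous_on by blast
qed

text \<open>The integral is linear in \<open>u\<close> and its weak derivatives, and continuous for convergence in \<open>L\<^sup>1\<close> on the compact set
  \<open>T ` C\<close>. An identity of this form that holds for \<open>C\<^sup>1\<close> functions therefore extends to weakly differentiable
  functions.\<close>

lemma weak_chain_rule_limit:
  assumes weak: "\<And>j. has_weak_deriv V (mi_unit j) u (g j)"
    and A: "continuous_on U A" and Bj: "\<And>j. continuous_on U (Bj j)"
    and C: "compact C" "C \<subseteq> U" "\<And>x. x \<in> U - C \<Longrightarrow> A x = 0" "\<And>j x. x \<in> U - C \<Longrightarrow> Bj j x = 0"
    and C1: "\<And>f. (\<And>x. f differentiable (at x)) \<Longrightarrow> (\<And>j. continuous_on UNIV (partial_deriv j f)) \<Longrightarrow>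
       (LINT x|lebesgue_on U. f (T x) * A x + (\<Sum>j\<in>UNIV. partial_deriv j f (T x) * Bj j x)) = 0"
  shows "(LINT x|lebesgue_on U. u (T x) * A x + (\<Sum>j\<in>UNIV. g j (T x) * Bj j x)) = 0" (is "?I = 0")
proof -
  have loc: "u \<in> L1_loc V" "\<And>j. g j \<in> L1_loc V"
    using weak by (auto simp: has_weak_deriv_def)
  have U: "U \<in> sets lebesgue" and Cl: "C \<in> sets lebesgue"
    using open_U compact_sets_lebesgue[OF C(1)] by auto
  have TC: "compact (T ` C)" "T ` C \<subseteq> V"
    using T_image_compact[OF C(1,2)] by auto
  have intA: "integrable (lebesgue_on U) (\<lambda>x. w x * A x)" if "w \<in> L1_loc U" for w
    using that C A U by (intro L1_loc_integrable_times[of w U C]) (auto intro: continuous_on_subset)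
  have intB: "integrable (lebesgue_on U) (\<lambda>x. w x * Bj j x)" if "w \<in> L1_loc U" for w j
    using that C U by (intro L1_loc_integrable_times[of w U C]) (auto intro: continuous_on_subset[OF Bj])
  have "bounded (A ` C)" "\<And>j. bounded (Bj j ` C)"
    using A Bj C by (auto intro!: compact_imp_bounded compact_continuous_image intro: continuous_on_subset)
  then obtain MA MB where MA: "\<And>x. x \<in> C \<Longrightarrow> \<bar>A x\<bar> \<le> MA" and MB: "\<And>j x. x \<in> C \<Longrightarrow> \<bar>Bj j x\<bar> \<le> MB j"
    unfolding bounded_iff real_norm_def by (metis imageI)
  define M where "M = \<bar>MA\<bar> + (\<Sum>j\<in>UNIV. \<bar>MB j\<bar>)"
  have M0: "M \<ge> 0"
    by (simp add: M_def sum_nonneg)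
  have "0 \<le> (\<Sum>j\<in>UNIV. \<bar>MB j\<bar>)"
    by (simp add: sum_nonneg)
  then have MA': "\<bar>A x\<bar> \<le> M" if "x \<in> C" for x
    using MA[OF that] abs_ge_self[of MA] unfolding M_def by linarith
  have MB': "\<bar>Bj j x\<bar> \<le> M" if "x \<in> C" for j x
    using MB[OF that, of j] member_le_sum[of j UNIV "\<lambda>j. \<bar>MB j\<bar>"] by (simp add: M_def)
  let ?c = "ennreal M * J * ennreal (1 + real CARD('n))"
  have cfin: "?c < top"
    using J_finite by (simp add: ennreal_mult_less_top)
  have "ennreal \<bar>?I\<bar> \<le> ?c * ennreal e" if "e > 0" for e
  proof -
    obtain f where f: "\<And>x. f differentiable (at x)" "\<And>j. continuous_on UNIV (partial_deriv j f)"
      "(\<integral>\<^sup>+x. ennreal \<bar>u x - f x\<bar> \<partial>lebesgue_on (T ` C)) \<le> ennreal e"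
      "\<And>j. (\<integral>\<^sup>+x. ennreal \<bar>g j x - partial_deriv j f x\<bar> \<partial>lebesgue_on (T ` C)) \<le> ennreal e"
      by (rule approximate_by_C1[OF open_V weak TC \<open>e > 0\<close>]) blast
    have contf: "continuous_on UNIV f"
      using f(1) by (intro differentiable_imp_continuous_on) (auto simp: differentiable_on_def differentiable_at_withinI)
    have locf: "f \<in> L1_loc V" "\<And>j. partial_deriv j f \<in> L1_loc V"
      using contf f(2) by (auto intro!: continuous_L1_loc intro: continuous_on_subset)
    let ?a = "\<lambda>x. u (T x) - f (T x)" and ?b = "\<lambda>j x. g j (T x) - partial_deriv j f (T x)"
    have locab: "?a \<in> L1_loc U" "\<And>j. ?b j \<in> L1_loc U"
      using L1_loc_comp[OF L1_loc_diff] loc locf by auto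
    let ?H = "\<lambda>x. ?a x * A x + (\<Sum>j\<in>UNIV. ?b j x * Bj j x)"
    have intH: "integrable (lebesgue_on U) ?H"
      using intA intB locab by auto
    have eqI: "?I = (LINT x|lebesgue_on U. ?H x)"
    proof -
      let ?F = "\<lambda>x. f (T x) * A x + (\<Sum>j\<in>UNIV. partial_deriv j f (T x) * Bj j x)"
      have "integrable (lebesgue_on U) ?F"
        using intA intB L1_loc_comp locf by auto
      then have "(LINT x|lebesgue_on U. ?H x + ?F x) = (LINT x|lebesgue_on U. ?H x)"
        using intH C1[OF f(1,2)] by simp
      moreover have "?H x + ?F x = u (T x) * A x + (\<Sum>j\<in>UNIV. g j (T x) * Bj j x)" for x
        by (simp add: left_diff_distrib sum_subtractf)
      ultimately show ?thesis
        by simp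
    qed
    have bound: "ennreal \<bar>?H x\<bar> \<le> ennreal M * (ennreal \<bar>?a x\<bar> + (\<Sum>j\<in>UNIV. ennreal \<bar>?b j x\<bar>)) * indicator C x"
      if "x \<in> U" for x
    proof (cases "x \<in> C")
      case True
      have "\<bar>?H x\<bar> \<le> \<bar>?a x * A x\<bar> + (\<Sum>j\<in>UNIV. \<bar>?b j x * Bj j x\<bar>)"
        by (rule order_trans[OF abs_triangle_ineq add_left_mono[OF sum_abs]])
      also have "\<dots> \<le> \<bar>?a x\<bar> * M + (\<Sum>j\<in>UNIV. \<bar>?b j x\<bar> * M)"
        unfolding abs_mult using MA'[OF True] MB'[OF True]
        by (intro add_mono sum_mono mult_left_mono) auto
      also have "\<dots> = M * (\<bar>?a x\<bar> + (\<Sum>j\<in>UNIV. \<bar>?b j x\<bar>))"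
        by (simp add: sum_distrib_left distrib_left mult.commute)
      finally have "ennreal \<bar>?H x\<bar> \<le> ennreal (M * (\<bar>?a x\<bar> + (\<Sum>j\<in>UNIV. \<bar>?b j x\<bar>)))"
        by (rule ennreal_leI)
      also have "\<dots> = ennreal M * (ennreal \<bar>?a x\<bar> + (\<Sum>j\<in>UNIV. ennreal \<bar>?b j x\<bar>))"
        using M0 by (simp add: ennreal_mult sum_nonneg ennreal_plus sum_ennreal)
      finally show ?thesis
        using True by simp
    next
      case False
      then show ?thesis
        using C(3,4) that by simp
    qed
    have meas: "w \<in> borel_measurable (lebesgue_on C)" if "w \<in> L1_loc U" for w
      using that C by (auto simp: L1_loc_def)
    have measV: "(\<lambda>y. u y - f y) \<in> borel_measurable (lebesgue_on V)"
      "\<And>j. (\<lambda>y. g j y - partial_deriv j f y) \<in> borel_measurable (lebesgue_on V)"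
      using loc locf L1_loc_measurable[OF open_V] L1_loc_diff by blast+
    have "ennreal \<bar>?I\<bar> \<le> (\<integral>\<^sup>+x. ennreal \<bar>?H x\<bar> \<partial>lebesgue_on U)"
      using integral_norm_bound_ennreal[OF intH] by (simp add: eqI)
    also have "\<dots> \<le> (\<integral>\<^sup>+x. ennreal M * (ennreal \<bar>?a x\<bar> + (\<Sum>j\<in>UNIV. ennreal \<bar>?b j x\<bar>)) * indicator C x \<partial>lebesgue_on U)"
      by (intro nn_integral_mono bound) (simp add: space_restrict_space)
    also have "\<dots> = (\<integral>\<^sup>+x. ennreal M * (ennreal \<bar>?a x\<bar> + (\<Sum>j\<in>UNIV. ennreal \<bar>?b j x\<bar>)) \<partial>lebesgue_on C)"
      unfolding nn_integral_lebesgue_on_eq[OF U] nn_integral_lebesgue_on_eq[OF Cl]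
      using C(2) by (intro nn_integral_cong) (auto simp: indicator_def)
    also have "\<dots> = ennreal M * ((\<integral>\<^sup>+x. ennreal \<bar>?a x\<bar> \<partial>lebesgue_on C) + (\<Sum>j\<in>UNIV. \<integral>\<^sup>+x. ennreal \<bar>?b j x\<bar> \<partial>lebesgue_on C))"
      using meas[OF locab(1)] meas[OF locab(2)]
      by (simp add: nn_integral_cmult nn_integral_add nn_integral_sum del: sum_ennreal)
    also have "\<dots> \<le> ennreal M * (J * ennreal e + (\<Sum>j\<in>(UNIV :: 'n set). J * ennreal e))"
    proof (intro mult_left_mono add_mono sum_mono)
      show "(\<integral>\<^sup>+x. ennreal \<bar>?a x\<bar> \<partial>lebesgue_on C) \<le> J * ennreal e"
        by (rule order_trans[OF nn_integral_comp_compact_le[OF measV(1) C(1,2)] mult_left_mono[OF f(3)]]) simp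
      show "(\<integral>\<^sup>+x. ennreal \<bar>?b j x\<bar> \<partial>lebesgue_on C) \<le> J * ennreal e" for j
        by (rule order_trans[OF nn_integral_comp_compact_le[OF measV(2)[of j] C(1,2)] mult_left_mono[OF f(4)]]) simp
    qed simp
    also have "\<dots> = ?c * ennreal e"
      by (simp add: ennreal_plus distrib_left distrib_right ennreal_of_nat_eq_real_of_nat mult_ac)
    finally show ?thesis .
  qed
  then have bnd: "ennreal \<bar>?I\<bar> \<le> ?c * ennreal e" if "e > 0" for e
    using that by blast
  obtain c where c: "c \<ge> 0" "?c = ennreal c"
    using cfin by (cases ?c) auto
  have *: "\<bar>?I\<bar> \<le> c * e" if "e > 0" for e
  proof -
    have "ennreal \<bar>?I\<bar> \<le> ennreal (c * e)"
      using bnd[OF that] c(1) that unfolding c(2) by (simp add: ennreal_mult)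
    then show ?thesis
      using c(1) that by (subst (asm) ennreal_le_iff) auto
  qed
  have "\<bar>?I\<bar> \<le> 0"
  proof (rule field_le_epsilon)
    fix e :: real assume "e > 0"
    have "\<bar>?I\<bar> \<le> c * (e / (c + 1))"
      using \<open>e > 0\<close> c(1) by (intro *) simp
    also have "\<dots> \<le> e"
      using \<open>e > 0\<close> c(1) by (simp add: field_simps)
    finally show "\<bar>?I\<bar> \<le> 0 + e"
      by simp
  qed
  then show ?thesis
    by simp
qed

text \<open>For \<open>C\<^sup>1\<close> functions this is the classical chain and product rule, tested with \<open>\<phi>\<close>; collecting the coefficients of \<open>u \<circ> T\<close>
  and of the \<open>g j \<circ> T\<close> puts it into the form to which the passage to the limit applies.\<close>

theorem weak_chain_rule:
  assumes weak: "\<And>j. has_weak_deriv V (mi_unit j) u (g j)"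
    and P: "P differentiable_on U" "continuous_on U (partial_deriv i P)"
  shows "has_weak_deriv U (mi_unit i) (\<lambda>x. u (T x) * P x)
     (\<lambda>x. (\<Sum>j\<in>UNIV. g j (T x) * (partial_deriv i (\<lambda>x. T x $ j) x * P x)) + u (T x) * partial_deriv i P x)"
  unfolding has_weak_deriv_unit_iff
proof (intro conjI ballI)
  have loc: "(\<lambda>x. u (T x)) \<in> L1_loc U" "\<And>j. (\<lambda>x. g j (T x)) \<in> L1_loc U"
    using weak by (auto simp: has_weak_deriv_def intro: L1_loc_comp)
  have contP: "continuous_on U P"
    by (rule differentiable_imp_continuous_on[OF P(1)])
  have sum_loc: "(\<lambda>x. \<Sum>j\<in>UNIV. w j x) \<in> L1_loc U" if "\<And>j. w j \<in> L1_loc U" for w :: "'n \<Rightarrow> _"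
    using that by (auto simp: L1_loc_def)
  show l1: "(\<lambda>x. u (T x) * P x) \<in> L1_loc U"
    by (rule L1_loc_mult[OF loc(1) contP])
  show l2: "(\<lambda>x. (\<Sum>j\<in>UNIV. g j (T x) * (partial_deriv i (\<lambda>x. T x $ j) x * P x)) + u (T x) * partial_deriv i P x) \<in> L1_loc U"
    by (intro L1_loc_add sum_loc L1_loc_mult loc P(2) continuous_on_mult T_partial_continuous contP)
  fix \<phi> assume \<phi>: "\<phi> \<in> test_fun U"
  obtain C where \<phi>_smooth: "\<forall>m. Ck_on m UNIV \<phi>" and C: "compact C" "C \<subseteq> U"
    and zero: "\<And>x. x \<notin> C \<Longrightarrow> \<phi> x = 0" "\<And>i x. x \<notin> C \<Longrightarrow> partial_deriv i \<phi> x = 0"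
    by (rule test_funE[OF \<phi>]) blast
  have cont\<phi>: "continuous_on U \<phi>" "continuous_on U (partial_deriv i \<phi>)"
    using continuous_on_subset[OF Ck_on_UNIV_continuous[OF \<phi>_smooth]]
      continuous_on_subset[OF Ck_on_UNIV_continuous[OF Ck_on_UNIV_partial[OF \<phi>_smooth]]] by auto
  \<comment> \<open>The coefficients of \<open>u \<circ> T\<close> and of \<open>g j \<circ> T\<close> in the tested identity.\<close>
  let ?A = "\<lambda>x. P x * partial_deriv i \<phi> x + partial_deriv i P x * \<phi> x"
  let ?B = "\<lambda>j x. partial_deriv i (\<lambda>x. T x $ j) x * P x * \<phi> x"
  have "(LINT x|lebesgue_on U. u (T x) * ?A x + (\<Sum>j\<in>UNIV. g j (T x) * ?B j x)) = 0"
  proof (rule weak_chain_rule_limit[OF weak _ _ C])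
    fix f :: "real^'n \<Rightarrow> real"
    assume f: "\<And>x. f differentiable (at x)" "\<And>j. continuous_on UNIV (partial_deriv j f)"
    let ?h = "\<lambda>x. f (T x) * P x"
    have contf: "continuous_on UNIV f"
      using f(1) by (intro differentiable_imp_continuous_on) (auto simp: differentiable_on_def differentiable_at_withinI)
    have Pd: "P differentiable (at x)" if "x \<in> U" for x
      using that P(1) open_U differentiable_on_open_at by blast
    have ph: "?h differentiable (at x)"
      "partial_deriv i ?h x = (\<Sum>j\<in>UNIV. partial_deriv j f (T x) * partial_deriv i (\<lambda>x. T x $ j) x) * P x + f (T x) * partial_deriv i P x"
      if "x \<in> U" for x
      using partial_deriv_compose[OF T_comp_diff[OF that] f(1)] Pd[OF that]
      by (auto simp: partial_deriv_mult intro: differentiable_mult)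
    have "(LINT x|lebesgue_on U. partial_deriv i ?h x * \<phi> x + ?h x * partial_deriv i \<phi> x) = 0"
    proof (rule integral_C1_test_fun[OF open_U \<phi>])
      have "continuous_on U (\<lambda>x. (\<Sum>j\<in>UNIV. partial_deriv j f (T x) * partial_deriv i (\<lambda>x. T x $ j) x) * P x + f (T x) * partial_deriv i P x)"
        by (intro continuous_intros T_partial_continuous contP P(2) continuous_on_compose2[OF f(2) T_continuous_on]
            continuous_on_compose2[OF contf T_continuous_on]) auto
      then show "continuous_on U (partial_deriv i ?h)"
        by (rule continuous_on_cong[THEN iffD1, rotated 2]) (simp_all add: ph(2))
    qed (use ph in auto)
    also have "(LINT x|lebesgue_on U. partial_deriv i ?h x * \<phi> x + ?h x * partial_deriv i \<phi> x)
       = (LINT x|lebesgue_on U. f (T x) * ?A x + (\<Sum>j\<in>UNIV. partial_deriv j f (T x) * ?B j x))"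
    proof (rule Bochner_Integration.integral_cong[OF refl])
      fix x assume "x \<in> space (lebesgue_on U)"
      then have "x \<in> U"
        by (simp add: space_restrict_space)
      from ph(2)[OF this] show "partial_deriv i ?h x * \<phi> x + ?h x * partial_deriv i \<phi> x
          = f (T x) * ?A x + (\<Sum>j\<in>UNIV. partial_deriv j f (T x) * ?B j x)"
        by (simp add: sum_distrib_left sum_distrib_right algebra_simps)
    qed
    finally show "(LINT x|lebesgue_on U. f (T x) * ?A x + (\<Sum>j\<in>UNIV. partial_deriv j f (T x) * ?B j x)) = 0" .
  qed (use zero cont\<phi> contP P(2) T_partial_continuous in \<open>auto intro!: continuous_intros\<close>)
  moreover have "u (T x) * ?A x + (\<Sum>j\<in>UNIV. g j (T x) * ?B j x)
     = u (T x) * P x * partial_deriv i \<phi> x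
       + ((\<Sum>j\<in>UNIV. g j (T x) * (partial_deriv i (\<lambda>x. T x $ j) x * P x)) + u (T x) * partial_deriv i P x) * \<phi> x" for x
    by (simp add: sum_distrib_left sum_distrib_right algebra_simps)
  ultimately show "(LINT x|lebesgue_on U. u (T x) * P x * partial_deriv i \<phi> x)
     = - (LINT x|lebesgue_on U. ((\<Sum>j\<in>UNIV. g j (T x) * (partial_deriv i (\<lambda>x. T x $ j) x * P x)) + u (T x) * partial_deriv i P x) * \<phi> x)"
    using test_fun_integrable_times[OF l1 open_U test_fun_partial_deriv[OF \<phi>]]
      test_fun_integrable_times[OF l2 open_U \<phi>] by simp
qed

subsection \<open>Higher derivatives of a composition\<close>

text \<open>The expressions that arise as derivatives of \<open>u \<circ> T\<close>: sums of products of weak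
  derivatives of \<open>u\<close> of order at most \<open>m\<close>, composed with \<open>T\<close>, and coefficients that can still be
  differentiated \<open>k - m\<close> times. They are operators acting on the family \<open>g\<close> of all weak derivatives of \<open>u\<close>,
  so that the coefficients do not depend on \<open>u\<close>.\<close>

inductive deriv_op :: "nat \<Rightarrow> ((('n \<Rightarrow> nat) \<Rightarrow> real^'n \<Rightarrow> real) \<Rightarrow> real^'n \<Rightarrow> real) \<Rightarrow> bool" where
  monomial: "mi_order \<beta> \<le> m \<Longrightarrow> m \<le> k \<Longrightarrow> bdd_lip_deriv (k - m) U P \<Longrightarrow> deriv_op m (\<lambda>g x. g \<beta> (T x) * P x)"
| add: "deriv_op m \<Phi> \<Longrightarrow> deriv_op m \<Psi> \<Longrightarrow> deriv_op m (\<lambda>g x. \<Phi> g x + \<Psi> g x)"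

lemma deriv_op_sum:
  assumes "finite I" "I \<noteq> {}" "\<And>i. i \<in> I \<Longrightarrow> deriv_op m (\<Phi> i)"
  shows "deriv_op m (\<lambda>g x. \<Sum>i\<in>I. \<Phi> i g x)"
  using assms by (induction I rule: finite_ne_induct) (auto intro: deriv_op.add)

text \<open>The entry of order zero is \<open>u\<close> itself and not only almost everywhere equal to it, so that \<open>u \<circ> T\<close> is one of the
  expressions to be differentiated.\<close>

definition weak_jet :: "(real^'n \<Rightarrow> real) \<Rightarrow> (('n \<Rightarrow> nat) \<Rightarrow> real^'n \<Rightarrow> real) \<Rightarrow> bool" where
  "weak_jet u g \<longleftrightarrow> g (\<lambda>_. 0) = u \<and> (\<forall>\<beta>. mi_order \<beta> \<le> k \<longrightarrow> has_weak_deriv V \<beta> u (g \<beta>))"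

lemma weak_jet_step:
  assumes "weak_jet u g" "mi_order \<beta> < k"
  shows "has_weak_deriv V (mi_unit j) (g \<beta>) (g (\<lambda>i. \<beta> i + mi_unit j i))"
  using assms unfolding weak_jet_def by (intro has_weak_deriv_step[of V \<beta> u]) auto

text \<open>A differentiation either raises the order of the derivative of \<open>u\<close> and creates a factor \<open>\<partial>\<^sub>i T\<^sub>j\<close>, or it hits the
  coefficient. Both \<open>\<partial>\<^sub>i T\<^sub>j\<close> and the differentiated coefficient still have \<open>k - m - 1\<close> bounded Lipschitz
  derivatives.\<close>

lemma deriv_op_derivative:
  assumes "deriv_op m \<Phi>" "m < k"
  shows "\<exists>\<Psi>. deriv_op (Suc m) \<Psi> \<and> (\<forall>u g. weak_jet u g \<longrightarrow> has_weak_deriv U (mi_unit i) (\<Phi> g) (\<Psi> g))"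
  using assms
proof induction
  case (monomial \<beta> m P)
  have k: "k - m = Suc (k - Suc m)"
    using monomial.prems by simp
  have P: "bdd_lip_deriv (Suc (k - Suc m)) U P"
    using monomial.hyps(3) by (simp only: k)
  then have Pi: "bdd_lip_deriv (k - Suc m) U (partial_deriv i P)" and Pd: "P differentiable_on U"
    by auto
  have Pc: "continuous_on U (partial_deriv i P)"
  proof -
    have "bdd_lip_deriv 0 U (partial_deriv i P)"
      using bdd_lip_deriv_mono[OF Pi] by blast
    then show ?thesis
      using lipschitz_on_continuous_on by auto
  qed
  have Ti: "bdd_lip_deriv (k - Suc m) U (partial_deriv i (\<lambda>x. T x $ j))" for j
  proof -
    have "bdd_lip_deriv (Suc (k - Suc m)) U (\<lambda>x. T x $ j)"
      using monomial.prems by (intro bdd_lip_deriv_mono[OF T_bdd_lip]) simp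
    then show ?thesis
      by simp
  qed
  let ?\<Psi> = "\<lambda>g x. (\<Sum>j\<in>UNIV. g (\<lambda>l. \<beta> l + mi_unit j l) (T x) * (partial_deriv i (\<lambda>x. T x $ j) x * P x))
      + g \<beta> (T x) * partial_deriv i P x"
  have "deriv_op (Suc m) ?\<Psi>"
    using monomial Pi
    by (intro deriv_op.add deriv_op_sum deriv_op.monomial bdd_lip_deriv_mult[OF open_U] Ti bdd_lip_deriv_SucD[OF P]) auto
  moreover have "has_weak_deriv U (mi_unit i) (\<lambda>x. g \<beta> (T x) * P x) (?\<Psi> g)" if "weak_jet u g" for u g
    using that monomial by (intro weak_chain_rule weak_jet_step Pd Pc) auto
  ultimately show ?case
    by blast
next
  case (add m \<Phi> \<Psi>)
  then obtain \<Phi>' \<Psi>' where "deriv_op (Suc m) \<Phi>'" "deriv_op (Suc m) \<Psi>'"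
    "\<And>u g. weak_jet u g \<Longrightarrow> has_weak_deriv U (mi_unit i) (\<Phi> g) (\<Phi>' g)"
    "\<And>u g. weak_jet u g \<Longrightarrow> has_weak_deriv U (mi_unit i) (\<Psi> g) (\<Psi>' g)"
    by blast
  then show ?case
    by (intro exI[of _ "\<lambda>g x. \<Phi>' g x + \<Psi>' g x"]) (auto intro: deriv_op.add has_weak_deriv_add[OF open_U])
qed

theorem weak_deriv_comp:
  assumes "mi_order \<nu> \<le> k"
  shows "\<exists>\<Phi>. deriv_op (mi_order \<nu>) \<Phi> \<and> (\<forall>u g. weak_jet u g \<longrightarrow> has_weak_deriv U \<nu> (u \<circ> T) (\<Phi> g))"
  using assms
proof (induction "mi_order \<nu>" arbitrary: \<nu>)
  case 0
  then have \<nu>: "\<nu> = (\<lambda>_. 0)"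
    using mi_order_0[of \<nu>] by simp
  have "deriv_op (mi_order (\<lambda>_. 0 :: nat)) (\<lambda>g x. g (\<lambda>_. 0) (T x) * 1)"
    unfolding mi_order_def sum.neutral_const
    by (intro deriv_op.monomial bdd_lip_deriv_const) (auto simp: mi_order_def)
  moreover have "has_weak_deriv U (\<lambda>_. 0) (u \<circ> T) (\<lambda>x. g (\<lambda>_. 0) (T x) * 1)" if "weak_jet u g" for u g
  proof -
    have "g (\<lambda>_. 0) = u" "u \<in> L1_loc V"
      using that by (auto simp: weak_jet_def has_weak_deriv_def dest: spec[of _ "\<lambda>_. 0"])
        (auto simp: mi_order_def dest: spec[of _ "\<lambda>_. 0"])
    then show ?thesis
      using has_weak_deriv_zero[OF L1_loc_comp[of u]] by (simp add: comp_def)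
  qed
  ultimately show ?case
    unfolding \<nu> by blast
next
  case (Suc m)
  obtain i \<mu> where \<mu>: "mi_order \<mu> = m" "\<nu> = (\<lambda>j. \<mu> j + mi_unit i j)"
    using mi_order_Suc_cases[OF Suc.hyps(2)[symmetric]] by blast
  have "mi_order \<mu> \<le> k"
    using \<mu>(1) Suc.prems Suc.hyps(2) by linarith
  then obtain \<Phi> where \<Phi>: "deriv_op m \<Phi>" "\<And>u g. weak_jet u g \<Longrightarrow> has_weak_deriv U \<mu> (u \<circ> T) (\<Phi> g)"
    using Suc.hyps(1)[of \<mu>] \<mu> by blast
  have "m < k"
    using Suc.prems Suc.hyps(2) by simp
  from deriv_op_derivative[OF \<Phi>(1) this, of i] obtain \<Psi> where \<Psi>: "deriv_op (Suc m) \<Psi>"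
    "\<And>u g. weak_jet u g \<Longrightarrow> has_weak_deriv U (mi_unit i) (\<Phi> g) (\<Psi> g)"
    by blast
  have "has_weak_deriv U \<nu> (u \<circ> T) (\<Psi> g)" if "weak_jet u g" for u g
    unfolding \<mu>(2) using \<Phi>(2)[OF that] \<Psi>(2)[OF that] by (rule has_weak_deriv_add_unit)
  then show ?case
    using \<Psi>(1) Suc.hyps(2) by auto
qed

end


section \<open>The Gagliardo integral\<close>

subsection \<open>An integrable kernel\<close>

lemma dyadic_below_one:
  fixes t :: real
  assumes "0 < t" "t < 1"
  shows "\<exists>j. (1 / 2) ^ Suc j \<le> t \<and> t < (1 / 2) ^ j"
proof -
  have ex: "\<exists>j. (1 / 2) ^ Suc j \<le> t"
  proof -
    obtain n where "(1 / 2 :: real) ^ n < t"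
      using real_arch_pow_inv[OF \<open>0 < t\<close>, of "1 / 2"] by auto
    then have "(1 / 2 :: real) ^ Suc n \<le> t"
      using \<open>0 < t\<close> by (simp add: field_simps)
    then show ?thesis ..
  qed
  define j where "j = (LEAST j. (1 / 2) ^ Suc j \<le> t)"
  have 1: "(1 / 2) ^ Suc j \<le> t"
    unfolding j_def by (rule LeastI_ex[OF ex])
  have "t < (1 / 2) ^ j"
  proof (cases j)
    case (Suc i)
    then have "\<not> (1 / 2) ^ Suc i \<le> t"
      using not_less_Least[of i "\<lambda>j. (1 / 2) ^ Suc j \<le> t"] by (simp add: j_def)
    with Suc show ?thesis
      by simp
  qed (use assms in simp)
  with 1 show ?thesis
    by blast
qed

lemma dyadic_above_one:
  fixes t :: real
  assumes "1 \<le> t"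
  shows "\<exists>j. 2 ^ j \<le> t \<and> t < 2 ^ Suc j"
proof -
  have ex: "\<exists>j. t < 2 ^ Suc j"
  proof -
    obtain n where "t < 2 ^ n"
      using real_arch_pow[of 2 t] by auto
    then have "t < 2 ^ Suc n"
      using assms by simp
    then show ?thesis ..
  qed
  define j where "j = (LEAST j. t < 2 ^ Suc j)"
  have 1: "t < 2 ^ Suc j"
    unfolding j_def by (rule LeastI_ex[OF ex])
  have "2 ^ j \<le> t"
  proof (cases j)
    case (Suc i)
    then have "\<not> t < 2 ^ Suc i"
      using not_less_Least[of i "\<lambda>j. t < 2 ^ Suc j"] by (simp add: j_def)
    with Suc show ?thesis
      by simp
  qed (use assms in simp)
  with 1 show ?thesis
    by blast
qed

definition shell :: "real \<Rightarrow> 'a::euclidean_space set" where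
  "shell R = {z. R \<le> norm z \<and> norm z < 2 * R}"

lemma shell_borel [measurable]: "shell R \<in> sets borel"
  unfolding shell_def by measurable

text \<open>The integrand is at most its value on the inner sphere, and the powers of \<open>R\<close> cancel against the volume of the shell.\<close>

lemma shell_integral_le:
  assumes "R > 0"
  shows "(\<integral>\<^sup>+z. ennreal (norm z powr (- real DIM('a))) * indicator (shell R) z \<partial>(lborel :: 'a measure))
     \<le> ennreal (unit_ball_vol (real DIM('a)) * 2 ^ DIM('a :: euclidean_space))" (is "?I \<le> _")
proof -
  have "?I \<le> (\<integral>\<^sup>+z. ennreal (R powr (- real DIM('a))) * indicator (ball (0 :: 'a) (2 * R)) z \<partial>lborel)"
  proof (rule nn_integral_mono)
    fix z :: 'a
    show "ennreal (norm z powr (- real DIM('a))) * indicator (shell R) z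
       \<le> ennreal (R powr (- real DIM('a))) * indicator (ball 0 (2 * R)) z"
      using assms by (auto simp: shell_def indicator_def intro!: ennreal_leI powr_mono2')
  qed
  also have "\<dots> = ennreal (R powr (- real DIM('a))) * emeasure lborel (ball (0 :: 'a) (2 * R))"
    by (rule nn_integral_cmult_indicator) simp
  also have "\<dots> = ennreal (unit_ball_vol (real DIM('a)) * 2 ^ DIM('a))"
    using assms by (simp add: emeasure_ball power_mult_distrib powr_minus powr_realpow flip: ennreal_mult)
  finally show ?thesis .
qed

text \<open>Up to a constant, a bound for the Gagliardo integrand of a bounded Lipschitz function.\<close>

definition gag_kernel :: "real \<Rightarrow> real \<Rightarrow> real^'n::finite \<Rightarrow> real" where
  "gag_kernel \<theta> p z = min 1 (norm z) powr p / norm z powr (real CARD('n) + \<theta> * p)"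

lemma gag_kernel_nonneg [simp]: "0 \<le> gag_kernel \<theta> p z"
  by (simp add: gag_kernel_def)

lemma gag_kernel_measurable [measurable]: "gag_kernel \<theta> p \<in> borel_measurable borel"
  unfolding gag_kernel_def[abs_def] by measurable

lemma gag_kernel_zero [simp]: "gag_kernel \<theta> p 0 = 0"
  by (simp add: gag_kernel_def)

lemma gag_kernel_le_inside:
  fixes z :: "real^'n::finite"
  assumes "0 < \<theta>" "\<theta> < 1" "0 < p" "z \<noteq> 0" "norm z < (1 / 2) ^ j"
  shows "gag_kernel \<theta> p z \<le> ((1 / 2) powr ((1 - \<theta>) * p)) ^ j * norm z powr (- real CARD('n))"
proof -
  have "(1 / 2 :: real) ^ j \<le> 1"
    by (simp add: power_le_one)
  then have "norm z \<le> 1"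
    using assms by linarith
  then have "gag_kernel \<theta> p z = norm z powr ((1 - \<theta>) * p) * norm z powr (- real CARD('n))"
    using assms by (simp add: gag_kernel_def powr_diff[symmetric] powr_add[symmetric] algebra_simps)
  also have "norm z powr ((1 - \<theta>) * p) \<le> ((1 / 2) ^ j) powr ((1 - \<theta>) * p)"
    using assms by (intro powr_mono2) auto
  also have "((1 / 2 :: real) ^ j) powr ((1 - \<theta>) * p) = ((1 / 2) powr ((1 - \<theta>) * p)) ^ j"
    by (simp add: powr_powr powr_realpow[symmetric] mult_ac)
  finally show ?thesis
    by (simp add: mult_right_mono)
qed

lemma gag_kernel_le_outside:
  fixes z :: "real^'n::finite"
  assumes "0 < \<theta>" "0 < p" "2 ^ j \<le> norm z"
  shows "gag_kernel \<theta> p z \<le> ((1 / 2) powr (\<theta> * p)) ^ j * norm z powr (- real CARD('n))"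
proof -
  have "(1 :: real) \<le> 2 ^ j"
    by simp
  then have z: "norm z \<ge> 1"
    using assms by linarith
  then have "gag_kernel \<theta> p z = norm z powr (- (\<theta> * p)) * norm z powr (- real CARD('n))"
    by (simp add: gag_kernel_def powr_minus_divide powr_add[symmetric] powr_diff algebra_simps)
  also have "norm z powr (- (\<theta> * p)) \<le> (2 ^ j) powr (- (\<theta> * p))"
    using assms by (intro powr_mono2') auto
  also have "(2 ^ j :: real) powr (- (\<theta> * p)) = ((1 / 2) powr (\<theta> * p)) ^ j"
  proof -
    have "(2 ^ j :: real) powr (- (\<theta> * p)) = (2 powr (- (\<theta> * p))) ^ j"
      by (simp add: powr_powr powr_realpow[symmetric] mult_ac)
    also have "(2 :: real) powr (- (\<theta> * p)) = (1 / 2) powr (\<theta> * p)"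
      by (simp only: powr_minus powr_divide powr_one_eq_one inverse_eq_divide)
    finally show ?thesis .
  qed
  finally show ?thesis
    by (simp add: mult_right_mono)
qed

text \<open>On the shell between two consecutive powers of two the kernel is comparable to \<open>|z|\<close> to the power
  minus the dimension, whose integral over a shell does not depend on the radius, times the term of a geometric
  series.\<close>

lemma gag_kernel_integrable:
  assumes "0 < \<theta>" "\<theta> < 1" "0 < p"
  shows "(\<integral>\<^sup>+z. ennreal (gag_kernel \<theta> p (z :: real^'n::finite)) \<partial>lborel) < \<infinity>"
proof -
  let ?n = "real CARD('n)"
  define q1 where "q1 = (1 / 2 :: real) powr ((1 - \<theta>) * p)"
  define q2 where "q2 = (1 / 2 :: real) powr (\<theta> * p)"
  have q: "0 \<le> q1" "q1 < 1" "0 \<le> q2" "q2 < 1"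
    using assms powr_less_mono2[of "(1 - \<theta>) * p" "1 / 2 :: real" 1] powr_less_mono2[of "\<theta> * p" "1 / 2 :: real" 1]
    by (auto simp: q1_def q2_def)
  define N where "N z = ennreal (norm z powr (- ?n))" for z :: "real^'n"
  have [measurable]: "N \<in> borel_measurable borel"
    unfolding N_def[abs_def] by measurable
  let ?t1 = "\<lambda>j z. ennreal (q1 ^ j) * (N z * indicator (shell ((1 / 2) ^ Suc j)) z)"
  let ?t2 = "\<lambda>j z. ennreal (q2 ^ j) * (N z * indicator (shell (2 ^ j)) z)"
  have bound: "ennreal (gag_kernel \<theta> p z) \<le> (\<Sum>j. ?t1 j z + ?t2 j z)" for z :: "real^'n"
  proof (cases "z = 0")
    case False
    have "\<exists>j. ennreal (gag_kernel \<theta> p z) \<le> ?t1 j z + ?t2 j z"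
    proof (cases "norm z < 1")
      case True
      then obtain j where j: "(1 / 2) ^ Suc j \<le> norm z" "norm z < (1 / 2) ^ j"
        using dyadic_below_one[of "norm z"] False by auto
      then have "ennreal (gag_kernel \<theta> p z) \<le> ennreal (q1 ^ j * norm z powr (- ?n))"
        unfolding q1_def using assms False by (intro ennreal_leI gag_kernel_le_inside)
      also have "\<dots> = ?t1 j z"
        using j q by (simp add: N_def shell_def ennreal_mult)
      also have "\<dots> \<le> ?t1 j z + ?t2 j z"
        by simp
      finally show ?thesis ..
    next
      case False
      then obtain j where j: "2 ^ j \<le> norm z" "norm z < 2 ^ Suc j"
        using dyadic_above_one[of "norm z"] by auto
      then have "ennreal (gag_kernel \<theta> p z) \<le> ennreal (q2 ^ j * norm z powr (- ?n))"
        unfolding q2_def using assms by (intro ennreal_leI gag_kernel_le_outside)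
      also have "\<dots> = ?t2 j z"
        using j q by (simp add: N_def shell_def ennreal_mult)
      also have "\<dots> \<le> ?t1 j z + ?t2 j z"
        by simp
      finally show ?thesis ..
    qed
    then obtain j where "ennreal (gag_kernel \<theta> p z) \<le> ?t1 j z + ?t2 j z"
      by blast
    also have "\<dots> = (\<Sum>j\<in>{j}. ?t1 j z + ?t2 j z)"
      by simp
    also have "\<dots> \<le> (\<Sum>j. ?t1 j z + ?t2 j z)"
      by (rule sum_le_suminf) auto
    finally show ?thesis .
  qed simp
  define c where "c = unit_ball_vol ?n * 2 ^ CARD('n)"
  have c: "0 \<le> c"
    by (simp add: c_def)
  have sh: "(\<integral>\<^sup>+z. N z * indicator (shell R) z \<partial>lborel) \<le> ennreal c" if "R > 0" for R
    using shell_integral_le[OF that, where 'a = "real^'n"] by (simp add: c_def N_def)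
  have "(\<integral>\<^sup>+z. ennreal (gag_kernel \<theta> p (z :: real^'n)) \<partial>lborel) \<le> (\<integral>\<^sup>+z. (\<Sum>j. ?t1 j z + ?t2 j z) \<partial>lborel)"
    by (intro nn_integral_mono bound)
  also have "\<dots> = (\<Sum>j. \<integral>\<^sup>+z. ?t1 j z + ?t2 j z \<partial>lborel)"
    by (rule nn_integral_suminf) measurable
  also have "\<dots> \<le> (\<Sum>j. ennreal ((q1 ^ j + q2 ^ j) * c))"
  proof (intro suminf_le)
    fix j
    have "(\<integral>\<^sup>+z. ?t1 j z + ?t2 j z \<partial>lborel)
        = ennreal (q1 ^ j) * (\<integral>\<^sup>+z. N z * indicator (shell ((1 / 2) ^ Suc j)) z \<partial>lborel)
        + ennreal (q2 ^ j) * (\<integral>\<^sup>+z. N z * indicator (shell (2 ^ j)) z \<partial>lborel)"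
      by (subst nn_integral_add; simp add: nn_integral_cmult)
    also have "\<dots> \<le> ennreal (q1 ^ j) * ennreal c + ennreal (q2 ^ j) * ennreal c"
      by (intro add_mono mult_left_mono sh) auto
    also have "\<dots> = ennreal ((q1 ^ j + q2 ^ j) * c)"
      using q c by (simp add: distrib_right ennreal_mult)
    finally show "(\<integral>\<^sup>+z. ?t1 j z + ?t2 j z \<partial>lborel) \<le> ennreal ((q1 ^ j + q2 ^ j) * c)" .
  qed auto
  also have "\<dots> < \<infinity>"
  proof -
    have "summable (\<lambda>j. (q1 ^ j + q2 ^ j) * c)"
      using q by (intro summable_mult2 summable_add summable_geometric) auto
    then have "(\<Sum>j. ennreal ((q1 ^ j + q2 ^ j) * c)) = ennreal (\<Sum>j. (q1 ^ j + q2 ^ j) * c)"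
      using q c by (intro suminf_ennreal2) auto
    then show ?thesis
      by simp
  qed
  finally show ?thesis .
qed

subsection \<open>Basic estimates\<close>

lemma powr_abs_add_le:
  fixes a b p :: real
  assumes "0 < p"
  shows "\<bar>a + b\<bar> powr p \<le> 2 powr p * (\<bar>a\<bar> powr p + \<bar>b\<bar> powr p)"
proof -
  have "\<bar>a + b\<bar> powr p \<le> (2 * max \<bar>a\<bar> \<bar>b\<bar>) powr p"
    using assms by (intro powr_mono2) auto
  also have "\<dots> = 2 powr p * max \<bar>a\<bar> \<bar>b\<bar> powr p"
    by (simp add: powr_mult)
  also have "max \<bar>a\<bar> \<bar>b\<bar> powr p \<le> \<bar>a\<bar> powr p + \<bar>b\<bar> powr p"
    by (simp add: max_def)
  finally show ?thesis
    by simp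
qed

definition Ip :: "real \<Rightarrow> (real^'n::finite) set \<Rightarrow> (real^'n \<Rightarrow> real) \<Rightarrow> ennreal" where
  "Ip p \<Omega> f = (\<integral>\<^sup>+x. ennreal (\<bar>f x\<bar> powr p) \<partial>lebesgue_on \<Omega>)"

definition Gag :: "real \<Rightarrow> real \<Rightarrow> (real^'n::finite) set \<Rightarrow> (real^'n \<Rightarrow> real) \<Rightarrow> ennreal" where
  "Gag \<theta> p \<Omega> f = (\<integral>\<^sup>+x. \<integral>\<^sup>+y. ennreal (\<bar>f x - f y\<bar> powr p / norm (x - y) powr (real CARD('n) + \<theta> * p))
     \<partial>lebesgue_on \<Omega> \<partial>lebesgue_on \<Omega>)"

lemma sigma_finite_lebesgue_on:
  assumes "\<Omega> \<in> sets lebesgue"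
  shows "sigma_finite_measure (lebesgue_on \<Omega> :: 'a::euclidean_space measure)"
proof -
  have "sigma_finite_measure (lebesgue :: 'a measure)"
  proof
    have "x \<in> (\<Union>n. cball 0 (real n))" for x :: 'a
      using real_arch_simple[of "norm x"] by auto
    moreover have "emeasure lebesgue (cball (0 :: 'a) r) \<noteq> \<infinity>" for r
      using emeasure_bounded_finite[OF bounded_cball[of "0 :: 'a" r]] by simp
    ultimately show "\<exists>A :: 'a set set. countable A \<and> A \<subseteq> sets lebesgue \<and> \<Union> A = space lebesgue
        \<and> (\<forall>a\<in>A. emeasure lebesgue a \<noteq> \<infinity>)"
      by (intro exI[of _ "range (\<lambda>n :: nat. cball 0 (real n))"]) auto
  qed
  then show ?thesis
    using assms by (intro sigma_finite_measure_restrict_space) auto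
qed

lemma id_measurable_lebesgue_on: "(\<lambda>x. x) \<in> borel_measurable (lebesgue_on \<Omega> :: 'a::euclidean_space measure)"
proof -
  have "(\<lambda>x. x) \<in> borel_measurable (lebesgue :: 'a measure)"
    by (intro measurable_completion) simp
  then show ?thesis
    by (rule measurable_restrict_space1)
qed

lemma Gag_integrand_measurable:
  fixes f :: "real^'n::finite \<Rightarrow> real"
  assumes [measurable]: "f \<in> borel_measurable (lebesgue_on \<Omega>)"
  shows "(\<lambda>(x, y). ennreal (\<bar>f x - f y\<bar> powr p / norm (x - y) powr a))
     \<in> borel_measurable (lebesgue_on \<Omega> \<Otimes>\<^sub>M lebesgue_on \<Omega>)"
proof -
  have [measurable]: "fst \<in> borel_measurable (lebesgue_on \<Omega> \<Otimes>\<^sub>M lebesgue_on \<Omega> :: ((real^'n) \<times> (real^'n)) measure)"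
    "snd \<in> borel_measurable (lebesgue_on \<Omega> \<Otimes>\<^sub>M lebesgue_on \<Omega> :: ((real^'n) \<times> (real^'n)) measure)"
    using measurable_compose[OF measurable_fst id_measurable_lebesgue_on]
      measurable_compose[OF measurable_snd id_measurable_lebesgue_on] by auto
  show ?thesis
    unfolding case_prod_beta by measurable
qed

lemma nn_integral_pair_eq_Gag:
  fixes f :: "real^'n::finite \<Rightarrow> real"
  assumes "\<Omega> \<in> sets lebesgue" and f: "f \<in> borel_measurable (lebesgue_on \<Omega>)"
  shows "(\<integral>\<^sup>+(x, y). ennreal (\<bar>f x - f y\<bar> powr p / norm (x - y) powr (real CARD('n) + \<theta> * p))
        \<partial>(lebesgue_on \<Omega> \<Otimes>\<^sub>M lebesgue_on \<Omega>)) = Gag \<theta> p \<Omega> f"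
proof -
  interpret sigma_finite_measure "lebesgue_on \<Omega>"
    by (rule sigma_finite_lebesgue_on[OF assms(1)])
  show ?thesis
    unfolding Gag_def by (subst nn_integral_fst[symmetric, OF Gag_integrand_measurable[OF f]]) simp
qed

lemma Ip_cong_AE: "AE_eq_on \<Omega> f g \<Longrightarrow> Ip p \<Omega> f = Ip p \<Omega> g"
  unfolding Ip_def AE_eq_on_def by (intro nn_integral_cong_AE) (auto elim!: eventually_mono)

lemma Gag_cong_AE:
  assumes "AE_eq_on \<Omega> f g"
  shows "Gag \<theta> p \<Omega> f = Gag \<theta> p \<Omega> g"
proof -
  have ae: "AE x in lebesgue_on \<Omega>. f x = g x"
    using assms by (simp add: AE_eq_on_def)
  show ?thesis
    unfolding Gag_def
    by (intro nn_integral_cong_AE, rule eventually_mono[OF ae], intro nn_integral_cong_AE, rule eventually_mono[OF ae]) simp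
qed

lemma Gag_inner_measurable:
  fixes f :: "real^'n::finite \<Rightarrow> real"
  assumes "\<Omega> \<in> sets lebesgue" "f \<in> borel_measurable (lebesgue_on \<Omega>)"
  shows "(\<lambda>x. \<integral>\<^sup>+y. ennreal (\<bar>f x - f y\<bar> powr p / norm (x - y) powr a) \<partial>lebesgue_on \<Omega>)
     \<in> borel_measurable (lebesgue_on \<Omega>)"
proof -
  interpret sigma_finite_measure "lebesgue_on \<Omega>"
    by (rule sigma_finite_lebesgue_on[OF assms(1)])
  show ?thesis
    by (rule borel_measurable_nn_integral[OF Gag_integrand_measurable[OF assms(2)]])
qed

lemma Gag_slice_measurable:
  fixes f :: "real^'n::finite \<Rightarrow> real"
  assumes [measurable]: "f \<in> borel_measurable (lebesgue_on \<Omega>)"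
  shows "(\<lambda>y. ennreal (\<bar>c - f y\<bar> powr p / norm (x - y) powr a)) \<in> borel_measurable (lebesgue_on \<Omega>)"
proof -
  note [measurable] = id_measurable_lebesgue_on
  show ?thesis
    by measurable
qed

lemma Ip_add_le:
  assumes "0 < p" and [measurable]: "f \<in> borel_measurable (lebesgue_on \<Omega>)" "g \<in> borel_measurable (lebesgue_on \<Omega>)"
  shows "Ip p \<Omega> (\<lambda>x. f x + g x) \<le> ennreal (2 powr p) * (Ip p \<Omega> f + Ip p \<Omega> g)"
proof -
  have "Ip p \<Omega> (\<lambda>x. f x + g x) \<le> (\<integral>\<^sup>+x. ennreal (2 powr p) * (ennreal (\<bar>f x\<bar> powr p) + ennreal (\<bar>g x\<bar> powr p)) \<partial>lebesgue_on \<Omega>)"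
    unfolding Ip_def
    by (intro nn_integral_mono) (simp add: ennreal_leI powr_abs_add_le[OF assms(1)] flip: ennreal_plus ennreal_mult)
  also have "\<dots> = ennreal (2 powr p) * (Ip p \<Omega> f + Ip p \<Omega> g)"
    unfolding Ip_def by (simp add: nn_integral_cmult nn_integral_add del: ennreal_plus)
  finally show ?thesis .
qed

lemma Gag_add_le:
  fixes f g :: "real^'n::finite \<Rightarrow> real"
  assumes "0 < p" "\<Omega> \<in> sets lebesgue"
    and fg: "f \<in> borel_measurable (lebesgue_on \<Omega>)" "g \<in> borel_measurable (lebesgue_on \<Omega>)"
  shows "Gag \<theta> p \<Omega> (\<lambda>x. f x + g x) \<le> ennreal (2 powr p) * (Gag \<theta> p \<Omega> f + Gag \<theta> p \<Omega> g)"
proof -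
  let ?a = "real CARD('n) + \<theta> * p"
  let ?e = "\<lambda>f x y. ennreal (\<bar>f x - f y\<bar> powr p / norm (x - y) powr ?a)"
  have "?e (\<lambda>x. f x + g x) x y \<le> ennreal (2 powr p) * (?e f x y + ?e g x y)" for x y
  proof -
    have "\<bar>(f x - f y) + (g x - g y)\<bar> powr p / norm (x - y) powr ?a
       \<le> 2 powr p * (\<bar>f x - f y\<bar> powr p + \<bar>g x - g y\<bar> powr p) / norm (x - y) powr ?a"
      by (intro divide_right_mono powr_abs_add_le assms) simp
    then have "\<bar>f x + g x - (f y + g y)\<bar> powr p / norm (x - y) powr ?a
       \<le> 2 powr p * (\<bar>f x - f y\<bar> powr p / norm (x - y) powr ?a + \<bar>g x - g y\<bar> powr p / norm (x - y) powr ?a)"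
      by (simp add: algebra_simps add_divide_distrib)
    then show ?thesis
      by (simp add: ennreal_leI flip: ennreal_plus ennreal_mult)
  qed
  then have "Gag \<theta> p \<Omega> (\<lambda>x. f x + g x)
      \<le> (\<integral>\<^sup>+x. \<integral>\<^sup>+y. ennreal (2 powr p) * (?e f x y + ?e g x y) \<partial>lebesgue_on \<Omega> \<partial>lebesgue_on \<Omega>)"
    unfolding Gag_def by (intro nn_integral_mono)
  also have "\<dots> = ennreal (2 powr p) * (Gag \<theta> p \<Omega> f + Gag \<theta> p \<Omega> g)"
    unfolding Gag_def
    using Gag_slice_measurable[OF fg(1)] Gag_slice_measurable[OF fg(2)]
      Gag_inner_measurable[OF assms(2) fg(1), of p ?a] Gag_inner_measurable[OF assms(2) fg(2), of p ?a]
    by (simp add: nn_integral_cmult nn_integral_add del: ennreal_plus)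
  finally show ?thesis .
qed

lemma nn_integral_lborel_shift:
  fixes h :: "'a::euclidean_space \<Rightarrow> ennreal"
  assumes "h \<in> borel_measurable borel"
  shows "(\<integral>\<^sup>+x. h (x + v) \<partial>lborel) = (\<integral>\<^sup>+x. h x \<partial>lborel)"
proof -
  have "(\<integral>\<^sup>+x. h x \<partial>lborel) = (\<integral>\<^sup>+x. h x \<partial>distr lborel borel ((+) v))"
    by (simp add: lborel_distr_plus)
  also have "\<dots> = (\<integral>\<^sup>+x. h (x + v) \<partial>lborel)"
    using assms by (subst nn_integral_distr) (auto simp: add.commute)
  finally show ?thesis ..
qed

lemma gag_kernel_slice_le:
  fixes y :: "real^'n::finite"
  assumes "\<Omega> \<in> sets lebesgue"
  shows "(\<integral>\<^sup>+x. ennreal (gag_kernel \<theta> p (x - y)) \<partial>lebesgue_on \<Omega>) \<le> (\<integral>\<^sup>+z. ennreal (gag_kernel \<theta> p (z :: real^'n)) \<partial>lborel)"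
proof -
  have "(\<integral>\<^sup>+x. ennreal (gag_kernel \<theta> p (x - y)) \<partial>lebesgue_on \<Omega>) \<le> (\<integral>\<^sup>+x. ennreal (gag_kernel \<theta> p (x - y)) \<partial>lebesgue)"
    unfolding nn_integral_lebesgue_on_eq[OF assms]
    by (intro nn_integral_mono) (auto simp: indicator_def)
  also have "\<dots> = (\<integral>\<^sup>+x. ennreal (gag_kernel \<theta> p (x + (- y))) \<partial>lborel)"
    by (simp add: nn_integral_completion)
  also have "\<dots> = (\<integral>\<^sup>+z. ennreal (gag_kernel \<theta> p (z :: real^'n)) \<partial>lborel)"
    by (rule nn_integral_lborel_shift) simp
  finally show ?thesis .
qed

text \<open>Write \<open>f x P x - f y P y = P x (f x - f y) + f y (P x - P y)\<close>. As \<open>P\<close> is bounded and Lipschitz, the second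
  summand contributes at most a multiple of \<open>|f y|\<^sup>p\<close> times \<open>gag_kernel\<close> at \<open>x - y\<close>. Integration over \<open>x\<close> leaves the
  finite integral of the kernel.\<close>

lemma Gag_mult_le:
  fixes P :: "real^'n::finite \<Rightarrow> real"
  assumes "0 < p" "0 < \<theta>" "\<theta> < 1" and \<Omega>: "\<Omega> \<in> sets lebesgue"
    and P: "bounded (P ` \<Omega>)" "L-lipschitz_on \<Omega> P"
  shows "\<exists>C. \<forall>f :: real^'n \<Rightarrow> real. f \<in> borel_measurable (lebesgue_on \<Omega>) \<longrightarrow> Gag \<theta> p \<Omega> (\<lambda>x. f x * P x) \<le> ennreal C * (Gag \<theta> p \<Omega> f + Ip p \<Omega> f)"
proof -
  let ?a = "real CARD('n) + \<theta> * p"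
  let ?e = "\<lambda>f x y. ennreal (\<bar>f x - f y\<bar> powr p / norm (x - y) powr ?a)"
  obtain M0 where M0: "\<And>x. x \<in> \<Omega> \<Longrightarrow> \<bar>P x\<bar> \<le> M0"
    using P(1) by (auto simp: bounded_iff)
  define M where "M = \<bar>M0\<bar> + \<bar>M0\<bar> + \<bar>L\<bar>"
  have M: "M \<ge> 0" "\<And>x. x \<in> \<Omega> \<Longrightarrow> \<bar>P x\<bar> \<le> M"
    using M0 by (force simp: M_def)+
  have P_diff: "\<bar>P x - P y\<bar> \<le> M * min 1 (norm (x - y))" if "x \<in> \<Omega>" "y \<in> \<Omega>" for x y
  proof (cases "norm (x - y) \<le> 1")
    case True
    have "\<bar>P x - P y\<bar> \<le> L * norm (x - y)"
      using lipschitz_onD[OF P(2) that] by (simp add: dist_norm dist_real_def)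
    also have "\<dots> \<le> M * norm (x - y)"
      by (intro mult_right_mono) (auto simp: M_def)
    finally show ?thesis
      using True by (simp add: min_def)
  next
    case False
    then show ?thesis
      using M0[OF that(1)] M0[OF that(2)] by (simp add: M_def min_def)
  qed
  define kap where "kap = (\<integral>\<^sup>+z. ennreal (gag_kernel \<theta> p (z :: real^'n)) \<partial>lborel)"
  have "kap < top"
    using gag_kernel_integrable[OF assms(2,3,1), where 'n = 'n] by (simp add: kap_def)
  then obtain kr where kr: "kr \<ge> 0" "kap = ennreal kr"
    by (cases kap) auto
  let ?c = "2 powr p * M powr p"
  show ?thesis
  proof (intro exI[of _ "?c * (1 + kr)"] allI impI)
    fix f :: "real^'n \<Rightarrow> real" assume f: "f \<in> borel_measurable (lebesgue_on \<Omega>)"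
    note [measurable] = f id_measurable_lebesgue_on
    have pt: "?e (\<lambda>x. f x * P x) x y \<le> ennreal ?c * (?e f x y + ennreal (\<bar>f y\<bar> powr p) * ennreal (gag_kernel \<theta> p (x - y)))"
      if "x \<in> \<Omega>" "y \<in> \<Omega>" for x y
    proof -
      have "\<bar>f x * P x - f y * P y\<bar> powr p = \<bar>P x * (f x - f y) + f y * (P x - P y)\<bar> powr p"
        by (simp add: algebra_simps)
      also have "\<dots> \<le> 2 powr p * (\<bar>P x * (f x - f y)\<bar> powr p + \<bar>f y * (P x - P y)\<bar> powr p)"
        by (rule powr_abs_add_le[OF assms(1)])
      also have "\<bar>P x * (f x - f y)\<bar> powr p \<le> M powr p * \<bar>f x - f y\<bar> powr p"
        unfolding abs_mult powr_mult
        using assms(1) M that by (intro mult_right_mono powr_mono2) auto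
      also have "\<bar>f y * (P x - P y)\<bar> powr p \<le> \<bar>f y\<bar> powr p * (M * min 1 (norm (x - y))) powr p"
        unfolding abs_mult powr_mult[of "\<bar>f y\<bar>"]
        using assms(1) P_diff[OF that] by (intro mult_left_mono powr_mono2) auto
      also have "(M * min 1 (norm (x - y))) powr p = M powr p * min 1 (norm (x - y)) powr p"
        using M(1) by (simp add: powr_mult)
      finally have "\<bar>f x * P x - f y * P y\<bar> powr p \<le> 2 powr p * (M powr p * \<bar>f x - f y\<bar> powr p
          + \<bar>f y\<bar> powr p * (M powr p * min 1 (norm (x - y)) powr p))"
        by simp
      then have "\<bar>f x * P x - f y * P y\<bar> powr p / norm (x - y) powr ?a \<le> 2 powr p * (M powr p * \<bar>f x - f y\<bar> powr p
          + \<bar>f y\<bar> powr p * (M powr p * min 1 (norm (x - y)) powr p)) / norm (x - y) powr ?a"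
        by (rule divide_right_mono) simp
      also have "\<dots> = ?c * (\<bar>f x - f y\<bar> powr p / norm (x - y) powr ?a + \<bar>f y\<bar> powr p * gag_kernel \<theta> p (x - y))"
        by (simp add: gag_kernel_def algebra_simps add_divide_distrib)
      finally show ?thesis
        by (simp add: ennreal_leI flip: ennreal_plus ennreal_mult)
    qed
    interpret M: sigma_finite_measure "lebesgue_on \<Omega> :: (real^'n) measure"
      by (rule sigma_finite_lebesgue_on[OF \<Omega>])
    interpret MM: pair_sigma_finite "lebesgue_on \<Omega> :: (real^'n) measure" "lebesgue_on \<Omega> :: (real^'n) measure" ..
    have [measurable]: "fst \<in> borel_measurable (lebesgue_on \<Omega> \<Otimes>\<^sub>M lebesgue_on \<Omega> :: ((real^'n) \<times> (real^'n)) measure)"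
      "snd \<in> borel_measurable (lebesgue_on \<Omega> \<Otimes>\<^sub>M lebesgue_on \<Omega> :: ((real^'n) \<times> (real^'n)) measure)"
      using measurable_compose[OF measurable_fst id_measurable_lebesgue_on]
        measurable_compose[OF measurable_snd id_measurable_lebesgue_on] by auto
    have m1: "(\<lambda>y. ennreal (\<bar>f y\<bar> powr p) * ennreal (gag_kernel \<theta> p (x - y))) \<in> borel_measurable (lebesgue_on \<Omega>)" for x
      by measurable
    have m2: "(\<lambda>(x, y). ennreal (\<bar>f y\<bar> powr p) * ennreal (gag_kernel \<theta> p (x - y))) \<in> borel_measurable (lebesgue_on \<Omega> \<Otimes>\<^sub>M lebesgue_on \<Omega>)"
      unfolding case_prod_beta by measurable
    have m3: "(\<lambda>x. \<integral>\<^sup>+y. ennreal (\<bar>f y\<bar> powr p) * ennreal (gag_kernel \<theta> p (x - y)) \<partial>lebesgue_on \<Omega>) \<in> borel_measurable (lebesgue_on \<Omega>)"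
      by (rule M.borel_measurable_nn_integral[OF m2])
    have sp: "space (lebesgue_on \<Omega>) = \<Omega>"
      by (simp add: space_restrict_space)
    have "(\<integral>\<^sup>+x. \<integral>\<^sup>+y. ennreal (\<bar>f y\<bar> powr p) * ennreal (gag_kernel \<theta> p (x - y)) \<partial>lebesgue_on \<Omega> \<partial>lebesgue_on \<Omega>)
       = (\<integral>\<^sup>+y. \<integral>\<^sup>+x. ennreal (\<bar>f y\<bar> powr p) * ennreal (gag_kernel \<theta> p (x - y)) \<partial>lebesgue_on \<Omega> \<partial>lebesgue_on \<Omega>)"
      by (rule MM.Fubini'[symmetric, OF m2])
    also have "\<dots> \<le> (\<integral>\<^sup>+y. ennreal (\<bar>f y\<bar> powr p) * kap \<partial>lebesgue_on \<Omega>)"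
    proof (rule nn_integral_mono)
      fix y
      have "(\<integral>\<^sup>+x. ennreal (\<bar>f y\<bar> powr p) * ennreal (gag_kernel \<theta> p (x - y)) \<partial>lebesgue_on \<Omega>)
         = ennreal (\<bar>f y\<bar> powr p) * (\<integral>\<^sup>+x. ennreal (gag_kernel \<theta> p (x - y)) \<partial>lebesgue_on \<Omega>)"
        by (rule nn_integral_cmult) measurable
      also have "\<dots> \<le> ennreal (\<bar>f y\<bar> powr p) * kap"
        unfolding kap_def by (intro mult_left_mono gag_kernel_slice_le[OF \<Omega>]) simp
      finally show "(\<integral>\<^sup>+x. ennreal (\<bar>f y\<bar> powr p) * ennreal (gag_kernel \<theta> p (x - y)) \<partial>lebesgue_on \<Omega>)
         \<le> ennreal (\<bar>f y\<bar> powr p) * kap" .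
    qed
    also have "\<dots> = Ip p \<Omega> f * kap"
      unfolding Ip_def by (rule nn_integral_multc) measurable
    finally have second: "(\<integral>\<^sup>+x. \<integral>\<^sup>+y. ennreal (\<bar>f y\<bar> powr p) * ennreal (gag_kernel \<theta> p (x - y)) \<partial>lebesgue_on \<Omega> \<partial>lebesgue_on \<Omega>)
       \<le> Ip p \<Omega> f * kap" .
    have "Gag \<theta> p \<Omega> (\<lambda>x. f x * P x) \<le> (\<integral>\<^sup>+x. \<integral>\<^sup>+y. ennreal ?c * (?e f x y
        + ennreal (\<bar>f y\<bar> powr p) * ennreal (gag_kernel \<theta> p (x - y))) \<partial>lebesgue_on \<Omega> \<partial>lebesgue_on \<Omega>)"
      unfolding Gag_def by (intro nn_integral_mono pt) (auto simp: sp)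
    also have "\<dots> = ennreal ?c * (Gag \<theta> p \<Omega> f
        + (\<integral>\<^sup>+x. \<integral>\<^sup>+y. ennreal (\<bar>f y\<bar> powr p) * ennreal (gag_kernel \<theta> p (x - y)) \<partial>lebesgue_on \<Omega> \<partial>lebesgue_on \<Omega>))"
      unfolding Gag_def
      using Gag_slice_measurable[OF f] Gag_inner_measurable[OF \<Omega> f, of p ?a] m1 m3
      by (simp add: nn_integral_cmult nn_integral_add del: ennreal_plus)
    also have "\<dots> \<le> ennreal ?c * (Gag \<theta> p \<Omega> f + Ip p \<Omega> f * kap)"
      by (intro mult_left_mono add_left_mono second) simp
    also have "\<dots> \<le> ennreal ?c * (ennreal (1 + kr) * (Gag \<theta> p \<Omega> f + Ip p \<Omega> f))"
    proof (intro mult_left_mono)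
      have "Gag \<theta> p \<Omega> f + Ip p \<Omega> f * kap \<le> ennreal (1 + kr) * Gag \<theta> p \<Omega> f + ennreal (1 + kr) * Ip p \<Omega> f"
      proof (rule add_mono)
        show "Gag \<theta> p \<Omega> f \<le> ennreal (1 + kr) * Gag \<theta> p \<Omega> f"
          using mult_right_mono[of 1 "ennreal (1 + kr)" "Gag \<theta> p \<Omega> f"] kr(1) by simp
        show "Ip p \<Omega> f * kap \<le> ennreal (1 + kr) * Ip p \<Omega> f"
          unfolding kr(2) mult.commute[of "Ip p \<Omega> f"] using kr(1) by (intro mult_right_mono ennreal_leI) auto
      qed
      then show "Gag \<theta> p \<Omega> f + Ip p \<Omega> f * kap \<le> ennreal (1 + kr) * (Gag \<theta> p \<Omega> f + Ip p \<Omega> f)"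
        by (simp add: distrib_left)
    qed simp
    also have "\<dots> = ennreal (?c * (1 + kr)) * (Gag \<theta> p \<Omega> f + Ip p \<Omega> f)"
      using kr(1) by (simp add: ennreal_mult mult.assoc)
    finally show "Gag \<theta> p \<Omega> (\<lambda>x. f x * P x) \<le> ennreal (?c * (1 + kr)) * (Gag \<theta> p \<Omega> f + Ip p \<Omega> f)" .
  qed
qed

lemma Ip_mult_le:
  fixes P :: "real^'n::finite \<Rightarrow> real"
  assumes "0 < p" "\<And>x. x \<in> \<Omega> \<Longrightarrow> \<bar>P x\<bar> \<le> M" and [measurable]: "f \<in> borel_measurable (lebesgue_on \<Omega>)"
  shows "Ip p \<Omega> (\<lambda>x. f x * P x) \<le> ennreal (M powr p) * Ip p \<Omega> f"
proof -
  have "Ip p \<Omega> (\<lambda>x. f x * P x) \<le> (\<integral>\<^sup>+x. ennreal (M powr p) * ennreal (\<bar>f x\<bar> powr p) \<partial>lebesgue_on \<Omega>)"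
    unfolding Ip_def
  proof (rule nn_integral_mono)
    fix x assume "x \<in> space (lebesgue_on \<Omega>)"
    then have "\<bar>P x\<bar> powr p \<le> M powr p"
      using assms by (intro powr_mono2) (auto simp: space_restrict_space)
    then have "\<bar>f x * P x\<bar> powr p \<le> M powr p * \<bar>f x\<bar> powr p"
      by (simp add: abs_mult powr_mult mult.commute mult_right_mono)
    then show "ennreal (\<bar>f x * P x\<bar> powr p) \<le> ennreal (M powr p) * ennreal (\<bar>f x\<bar> powr p)"
      by (simp add: ennreal_leI flip: ennreal_mult)
  qed
  also have "\<dots> = ennreal (M powr p) * Ip p \<Omega> f"
    unfolding Ip_def by (rule nn_integral_cmult) measurable
  finally show ?thesis .
qed

context lipschitz_diffeo
begin

lemma Ip_comp_le:
  assumes [measurable]: "f \<in> borel_measurable (lebesgue_on V)"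
  shows "Ip p U (\<lambda>x. f (T x)) \<le> J * Ip p V f"
  unfolding Ip_def by (rule nn_integral_comp_le) measurable

text \<open>Since \<open>|T x - T y| \<le> L |x - y|\<close>, the singular factor at \<open>(x, y)\<close> is at most a multiple of the one at \<open>(T x, T y)\<close>;
  then the variables are changed one after the other.\<close>

lemma Gag_comp_le:
  assumes "0 < p" "0 < \<theta>" and f: "f \<in> borel_measurable (lebesgue_on V)"
  shows "Gag \<theta> p U (\<lambda>x. f (T x)) \<le> ennreal (L powr (real CARD('n) + \<theta> * p)) * (J * (J * Gag \<theta> p V f))"
proof -
  note [measurable] = f id_measurable_lebesgue_on
  let ?a = "real CARD('n) + \<theta> * p"
  let ?e = "\<lambda>x y. ennreal (\<bar>f x - f y\<bar> powr p / norm (x - y) powr ?a)"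
  have V: "V \<in> sets lebesgue"
    using open_V by simp
  have a: "?a > 0"
    using assms by (simp add: add_pos_pos)
  have pt: "ennreal (\<bar>f (T x) - f (T y)\<bar> powr p / norm (x - y) powr ?a) \<le> ennreal (L powr ?a) * ?e (T x) (T y)"
    if "x \<in> U" "y \<in> U" for x y
  proof (cases "x = y")
    case False
    then have "T x \<noteq> T y"
      using that S_T by metis
    have "norm (T x - T y) powr ?a \<le> (L * norm (x - y)) powr ?a"
      using T_lipschitz[OF that] a by (intro powr_mono2) auto
    also have "\<dots> = L powr ?a * norm (x - y) powr ?a"
      using L_pos by (simp add: powr_mult)
    finally have "1 / norm (x - y) powr ?a \<le> L powr ?a / norm (T x - T y) powr ?a"
      using False \<open>T x \<noteq> T y\<close> by (simp add: field_simps)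
    then have "\<bar>f (T x) - f (T y)\<bar> powr p * (1 / norm (x - y) powr ?a)
        \<le> \<bar>f (T x) - f (T y)\<bar> powr p * (L powr ?a / norm (T x - T y) powr ?a)"
      by (rule mult_left_mono) simp
    then show ?thesis
      by (simp add: ennreal_leI mult_ac flip: ennreal_mult)
  qed simp
  have m1: "(\<lambda>y. ennreal (L powr ?a) * ?e x y) \<in> borel_measurable (lebesgue_on V)" for x
    by measurable
  have m2: "(\<lambda>x. J * (ennreal (L powr ?a) * (\<integral>\<^sup>+y. ?e x y \<partial>lebesgue_on V))) \<in> borel_measurable (lebesgue_on V)"
    using Gag_inner_measurable[OF V f, of p ?a] by measurable
  have "Gag \<theta> p U (\<lambda>x. f (T x)) \<le> (\<integral>\<^sup>+x. \<integral>\<^sup>+y. ennreal (L powr ?a) * ?e (T x) (T y) \<partial>lebesgue_on U \<partial>lebesgue_on U)"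
    unfolding Gag_def by (intro nn_integral_mono pt) (auto simp: space_restrict_space)
  also have "\<dots> \<le> (\<integral>\<^sup>+x. J * (ennreal (L powr ?a) * (\<integral>\<^sup>+y. ?e (T x) y \<partial>lebesgue_on V)) \<partial>lebesgue_on U)"
  proof (rule nn_integral_mono)
    fix x
    have "(\<integral>\<^sup>+y. ennreal (L powr ?a) * ?e (T x) (T y) \<partial>lebesgue_on U)
       \<le> J * (\<integral>\<^sup>+y. ennreal (L powr ?a) * ?e (T x) y \<partial>lebesgue_on V)"
      by (rule nn_integral_comp_le[OF m1])
    also have "(\<integral>\<^sup>+y. ennreal (L powr ?a) * ?e (T x) y \<partial>lebesgue_on V) = ennreal (L powr ?a) * (\<integral>\<^sup>+y. ?e (T x) y \<partial>lebesgue_on V)"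
      by (rule nn_integral_cmult) measurable
    finally show "(\<integral>\<^sup>+y. ennreal (L powr ?a) * ?e (T x) (T y) \<partial>lebesgue_on U)
       \<le> J * (ennreal (L powr ?a) * (\<integral>\<^sup>+y. ?e (T x) y \<partial>lebesgue_on V))" .
  qed
  also have "\<dots> \<le> J * (\<integral>\<^sup>+x. J * (ennreal (L powr ?a) * (\<integral>\<^sup>+y. ?e x y \<partial>lebesgue_on V)) \<partial>lebesgue_on V)"
    by (rule nn_integral_comp_le[OF m2])
  also have "\<dots> = J * (J * (ennreal (L powr ?a) * Gag \<theta> p V f))"
    unfolding Gag_def using Gag_inner_measurable[OF V f, of p ?a] by (simp add: nn_integral_cmult)
  finally show ?thesis
    by (simp add: mult_ac)
qed

end

subsection \<open>Translations of weakly differentiable functions\<close>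

text \<open>Jensen's inequality on the unit interval, from the tangent to the graph of the \<open>p\<close>-th power at \<open>m\<close>.\<close>

lemma powr_above_tangent:
  fixes m h p :: real
  assumes "1 \<le> p" "0 < m" "0 \<le> h"
  shows "p * m powr (p - 1) * h \<le> h powr p + (p - 1) * m powr p"
proof (cases "h = 0")
  case False
  have "((\<lambda>x. x powr p) has_field_derivative p * m powr (p - 1)) (at m within {0<..})"
    using assms by (auto intro!: derivative_eq_intros)
  then have "p * m powr (p - 1) * (h - m) \<le> h powr p - m powr p"
    using assms False
    by (intro convex_on_imp_above_tangent[OF powr_convex[OF \<open>1 \<le> p\<close>]])
      (auto simp: interior_open)
  moreover have "p * m powr (p - 1) * (h - m) = p * m powr (p - 1) * h - p * (m powr (p - 1) * m)"
    by (simp add: algebra_simps)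
  moreover have "m powr (p - 1) * m = m powr p"
    using assms by (simp add: powr_diff)
  ultimately have "p * m powr (p - 1) * h - p * m powr p \<le> h powr p - m powr p"
    by metis
  then show ?thesis
    by (simp add: left_diff_distrib)
qed (use assms in simp)

lemma powr_le_nn_integral:
  fixes h :: "real \<Rightarrow> real"
  assumes "1 \<le> p" "0 \<le> m" "\<And>t. 0 \<le> h t" and [measurable]: "h \<in> borel_measurable borel"
    and le: "ennreal m \<le> (\<integral>\<^sup>+t. ennreal (h t) * indicator {0..1} t \<partial>lborel)"
  shows "ennreal (m powr p) \<le> (\<integral>\<^sup>+t. ennreal (h t powr p) * indicator {0..1} t \<partial>lborel)"
proof (cases "m = 0")
  case False
  then have "m > 0"
    using assms by simp
  let ?c = "p * m powr (p - 1)" and ?d = "(p - 1) * m powr p"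
  have c: "?c \<ge> 0" "?d \<ge> 0" "?c * m = ?d + m powr p"
    using assms \<open>m > 0\<close> by (auto simp: powr_diff algebra_simps)
  have "ennreal ?d + ennreal (m powr p) = ennreal ?c * ennreal m"
    using c assms by (simp flip: ennreal_mult ennreal_plus)
  also have "\<dots> \<le> ennreal ?c * (\<integral>\<^sup>+t. ennreal (h t) * indicator {0..1} t \<partial>lborel)"
    by (rule mult_left_mono[OF le]) simp
  also have "\<dots> = (\<integral>\<^sup>+t. ennreal ?c * (ennreal (h t) * indicator {0..1} t) \<partial>lborel)"
    by (simp add: nn_integral_cmult)
  also have "\<dots> \<le> (\<integral>\<^sup>+t. ennreal (h t powr p) * indicator {0..1} t + ennreal ?d * indicator {0..1} t \<partial>lborel)"
  proof (rule nn_integral_mono)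
    fix t
    have "ennreal ?c * ennreal (h t) \<le> ennreal (h t powr p) + ennreal ?d"
      using powr_above_tangent[OF assms(1) \<open>m > 0\<close> assms(3)[of t]] c assms(3)
      by (simp add: ennreal_leI flip: ennreal_mult ennreal_plus)
    then show "ennreal ?c * (ennreal (h t) * indicator {0..1} t)
        \<le> ennreal (h t powr p) * indicator {0..1} t + ennreal ?d * indicator {0..1} t"
      by (simp add: indicator_def)
  qed
  also have "\<dots> = (\<integral>\<^sup>+t. ennreal (h t powr p) * indicator {0..1} t \<partial>lborel) + ennreal ?d"
    by (simp add: nn_integral_add nn_integral_cmult)
  finally show ?thesis
    by (simp add: add.commute[of "ennreal ?d"])
qed simp

lemma nn_integral_shift_indicator_le:
  fixes q :: "'a::euclidean_space \<Rightarrow> ennreal"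
  assumes [measurable]: "q \<in> borel_measurable borel" "E \<in> sets borel" "K \<in> sets borel"
    and sub: "\<And>x. x \<in> E \<Longrightarrow> x + v \<in> K"
  shows "(\<integral>\<^sup>+x. q (x + v) * indicator E x \<partial>lborel) \<le> (\<integral>\<^sup>+y. q y * indicator K y \<partial>lborel)"
proof -
  have "(\<integral>\<^sup>+x. q (x + v) * indicator E x \<partial>lborel) \<le> (\<integral>\<^sup>+x. q (x + v) * indicator K (x + v) \<partial>lborel)"
    using sub by (intro nn_integral_mono) (auto simp: indicator_def)
  also have "\<dots> = (\<integral>\<^sup>+y. q y * indicator K y \<partial>lborel)"
    by (rule nn_integral_lborel_shift[of "\<lambda>y. q y * indicator K y"]) measurable
  finally show ?thesis .
qed

lemma C1_increment_le:
  fixes f :: "real^'n::finite \<Rightarrow> real"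
  assumes "\<And>x. f differentiable (at x)" "\<And>i. continuous_on UNIV (partial_deriv i f)"
  shows "ennreal \<bar>f (x + w) - f x\<bar>
     \<le> (\<integral>\<^sup>+t. ennreal (\<Sum>i\<in>UNIV. \<bar>w $ i\<bar> * \<bar>partial_deriv i f (x + t *\<^sub>R w)\<bar>) * indicator {0..1} t \<partial>lborel)"
proof -
  let ?d = "\<lambda>t. \<Sum>i\<in>UNIV. w $ i * partial_deriv i f (x + t *\<^sub>R w)"
  have der: "((\<lambda>t. f (x + t *\<^sub>R w)) has_vector_derivative ?d t) (at t within {0..1})" for t
  proof -
    have "((\<lambda>t. f (x + t *\<^sub>R w)) has_derivative (\<lambda>s. \<Sum>i\<in>UNIV. (s *\<^sub>R w) $ i * partial_deriv i f (x + t *\<^sub>R w))) (at t)"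
      by (rule has_derivative_compose[OF _ has_derivative_partial_deriv[OF assms(1)], of "\<lambda>t. x + t *\<^sub>R w"])
        (auto intro!: derivative_eq_intros)
    then have "((\<lambda>t. f (x + t *\<^sub>R w)) has_vector_derivative ?d t) (at t)"
      by (simp add: has_vector_derivative_def sum_distrib_left mult_ac)
    then show ?thesis
      by (rule has_vector_derivative_at_within)
  qed
  have cont: "continuous_on UNIV ?d"
    by (intro continuous_intros continuous_on_compose2[OF assms(2)]) auto
  have int: "integrable lborel (\<lambda>t. indicator {0..1} t *\<^sub>R ?d t)"
    by (rule borel_integrable_compact) (auto intro: continuous_on_subset[OF cont])
  have "(\<integral>t. indicator {0..1} t *\<^sub>R ?d t \<partial>lborel) = f (x + 1 *\<^sub>R w) - f (x + 0 *\<^sub>R w)"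
    using der continuous_on_subset[OF cont] by (intro integral_FTC_atLeastAtMost) auto
  then have "ennreal \<bar>f (x + w) - f x\<bar> = ennreal (norm (\<integral>t. indicator {0..1} t *\<^sub>R ?d t \<partial>lborel))"
    by simp
  also have "\<dots> \<le> (\<integral>\<^sup>+t. ennreal (norm (indicator {0..1} t *\<^sub>R ?d t)) \<partial>lborel)"
    by (rule integral_norm_bound_ennreal[OF int])
  also have "\<dots> \<le> (\<integral>\<^sup>+t. ennreal (\<Sum>i\<in>UNIV. \<bar>w $ i\<bar> * \<bar>partial_deriv i f (x + t *\<^sub>R w)\<bar>) * indicator {0..1} t \<partial>lborel)"
  proof (rule nn_integral_mono)
    fix t
    have "\<bar>?d t\<bar> \<le> (\<Sum>i\<in>UNIV. \<bar>w $ i\<bar> * \<bar>partial_deriv i f (x + t *\<^sub>R w)\<bar>)"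
      unfolding abs_mult[symmetric] by (rule sum_abs)
    then show "ennreal (norm (indicator {0..1} t *\<^sub>R ?d t))
       \<le> ennreal (\<Sum>i\<in>UNIV. \<bar>w $ i\<bar> * \<bar>partial_deriv i f (x + t *\<^sub>R w)\<bar>) * indicator {0..1} t"
      by (auto simp: indicator_def intro: ennreal_leI)
  qed
  finally show ?thesis .
qed


text \<open>For each \<open>t\<close> the inner substitution is a translation, and the interval of the \<open>t\<close> has length one.\<close>

lemma tube_integral_le:
  fixes Q :: "'a::euclidean_space \<Rightarrow> ennreal"
  assumes [measurable]: "Q \<in> borel_measurable borel" "E \<in> sets borel" "K \<in> sets borel"
    and sub: "\<And>x t. x \<in> E \<Longrightarrow> 0 \<le> t \<Longrightarrow> t \<le> 1 \<Longrightarrow> x + t *\<^sub>R w \<in> K"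
  shows "(\<integral>\<^sup>+x. (\<integral>\<^sup>+t. Q (x + t *\<^sub>R w) * indicator {0..1} t \<partial>lborel) * indicator E x \<partial>lborel)
     \<le> (\<integral>\<^sup>+y. Q y * indicator K y \<partial>lborel)"
proof -
  have "(\<integral>\<^sup>+x. (\<integral>\<^sup>+t. Q (x + t *\<^sub>R w) * indicator {0..1} t \<partial>lborel) * indicator E x \<partial>lborel)
     = (\<integral>\<^sup>+x. \<integral>\<^sup>+t. Q (x + t *\<^sub>R w) * indicator {0..1 :: real} t * indicator E x \<partial>lborel \<partial>lborel)"
    by (intro nn_integral_cong nn_integral_multc[symmetric]) measurable
  also have "\<dots> = (\<integral>\<^sup>+t. \<integral>\<^sup>+x. Q (x + t *\<^sub>R w) * indicator {0..1 :: real} t * indicator E x \<partial>lborel \<partial>lborel)"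
    by (rule lborel_pair.Fubini'[symmetric]) measurable
  also have "\<dots> \<le> (\<integral>\<^sup>+t. (\<integral>\<^sup>+y. Q y * indicator K y \<partial>lborel) * indicator {0..1 :: real} t \<partial>lborel)"
  proof (rule nn_integral_mono)
    fix t :: real
    show "(\<integral>\<^sup>+x. Q (x + t *\<^sub>R w) * indicator {0..1} t * indicator E x \<partial>lborel)
       \<le> (\<integral>\<^sup>+y. Q y * indicator K y \<partial>lborel) * indicator {0..1} t"
    proof (cases "t \<in> {0..1}")
      case True
      have "(\<integral>\<^sup>+x. Q (x + t *\<^sub>R w) * indicator E x \<partial>lborel) \<le> (\<integral>\<^sup>+y. Q y * indicator K y \<partial>lborel)"
        using sub True by (intro nn_integral_shift_indicator_le) auto
      with True show ?thesis
        by simp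
    qed simp
  qed
  also have "\<dots> = (\<integral>\<^sup>+y. Q y * indicator K y \<partial>lborel)"
    by (simp add: nn_integral_cmult)
  finally show ?thesis .
qed

lemma sum_powr_le:
  fixes a :: "'n::finite \<Rightarrow> real"
  assumes "0 < p" "\<And>i. 0 \<le> a i"
  shows "(\<Sum>i\<in>UNIV. a i) powr p \<le> real CARD('n) powr p * (\<Sum>i\<in>UNIV. a i powr p)"
proof -
  define m where "m = Max (range a)"
  have m: "a i \<le> m" for i
    by (simp add: m_def)
  have "m \<in> range a"
    unfolding m_def by (rule Max_in) auto
  then obtain j where j: "m = a j"
    by blast
  have "(\<Sum>i\<in>UNIV. a i) powr p \<le> (real CARD('n) * m) powr p"
    using assms sum_bounded_above[of UNIV a m] m by (intro powr_mono2) (auto intro: sum_nonneg)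
  also have "\<dots> = real CARD('n) powr p * a j powr p"
    by (simp add: powr_mult j)
  also have "\<dots> \<le> real CARD('n) powr p * (\<Sum>i\<in>UNIV. a i powr p)"
    by (intro mult_left_mono member_le_sum) auto
  finally show ?thesis .
qed

lemma nn_integral_indicator_le_lebesgue_on:
  assumes "K \<subseteq> V" "V \<in> sets lebesgue"
  shows "(\<integral>\<^sup>+y. q y * indicator K y \<partial>lborel) \<le> (\<integral>\<^sup>+y. q y \<partial>lebesgue_on V)"
proof -
  have "(\<integral>\<^sup>+y. q y * indicator K y \<partial>lborel) = (\<integral>\<^sup>+y. q y * indicator K y \<partial>lebesgue)"
    by (simp add: nn_integral_completion)
  also have "\<dots> \<le> (\<integral>\<^sup>+y. q y * indicator V y \<partial>lebesgue)"
    using assms by (intro nn_integral_mono) (auto simp: indicator_def)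
  finally show ?thesis
    using assms by (simp add: nn_integral_lebesgue_on_eq)
qed

lemma nn_integral_lebesgue_on_borel_eq:
  assumes "V \<in> sets lebesgue"
  shows "(\<integral>\<^sup>+y. q y \<partial>lebesgue_on V) = (\<integral>\<^sup>+y. q y * indicator V y \<partial>lborel)"
  using assms by (simp add: nn_integral_lebesgue_on_eq nn_integral_completion)

text \<open>The fundamental theorem of calculus along a fixed translation vector, by approximation
  with \<open>C\<^sup>1\<close> functions in a neighbourhood of the tube swept by the translation.\<close>

lemma weak_increment_le:
  fixes u :: "real^'n::finite \<Rightarrow> real"
  assumes "open V" and weak: "\<And>i. has_weak_deriv V (mi_unit i) u (g i)"
    and [measurable]: "u \<in> borel_measurable borel" "\<And>i. g i \<in> borel_measurable borel"
    and "compact E" and seg: "\<And>x t. x \<in> E \<Longrightarrow> 0 \<le> t \<Longrightarrow> t \<le> 1 \<Longrightarrow> x + t *\<^sub>R w \<in> V"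
  shows "AE x in lborel. x \<in> E \<longrightarrow> ennreal \<bar>u (x + w) - u x\<bar>
    \<le> (\<integral>\<^sup>+t. ennreal (\<Sum>i\<in>UNIV. \<bar>w $ i\<bar> * \<bar>g i (x + t *\<^sub>R w)\<bar>) * indicator {0..1} t \<partial>lborel)"
proof -
  let ?K = "(\<lambda>(x, t). x + t *\<^sub>R w) ` (E \<times> {0..1})"
  have K: "compact ?K" "?K \<subseteq> V"
    using \<open>compact E\<close> seg
    by (auto intro!: compact_continuous_image compact_Times continuous_intros simp: case_prod_beta)
  have Kin: "x + t *\<^sub>R w \<in> ?K" if "x \<in> E" "0 \<le> t" "t \<le> 1" for x t
    using that by force
  have [measurable]: "E \<in> sets borel" "?K \<in> sets borel"
    using \<open>compact E\<close> K by (auto intro: borel_compact)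
  define \<Lambda> where "\<Lambda> x = ennreal \<bar>u (x + w) - u x\<bar>" for x
  define M where "M x = (\<integral>\<^sup>+t. ennreal (\<Sum>i\<in>UNIV. \<bar>w $ i\<bar> * \<bar>g i (x + t *\<^sub>R w)\<bar>) * indicator {0..1} t \<partial>lborel)" for x
  have [measurable]: "\<Lambda> \<in> borel_measurable borel" "M \<in> borel_measurable borel"
    unfolding \<Lambda>_def[abs_def] M_def[abs_def] by measurable
  let ?c = "2 + (\<Sum>i\<in>UNIV. \<bar>w $ i\<bar>)"
  have c0: "?c > 0"
    by (simp add: add_pos_nonneg sum_nonneg)
  have bound: "(\<integral>\<^sup>+x. (\<Lambda> x - M x) * indicator E x \<partial>lborel) \<le> 0 + ennreal e'" if "e' > 0" for e'
  proof -
    define e where "e = e' / ?c"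
    have e: "e > 0"
      using that c0 by (simp add: e_def)
    obtain f where f: "\<And>x. f differentiable (at x)" "\<And>j. continuous_on UNIV (partial_deriv j f)"
      "(\<integral>\<^sup>+x. ennreal \<bar>u x - f x\<bar> \<partial>lebesgue_on ?K) \<le> ennreal e"
      "\<And>j. (\<integral>\<^sup>+x. ennreal \<bar>g j x - partial_deriv j f x\<bar> \<partial>lebesgue_on ?K) \<le> ennreal e"
      by (rule approximate_by_C1[OF \<open>open V\<close> weak K e]) blast
    have contf: "continuous_on UNIV f"
      using f(1) by (intro differentiable_imp_continuous_on) (auto simp: differentiable_on_def differentiable_at_withinI)
    have [measurable]: "f \<in> borel_measurable borel" "\<And>i. partial_deriv i f \<in> borel_measurable borel"
      using contf f(2) by (auto intro: borel_measurable_continuous_onI)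
    define q0 where "q0 y = ennreal \<bar>u y - f y\<bar>" for y
    define Q where "Q y = (\<Sum>i\<in>UNIV. ennreal \<bar>w $ i\<bar> * ennreal \<bar>g i y - partial_deriv i f y\<bar>)" for y
    have [measurable]: "q0 \<in> borel_measurable borel" "Q \<in> borel_measurable borel"
      unfolding q0_def[abs_def] Q_def[abs_def] by measurable
    have q0: "(\<integral>\<^sup>+y. q0 y * indicator ?K y \<partial>lborel) \<le> ennreal e"
      using f(3) compact_sets_lebesgue[OF K(1)] by (simp add: nn_integral_lebesgue_on_borel_eq q0_def)
    have Q: "(\<integral>\<^sup>+y. Q y * indicator ?K y \<partial>lborel) \<le> ennreal ((\<Sum>i\<in>UNIV. \<bar>w $ i\<bar>) * e)"
    proof -
      have "(\<integral>\<^sup>+y. Q y * indicator ?K y \<partial>lborel)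
        = (\<integral>\<^sup>+y. (\<Sum>i\<in>UNIV. ennreal \<bar>w $ i\<bar> * (ennreal \<bar>g i y - partial_deriv i f y\<bar> * indicator ?K y)) \<partial>lborel)"
        by (simp add: Q_def sum_distrib_right mult.assoc)
      also have "\<dots> = (\<Sum>i\<in>UNIV. ennreal \<bar>w $ i\<bar> * (\<integral>\<^sup>+y. ennreal \<bar>g i y - partial_deriv i f y\<bar> * indicator ?K y \<partial>lborel))"
        by (subst nn_integral_sum) (auto simp: nn_integral_cmult)
      also have "\<dots> \<le> (\<Sum>i\<in>UNIV. ennreal \<bar>w $ i\<bar> * ennreal e)"
        using f(4) compact_sets_lebesgue[OF K(1)]
        by (intro sum_mono mult_left_mono) (auto simp: nn_integral_lebesgue_on_borel_eq)
      also have "\<dots> = ennreal ((\<Sum>i\<in>UNIV. \<bar>w $ i\<bar>) * e)"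
        using e by (simp add: sum_distrib_right flip: ennreal_mult)
      finally show ?thesis .
    qed
    let ?R = "\<lambda>x. q0 (x + w) + q0 x + (\<integral>\<^sup>+t. Q (x + t *\<^sub>R w) * indicator {0..1} t \<partial>lborel)"
    have pt: "\<Lambda> x - M x \<le> ?R x" for x
    proof -
      have "\<bar>u (x + w) - u x\<bar> \<le> \<bar>u (x + w) - f (x + w)\<bar> + \<bar>u x - f x\<bar> + \<bar>f (x + w) - f x\<bar>"
        by linarith
      then have "\<Lambda> x \<le> q0 (x + w) + q0 x + ennreal \<bar>f (x + w) - f x\<bar>"
        by (simp add: \<Lambda>_def q0_def ennreal_leI flip: ennreal_plus)
      also have "ennreal \<bar>f (x + w) - f x\<bar>
          \<le> (\<integral>\<^sup>+t. ennreal (\<Sum>i\<in>UNIV. \<bar>w $ i\<bar> * \<bar>partial_deriv i f (x + t *\<^sub>R w)\<bar>) * indicator {0..1} t \<partial>lborel)"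
        by (rule C1_increment_le[OF f(1,2)])
      also have "\<dots> \<le> (\<integral>\<^sup>+t. ennreal (\<Sum>i\<in>UNIV. \<bar>w $ i\<bar> * \<bar>g i (x + t *\<^sub>R w)\<bar>) * indicator {0..1} t
          + Q (x + t *\<^sub>R w) * indicator {0..1} t \<partial>lborel)"
      proof (rule nn_integral_mono)
        fix t
        let ?y = "x + t *\<^sub>R w"
        have "(\<Sum>i\<in>UNIV. \<bar>w $ i\<bar> * \<bar>partial_deriv i f ?y\<bar>)
           \<le> (\<Sum>i\<in>UNIV. \<bar>w $ i\<bar> * \<bar>g i ?y\<bar> + \<bar>w $ i\<bar> * \<bar>g i ?y - partial_deriv i f ?y\<bar>)"
          by (intro sum_mono) (auto simp flip: distrib_left intro!: mult_left_mono)
        then have "ennreal (\<Sum>i\<in>UNIV. \<bar>w $ i\<bar> * \<bar>partial_deriv i f ?y\<bar>)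
           \<le> ennreal ((\<Sum>i\<in>UNIV. \<bar>w $ i\<bar> * \<bar>g i ?y\<bar>) + (\<Sum>i\<in>UNIV. \<bar>w $ i\<bar> * \<bar>g i ?y - partial_deriv i f ?y\<bar>))"
          by (simp add: ennreal_leI sum.distrib)
        also have "\<dots> = ennreal (\<Sum>i\<in>UNIV. \<bar>w $ i\<bar> * \<bar>g i ?y\<bar>) + Q ?y"
          by (simp add: Q_def sum_nonneg ennreal_plus flip: ennreal_mult sum_ennreal)
        finally show "ennreal (\<Sum>i\<in>UNIV. \<bar>w $ i\<bar> * \<bar>partial_deriv i f ?y\<bar>) * indicator {0..1} t
           \<le> ennreal (\<Sum>i\<in>UNIV. \<bar>w $ i\<bar> * \<bar>g i ?y\<bar>) * indicator {0..1} t + Q ?y * indicator {0..1} t"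
          by (auto simp: indicator_def)
      qed
      also have "\<dots> = M x + (\<integral>\<^sup>+t. Q (x + t *\<^sub>R w) * indicator {0..1} t \<partial>lborel)"
        unfolding M_def by (rule nn_integral_add) measurable
      finally have "\<Lambda> x \<le> M x + ?R x"
        by (simp add: ac_simps add_left_mono)
      then show ?thesis
        by (simp add: ennreal_minus_le_iff \<Lambda>_def)
    qed
    have "(\<integral>\<^sup>+x. (\<Lambda> x - M x) * indicator E x \<partial>lborel) \<le> (\<integral>\<^sup>+x. ?R x * indicator E x \<partial>lborel)"
      by (intro nn_integral_mono mult_right_mono pt) simp
    also have "\<dots> = (\<integral>\<^sup>+x. q0 (x + w) * indicator E x \<partial>lborel) + (\<integral>\<^sup>+x. q0 (x + 0) * indicator E x \<partial>lborel)
       + (\<integral>\<^sup>+x. (\<integral>\<^sup>+t. Q (x + t *\<^sub>R w) * indicator {0..1} t \<partial>lborel) * indicator E x \<partial>lborel)"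
      by (simp add: distrib_right nn_integral_add)
    also have "\<dots> \<le> ennreal e + ennreal e + ennreal ((\<Sum>i\<in>UNIV. \<bar>w $ i\<bar>) * e)"
    proof (intro add_mono)
      show "(\<integral>\<^sup>+x. q0 (x + w) * indicator E x \<partial>lborel) \<le> ennreal e"
        using Kin[where t = 1] by (intro order_trans[OF nn_integral_shift_indicator_le q0]) auto
      show "(\<integral>\<^sup>+x. q0 (x + 0) * indicator E x \<partial>lborel) \<le> ennreal e"
        using Kin[where t = 0] by (intro order_trans[OF nn_integral_shift_indicator_le q0]) auto
      show "(\<integral>\<^sup>+x. (\<integral>\<^sup>+t. Q (x + t *\<^sub>R w) * indicator {0..1} t \<partial>lborel) * indicator E x \<partial>lborel)
          \<le> ennreal ((\<Sum>i\<in>UNIV. \<bar>w $ i\<bar>) * e)"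
        using Kin by (intro order_trans[OF tube_integral_le Q]) auto
    qed
    also have "\<dots> = ennreal (e + e + (\<Sum>i\<in>UNIV. \<bar>w $ i\<bar>) * e)"
      using e sum_nonneg[of UNIV "\<lambda>i. \<bar>w $ i\<bar>"] by (simp flip: ennreal_plus del: sum_ennreal)
    also have "e + e + (\<Sum>i\<in>UNIV. \<bar>w $ i\<bar>) * e = ?c * e"
      by (simp add: algebra_simps)
    also have "?c * e = e'"
      using c0 by (simp add: e_def)
    finally show ?thesis
      by simp
  qed
  have "(\<integral>\<^sup>+x. (\<Lambda> x - M x) * indicator E x \<partial>lborel) \<le> 0"
    by (rule ennreal_le_epsilon) (rule bound)
  then have "AE x in lborel. (\<Lambda> x - M x) * indicator E x = 0"
    by (subst nn_integral_0_iff_AE[symmetric]) auto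
  then have "AE x in lborel. x \<in> E \<longrightarrow> \<Lambda> x \<le> M x"
  proof (rule eventually_mono, intro impI)
    fix x assume "(\<Lambda> x - M x) * indicator E x = 0" "x \<in> E"
    then have "\<Lambda> x - M x = 0"
      by simp
    then show "\<Lambda> x \<le> M x"
      by (simp add: diff_eq_0_iff_ennreal \<Lambda>_def)
  qed
  then show ?thesis
    by (simp add: \<Lambda>_def M_def)
qed

text \<open>The increment is an average of derivatives along a segment. Jensen's inequality moves the power under
  this average, and the integral over the tube is at most the integral over \<open>V\<close>.\<close>

lemma translation_estimate_compact:
  fixes u :: "real^'n::finite \<Rightarrow> real"
  assumes "open V" and weak: "\<And>i. has_weak_deriv V (mi_unit i) u (g i)"
    and [measurable]: "u \<in> borel_measurable borel" "\<And>i. g i \<in> borel_measurable borel"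
    and "compact E" and seg: "\<And>x t. x \<in> E \<Longrightarrow> 0 \<le> t \<Longrightarrow> t \<le> 1 \<Longrightarrow> x + t *\<^sub>R w \<in> V" and p: "1 \<le> p"
  shows "(\<integral>\<^sup>+x. ennreal (\<bar>u (x + w) - u x\<bar> powr p) * indicator E x \<partial>lborel)
    \<le> ennreal ((real CARD('n) * norm w) powr p) * (\<Sum>i\<in>UNIV. Ip p V (g i))"
proof -
  let ?K = "(\<lambda>(x, t). x + t *\<^sub>R w) ` (E \<times> {0..1})"
  have K: "compact ?K" "?K \<subseteq> V"
    using \<open>compact E\<close> seg
    by (auto intro!: compact_continuous_image compact_Times continuous_intros simp: case_prod_beta)
  have Kin: "x + t *\<^sub>R w \<in> ?K" if "x \<in> E" "0 \<le> t" "t \<le> 1" for x t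
    using that by force
  have [measurable]: "E \<in> sets borel" "?K \<in> sets borel"
    using \<open>compact E\<close> K by (auto intro: borel_compact)
  define H where "H y = (\<Sum>i\<in>UNIV. \<bar>w $ i\<bar> * \<bar>g i y\<bar>)" for y
  have [measurable]: "H \<in> borel_measurable borel"
    unfolding H_def[abs_def] by measurable
  have H0: "0 \<le> H y" for y
    by (simp add: H_def sum_nonneg)
  have pt: "ennreal (\<bar>u (x + w) - u x\<bar> powr p) \<le> (\<integral>\<^sup>+t. ennreal (H (x + t *\<^sub>R w) powr p) * indicator {0..1} t \<partial>lborel)"
    if "ennreal \<bar>u (x + w) - u x\<bar> \<le> (\<integral>\<^sup>+t. ennreal (H (x + t *\<^sub>R w)) * indicator {0..1} t \<partial>lborel)" for x
    using that p H0 by (intro powr_le_nn_integral) auto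
  have HP: "ennreal (H y powr p) \<le> ennreal ((real CARD('n) * norm w) powr p) * (\<Sum>i\<in>UNIV. ennreal (\<bar>g i y\<bar> powr p))" for y
  proof -
    have "H y \<le> (\<Sum>i\<in>UNIV. norm w * \<bar>g i y\<bar>)"
      unfolding H_def by (intro sum_mono mult_right_mono component_le_norm_cart) auto
    then have "H y powr p \<le> (norm w * (\<Sum>i\<in>UNIV. \<bar>g i y\<bar>)) powr p"
      using p H0 by (intro powr_mono2) (auto simp: sum_distrib_left)
    also have "\<dots> = norm w powr p * (\<Sum>i\<in>UNIV. \<bar>g i y\<bar>) powr p"
      by (simp add: powr_mult sum_nonneg)
    also have "\<dots> \<le> norm w powr p * (real CARD('n) powr p * (\<Sum>i\<in>UNIV. \<bar>g i y\<bar> powr p))"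
      using p by (intro mult_left_mono sum_powr_le) auto
    also have "\<dots> = (real CARD('n) * norm w) powr p * (\<Sum>i\<in>UNIV. \<bar>g i y\<bar> powr p)"
      by (simp add: powr_mult)
    finally have "ennreal (H y powr p) \<le> ennreal ((real CARD('n) * norm w) powr p * (\<Sum>i\<in>UNIV. \<bar>g i y\<bar> powr p))"
      by (rule ennreal_leI)
    also have "\<dots> = ennreal ((real CARD('n) * norm w) powr p) * (\<Sum>i\<in>UNIV. ennreal (\<bar>g i y\<bar> powr p))"
      by (simp add: ennreal_mult sum_nonneg)
    finally show ?thesis .
  qed
  have "AE x in lborel. x \<in> E \<longrightarrow> ennreal \<bar>u (x + w) - u x\<bar>
    \<le> (\<integral>\<^sup>+t. ennreal (H (x + t *\<^sub>R w)) * indicator {0..1} t \<partial>lborel)"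
    unfolding H_def by (rule weak_increment_le[OF \<open>open V\<close> weak _ _ \<open>compact E\<close> seg]) auto
  then have "(\<integral>\<^sup>+x. ennreal (\<bar>u (x + w) - u x\<bar> powr p) * indicator E x \<partial>lborel)
    \<le> (\<integral>\<^sup>+x. (\<integral>\<^sup>+t. ennreal (H (x + t *\<^sub>R w) powr p) * indicator {0..1} t \<partial>lborel) * indicator E x \<partial>lborel)"
  proof (intro nn_integral_mono_AE, elim eventually_mono)
    fix x
    assume "x \<in> E \<longrightarrow> ennreal \<bar>u (x + w) - u x\<bar>
      \<le> (\<integral>\<^sup>+t. ennreal (H (x + t *\<^sub>R w)) * indicator {0..1} t \<partial>lborel)"
    then show "ennreal (\<bar>u (x + w) - u x\<bar> powr p) * indicator E x
      \<le> (\<integral>\<^sup>+t. ennreal (H (x + t *\<^sub>R w) powr p) * indicator {0..1} t \<partial>lborel) * indicator E x"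
      using pt[of x] by (cases "x \<in> E") simp_all
  qed
  also have "\<dots> \<le> (\<integral>\<^sup>+y. ennreal (H y powr p) * indicator ?K y \<partial>lborel)"
    by (rule tube_integral_le[of "\<lambda>y. ennreal (H y powr p)"]) (use Kin in auto)
  also have "\<dots> \<le> (\<integral>\<^sup>+y. ennreal ((real CARD('n) * norm w) powr p) * (\<Sum>i\<in>UNIV. ennreal (\<bar>g i y\<bar> powr p) * indicator ?K y) \<partial>lborel)"
    using HP by (intro nn_integral_mono) (auto simp: indicator_def)
  also have "\<dots> = ennreal ((real CARD('n) * norm w) powr p) * (\<Sum>i\<in>UNIV. \<integral>\<^sup>+y. ennreal (\<bar>g i y\<bar> powr p) * indicator ?K y \<partial>lborel)"
    by (subst nn_integral_cmult, measurable) (subst nn_integral_sum, measurable)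
  also have "\<dots> \<le> ennreal ((real CARD('n) * norm w) powr p) * (\<Sum>i\<in>UNIV. Ip p V (g i))"
    unfolding Ip_def using K(2) \<open>open V\<close>
    by (intro mult_left_mono sum_mono nn_integral_indicator_le_lebesgue_on) auto
  finally show ?thesis .
qed

text \<open>The constant for compact sets does not depend on the set, so Fatou's lemma extends the estimate to open sets,
  which are exhausted by compact ones.\<close>

lemma translation_estimate:
  fixes u :: "real^'n::finite \<Rightarrow> real"
  assumes "open V" and weak: "\<And>i. has_weak_deriv V (mi_unit i) u (g i)"
    and [measurable]: "u \<in> borel_measurable borel" "\<And>i. g i \<in> borel_measurable borel"
    and "open E" and seg: "\<And>x t. x \<in> E \<Longrightarrow> 0 \<le> t \<Longrightarrow> t \<le> 1 \<Longrightarrow> x + t *\<^sub>R w \<in> V" and p: "1 \<le> p"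
  shows "(\<integral>\<^sup>+x. ennreal (\<bar>u (x + w) - u x\<bar> powr p) * indicator E x \<partial>lborel)
    \<le> ennreal ((real CARD('n) * norm w) powr p) * (\<Sum>i\<in>UNIV. Ip p V (g i))" (is "_ \<le> ?B")
proof -
  let ?h = "\<lambda>x. ennreal (\<bar>u (x + w) - u x\<bar> powr p)"
  obtain C :: "nat \<Rightarrow> (real^'n) set" where C: "\<forall>n. compact (C n)" "\<forall>n. C n \<subseteq> E"
    "\<forall>K. compact K \<longrightarrow> K \<subseteq> E \<longrightarrow> (\<exists>N. \<forall>n\<ge>N. K \<subseteq> C n)"
    using compact_exhaustion[OF \<open>open E\<close>] by blast
  have [measurable]: "C n \<in> sets borel" for n
    using C(1) by (simp add: borel_compact)
  have le: "(\<integral>\<^sup>+x. ?h x * indicator (C n) x \<partial>lborel) \<le> ?B" for n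
    using C(1,2) by (intro translation_estimate_compact[OF \<open>open V\<close> weak] seg p) auto
  have "(\<integral>\<^sup>+x. ?h x * indicator E x \<partial>lborel) \<le> (\<integral>\<^sup>+x. liminf (\<lambda>n. ?h x * indicator (C n) x) \<partial>lborel)"
  proof (rule nn_integral_mono)
    fix x
    show "?h x * indicator E x \<le> liminf (\<lambda>n. ?h x * indicator (C n) x)"
    proof (cases "x \<in> E")
      case True
      then obtain N where N: "\<forall>n\<ge>N. {x} \<subseteq> C n"
        using C(3)[rule_format, of "{x}"] by auto
      have "\<forall>\<^sub>F n in sequentially. ?h x \<le> ?h x * indicator (C n) x"
        using N by (intro eventually_sequentiallyI[of N]) auto
      then have "?h x \<le> liminf (\<lambda>n. ?h x * indicator (C n) x)"
        by (rule Liminf_bounded)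
      with True show ?thesis
        by simp
    qed simp
  qed
  also have "\<dots> \<le> liminf (\<lambda>n. \<integral>\<^sup>+x. ?h x * indicator (C n) x \<partial>lborel)"
    by (rule nn_integral_liminf) measurable
  also have "\<dots> \<le> liminf (\<lambda>n :: nat. ?B)"
    by (intro Liminf_mono always_eventually allI le)
  also have "\<dots> = ?B"
    by (rule Liminf_const) simp
  finally show ?thesis .
qed

section \<open>Embedding of \<open>W\<^sup>1\<^sup>,\<^sup>p\<close> into \<open>W\<^sup>\<theta>\<^sup>,\<^sup>p\<close>\<close>

subsection \<open>The Gagliardo integral as an average over translations\<close>

definition shift_dom :: "(real^'n::finite) set \<Rightarrow> real^'n \<Rightarrow> (real^'n) set" where
  "shift_dom V z = {x \<in> V. x + z \<in> V}"

definition shift_Lp :: "real \<Rightarrow> (real^'n::finite) set \<Rightarrow> (real^'n \<Rightarrow> real) \<Rightarrow> real^'n \<Rightarrow> ennreal" where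
  "shift_Lp p V f z = (\<integral>\<^sup>+x. ennreal (\<bar>f (x + z) - f x\<bar> powr p) * indicator (shift_dom V z) x \<partial>lborel)"

lemma open_shift_dom: "open V \<Longrightarrow> open (shift_dom V z)"
proof -
  assume "open V"
  then have "open (V \<inter> (\<lambda>x. x + z) -` V)"
    by (intro open_Int open_vimage continuous_intros)
  also have "V \<inter> (\<lambda>x. x + z) -` V = shift_dom V z"
    by (auto simp: shift_dom_def)
  finally show ?thesis .
qed

lemma Gag_eq_shift_Lp:
  fixes f :: "real^'n::finite \<Rightarrow> real"
  assumes "open V" and [measurable]: "f \<in> borel_measurable borel"
  shows "Gag \<theta> p V f = (\<integral>\<^sup>+z. ennreal (1 / norm z powr (real CARD('n) + \<theta> * p)) * shift_Lp p V f z \<partial>lborel)"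
proof -
  let ?a = "real CARD('n) + \<theta> * p"
  have V: "V \<in> sets lebesgue" and [measurable]: "V \<in> sets borel"
    using \<open>open V\<close> by auto
  let ?F = "\<lambda>x z. ennreal (1 / norm z powr ?a) * (ennreal (\<bar>f (x + z) - f x\<bar> powr p) * (indicator V x * indicator V (x + z)))"
  have "Gag \<theta> p V f = (\<integral>\<^sup>+x. (\<integral>\<^sup>+y. ennreal (\<bar>f x - f y\<bar> powr p / norm (x - y) powr ?a) * indicator V y \<partial>lborel)
      * indicator V x \<partial>lborel)"
    unfolding Gag_def by (simp add: nn_integral_lebesgue_on_borel_eq[OF V])
  also have "\<dots> = (\<integral>\<^sup>+x. \<integral>\<^sup>+z. ?F x z \<partial>lborel \<partial>lborel)"
  proof (rule nn_integral_cong)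
    fix x
    let ?G = "\<lambda>y. ennreal (\<bar>f x - f y\<bar> powr p / norm (x - y) powr ?a) * indicator V y"
    have "(\<integral>\<^sup>+y. ?G y \<partial>lborel) = (\<integral>\<^sup>+z. ?G (z + x) \<partial>lborel)"
      by (rule nn_integral_lborel_shift[symmetric]) measurable
    then have "(\<integral>\<^sup>+y. ?G y \<partial>lborel) * indicator V x = (\<integral>\<^sup>+z. ?G (z + x) * indicator V x \<partial>lborel)"
      by (simp add: nn_integral_multc)
    also have "\<dots> = (\<integral>\<^sup>+z. ?F x z \<partial>lborel)"
    proof (rule nn_integral_cong)
      fix z
      show "?G (z + x) * indicator V x = ?F x z"
        by (simp add: add.commute abs_minus_commute norm_minus_commute indicator_def flip: ennreal_mult)
    qed
    finally show "(\<integral>\<^sup>+y. ?G y \<partial>lborel) * indicator V x = (\<integral>\<^sup>+z. ?F x z \<partial>lborel)" .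
  qed
  also have "\<dots> = (\<integral>\<^sup>+z. \<integral>\<^sup>+x. ?F x z \<partial>lborel \<partial>lborel)"
    by (rule lborel_pair.Fubini'[symmetric]) measurable
  also have "\<dots> = (\<integral>\<^sup>+z. ennreal (1 / norm z powr ?a) * shift_Lp p V f z \<partial>lborel)"
  proof (rule nn_integral_cong)
    fix z :: "real^'n"
    have "(\<integral>\<^sup>+x. ?F x z \<partial>lborel) = ennreal (1 / norm z powr ?a)
        * (\<integral>\<^sup>+x. ennreal (\<bar>f (x + z) - f x\<bar> powr p) * (indicator V x * indicator V (x + z)) \<partial>lborel)"
      by (rule nn_integral_cmult) measurable
    also have "(\<integral>\<^sup>+x. ennreal (\<bar>f (x + z) - f x\<bar> powr p) * (indicator V x * indicator V (x + z)) \<partial>lborel) = shift_Lp p V f z"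
      unfolding shift_Lp_def by (intro nn_integral_cong) (auto simp: shift_dom_def indicator_def)
    finally show "(\<integral>\<^sup>+x. ?F x z \<partial>lborel) = ennreal (1 / norm z powr ?a) * shift_Lp p V f z" .
  qed
  finally show ?thesis .
qed

lemma shift_Lp_le:
  fixes f :: "real^'n::finite \<Rightarrow> real"
  assumes "open V" "0 < p" and [measurable]: "f \<in> borel_measurable borel"
  shows "shift_Lp p V f z \<le> ennreal (2 powr p) * (Ip p V f + Ip p V f)"
proof -
  have V: "V \<in> sets lebesgue" and [measurable]: "V \<in> sets borel" "shift_dom V z \<in> sets borel"
    using \<open>open V\<close> open_shift_dom[OF \<open>open V\<close>] by auto
  have I: "Ip p V f = (\<integral>\<^sup>+y. ennreal (\<bar>f y\<bar> powr p) * indicator V y \<partial>lborel)"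
    unfolding Ip_def by (rule nn_integral_lebesgue_on_borel_eq[OF V])
  have "shift_Lp p V f z \<le> (\<integral>\<^sup>+x. ennreal (2 powr p) * (ennreal (\<bar>f (x + z)\<bar> powr p) * indicator (shift_dom V z) x
      + ennreal (\<bar>f x\<bar> powr p) * indicator V x) \<partial>lborel)"
    unfolding shift_Lp_def
  proof (rule nn_integral_mono)
    fix x
    have "\<bar>f (x + z) + - f x\<bar> powr p \<le> 2 powr p * (\<bar>f (x + z)\<bar> powr p + \<bar>- f x\<bar> powr p)"
      by (rule powr_abs_add_le[OF \<open>0 < p\<close>])
    then have "ennreal (\<bar>f (x + z) - f x\<bar> powr p) \<le> ennreal (2 powr p) * (ennreal (\<bar>f (x + z)\<bar> powr p) + ennreal (\<bar>f x\<bar> powr p))"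
      by (simp add: ennreal_leI flip: ennreal_plus ennreal_mult)
    then show "ennreal (\<bar>f (x + z) - f x\<bar> powr p) * indicator (shift_dom V z) x
      \<le> ennreal (2 powr p) * (ennreal (\<bar>f (x + z)\<bar> powr p) * indicator (shift_dom V z) x + ennreal (\<bar>f x\<bar> powr p) * indicator V x)"
      by (auto simp: indicator_def shift_dom_def)
  qed
  also have "\<dots> = ennreal (2 powr p) * ((\<integral>\<^sup>+x. ennreal (\<bar>f (x + z)\<bar> powr p) * indicator (shift_dom V z) x \<partial>lborel)
      + Ip p V f)"
    by (simp add: I nn_integral_cmult nn_integral_add)
  also have "(\<integral>\<^sup>+x. ennreal (\<bar>f (x + z)\<bar> powr p) * indicator (shift_dom V z) x \<partial>lborel) \<le> Ip p V f"
    unfolding I by (rule nn_integral_shift_indicator_le[of "\<lambda>y. ennreal (\<bar>f y\<bar> powr p)"]) (auto simp: shift_dom_def)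
  finally show ?thesis
    by (simp add: add_right_mono mult_left_mono)
qed

text \<open>For small \<open>z\<close> the factor \<open>|z|\<^sup>p\<close> turns the singular weight into the integrable kernel. Away from the origin the weight
  itself is comparable to the kernel, and the trivial bound for translations suffices.\<close>

lemma Gag_le_if_shift_Lp_le:
  fixes V :: "(real^'n::finite) set"
  assumes "open V" "0 < \<theta>" "\<theta> < 1" "0 < p" "\<delta> > 0"
  shows "\<exists>C\<ge>0. \<forall>f Q. f \<in> borel_measurable borel \<longrightarrow>
     (\<forall>z. norm z < \<delta> \<longrightarrow> shift_Lp p V f z \<le> ennreal (norm z powr p) * Q) \<longrightarrow>
     Gag \<theta> p V f \<le> ennreal C * (Q + Ip p V f)"
proof -
  let ?a = "real CARD('n) + \<theta> * p"
  define d where "d = min \<delta> 1"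
  have d: "0 < d" "d \<le> \<delta>" "d \<le> 1"
    using \<open>\<delta> > 0\<close> by (auto simp: d_def)
  define kap where "kap = (\<integral>\<^sup>+z. ennreal (gag_kernel \<theta> p (z :: real^'n)) \<partial>lborel)"
  have "kap < top"
    using gag_kernel_integrable[OF assms(2,3,4), where 'n = 'n] by (simp add: kap_def)
  then obtain kr where kr: "kr \<ge> 0" "kap = ennreal kr"
    by (cases kap) auto
  define c where "c = 1 + d powr (- p) * (2 powr p * 2)"
  have c: "c \<ge> 1"
    by (simp add: c_def)
  have "Gag \<theta> p V f \<le> ennreal (kr * c) * (Q + Ip p V f)"
    if f[measurable]: "f \<in> borel_measurable borel"
      and Q: "\<And>z. norm z < \<delta> \<Longrightarrow> shift_Lp p V f z \<le> ennreal (norm z powr p) * Q" for f Q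
  proof -
    let ?S = "Q + Ip p V f"
    have pt: "ennreal (1 / norm z powr ?a) * shift_Lp p V f z \<le> ennreal (gag_kernel \<theta> p z) * (ennreal c * ?S)" for z
    proof (cases "norm z < d")
      case True
      have "ennreal (1 / norm z powr ?a) * shift_Lp p V f z \<le> ennreal (1 / norm z powr ?a) * (ennreal (norm z powr p) * Q)"
        using True d by (intro mult_left_mono Q) auto
      also have "\<dots> = ennreal (gag_kernel \<theta> p z) * Q"
        using True d by (simp add: gag_kernel_def min_def mult.assoc[symmetric] flip: ennreal_mult)
      also have "\<dots> \<le> ennreal (gag_kernel \<theta> p z) * (ennreal c * ?S)"
      proof (rule mult_left_mono)
        have "Q \<le> 1 * ?S"
          by simp
        also have "\<dots> \<le> ennreal c * ?S"
          using c by (intro mult_right_mono) auto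
        finally show "Q \<le> ennreal c * ?S" .
      qed simp
      finally show ?thesis .
    next
      case False
      have "d powr p \<le> min 1 (norm z) powr p"
        using False d \<open>0 < p\<close> by (intro powr_mono2) auto
      then have "1 / norm z powr ?a \<le> d powr (- p) * gag_kernel \<theta> p z"
      proof -
        have "1 \<le> d powr (- p) * min 1 (norm z) powr p"
          using d \<open>d powr p \<le> min 1 (norm z) powr p\<close> by (simp add: powr_minus field_simps)
        then have "1 / norm z powr ?a \<le> d powr (- p) * min 1 (norm z) powr p / norm z powr ?a"
          by (rule divide_right_mono) simp
        then show ?thesis
          by (simp add: gag_kernel_def)
      qed
      then have "ennreal (1 / norm z powr ?a) * shift_Lp p V f z
        \<le> ennreal (d powr (- p) * gag_kernel \<theta> p z) * (ennreal (2 powr p) * (Ip p V f + Ip p V f))"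
        by (intro mult_mono ennreal_leI shift_Lp_le[OF \<open>open V\<close> \<open>0 < p\<close> f]) auto
      also have "\<dots> = ennreal (gag_kernel \<theta> p z) * (ennreal (d powr (- p) * (2 powr p * 2)) * Ip p V f)"
        by (simp add: ennreal_mult mult_2_right distrib_left distrib_right mult_ac flip: mult_2)
      also have "\<dots> \<le> ennreal (gag_kernel \<theta> p z) * (ennreal c * ?S)"
        by (intro mult_left_mono mult_mono ennreal_leI) (auto simp: c_def)
      finally show ?thesis .
    qed
    have "Gag \<theta> p V f \<le> (\<integral>\<^sup>+z. ennreal (gag_kernel \<theta> p (z :: real^'n)) * (ennreal c * ?S) \<partial>lborel)"
      unfolding Gag_eq_shift_Lp[OF \<open>open V\<close> f] by (intro nn_integral_mono pt)
    also have "\<dots> = kap * (ennreal c * ?S)"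
      unfolding kap_def by (rule nn_integral_multc) measurable
    also have "\<dots> = ennreal (kr * c) * ?S"
      using kr c by (simp add: ennreal_mult mult.assoc)
    finally show ?thesis .
  qed
  then show ?thesis
    using kr c by (intro exI[of _ "kr * c"]) auto
qed

subsection \<open>Borel representatives\<close>

lemma borel_representative:
  fixes u :: "real^'n::finite \<Rightarrow> real"
  assumes "V \<in> sets lebesgue" "u \<in> borel_measurable (lebesgue_on V)"
  obtains v where "v \<in> borel_measurable borel" "AE_eq_on V u v"
proof -
  have "(\<lambda>x. indicator V x * u x) \<in> borel_measurable lebesgue"
    using assms borel_measurable_restrict_space_iff[of V lebesgue u] by simp
  then obtain v where v: "v \<in> borel_measurable lborel" "AE x in lborel. indicator V x * u x = v x"
    using completion_ex_borel_measurable_real[of "\<lambda>x. indicator V x * u x" lborel] by blast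
  have "AE x in lebesgue. indicator V x * u x = v x"
    using v(2) by (rule AE_completion)
  then have "AE x in lebesgue. x \<in> V \<longrightarrow> u x = v x"
    by (rule eventually_mono) auto
  then have "AE_eq_on V u v"
    using assms(1) by (simp add: AE_eq_on_def AE_lebesgue_on_iff)
  with v(1) that show thesis
    by simp
qed

lemma AE_eq_on_subset:
  assumes "AE_eq_on V u v" "K \<subseteq> V" "K \<in> sets lebesgue" "V \<in> sets lebesgue"
  shows "AE_eq_on K u v"
proof -
  have "AE x in lebesgue. x \<in> V \<longrightarrow> u x = v x"
    using assms by (simp add: AE_eq_on_def AE_lebesgue_on_iff)
  then have "AE x in lebesgue. x \<in> K \<longrightarrow> u x = v x"
    by (rule eventually_mono) (use assms(2) in auto)
  then show ?thesis
    using assms by (simp add: AE_eq_on_def AE_lebesgue_on_iff)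
qed

lemma AE_eq_on_sym: "AE_eq_on V u v \<Longrightarrow> AE_eq_on V v u"
  unfolding AE_eq_on_def by (auto elim!: eventually_mono)

lemma measurable_lebesgue_on_borel:
  "v \<in> borel_measurable borel \<Longrightarrow> v \<in> borel_measurable (lebesgue_on V)"
  by (intro measurable_restrict_space1 measurable_completion) simp

lemma L1_loc_cong_AE:
  assumes "u \<in> L1_loc V" "AE_eq_on V u v" "V \<in> sets lebesgue" "v \<in> borel_measurable borel"
  shows "v \<in> L1_loc V"
  unfolding L1_loc_def mem_Collect_eq
proof (intro allI impI, elim conjE)
  fix K assume K: "compact K" "K \<subseteq> V"
  have int: "integrable (lebesgue_on K) u"
    using assms(1) K by (auto simp: L1_loc_def)
  have "AE x in lebesgue_on K. u x = v x"
    using AE_eq_on_subset[OF assms(2) K(2) compact_sets_lebesgue[OF K(1)] assms(3)] by (simp add: AE_eq_on_def)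
  then show "integrable (lebesgue_on K) v"
    using int borel_measurable_integrable[OF int] measurable_lebesgue_on_borel[OF assms(4)]
    by (subst integrable_cong_AE[symmetric]) auto
qed

lemma has_weak_deriv_cong_AE:
  assumes "open V" "has_weak_deriv V (mi_unit i) u g" "AE_eq_on V u u'" "AE_eq_on V g g'"
    and meas: "u' \<in> borel_measurable borel" "g' \<in> borel_measurable borel"
  shows "has_weak_deriv V (mi_unit i) u' g'"
  unfolding has_weak_deriv_unit_iff
proof (intro conjI ballI)
  have V: "V \<in> sets lebesgue"
    using \<open>open V\<close> by simp
  have loc: "u \<in> L1_loc V" "g \<in> L1_loc V"
    using assms(2) by (auto simp: has_weak_deriv_def)
  show loc': "u' \<in> L1_loc V" "g' \<in> L1_loc V"
    using L1_loc_cong_AE loc assms V by blast+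
  have int_eq: "(LINT x|lebesgue_on V. w x * \<psi> x) = (LINT x|lebesgue_on V. w' x * \<psi> x)"
    if "w \<in> L1_loc V" "w' \<in> L1_loc V" "AE_eq_on V w w'" "\<psi> \<in> test_fun V" for w w' \<psi>
  proof (rule integral_cong_AE)
    show "AE x in lebesgue_on V. w x * \<psi> x = w' x * \<psi> x"
      using that(3) unfolding AE_eq_on_def by (rule eventually_mono) simp
  qed (use test_fun_integrable_times[OF _ \<open>open V\<close> that(4)] that in blast)+
  fix \<phi> assume \<phi>: "\<phi> \<in> test_fun V"
  show "(LINT x|lebesgue_on V. u' x * partial_deriv i \<phi> x) = - (LINT x|lebesgue_on V. g' x * \<phi> x)"
    using assms(2) \<phi>
    unfolding int_eq[OF loc(1) loc'(1) assms(3) test_fun_partial_deriv[OF \<phi>], symmetric]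
      int_eq[OF loc(2) loc'(2) assms(4) \<phi>, symmetric] by (simp add: has_weak_deriv_unit_iff)
qed

text \<open>Translates of a Lebesgue measurable function on \<open>V\<close> are handled through Borel representatives; the
  Gagliardo integral and the weak derivatives do not notice the change. The set \<open>N\<close> on which the functions vanish
  serves to treat functions of compact support and general functions at once.\<close>

lemma Gag_embedding_if_shift_Lp_le:
  fixes V :: "(real^'n::finite) set"
  assumes "open V" "0 < \<theta>" "\<theta> < 1" "1 \<le> p" "\<delta> > 0" "0 \<le> c"
    and zero_set: "N \<in> sets lebesgue"
    and shift: "\<And>u g z. u \<in> borel_measurable borel \<Longrightarrow> (\<And>i. g i \<in> borel_measurable borel) \<Longrightarrow>
       (\<And>i. has_weak_deriv V (mi_unit i) u (g i)) \<Longrightarrow> (AE x in lebesgue_on V. x \<in> N \<longrightarrow> u x = 0) \<Longrightarrow> norm z < \<delta> \<Longrightarrow>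
       shift_Lp p V u z \<le> ennreal (norm z powr p) * (ennreal c * (\<Sum>i\<in>UNIV. Ip p V (g i)))"
  shows "\<exists>C\<ge>0. \<forall>u g. (\<forall>i. has_weak_deriv V (mi_unit i) u (g i)) \<longrightarrow> (AE x in lebesgue_on V. x \<in> N \<longrightarrow> u x = 0) \<longrightarrow>
     Gag \<theta> p V u \<le> ennreal C * (Ip p V u + (\<Sum>i\<in>UNIV. Ip p V (g i)))"
proof -
  have V: "V \<in> sets lebesgue" and p: "0 < p"
    using \<open>open V\<close> \<open>1 \<le> p\<close> by auto
  obtain C where C: "C \<ge> 0" "\<And>f Q. f \<in> borel_measurable borel \<Longrightarrow>
     (\<And>z. norm z < \<delta> \<Longrightarrow> shift_Lp p V f z \<le> ennreal (norm z powr p) * Q) \<Longrightarrow>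
     Gag \<theta> p V f \<le> ennreal C * (Q + Ip p V f)"
    using Gag_le_if_shift_Lp_le[OF assms(1,2,3) p assms(5)] by blast
  have "Gag \<theta> p V u \<le> ennreal (C * (1 + c)) * (Ip p V u + (\<Sum>i\<in>UNIV. Ip p V (g i)))"
    if weak: "\<And>i. has_weak_deriv V (mi_unit i) u (g i)" and zero: "AE x in lebesgue_on V. x \<in> N \<longrightarrow> u x = 0" for u g
  proof -
    have meas: "u \<in> borel_measurable (lebesgue_on V)" "\<And>i. g i \<in> borel_measurable (lebesgue_on V)"
      using weak L1_loc_measurable[OF \<open>open V\<close>] by (auto simp: has_weak_deriv_def)
    obtain u' where u': "u' \<in> borel_measurable borel" "AE_eq_on V u u'"
      using borel_representative[OF V meas(1)] by blast
    have "\<forall>i. \<exists>v. v \<in> borel_measurable borel \<and> AE_eq_on V (g i) v"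
      using borel_representative[OF V meas(2)] by blast
    then obtain g' where g': "\<And>i. g' i \<in> borel_measurable borel" "\<And>i. AE_eq_on V (g i) (g' i)"
      by metis
    have weak': "has_weak_deriv V (mi_unit i) u' (g' i)" for i
      by (rule has_weak_deriv_cong_AE[OF \<open>open V\<close> weak u'(2) g'(2) u'(1) g'(1)])
    have zero': "AE x in lebesgue_on V. x \<in> N \<longrightarrow> u' x = 0"
      using zero u'(2) unfolding AE_eq_on_def by eventually_elim auto
    let ?G = "\<Sum>i\<in>UNIV. Ip p V (g i)"
    have G: "?G = (\<Sum>i\<in>UNIV. Ip p V (g' i))"
      using Ip_cong_AE[OF g'(2)] by simp
    have "Gag \<theta> p V u = Gag \<theta> p V u'"
      by (rule Gag_cong_AE[OF u'(2)])
    also have "\<dots> \<le> ennreal C * (ennreal c * ?G + Ip p V u')"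
      unfolding G by (rule C(2)[OF u'(1)]) (rule shift[OF u'(1) g'(1) weak' zero'])
    also have "Ip p V u' = Ip p V u"
      by (rule Ip_cong_AE[OF AE_eq_on_sym[OF u'(2)]])
    also have "ennreal C * (ennreal c * ?G + Ip p V u) \<le> ennreal C * (ennreal (1 + c) * (Ip p V u + ?G))"
    proof (rule mult_left_mono)
      have "ennreal c * ?G + Ip p V u \<le> ennreal (1 + c) * ?G + ennreal (1 + c) * Ip p V u"
      proof (rule add_mono)
        show "ennreal c * ?G \<le> ennreal (1 + c) * ?G"
          by (intro mult_right_mono ennreal_leI) auto
        show "Ip p V u \<le> ennreal (1 + c) * Ip p V u"
          using mult_right_mono[of 1 "ennreal (1 + c)" "Ip p V u"] \<open>0 \<le> c\<close> by simp
      qed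
      then show "ennreal c * ?G + Ip p V u \<le> ennreal (1 + c) * (Ip p V u + ?G)"
        by (simp add: distrib_left add.commute)
    qed simp
    also have "\<dots> = ennreal (C * (1 + c)) * (Ip p V u + ?G)"
      using C(1) \<open>0 \<le> c\<close> by (simp add: ennreal_mult mult.assoc)
    finally show ?thesis .
  qed
  then show ?thesis
    using C(1) \<open>0 \<le> c\<close> by (intro exI[of _ "C * (1 + c)"]) auto
qed

subsection \<open>Functions supported in a compact set\<close>

text \<open>Let the \<open>\<delta>\<close>-neighbourhood of \<open>K\<close> be contained in \<open>V\<close> and \<open>|z| < \<delta> / 2\<close>. If \<open>x\<close> has distance at least \<open>\<delta> / 2\<close> from \<open>K\<close>,
  then \<open>u\<close> vanishes at \<open>x\<close> and at \<open>x + z\<close>; otherwise the segment from \<open>x\<close> to \<open>x + z\<close> lies in \<open>V\<close>.\<close>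

theorem Gag_embedding_compact_support:
  fixes V :: "(real^'n::finite) set"
  assumes "open V" "compact K" "K \<subseteq> V" "0 < \<theta>" "\<theta> < 1" "1 \<le> p"
  shows "\<exists>C\<ge>0. \<forall>u g. (\<forall>i. has_weak_deriv V (mi_unit i) u (g i)) \<longrightarrow> (AE x in lebesgue_on V. x \<notin> K \<longrightarrow> u x = 0) \<longrightarrow>
     Gag \<theta> p V u \<le> ennreal C * (Ip p V u + (\<Sum>i\<in>UNIV. Ip p V (g i)))"
proof -
  obtain \<delta> where \<delta>: "\<delta> > 0" "(\<Union>x\<in>K. ball x \<delta>) \<subseteq> V"
    using compact_subset_open_imp_ball_epsilon_subset[OF assms(2,1,3)] by blast
  have V: "V \<in> sets lebesgue"
    using \<open>open V\<close> by simp
  let ?c = "real CARD('n) powr p"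
  have "\<exists>C\<ge>0. \<forall>u g. (\<forall>i. has_weak_deriv V (mi_unit i) u (g i)) \<longrightarrow> (AE x in lebesgue_on V. x \<in> - K \<longrightarrow> u x = 0) \<longrightarrow>
     Gag \<theta> p V u \<le> ennreal C * (Ip p V u + (\<Sum>i\<in>UNIV. Ip p V (g i)))"
  proof (rule Gag_embedding_if_shift_Lp_le[OF \<open>open V\<close> assms(4,5,6), of "\<delta> / 2" ?c])
    show "- K \<in> sets lebesgue"
      using compact_sets_lebesgue[OF \<open>compact K\<close>] by (simp add: Compl_in_sets_lebesgue)
    fix u :: "real^'n \<Rightarrow> real" and g :: "'n \<Rightarrow> real^'n \<Rightarrow> real" and z :: "real^'n"
    assume u[measurable]: "u \<in> borel_measurable borel" and g: "\<And>i. g i \<in> borel_measurable borel"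
      and weak: "\<And>i. has_weak_deriv V (mi_unit i) u (g i)"
      and zero: "AE x in lebesgue_on V. x \<in> - K \<longrightarrow> u x = 0" and z: "norm z < \<delta> / 2"
    let ?E = "{x. \<exists>y\<in>K. dist y x < \<delta> / 2}"
    have E: "?E = (\<Union>y\<in>K. ball y (\<delta> / 2))"
      by auto
    have "open ?E"
      unfolding E by auto
    have seg: "x + t *\<^sub>R z \<in> V" if x: "x \<in> ?E" and t: "0 \<le> t" "t \<le> 1" for x t
    proof -
      obtain y where y: "y \<in> K" "dist y x < \<delta> / 2"
        using x by blast
      have "norm (t *\<^sub>R z) \<le> norm z"
        using t by (simp add: mult_left_le_one_le)
      then have "dist y (x + t *\<^sub>R z) < \<delta>"
        using y(2) z dist_triangle[of y "x + t *\<^sub>R z" x] by (simp add: dist_norm)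
      then have "x + t *\<^sub>R z \<in> ball y \<delta>"
        by simp
      then show ?thesis
        using \<delta>(2) y(1) by blast
    qed
    have null: "AE x in lborel. x \<in> V \<and> x \<notin> K \<longrightarrow> u x = 0"
    proof -
      have "AE x in lebesgue. x \<in> V \<longrightarrow> x \<in> - K \<longrightarrow> u x = 0"
        using zero V by (simp add: AE_lebesgue_on_iff)
      then show ?thesis
        by (auto simp: AE_completion_iff elim!: eventually_mono)
    qed
    have null_shift: "AE x in lborel. x + z \<in> V \<and> x + z \<notin> K \<longrightarrow> u (x + z) = 0"
    proof -
      have "AE x in distr lborel borel ((+) z). x \<in> V \<and> x \<notin> K \<longrightarrow> u x = 0"
        by (subst lborel_distr_plus) (rule null)
      then show ?thesis
        using AE_distrD[of "(+) z" lborel borel "\<lambda>x. x \<in> V \<and> x \<notin> K \<longrightarrow> u x = 0"] by (simp add: add.commute)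
    qed
    have "shift_Lp p V u z \<le> (\<integral>\<^sup>+x. ennreal (\<bar>u (x + z) - u x\<bar> powr p) * indicator ?E x \<partial>lborel)"
      unfolding shift_Lp_def
    proof (rule nn_integral_mono_AE)
      show "AE x in lborel. ennreal (\<bar>u (x + z) - u x\<bar> powr p) * indicator (shift_dom V z) x
         \<le> ennreal (\<bar>u (x + z) - u x\<bar> powr p) * indicator ?E x"
        using null null_shift
      proof eventually_elim
        case (elim x)
        show ?case
        proof (cases "x \<in> shift_dom V z \<and> x \<notin> ?E")
          case True
          then have "x \<notin> K" "x + z \<notin> K"
            using z \<delta>(1) by (auto simp: dist_norm)
          then have "u (x + z) - u x = 0"
            using elim True by (simp add: shift_dom_def)
          then show ?thesis
            by simp
        qed (auto simp: indicator_def)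
      qed
    qed
    also have "\<dots> \<le> ennreal ((real CARD('n) * norm z) powr p) * (\<Sum>i\<in>UNIV. Ip p V (g i))"
      by (rule translation_estimate[OF \<open>open V\<close> weak u g \<open>open ?E\<close> seg \<open>1 \<le> p\<close>])
    also have "\<dots> = ennreal (norm z powr p) * (ennreal ?c * (\<Sum>i\<in>UNIV. Ip p V (g i)))"
      by (simp add: powr_mult ennreal_mult mult_ac)
    finally show "shift_Lp p V u z \<le> ennreal (norm z powr p) * (ennreal ?c * (\<Sum>i\<in>UNIV. Ip p V (g i)))" .
  qed (use \<delta> in auto)
  then show ?thesis
    by simp
qed


subsection \<open>The cone condition\<close>

text \<open>The points \<open>v + s (e + b)\<close> with \<open>s > 0\<close> and \<open>|b| < c\<close> form the open cone with vertex \<open>v\<close> around the direction \<open>e\<close>. Near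
  \<open>x0\<close> the set contains, with each of its points, the cone above that point.\<close>

definition upward_cone :: "'a::real_normed_vector set \<Rightarrow> 'a \<Rightarrow> real \<Rightarrow> real \<Rightarrow> 'a \<Rightarrow> bool" where
  "upward_cone \<Omega> x0 r c e \<longleftrightarrow> (\<forall>v s b. v \<in> \<Omega> \<longrightarrow> v \<in> ball x0 r \<longrightarrow> 0 < s \<longrightarrow> norm b < c \<longrightarrow>
     v + s *\<^sub>R (e + b) \<in> ball x0 r \<longrightarrow> v + s *\<^sub>R (e + b) \<in> \<Omega>)"

lemma norm_projection_le:
  fixes b e :: "'a::real_inner"
  assumes "norm e = 1"
  shows "norm (b - (b \<bullet> e) *\<^sub>R e) \<le> norm b"
proof (rule power2_le_imp_le)
  have "e \<bullet> e = 1"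
    using assms by (simp add: dot_square_norm)
  then have "(norm (b - (b \<bullet> e) *\<^sub>R e))\<^sup>2 = (norm b)\<^sup>2 - (b \<bullet> e)\<^sup>2"
    by (simp only: power2_norm_eq_inner inner_diff_left inner_diff_right inner_scaleR_left inner_scaleR_right)
      (simp add: inner_commute power2_eq_square)
  then show "(norm (b - (b \<bullet> e) *\<^sub>R e))\<^sup>2 \<le> (norm b)\<^sup>2"
    by simp
qed simp

text \<open>The step \<open>s (e + b)\<close> raises the height above the hyperplane by at least \<open>s (1 - |b|)\<close>, and the height of the graph by
  at most \<open>L s |b|\<close>. Hence the point stays above the graph if \<open>(L + 1) |b| < 1\<close>.\<close>

lemma upward_cone_if_lipschitz_boundary:
  fixes \<Omega> :: "(real^'n::finite) set"
  assumes "lipschitz_boundary \<Omega>" "x0 \<in> frontier \<Omega>"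
  shows "\<exists>r>0. \<exists>c>0. \<exists>e. norm e = 1 \<and> upward_cone \<Omega> x0 r c e"
proof -
  obtain r e \<gamma> L where r: "r > 0" and e: "norm e = 1" and L: "L-lipschitz_on {z. z \<bullet> e = 0} \<gamma>"
    and \<Omega>: "\<Omega> \<inter> ball x0 r = {y \<in> ball x0 r. \<gamma> (y - (y \<bullet> e) *\<^sub>R e) < y \<bullet> e}"
    using bspec[OF assms(1)[unfolded lipschitz_boundary_def] assms(2)] by blast
  have L0: "L \<ge> 0"
    using L by (rule lipschitz_on_nonneg)
  have ee: "e \<bullet> e = 1"
    using e by (simp add: dot_square_norm)
  let ?c = "1 / (L + 2)"
  have "upward_cone \<Omega> x0 r ?c e"
    unfolding upward_cone_def
  proof (intro allI impI)
    fix v s b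
    assume v: "v \<in> \<Omega>" "v \<in> ball x0 r" and "0 < s" and b: "norm b < ?c" and w: "v + s *\<^sub>R (e + b) \<in> ball x0 r"
    let ?w = "s *\<^sub>R (e + b)"
    let ?p = "\<lambda>y. y - (y \<bullet> e) *\<^sub>R e"
    have perp: "?p y \<in> {z. z \<bullet> e = 0}" for y
      using ee by (simp add: inner_diff_left)
    have "?p (v + ?w) - ?p v = s *\<^sub>R ?p b"
      using ee by (simp add: inner_add_left algebra_simps)
    then have "dist (?p (v + ?w)) (?p v) \<le> s * norm b"
      using norm_projection_le[OF e, of b] \<open>0 < s\<close> by (simp add: dist_norm)
    then have "dist (\<gamma> (?p (v + ?w))) (\<gamma> (?p v)) \<le> L * (s * norm b)"
      using lipschitz_onD[OF L perp perp, of "v + ?w" v] L0 by (meson mult_left_mono order_trans)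
    then have 1: "\<gamma> (?p (v + ?w)) \<le> \<gamma> (?p v) + L * (s * norm b)"
      by (simp add: dist_real_def)
    have 2: "\<gamma> (?p v) < v \<bullet> e"
      using v \<Omega> by blast
    have "\<bar>b \<bullet> e\<bar> \<le> norm b"
      using Cauchy_Schwarz_ineq2[of b e] e by simp
    then have "s * (1 - norm b) \<le> s * (1 + b \<bullet> e)"
      using \<open>0 < s\<close> by (intro mult_left_mono) auto
    also have "\<dots> = ?w \<bullet> e"
      using ee by (simp add: inner_add_left)
    finally have 3: "s * (1 - norm b) \<le> ?w \<bullet> e" .
    have "(L + 1) * norm b \<le> (L + 1) * ?c"
      using b L0 by (intro mult_left_mono) auto
    also have "\<dots> < 1"
      using L0 by (simp add: field_simps)
    finally have "s * ((L + 1) * norm b) \<le> s * 1"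
      using \<open>0 < s\<close> by (intro mult_left_mono) auto
    then have "L * (s * norm b) \<le> s * (1 - norm b)"
      by (simp add: algebra_simps)
    with 1 2 3 have "\<gamma> (?p (v + ?w)) < (v + ?w) \<bullet> e"
      by (simp add: inner_add_left)
    then have "v + ?w \<in> \<Omega> \<inter> ball x0 r"
      unfolding \<Omega> using w by blast
    then show "v + ?w \<in> \<Omega>"
      by blast
  qed
  with r e L0 show ?thesis
    by (intro exI[of _ r] conjI exI[of _ ?c] exI[of _ e]) auto
qed

text \<open>The boundary function is the lower envelope of the cones with vertices in \<open>\<Omega>\<close>;
  as an infimum of uniformly Lipschitz functions it is Lipschitz on the whole hyperplane.\<close>

lemma lipschitz_boundary_if_upward_cone:
  fixes \<Omega> :: "(real^'n::finite) set"
  assumes "open \<Omega>" and cone: "\<And>x0. x0 \<in> frontier \<Omega> \<Longrightarrow> \<exists>r>0. \<exists>c>0. \<exists>e. norm e = 1 \<and> upward_cone \<Omega> x0 r c e"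
  shows "lipschitz_boundary \<Omega>"
  unfolding lipschitz_boundary_def
proof
  fix x0 assume x0: "x0 \<in> frontier \<Omega>"
  obtain r c e where r: "r > 0" and c: "c > 0" and e: "norm e = 1" and up: "upward_cone \<Omega> x0 r c e"
    using cone[OF x0] by blast
  have ee: "e \<bullet> e = 1"
    using e by (simp add: dot_square_norm)
  let ?M = "1 / c"
  let ?p = "\<lambda>y. y - (y \<bullet> e) *\<^sub>R e"
  let ?A = "\<Omega> \<inter> ball x0 r"
  have "x0 \<in> closure \<Omega>"
    using x0 by (simp add: frontier_def)
  then obtain u0 where "u0 \<in> \<Omega>" "dist u0 x0 < r"
    using r closure_approachable by blast
  then have ne: "?A \<noteq> {}"
    by (auto simp: dist_commute)
  define \<gamma> where "\<gamma> z = (INF u\<in>?A. u \<bullet> e + ?M * norm (z - ?p u))" for z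
  have bdd: "bdd_below ((\<lambda>u. u \<bullet> e + ?M * norm (z - ?p u)) ` ?A)" for z
  proof (rule bdd_belowI2)
    fix u assume "u \<in> ?A"
    then have "\<bar>(u - x0) \<bullet> e\<bar> \<le> r"
      using Cauchy_Schwarz_ineq2[of "u - x0" e] e by (simp add: dist_norm norm_minus_commute)
    then have "x0 \<bullet> e - r \<le> u \<bullet> e"
      by (simp add: inner_diff_left)
    moreover have "0 \<le> ?M * norm (z - ?p u)"
      using c by simp
    ultimately show "x0 \<bullet> e - r \<le> u \<bullet> e + ?M * norm (z - ?p u)"
      by linarith
  qed
  have le: "\<gamma> z \<le> \<gamma> z' + ?M * dist z z'" for z z'
  proof -
    have "\<gamma> z - ?M * dist z z' \<le> u \<bullet> e + ?M * norm (z' - ?p u)" if "u \<in> ?A" for u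
    proof -
      have "\<gamma> z \<le> u \<bullet> e + ?M * norm (z - ?p u)"
        unfolding \<gamma>_def by (rule cINF_lower[OF bdd that])
      also have "\<dots> \<le> u \<bullet> e + ?M * (dist z z' + norm (z' - ?p u))"
      proof (intro add_left_mono mult_left_mono)
        show "norm (z - ?p u) \<le> dist z z' + norm (z' - ?p u)"
          using norm_triangle_ineq[of "z - z'" "z' - ?p u"]
          by (simp only: add_diff_eq diff_add_cancel dist_norm)
      qed (use c in simp)
      finally show ?thesis
        by (simp add: algebra_simps)
    qed
    then have "\<gamma> z - ?M * dist z z' \<le> \<gamma> z'"
      unfolding \<gamma>_def[of z'] by (intro cINF_greatest ne)
    then show ?thesis
      by simp
  qed
  have lip: "?M-lipschitz_on {z. z \<bullet> e = 0} \<gamma>"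
  proof (rule lipschitz_onI)
    fix x y
    show "dist (\<gamma> x) (\<gamma> y) \<le> ?M * dist x y"
      using le[of x y] le[of y x] by (simp add: dist_real_def dist_commute)
  qed (use c in simp)
  have "?A = {y \<in> ball x0 r. \<gamma> (?p y) < y \<bullet> e}"
  proof (intro set_eqI iffI)
    fix y assume y: "y \<in> ?A"
    have "open ?A"
      using \<open>open \<Omega>\<close> by auto
    then obtain d where d: "d > 0" "cball y d \<subseteq> ?A"
      using y open_contains_cball by blast
    \<comment> \<open>A point of the set slightly below \<open>y\<close> makes the inequality strict.\<close>
    let ?u = "y - d *\<^sub>R e"
    have "?u \<in> ?A"
      using d e by (intro subsetD[OF d(2)]) (simp add: dist_norm)
    then have "\<gamma> (?p y) \<le> ?u \<bullet> e + ?M * norm (?p y - ?p ?u)"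
      unfolding \<gamma>_def by (rule cINF_lower[OF bdd])
    also have "?p y - ?p ?u = 0"
      using ee by (simp add: inner_diff_left algebra_simps)
    finally have "\<gamma> (?p y) < y \<bullet> e"
      using ee d(1) by (simp add: inner_diff_left)
    with y show "y \<in> {y \<in> ball x0 r. \<gamma> (?p y) < y \<bullet> e}"
      by blast
  next
    fix y assume "y \<in> {y \<in> ball x0 r. \<gamma> (?p y) < y \<bullet> e}"
    then have y: "y \<in> ball x0 r" "\<gamma> (?p y) < y \<bullet> e"
      by auto
    then obtain u where u: "u \<in> ?A" "u \<bullet> e + ?M * norm (?p y - ?p u) < y \<bullet> e"
      unfolding \<gamma>_def using cINF_less_iff[OF ne bdd] by blast
    let ?s = "(y - u) \<bullet> e"
    have "0 \<le> ?M * norm (?p y - ?p u)"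
      using c by simp
    then have s: "?M * norm (?p y - ?p u) < ?s" "0 < ?s"
      using u(2) by (auto simp: inner_diff_left)
    let ?b = "(1 / ?s) *\<^sub>R (?p y - ?p u)"
    have "norm (?p y - ?p u) < c * ?s"
      using s c by (simp add: field_simps)
    then have "norm (?p y - ?p u) / ?s < c"
      using s(2) by (simp add: pos_divide_less_eq)
    moreover have "norm ?b = norm (?p y - ?p u) / ?s"
      unfolding norm_scaleR using s(2) by (simp only: abs_of_pos real_norm_def abs_divide abs_one) simp
    ultimately have "norm ?b < c"
      by (simp only:)
    moreover have yu: "y = u + ?s *\<^sub>R (e + ?b)"
    proof -
      have "?s *\<^sub>R ?b = ?p y - ?p u"
        using s(2) by simp
      then show ?thesis
        unfolding scaleR_add_right by (simp add: inner_diff_left algebra_simps)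
    qed
    ultimately have "y \<in> \<Omega>"
      using up u(1) s(2) y(1) unfolding upward_cone_def by (metis IntE)
    with y(1) show "y \<in> ?A"
      by blast
  qed
  with r e lip show "\<exists>r>0. \<exists>e \<gamma> L. norm e = 1 \<and> L-lipschitz_on {z. z \<bullet> e = 0} \<gamma>
     \<and> \<Omega> \<inter> ball x0 r = {y \<in> ball x0 r. \<gamma> (y - (y \<bullet> e) *\<^sub>R e) < y \<bullet> e}"
    by blast
qed

subsection \<open>Functions on a Lipschitz domain\<close>

text \<open>Two nearby points \<open>x\<close> and \<open>x + z\<close> of the domain can both be joined by a segment to the point \<open>x + z + M |z| e\<close>. The
  second segment points in the direction \<open>e\<close>, and the first one lies in the cone above \<open>x\<close> if the slope \<open>M\<close> exceeds
  \<open>1 / c\<close>. Near an interior point of the domain one may take \<open>M = 0\<close>.\<close>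

lemma two_segments:
  fixes V :: "(real^'n::finite) set"
  assumes "open V" "lipschitz_boundary V" "y \<in> closure V"
  shows "\<exists>r>0. \<exists>M\<ge>0. \<exists>e. norm e = 1 \<and> (\<forall>x z t. x \<in> V \<longrightarrow> x \<in> ball y r \<longrightarrow> x + z \<in> V \<longrightarrow> x + z \<in> ball y r \<longrightarrow> 0 \<le> t \<longrightarrow> t \<le> 1 \<longrightarrow>
     x + t *\<^sub>R (z + (M * norm z) *\<^sub>R e) \<in> V \<and> x + z + t *\<^sub>R ((M * norm z) *\<^sub>R e) \<in> V)"
proof (cases "y \<in> V")
  case True
  then obtain r where r: "r > 0" "ball y r \<subseteq> V"
    using \<open>open V\<close> open_contains_ball by blast
  have "x + t *\<^sub>R z \<in> V" if "x \<in> ball y r" "x + z \<in> ball y r" "0 \<le> t" "t \<le> 1" for x z t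
  proof -
    have "(1 - t) *\<^sub>R x + t *\<^sub>R (x + z) \<in> ball y r"
      using that convexD[OF convex_ball[of y r] that(1,2), of "1 - t" t] by simp
    then show ?thesis
      using r(2) by (auto simp: algebra_simps)
  qed
  then show ?thesis
    using r(1) by (intro exI[of _ r] conjI exI[of _ 0] exI[of _ "axis undefined 1"]) auto
next
  case False
  then have "y \<in> frontier V"
    using assms(3) \<open>open V\<close> by (simp add: frontier_def interior_open)
  then obtain R c e where R: "R > 0" and c: "c > 0" and e: "norm e = 1" and up: "upward_cone V y R c e"
    using upward_cone_if_lipschitz_boundary[OF assms(2)] by blast
  \<comment> \<open>The choice of \<open>r\<close> keeps segments of length at most \<open>(1 + M) |z|\<close>, where \<open>|z| \<le> 2 r\<close>, in the ball of radius \<open>R\<close>.\<close>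
  define M where "M = 1 + 1 / c"
  have M: "M > 0" "1 / M < c"
    using c by (auto simp: M_def field_simps add_pos_pos)
  define r where "r = R / (2 * M + 3)"
  have r: "r > 0" "r * (2 * M + 3) = R"
    using R M(1) by (auto simp: r_def)
  have "x + t *\<^sub>R (z + (M * norm z) *\<^sub>R e) \<in> V \<and> x + z + t *\<^sub>R ((M * norm z) *\<^sub>R e) \<in> V"
    if x: "x \<in> V" "x \<in> ball y r" and xz: "x + z \<in> V" "x + z \<in> ball y r" and t: "0 \<le> t" "t \<le> 1" for x z t
  proof (cases "t = 0 \<or> z = 0")
    case True
    then show ?thesis
      using x xz by auto
  next
    case False
    then have tz: "t > 0" "norm z > 0"
      using t by auto
    have "norm z \<le> dist y x + dist y (x + z)"
      using norm_triangle_ineq4[of "x + z - y" "x - y"] by (simp add: dist_norm norm_minus_commute)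
    then have z: "norm z \<le> 2 * r"
      using x xz by simp
    then have Mz: "M * norm z \<le> 2 * M * r"
      using M(1) mult_left_mono[of "norm z" "2 * r" M] by simp
    have nM: "norm (t *\<^sub>R ((M * norm z) *\<^sub>R e)) \<le> 2 * M * r"
    proof -
      have "norm (t *\<^sub>R ((M * norm z) *\<^sub>R e)) = t * (M * norm z)"
        using t M e by simp
      also have "\<dots> \<le> M * norm z"
        using t M by (intro mult_left_le_one_le) auto
      finally show ?thesis
        using Mz by simp
    qed
    have nz: "norm (t *\<^sub>R z) \<le> 2 * r"
      using z t mult_left_le_one_le[of "norm z" t] by simp
    have rr: "r + (2 * r + 2 * M * r) = R"
      using r(2) by (simp add: algebra_simps)
    have "norm (t *\<^sub>R (z + (M * norm z) *\<^sub>R e)) \<le> 2 * r + 2 * M * r"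
      unfolding scaleR_add_right[of t z] by (rule norm_triangle_le) (use nM nz in linarith)
    then have in1: "x + t *\<^sub>R (z + (M * norm z) *\<^sub>R e) \<in> ball y R"
      using x(2) rr dist_triangle[of y "x + t *\<^sub>R (z + (M * norm z) *\<^sub>R e)" x] by (simp add: dist_norm)
    have in2: "x + z + t *\<^sub>R ((M * norm z) *\<^sub>R e) \<in> ball y R"
      using xz(2) nM rr r(1) dist_triangle[of y "x + z + t *\<^sub>R ((M * norm z) *\<^sub>R e)" "x + z"] by (simp add: dist_norm)
    have s: "t * (M * norm z) > 0"
      using tz M by simp
    have "2 * M * r > 0"
      using M r by simp
    then have "r \<le> R"
      using r(1) rr by linarith
    then have xR: "x \<in> ball y R" "x + z \<in> ball y R"
      using x xz by auto
    have "x + (t * (M * norm z)) *\<^sub>R (e + (1 / (M * norm z)) *\<^sub>R z) = x + t *\<^sub>R (z + (M * norm z) *\<^sub>R e)"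
      using tz M by (simp add: algebra_simps)
    moreover have "norm ((1 / (M * norm z)) *\<^sub>R z) < c"
      using tz M by simp
    ultimately have 1: "x + t *\<^sub>R (z + (M * norm z) *\<^sub>R e) \<in> V"
      using up x(1) xR(1) s in1 unfolding upward_cone_def by metis
    have "x + z + (t * (M * norm z)) *\<^sub>R (e + 0) = x + z + t *\<^sub>R ((M * norm z) *\<^sub>R e)"
      by simp
    moreover have "norm (0 :: real^'n) < c"
      using c by simp
    ultimately have "x + z + t *\<^sub>R ((M * norm z) *\<^sub>R e) \<in> V"
      using up xz(1) xR(2) s in2 unfolding upward_cone_def by metis
    with 1 show ?thesis ..
  qed
  with r(1) M(1) e show ?thesis
    by (intro exI[of _ r] conjI exI[of _ M] exI[of _ e]) auto
qed

text \<open>The increment from \<open>x\<close> to \<open>x + z\<close> is the difference of the increments along the two segments.\<close>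

lemma local_translation_estimate:
  fixes V :: "(real^'n::finite) set"
  assumes "open V" "1 \<le> p" "norm e = 1" "M \<ge> 0"
    and u[measurable]: "u \<in> borel_measurable borel" and g: "\<And>i. g i \<in> borel_measurable borel"
    and weak: "\<And>i. has_weak_deriv V (mi_unit i) u (g i)"
    and "open E"
    and seg1: "\<And>x t. x \<in> E \<Longrightarrow> 0 \<le> t \<Longrightarrow> t \<le> 1 \<Longrightarrow> x + t *\<^sub>R (z + (M * norm z) *\<^sub>R e) \<in> V"
    and seg2: "\<And>x t. x \<in> E \<Longrightarrow> 0 \<le> t \<Longrightarrow> t \<le> 1 \<Longrightarrow> x + z + t *\<^sub>R ((M * norm z) *\<^sub>R e) \<in> V"
  shows "(\<integral>\<^sup>+x. ennreal (\<bar>u (x + z) - u x\<bar> powr p) * indicator E x \<partial>lborel)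
     \<le> ennreal (norm z powr p) * (ennreal (2 powr p * (2 * (real CARD('n) * (1 + M)) powr p)) * (\<Sum>i\<in>UNIV. Ip p V (g i)))"
proof -
  let ?v = "(M * norm z) *\<^sub>R e"
  let ?w = "z + ?v"
  let ?G = "\<Sum>i\<in>UNIV. Ip p V (g i)"
  let ?E' = "{x. x - z \<in> E}"
  have [measurable]: "E \<in> sets borel"
    using \<open>open E\<close> by simp
  have E': "open ?E'"
  proof -
    have "continuous_on UNIV (\<lambda>x. x - z)"
      by (intro continuous_intros)
    from open_vimage[OF \<open>open E\<close> this] show ?thesis
      by (simp add: vimage_def)
  qed
  then have [measurable]: "?E' \<in> sets borel"
    by simp
  have v: "norm ?v = M * norm z"
    using assms by simp
  let ?N = "ennreal ((real CARD('n) * ((1 + M) * norm z)) powr p)"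
  have N: "ennreal ((real CARD('n) * norm w) powr p) * ?G \<le> ?N * ?G" if "norm w \<le> (1 + M) * norm z" for w :: "real^'n"
    using that assms by (intro mult_right_mono ennreal_leI powr_mono2 mult_left_mono) auto
  have 1: "(\<integral>\<^sup>+x. ennreal (\<bar>u (x + ?w) - u x\<bar> powr p) * indicator E x \<partial>lborel) \<le> ?N * ?G"
  proof (rule order_trans[OF translation_estimate[OF \<open>open V\<close> weak u g \<open>open E\<close> seg1 \<open>1 \<le> p\<close>] N])
    show "norm ?w \<le> (1 + M) * norm z"
      using norm_triangle_ineq[of z ?v] unfolding v by (simp add: algebra_simps)
  qed
  have 2: "(\<integral>\<^sup>+x. ennreal (\<bar>u (x + z + ?v) - u (x + z)\<bar> powr p) * indicator E x \<partial>lborel) \<le> ?N * ?G"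
  proof -
    have "(\<integral>\<^sup>+x. ennreal (\<bar>u (x + z + ?v) - u (x + z)\<bar> powr p) * indicator E x \<partial>lborel)
       \<le> (\<integral>\<^sup>+y. ennreal (\<bar>u (y + ?v) - u y\<bar> powr p) * indicator ?E' y \<partial>lborel)"
      by (rule nn_integral_shift_indicator_le[of "\<lambda>y. ennreal (\<bar>u (y + ?v) - u y\<bar> powr p)"]) auto
    also have "\<dots> \<le> ennreal ((real CARD('n) * norm ?v) powr p) * ?G"
    proof (rule translation_estimate[OF \<open>open V\<close> weak u g E' _ \<open>1 \<le> p\<close>])
      show "x + t *\<^sub>R ?v \<in> V" if "x \<in> ?E'" "0 \<le> t" "t \<le> 1" for x t
        using seg2[of "x - z" t] that by simp
    qed
    also have "\<dots> \<le> ?N * ?G"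
      unfolding v using assms by (intro mult_right_mono ennreal_leI powr_mono2 mult_left_mono) auto
    finally show ?thesis .
  qed
  have "(\<integral>\<^sup>+x. ennreal (\<bar>u (x + z) - u x\<bar> powr p) * indicator E x \<partial>lborel)
    \<le> (\<integral>\<^sup>+x. ennreal (2 powr p) * (ennreal (\<bar>u (x + ?w) - u x\<bar> powr p) * indicator E x
        + ennreal (\<bar>u (x + z + ?v) - u (x + z)\<bar> powr p) * indicator E x) \<partial>lborel)"
  proof (rule nn_integral_mono)
    fix x
    have "\<bar>(u (x + ?w) - u x) + - (u (x + z + ?v) - u (x + z))\<bar> powr p
       \<le> 2 powr p * (\<bar>u (x + ?w) - u x\<bar> powr p + \<bar>- (u (x + z + ?v) - u (x + z))\<bar> powr p)"
      using \<open>1 \<le> p\<close> by (intro powr_abs_add_le) simp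
    moreover have "(u (x + ?w) - u x) + - (u (x + z + ?v) - u (x + z)) = u (x + z) - u x"
      by (simp add: add.assoc)
    ultimately have "\<bar>u (x + z) - u x\<bar> powr p
       \<le> 2 powr p * (\<bar>u (x + ?w) - u x\<bar> powr p + \<bar>u (x + z + ?v) - u (x + z)\<bar> powr p)"
      by (simp only: abs_minus_cancel)
    then have "ennreal (\<bar>u (x + z) - u x\<bar> powr p)
       \<le> ennreal (2 powr p) * (ennreal (\<bar>u (x + ?w) - u x\<bar> powr p) + ennreal (\<bar>u (x + z + ?v) - u (x + z)\<bar> powr p))"
      by (simp add: ennreal_leI flip: ennreal_plus ennreal_mult)
    then show "ennreal (\<bar>u (x + z) - u x\<bar> powr p) * indicator E x
       \<le> ennreal (2 powr p) * (ennreal (\<bar>u (x + ?w) - u x\<bar> powr p) * indicator E x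
        + ennreal (\<bar>u (x + z + ?v) - u (x + z)\<bar> powr p) * indicator E x)"
      by (auto simp: indicator_def)
  qed
  also have "\<dots> = ennreal (2 powr p) * ((\<integral>\<^sup>+x. ennreal (\<bar>u (x + ?w) - u x\<bar> powr p) * indicator E x \<partial>lborel)
      + (\<integral>\<^sup>+x. ennreal (\<bar>u (x + z + ?v) - u (x + z)\<bar> powr p) * indicator E x \<partial>lborel))"
    by (subst nn_integral_cmult, measurable) (subst nn_integral_add, measurable)
  also have "\<dots> \<le> ennreal (2 powr p) * (?N * ?G + ?N * ?G)"
    by (intro mult_left_mono add_mono 1 2) simp
  also have "\<dots> = ennreal (norm z powr p) * (ennreal (2 powr p * (2 * (real CARD('n) * (1 + M)) powr p)) * ?G)"
  proof -
    have "(real CARD('n) * ((1 + M) * norm z)) powr p = norm z powr p * (real CARD('n) * (1 + M)) powr p"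
      using \<open>M \<ge> 0\<close> by (simp add: powr_mult mult_ac)
    then show ?thesis
      by (simp add: ennreal_mult mult_2 distrib_right distrib_left mult_ac flip: mult_2)
  qed
  finally show ?thesis .
qed

text \<open>The compact closure is covered by finitely many balls on which pairs of points can be joined by two segments. If \<open>z\<close> is
  small, then \<open>x\<close> and \<open>x + z\<close> lie in a common ball.\<close>

theorem Gag_embedding_lipschitz_domain:
  fixes V :: "(real^'n::finite) set"
  assumes "lipschitz_domain V" "0 < \<theta>" "\<theta> < 1" "1 \<le> p"
  shows "\<exists>C\<ge>0. \<forall>u g. (\<forall>i. has_weak_deriv V (mi_unit i) u (g i)) \<longrightarrow>
     Gag \<theta> p V u \<le> ennreal C * (Ip p V u + (\<Sum>i\<in>UNIV. Ip p V (g i)))"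
proof -
  have V: "open V" "bounded V" "lipschitz_boundary V"
    using assms(1) by (auto simp: lipschitz_domain_def)
  let ?good = "\<lambda>y r M e. r > 0 \<and> M \<ge> 0 \<and> norm e = 1 \<and> (\<forall>x z t. x \<in> V \<longrightarrow> x \<in> ball y r \<longrightarrow> x + z \<in> V \<longrightarrow> x + z \<in> ball y r \<longrightarrow> 0 \<le> t \<longrightarrow> t \<le> 1 \<longrightarrow>
     x + t *\<^sub>R (z + (M * norm z) *\<^sub>R e) \<in> V \<and> x + z + t *\<^sub>R ((M * norm z) *\<^sub>R e) \<in> V)"
  have "\<forall>y\<in>closure V. \<exists>q. ?good y (fst q) (fst (snd q)) (snd (snd q))"
  proof
    fix y assume "y \<in> closure V"
    from two_segments[OF V(1,3) this] obtain r M e where "?good y r M e"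
      by blast
    then show "\<exists>q. ?good y (fst q) (fst (snd q)) (snd (snd q))"
      by (intro exI[of _ "(r, M, e)"]) simp
  qed
  from bchoice[OF this] obtain q where q: "\<forall>y\<in>closure V. ?good y (fst (q y)) (fst (snd (q y))) (snd (snd (q y)))"
    by blast
  define r where "r y = fst (q y)" for y
  define M where "M y = fst (snd (q y))" for y
  define e where "e y = snd (snd (q y))" for y
  have good: "?good y (r y) (M y) (e y)" if "y \<in> closure V" for y
    using q that by (simp add: r_def M_def e_def)
  have comp: "compact (closure V)"
    using V(2) by simp
  have op: "open (ball y (r y / 2))" if "y \<in> closure V" for y
    by simp
  have cov: "closure V \<subseteq> (\<Union>y\<in>closure V. ball y (r y / 2))"
    using good by force
  obtain Y where Y: "Y \<subseteq> closure V" "finite Y" "closure V \<subseteq> (\<Union>y\<in>Y. ball y (r y / 2))"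
    by (rule compactE_image[OF comp op cov])
  have Yne: "Y \<noteq> {}"
    using Y(3) assms(1) closure_subset[of V] by (auto simp: lipschitz_domain_def)
  define \<delta> where "\<delta> = Min ((\<lambda>y. r y / 2) ` Y)"
  have \<delta>: "\<delta> > 0" "\<And>y. y \<in> Y \<Longrightarrow> \<delta> \<le> r y / 2"
  proof -
    have "\<forall>y\<in>Y. 0 < r y / 2"
      using good Y(1) by force
    then show "\<delta> > 0"
      using Y(2) Yne by (simp add: \<delta>_def)
    show "\<delta> \<le> r y / 2" if "y \<in> Y" for y
      unfolding \<delta>_def using Y(2) that by (intro Min_le) auto
  qed
  define cy where "cy y = 2 powr p * (2 * (real CARD('n) * (1 + M y)) powr p)" for y
  have cy: "cy y \<ge> 0" for y
    by (simp add: cy_def)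
  have "\<exists>C\<ge>0. \<forall>u g. (\<forall>i. has_weak_deriv V (mi_unit i) u (g i)) \<longrightarrow> (AE x in lebesgue_on V. x \<in> {} \<longrightarrow> u x = 0) \<longrightarrow>
     Gag \<theta> p V u \<le> ennreal C * (Ip p V u + (\<Sum>i\<in>UNIV. Ip p V (g i)))"
  proof (rule Gag_embedding_if_shift_Lp_le[OF V(1) assms(2,3,4) \<delta>(1), of "\<Sum>y\<in>Y. cy y"])
    fix u :: "real^'n \<Rightarrow> real" and g :: "'n \<Rightarrow> real^'n \<Rightarrow> real" and z :: "real^'n"
    assume u[measurable]: "u \<in> borel_measurable borel" and g: "\<And>i. g i \<in> borel_measurable borel"
      and weak: "\<And>i. has_weak_deriv V (mi_unit i) u (g i)" and z: "norm z < \<delta>"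
    define E where "E y = {x \<in> V \<inter> ball y (r y). x + z \<in> V \<inter> ball y (r y)}" for y
    have openE: "open (E y)" for y
      using open_shift_dom[of "V \<inter> ball y (r y)" z] V(1) by (simp add: E_def shift_dom_def open_Int)
    have [measurable]: "E y \<in> sets borel" for y
      using openE by simp
    let ?h = "\<lambda>x. ennreal (\<bar>u (x + z) - u x\<bar> powr p)"
    let ?G = "\<Sum>i\<in>UNIV. Ip p V (g i)"
    have cover: "\<exists>y\<in>Y. x \<in> E y" if "x \<in> shift_dom V z" for x
    proof -
      have x: "x \<in> V" "x + z \<in> V"
        using that by (auto simp: shift_dom_def)
      then obtain y where y: "y \<in> Y" "x \<in> ball y (r y / 2)"
        using Y(3) closure_subset by blast
      have "dist y (x + z) \<le> dist y x + norm z"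
        using dist_triangle[of y "x + z" x] by (simp add: dist_norm)
      then have "x + z \<in> ball y (r y)" "x \<in> ball y (r y)"
        using y(2) z \<delta>(1) \<delta>(2)[OF y(1)] unfolding mem_ball by linarith+
      with x y show ?thesis
        by (auto simp: E_def)
    qed
    have "shift_Lp p V u z \<le> (\<integral>\<^sup>+x. (\<Sum>y\<in>Y. ?h x * indicator (E y) x) \<partial>lborel)"
      unfolding shift_Lp_def
    proof (rule nn_integral_mono)
      fix x
      show "?h x * indicator (shift_dom V z) x \<le> (\<Sum>y\<in>Y. ?h x * indicator (E y) x)"
      proof (cases "x \<in> shift_dom V z")
        case True
        then obtain y where y: "y \<in> Y" "x \<in> E y"
          using cover by blast
        have "?h x * indicator (E y) x \<le> (\<Sum>y\<in>Y. ?h x * indicator (E y) x)"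
          by (rule member_le_sum[OF y(1) _ Y(2)]) simp
        then show ?thesis
          using True y(2) by simp
      qed simp
    qed
    also have "\<dots> = (\<Sum>y\<in>Y. \<integral>\<^sup>+x. ?h x * indicator (E y) x \<partial>lborel)"
      by (rule nn_integral_sum) measurable
    also have "\<dots> \<le> (\<Sum>y\<in>Y. ennreal (norm z powr p) * (ennreal (cy y) * ?G))"
    proof (rule sum_mono)
      fix y assume "y \<in> Y"
      then have gy: "?good y (r y) (M y) (e y)"
        using good Y(1) by blast
      show "(\<integral>\<^sup>+x. ?h x * indicator (E y) x \<partial>lborel) \<le> ennreal (norm z powr p) * (ennreal (cy y) * ?G)"
        unfolding cy_def using gy
        by (intro local_translation_estimate[OF V(1) assms(4) _ _ u g weak openE, of "e y" "M y"]) (auto simp: E_def)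
    qed
    also have "\<dots> = ennreal (norm z powr p) * (ennreal (\<Sum>y\<in>Y. cy y) * ?G)"
      by (simp only: sum_distrib_left[symmetric] sum_distrib_right[symmetric] sum_ennreal[OF cy])
    finally show "shift_Lp p V u z \<le> ennreal (norm z powr p) * (ennreal (\<Sum>y\<in>Y. cy y) * ?G)" .
  qed (use cy in \<open>auto intro: sum_nonneg\<close>)
  then show ?thesis
    by simp
qed

section \<open>Diffeomorphic images of Lipschitz domains\<close>

context lipschitz_diffeo
begin

lemma DT_bounds: "\<exists>A\<ge>0. \<exists>\<Lambda>\<ge>0. (\<forall>x\<in>U. \<forall>h. norm (DT x h) \<le> A * norm h) \<and>
   (\<forall>x\<in>U. \<forall>y\<in>U. \<forall>h. norm (DT x h - DT y h) \<le> \<Lambda> * norm (x - y) * norm h)"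
proof -
  have bl: "bounded (partial_deriv i (\<lambda>x. T x $ j) ` U) \<and> (\<exists>L. L-lipschitz_on U (partial_deriv i (\<lambda>x. T x $ j)))" for i j
  proof -
    have "bdd_lip_deriv 1 U (\<lambda>x. T x $ j)"
      using bdd_lip_deriv_mono[OF T_bdd_lip k_pos] .
    then show ?thesis
      by simp
  qed
  have "\<exists>a l. \<forall>x\<in>U. \<bar>partial_deriv i (\<lambda>x. T x $ j) x\<bar> \<le> a
      \<and> (\<forall>y\<in>U. \<bar>partial_deriv i (\<lambda>x. T x $ j) x - partial_deriv i (\<lambda>x. T x $ j) y\<bar> \<le> l * norm (x - y))" for i j
  proof -
    obtain a where a: "\<forall>x\<in>U. \<bar>partial_deriv i (\<lambda>x. T x $ j) x\<bar> \<le> a"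
      using bl[of i j] by (auto simp: bounded_iff)
    obtain l where "l-lipschitz_on U (partial_deriv i (\<lambda>x. T x $ j))"
      using bl[of i j] by blast
    then have "\<forall>x\<in>U. \<forall>y\<in>U. \<bar>partial_deriv i (\<lambda>x. T x $ j) x - partial_deriv i (\<lambda>x. T x $ j) y\<bar> \<le> l * norm (x - y)"
      by (auto simp: lipschitz_on_def dist_norm)
    with a show ?thesis
      by blast
  qed
  then obtain a l where al: "\<And>i j x. x \<in> U \<Longrightarrow> \<bar>partial_deriv i (\<lambda>x. T x $ j) x\<bar> \<le> a i j"
    "\<And>i j x y. x \<in> U \<Longrightarrow> y \<in> U \<Longrightarrow> \<bar>partial_deriv i (\<lambda>x. T x $ j) x - partial_deriv i (\<lambda>x. T x $ j) y\<bar> \<le> l i j * norm (x - y)"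
    by metis
  have bound: "norm (\<chi> j. \<Sum>i\<in>UNIV. h $ i * b i j) \<le> (\<Sum>j\<in>UNIV. \<Sum>i\<in>UNIV. c i j) * norm h"
    if "\<And>i j. \<bar>b i j\<bar> \<le> c i j" for b c :: "'n \<Rightarrow> 'n \<Rightarrow> real" and h :: "real^'n"
  proof -
    have "norm (\<chi> j. \<Sum>i\<in>UNIV. h $ i * b i j) \<le> (\<Sum>j\<in>UNIV. \<bar>\<Sum>i\<in>UNIV. h $ i * b i j\<bar>)"
      using norm_le_l1_cart[of "\<chi> j. \<Sum>i\<in>UNIV. h $ i * b i j"] by simp
    also have "\<dots> \<le> (\<Sum>j\<in>UNIV. \<Sum>i\<in>UNIV. norm h * c i j)"
    proof (intro sum_mono order_trans[OF sum_abs])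
      fix i j
      show "\<bar>h $ i * b i j\<bar> \<le> norm h * c i j"
        unfolding abs_mult using that[of i j] by (intro mult_mono component_le_norm_cart) auto
    qed
    also have "\<dots> = (\<Sum>j\<in>UNIV. \<Sum>i\<in>UNIV. c i j) * norm h"
      by (simp add: sum_distrib_left mult.commute)
    finally show ?thesis .
  qed
  show ?thesis
  proof (intro exI conjI ballI allI)
    show "0 \<le> (\<Sum>j\<in>UNIV. \<Sum>i\<in>UNIV. \<bar>a i j\<bar>)" "0 \<le> (\<Sum>j\<in>UNIV. \<Sum>i\<in>UNIV. \<bar>l i j\<bar>)"
      by (auto intro!: sum_nonneg)
    show "norm (DT x h) \<le> (\<Sum>j\<in>UNIV. \<Sum>i\<in>UNIV. \<bar>a i j\<bar>) * norm h" if "x \<in> U" for x h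
      unfolding DT_def using al(1)[OF that] by (intro bound) (meson abs_ge_self order_trans)
    show "norm (DT x h - DT y h) \<le> (\<Sum>j\<in>UNIV. \<Sum>i\<in>UNIV. \<bar>l i j\<bar>) * norm (x - y) * norm h" if "x \<in> U" "y \<in> U" for x y h
    proof -
      have "DT x h - DT y h = (\<chi> j. \<Sum>i\<in>UNIV. h $ i * (partial_deriv i (\<lambda>x. T x $ j) x - partial_deriv i (\<lambda>x. T x $ j) y))"
        by (simp add: DT_def vec_eq_iff right_diff_distrib sum_subtractf)
      also have "norm \<dots> \<le> (\<Sum>j\<in>UNIV. \<Sum>i\<in>UNIV. \<bar>l i j\<bar> * norm (x - y)) * norm h"
        using al(2)[OF that] by (intro bound) (meson abs_ge_self mult_right_mono norm_ge_zero order_trans)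
      finally show ?thesis
        by (simp add: sum_distrib_right)
    qed
  qed
qed

lemma DT_DS: "y \<in> V \<Longrightarrow> DT (S y) (DS y h) = h"
proof -
  assume y: "y \<in> V"
  have "((\<lambda>y. T (S y)) has_derivative (\<lambda>h. DT (S y) (DS y h))) (at y)"
    by (rule has_derivative_compose[OF S_has_derivative[OF y] T_has_derivative[OF S_in[OF y]]])
  moreover have "((\<lambda>y. T (S y)) has_derivative (\<lambda>h. h)) (at y)"
    by (rule has_derivative_transform_within_open[OF has_derivative_ident open_V y]) (simp add: T_S)
  ultimately show ?thesis
    using has_derivative_unique by metis
qed

lemma DT_linear: "x \<in> U \<Longrightarrow> linear (DT x)"
  using T_has_derivative has_derivative_linear by blast

text \<open>The map \<open>T\<close> extends continuously to the boundary. Follow a segment in a narrow cone from a point of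
  \<open>U\<close>: as long as it stays in \<open>U\<close>, its image stays in the cone of \<open>V\<close>, because the derivative of
  \<open>T\<close> varies little. At a first exit time the image would therefore still lie in \<open>V\<close>, and by
  continuity of the inverse the segment would not have left \<open>U\<close>.\<close>

lemma upward_cone_pullback:
  assumes lipV: "lipschitz_boundary V" and x0: "x0 \<in> frontier U"
  shows "\<exists>r>0. \<exists>c>0. \<exists>e. norm e = 1 \<and> upward_cone U x0 r c e"
proof -
  have "L-lipschitz_on U T"
    using T_lipschitz L_pos by (intro lipschitz_onI) (auto simp: dist_norm)
  from lipschitz_extend_closure[OF this] obtain G where G: "L-lipschitz_on (closure U) G" "\<And>x. x \<in> U \<Longrightarrow> G x = T x"
    by blast
  have Gc: "continuous_on (closure U) G"
    using G(1) by (rule lipschitz_on_continuous_on)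
  have x0c: "x0 \<in> closure U" "x0 \<notin> U"
    using x0 open_U by (auto simp: frontier_def interior_open)
  have G_closure: "G x \<in> closure V" if "x \<in> closure U" for x
  proof -
    have "G ` closure U \<subseteq> closure V"
      using Gc G(2) T_in closure_subset by (intro image_closure_subset) (auto intro: subsetD[OF closure_subset])
    with that show ?thesis
      by blast
  qed
  \<comment> \<open>A point of the closure that the extension \<open>G\<close> of \<open>T\<close> maps into \<open>V\<close> belongs to \<open>U\<close>, since \<open>S\<close> is continuous at its image.\<close>
  have in_U: "x \<in> U" if x: "x \<in> closure U" "G x \<in> V" for x
  proof -
    obtain s where s: "\<And>n. s n \<in> U" "s \<longlonglongrightarrow> x"
      using x(1) closure_sequential by metis
    have "(\<lambda>n. G (s n)) \<longlonglongrightarrow> G x"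
      using Gc x(1) s closure_subset by (intro continuous_on_tendsto_compose[OF Gc s(2)]) (auto intro!: always_eventually)
    then have "(\<lambda>n. S (G (s n))) \<longlonglongrightarrow> S (G x)"
      using s(1) G(2) T_in x(2) by (intro continuous_on_tendsto_compose[OF S_continuous_on]) auto
    moreover have "S (G (s n)) = s n" for n
      using s(1) G(2) S_T by simp
    ultimately have "x = S (G x)"
      using s(2) LIMSEQ_unique by simp
    with S_in[OF x(2)] show ?thesis
      by simp
  qed
  let ?y0 = "G x0"
  have "?y0 \<notin> V"
    using in_U[OF x0c(1)] x0c(2) by blast
  then have "?y0 \<in> frontier V"
    using G_closure[OF x0c(1)] open_V by (simp add: frontier_def interior_open)
  then obtain r c e where r: "r > 0" and c: "c > 0" and e: "norm e = 1" and up: "upward_cone V ?y0 r c e"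
    using upward_cone_if_lipschitz_boundary[OF lipV] by blast
  obtain A \<Lambda> where A: "A \<ge> 0" "\<And>x h. x \<in> U \<Longrightarrow> norm (DT x h) \<le> A * norm h"
    and \<Lambda>: "\<Lambda> \<ge> 0" "\<And>x y h. x \<in> U \<Longrightarrow> y \<in> U \<Longrightarrow> norm (DT x h - DT y h) \<le> \<Lambda> * norm (x - y) * norm h"
    using DT_bounds by blast
  \<comment> \<open>The increment of \<open>T\<close> along a vector \<open>s (e' + b)\<close> is to differ from \<open>s \<kappa> e\<close> by at most \<open>s \<kappa> c / 2\<close>, where
    \<open>\<kappa> \<ge> 1 / Bn\<close>. The opening \<open>c'\<close> bounds the contribution of \<open>b\<close>, and the radius \<open>\<rho>\<close> that of the
    variation of the derivative of \<open>T\<close>, by \<open>s \<kappa> c / 4\<close> each; moreover, \<open>\<rho> \<le> r / L\<close> keeps the images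
    in the ball of radius \<open>r\<close>.\<close>
  define c' where "c' = min 1 (c / (4 * (A * Bn + 1)))"
  have ABn: "A * Bn \<ge> 0"
    using A Bn_pos by simp
  have c': "0 < c'" "c' \<le> 1" "A * Bn * c' \<le> c / 4"
  proof -
    show "0 < c'" "c' \<le> 1"
      using c ABn by (auto simp: c'_def)
    have "A * Bn * c' \<le> (A * Bn + 1) * (c / (4 * (A * Bn + 1)))"
      using ABn c by (intro mult_mono) (auto simp: c'_def)
    also have "\<dots> = c / 4"
      using ABn by (simp add: field_simps)
    finally show "A * Bn * c' \<le> c / 4" .
  qed
  define \<rho> where "\<rho> = min (r / L) (c / (16 * (\<Lambda> * Bn + 1)))"
  have \<Lambda>Bn: "\<Lambda> * Bn \<ge> 0"
    using \<Lambda> Bn_pos by simp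
  have \<rho>: "0 < \<rho>" "L * \<rho> \<le> r" "4 * (\<Lambda> * Bn * \<rho>) \<le> c / 4"
  proof -
    show "0 < \<rho>"
      using r L_pos c \<Lambda>Bn by (auto simp: \<rho>_def)
    have "\<rho> \<le> r / L"
      by (simp add: \<rho>_def)
    then show "L * \<rho> \<le> r"
      using L_pos by (simp add: field_simps)
    have "\<Lambda> * Bn * \<rho> \<le> (\<Lambda> * Bn + 1) * (c / (16 * (\<Lambda> * Bn + 1)))"
      using \<Lambda>Bn c \<open>0 < \<rho>\<close> by (intro mult_mono) (auto simp: \<rho>_def)
    also have "\<dots> = c / 16"
      using \<Lambda>Bn by (simp add: field_simps)
    finally show "4 * (\<Lambda> * Bn * \<rho>) \<le> c / 4"
      by simp
  qed
  obtain u1 where u1: "u1 \<in> U" "u1 \<in> ball x0 \<rho>"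
    using x0c(1) \<rho>(1) closure_approachable by (metis dist_commute mem_ball)
  \<comment> \<open>At a fixed point \<open>u1\<close> near \<open>x0\<close>, the direction that the derivative of \<open>T\<close> maps to a positive multiple of \<open>e\<close>.\<close>
  define a where "a = DS (T u1) e"
  have Da: "DT u1 a = e"
    using DT_DS[OF T_in[OF u1(1)], of e] S_T[OF u1(1)] by (simp add: a_def)
  have "a \<noteq> 0"
    using Da e linear_0[OF DT_linear[OF u1(1)]] by auto
  have na: "0 < norm a" "norm a \<le> Bn"
    using \<open>a \<noteq> 0\<close> norm_DS_le[OF T_in[OF u1(1)], of e] e by (auto simp: a_def)
  define e' where "e' = (1 / norm a) *\<^sub>R a"
  define \<kappa> where "\<kappa> = 1 / norm a"
  have e': "norm e' = 1"
    using \<open>a \<noteq> 0\<close> by (simp add: e'_def)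
  have \<kappa>: "\<kappa> > 0" "1 / \<kappa> \<le> Bn"
    using na by (auto simp: \<kappa>_def)
  have De': "DT u1 e' = \<kappa> *\<^sub>R e"
    by (simp add: e'_def \<kappa>_def linear_cmul[OF DT_linear[OF u1(1)]] Da)
  have "upward_cone U x0 \<rho> c' e'"
    unfolding upward_cone_def
  proof (intro allI impI)
    fix u s b
    assume u: "u \<in> U" "u \<in> ball x0 \<rho>" and s: "0 < s" and b: "norm b < c'" and ub: "u + s *\<^sub>R (e' + b) \<in> ball x0 \<rho>"
    define w where "w = s *\<^sub>R (e' + b)"
    have nw: "norm w \<le> 2 * s"
      using norm_triangle_ineq[of e' b] e' b c'(2) s by (simp add: w_def)
    have seg_ball: "u + t *\<^sub>R w \<in> ball x0 \<rho>" if "0 \<le> t" "t \<le> 1" for t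
    proof -
      have "(1 - t) *\<^sub>R u + t *\<^sub>R (u + w) \<in> ball x0 \<rho>"
        using that ub u(2) unfolding w_def by (intro convexD[OF convex_ball]) auto
      then show ?thesis
        by (simp add: algebra_simps)
    qed
    have increment: "norm (T (u + t *\<^sub>R w) - T u - t *\<^sub>R (s *\<^sub>R (\<kappa> *\<^sub>R e))) \<le> t * (s * \<kappa> * (c / 2))"
      if t: "0 \<le> t" "t \<le> 1" and inside: "\<And>\<tau>. 0 \<le> \<tau> \<Longrightarrow> \<tau> \<le> t \<Longrightarrow> u + \<tau> *\<^sub>R w \<in> U" for t
    proof -
      let ?X = "U \<inter> ball x0 \<rho>"
      have "norm (T (u + t *\<^sub>R w) - T u - DT u1 ((u + t *\<^sub>R w) - u)) \<le> norm ((u + t *\<^sub>R w) - u) * (\<Lambda> * (2 * \<rho>))"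
      proof (rule differentiable_bound_linearization[where S = ?X and f' = DT and ?x0.0 = u1])
        show "u + \<tau> *\<^sub>R (u + t *\<^sub>R w - u) \<in> ?X" if "\<tau> \<in> {0..1}" for \<tau>
        proof -
          have \<tau>: "0 \<le> \<tau> * t" "\<tau> * t \<le> t"
            using that t by (auto simp: mult_left_le_one_le)
          then show ?thesis
            using inside[OF \<tau>] seg_ball[of "\<tau> * t"] t by simp
        qed
        show "(T has_derivative DT x) (at x within ?X)" if "x \<in> ?X" for x
          using that T_has_derivative has_derivative_at_withinI by blast
        show "onorm (DT x - DT u1) \<le> \<Lambda> * (2 * \<rho>)" if x: "x \<in> ?X" for x
        proof (rule onorm_le)
          fix h :: "real^'n"
          have "norm (x - u1) \<le> 2 * \<rho>"
            using x u1(2) dist_triangle2[of x u1 x0] by (simp add: dist_norm norm_minus_commute)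
          then have "\<Lambda> * norm (x - u1) * norm h \<le> \<Lambda> * (2 * \<rho>) * norm h"
            using \<Lambda>(1) by (intro mult_right_mono mult_left_mono) auto
          then show "norm ((DT x - DT u1) h) \<le> \<Lambda> * (2 * \<rho>) * norm h"
            using \<Lambda>(2)[of x u1 h] x u1(1) by simp
        qed
        show "u1 \<in> ?X"
          using u1 by simp
      qed
      also have "norm ((u + t *\<^sub>R w) - u) * (\<Lambda> * (2 * \<rho>)) \<le> (t * (2 * s)) * (\<Lambda> * (2 * \<rho>))"
        using nw t \<Lambda>(1) \<rho>(1) by (intro mult_right_mono) (auto intro: mult_left_mono)
      finally have 1: "norm (T (u + t *\<^sub>R w) - T u - DT u1 (t *\<^sub>R w)) \<le> (t * (2 * s)) * (\<Lambda> * (2 * \<rho>))"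
        by simp
      have "DT u1 (t *\<^sub>R w) - t *\<^sub>R (s *\<^sub>R (\<kappa> *\<^sub>R e)) = (t * s) *\<^sub>R DT u1 b"
        by (simp add: w_def linear_cmul[OF DT_linear[OF u1(1)]] linear_add[OF DT_linear[OF u1(1)]] De' algebra_simps)
      then have 2: "norm (DT u1 (t *\<^sub>R w) - t *\<^sub>R (s *\<^sub>R (\<kappa> *\<^sub>R e))) \<le> t * s * (A * c')"
      proof -
        have "norm (DT u1 b) \<le> A * c'"
          using A(2)[OF u1(1), of b] A(1) b by (meson less_imp_le mult_left_mono order_trans)
        then have "norm ((t * s) *\<^sub>R DT u1 b) \<le> t * s * (A * c')"
          using t s by (simp add: mult_left_mono abs_mult)
        then show ?thesis
          using \<open>DT u1 (t *\<^sub>R w) - t *\<^sub>R (s *\<^sub>R (\<kappa> *\<^sub>R e)) = (t * s) *\<^sub>R DT u1 b\<close> by simp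
      qed
      have "4 * \<Lambda> * \<rho> + A * c' \<le> \<kappa> * (c / 2)"
      proof -
        have "4 * \<Lambda> * \<rho> + A * c' \<ge> 0"
          using \<Lambda> \<rho> A c' by simp
        then have "(4 * \<Lambda> * \<rho> + A * c') * (1 / \<kappa>) \<le> (4 * \<Lambda> * \<rho> + A * c') * Bn"
          using \<kappa>(2) by (intro mult_left_mono) auto
        also have "\<dots> = 4 * (\<Lambda> * Bn * \<rho>) + A * Bn * c'"
          by (simp add: algebra_simps)
        also have "\<dots> \<le> c / 2"
          using c'(3) \<rho>(3) by linarith
        finally show ?thesis
          using \<kappa>(1) by (simp add: field_simps)
      qed
      then have "t * s * (4 * \<Lambda> * \<rho> + A * c') \<le> t * s * (\<kappa> * (c / 2))"
        using t s by (intro mult_left_mono) auto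
      moreover have "norm (T (u + t *\<^sub>R w) - T u - t *\<^sub>R (s *\<^sub>R (\<kappa> *\<^sub>R e)))
        \<le> (t * (2 * s)) * (\<Lambda> * (2 * \<rho>)) + t * s * (A * c')"
        using norm_triangle_le[OF add_mono[OF 1 2]] by (simp add: algebra_simps)
      ultimately show ?thesis
        by (simp add: algebra_simps)
    qed
    define X where "X = {t \<in> {0..1}. u + t *\<^sub>R w \<notin> U}"
    have "X = {}"
    proof (rule ccontr)
      assume "X \<noteq> {}"
      have "X = {0..1} \<inter> (\<lambda>t. u + t *\<^sub>R w) -` (- U)"
        by (auto simp: X_def)
      moreover have "closed ((\<lambda>t. u + t *\<^sub>R w) -` (- U))"
        using open_U by (intro closed_vimage continuous_intros) auto
      ultimately have "compact X"
        by (simp add: compact_Int_closed)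
      \<comment> \<open>The first exit time; the estimate for the increments holds up to it by passage to the limit.\<close>
      then obtain t0 where t0: "t0 \<in> X" "\<And>t. t \<in> X \<Longrightarrow> t0 \<le> t"
        using compact_attains_inf[OF _ \<open>X \<noteq> {}\<close>] by blast
      have t01: "0 \<le> t0" "t0 \<le> 1" "u + t0 *\<^sub>R w \<notin> U"
        using t0(1) by (auto simp: X_def)
      then have "t0 \<noteq> 0"
        using u(1) by (intro notI) simp
      with t01 have t0pos: "0 < t0"
        by simp
      have before: "u + t *\<^sub>R w \<in> U" if "0 \<le> t" "t < t0" for t
        using t0(2)[of t] that t01(2) by (force simp: X_def)
      define tn where "tn n = t0 * (1 - 1 / real (Suc n))" for n
      have tn: "0 \<le> tn n" "tn n < t0" for n
        using t0pos by (auto simp: tn_def field_simps)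
      have "(\<lambda>n. t0 * (1 - inverse (real (Suc n)))) \<longlonglongrightarrow> t0 * (1 - 0)"
        by (intro tendsto_intros LIMSEQ_inverse_real_of_nat)
      then have tn_lim: "tn \<longlonglongrightarrow> t0"
        by (simp add: tn_def[abs_def] inverse_eq_divide)
      let ?x = "u + t0 *\<^sub>R w"
      have x_lim: "(\<lambda>n. u + tn n *\<^sub>R w) \<longlonglongrightarrow> ?x"
        by (intro tendsto_intros tn_lim)
      have x_cl: "?x \<in> closure U"
        unfolding closure_sequential
        by (intro exI[of _ "\<lambda>n. u + tn n *\<^sub>R w"] conjI allI x_lim before tn)
      have "(\<lambda>n. G (u + tn n *\<^sub>R w)) \<longlonglongrightarrow> G ?x"
        using before[OF tn]
        by (intro continuous_on_tendsto_compose[OF Gc x_lim x_cl] always_eventually allI subsetD[OF closure_subset])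
      then have T_lim: "(\<lambda>n. T (u + tn n *\<^sub>R w)) \<longlonglongrightarrow> G ?x"
        using G(2) before tn by simp
      have "norm (G ?x - T u - t0 *\<^sub>R (s *\<^sub>R (\<kappa> *\<^sub>R e))) \<le> t0 * (s * \<kappa> * (c / 2))"
      proof (rule LIMSEQ_le)
        show "(\<lambda>n. norm (T (u + tn n *\<^sub>R w) - T u - tn n *\<^sub>R (s *\<^sub>R (\<kappa> *\<^sub>R e)))) \<longlonglongrightarrow> norm (G ?x - T u - t0 *\<^sub>R (s *\<^sub>R (\<kappa> *\<^sub>R e)))"
          by (intro tendsto_intros T_lim tn_lim)
        show "(\<lambda>n. tn n * (s * \<kappa> * (c / 2))) \<longlonglongrightarrow> t0 * (s * \<kappa> * (c / 2))"
          by (intro tendsto_intros tn_lim)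
        show "\<exists>N. \<forall>n\<ge>N. norm (T (u + tn n *\<^sub>R w) - T u - tn n *\<^sub>R (s *\<^sub>R (\<kappa> *\<^sub>R e))) \<le> tn n * (s * \<kappa> * (c / 2))"
        proof (intro exI allI impI)
          fix n
          show "norm (T (u + tn n *\<^sub>R w) - T u - tn n *\<^sub>R (s *\<^sub>R (\<kappa> *\<^sub>R e))) \<le> tn n * (s * \<kappa> * (c / 2))"
          proof (rule increment[OF tn(1)])
            show "tn n \<le> 1"
              using tn(2)[of n] t01(2) by linarith
            show "u + \<tau> *\<^sub>R w \<in> U" if "0 \<le> \<tau>" "\<tau> \<le> tn n" for \<tau>
              using that tn(2)[of n] by (intro before) auto
          qed
        qed
      qed
      moreover define s' where "s' = t0 * s * \<kappa>"
      moreover have s': "s' > 0"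
        using t0pos s \<kappa>(1) by (simp add: s'_def)
      ultimately have near: "norm (G ?x - T u - s' *\<^sub>R e) \<le> s' * (c / 2)"
        by (simp add: mult_ac)
      define \<beta> where "\<beta> = (1 / s') *\<^sub>R (G ?x - T u - s' *\<^sub>R e)"
      have "norm \<beta> = norm (G ?x - T u - s' *\<^sub>R e) / s'"
        unfolding \<beta>_def norm_scaleR using s' by simp
      also have "\<dots> \<le> c / 2"
        using near s' by (simp only: pos_divide_le_eq mult.commute)
      finally have "norm \<beta> \<le> c / 2" .
      then have \<beta>: "norm \<beta> < c"
        using c by simp
      have Gx: "G ?x = T u + s' *\<^sub>R (e + \<beta>)"
        using s' by (simp add: \<beta>_def scaleR_add_right)
      have in_ball: "G x \<in> ball ?y0 r" if "x \<in> closure U" "x \<in> ball x0 \<rho>" for x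
      proof -
        have "dist (G x0) (G x) \<le> L * dist x0 x"
          by (rule lipschitz_onD[OF G(1) x0c(1) that(1)])
        also have "\<dots> < L * \<rho>"
          using that(2) L_pos by simp
        finally show ?thesis
          using \<rho>(2) by simp
      qed
      have "T u \<in> ball ?y0 r"
        using in_ball[of u] u G(2)[OF u(1)] closure_subset by auto
      moreover have "G ?x \<in> ball ?y0 r"
        using in_ball[OF x_cl seg_ball[OF t01(1,2)]] .
      ultimately have "G ?x \<in> V"
        using up T_in[OF u(1)] s' \<beta> unfolding upward_cone_def Gx by blast
      then have "?x \<in> U"
        by (rule in_U[OF x_cl])
      with t01(3) show False ..
    qed
    then have "(1 :: real) \<notin> X"
      by simp
    then show "u + s *\<^sub>R (e' + b) \<in> U"
      by (simp add: X_def w_def)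
  qed
  with \<rho>(1) c'(1) e' show ?thesis
    by blast
qed

theorem lipschitz_domain_pullback:
  assumes "lipschitz_domain V" "U \<noteq> {}" "bounded U"
  shows "lipschitz_domain U"
  using assms lipschitz_boundary_if_upward_cone[OF open_U upward_cone_pullback] open_U
  by (simp add: lipschitz_domain_def)

end


section \<open>Boundedness of the composition operator\<close>

lemma ennreal_powr_le:
  assumes "X \<le> ennreal (C * r powr p)" "0 \<le> C" "0 \<le> r" "0 < p"
  shows "ennreal_powr X (1 / p) \<le> ennreal (C powr (1 / p) * r)"
proof -
  have X: "X < top"
    using assms(1) by (rule order_le_less_trans) simp
  then have "enn2real X \<le> C * r powr p"
    using assms by (intro enn2real_leI) auto
  then have "enn2real X powr (1 / p) \<le> (C * r powr p) powr (1 / p)"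
    using assms by (intro powr_mono2) auto
  also have "\<dots> = C powr (1 / p) * r"
    using assms by (simp add: powr_mult powr_powr)
  finally show ?thesis
    using X by (auto simp: ennreal_powr_def ennreal_leI)
qed

lemma le_powr_if_ennreal_powr_le:
  assumes "ennreal_powr X (1 / p) \<le> ennreal r" "0 \<le> r" "0 < p"
  shows "X \<le> ennreal (r powr p)"
proof -
  have X: "X \<noteq> \<infinity>"
    using assms(1) by (auto simp: ennreal_powr_def top_unique)
  then have "enn2real X powr (1 / p) \<le> r"
    using assms by (simp add: ennreal_powr_def)
  then have "(enn2real X powr (1 / p)) powr p \<le> r powr p"
    using assms by (intro powr_mono2) auto
  then have "enn2real X \<le> r powr p"
    using assms by (simp add: powr_powr)
  then have "ennreal (enn2real X) \<le> ennreal (r powr p)"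
    by (rule ennreal_leI)
  then show ?thesis
    using X by (cases X) auto
qed

lemma Lp_norm_eq: "Lp_norm p \<Omega> f = ennreal_powr (Ip p \<Omega> f) (1 / p)"
  by (simp add: Lp_norm_def Ip_def)

lemma slobodeckij_seminorm_eq:
  assumes "open \<Omega>" "f \<in> borel_measurable (lebesgue_on \<Omega>)"
  shows "slobodeckij_seminorm \<theta> p \<Omega> f = ennreal_powr (Gag \<theta> p \<Omega> f) (1 / p)"
  unfolding slobodeckij_seminorm_def using assms by (subst nn_integral_pair_eq_Gag) auto

lemma has_weak_deriv_weak_deriv: "has_weak_deriv \<Omega> \<nu> u g \<Longrightarrow> has_weak_deriv \<Omega> \<nu> u (weak_deriv \<Omega> \<nu> u)"
  unfolding weak_deriv_def by (rule someI[of "has_weak_deriv \<Omega> \<nu> u"])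

lemma has_weak_deriv_measurable:
  "open \<Omega> \<Longrightarrow> has_weak_deriv \<Omega> \<nu> u g \<Longrightarrow> g \<in> borel_measurable (lebesgue_on \<Omega>)"
  by (auto simp: has_weak_deriv_def intro: L1_loc_measurable)

lemma sobolev_norm_eq:
  assumes "0 < \<theta>" "\<theta> < 1"
  shows "sobolev_norm (real k + \<theta>) p \<Omega> u = sobolev_norm_int k p \<Omega> u +
     (\<Sum>\<nu> | mi_order \<nu> = k. slobodeckij_seminorm \<theta> p \<Omega> (weak_deriv \<Omega> \<nu> u))"
proof -
  have "\<lfloor>real k + \<theta>\<rfloor> = int k"
    using assms by (intro floor_unique) auto
  then have "nat \<lfloor>real k + \<theta>\<rfloor> = k" "frac (real k + \<theta>) = \<theta>"
    by (auto simp: frac_def)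
  then show ?thesis
    using assms by (simp add: sobolev_norm_def)
qed

lemma finite_mi_order_eq: "finite {\<nu> :: 'n::finite \<Rightarrow> nat. mi_order \<nu> = k}"
  by (rule finite_subset[OF _ finite_mi_order_le[of k]]) auto

lemma sobolev_norm_bounds:
  fixes u :: "real^'n::finite \<Rightarrow> real"
  assumes "0 < \<theta>" "\<theta> < 1" "0 < p" "open \<Omega>" and fin: "sobolev_norm (real k + \<theta>) p \<Omega> u = ennreal r" "0 \<le> r"
  shows "mi_order \<nu> \<le> k \<Longrightarrow> has_weak_deriv \<Omega> \<nu> u (weak_deriv \<Omega> \<nu> u)"
    and "mi_order \<nu> \<le> k \<Longrightarrow> Ip p \<Omega> (weak_deriv \<Omega> \<nu> u) \<le> ennreal (r powr p)"
    and "mi_order \<nu> = k \<Longrightarrow> Gag \<theta> p \<Omega> (weak_deriv \<Omega> \<nu> u) \<le> ennreal (r powr p)"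
proof -
  let ?I = "\<Sum>\<nu> | mi_order \<nu> \<le> k. Lp_norm p \<Omega> (weak_deriv \<Omega> \<nu> u)"
  let ?G = "\<Sum>\<nu> | mi_order \<nu> = k. slobodeckij_seminorm \<theta> p \<Omega> (weak_deriv \<Omega> \<nu> u)"
  have norm: "sobolev_norm_int k p \<Omega> u + ?G = ennreal r"
    using fin(1) by (simp add: sobolev_norm_eq[OF assms(1,2)])
  have ex: "\<forall>\<nu>. mi_order \<nu> \<le> k \<longrightarrow> (\<exists>g. has_weak_deriv \<Omega> \<nu> u g)"
  proof (rule ccontr)
    assume "\<not> ?thesis"
    then have "sobolev_norm_int k p \<Omega> u = \<infinity>"
      unfolding sobolev_norm_int_def by (rule if_not_P)
    with norm show False
      by simp
  qed
  then have int: "sobolev_norm_int k p \<Omega> u = ?I"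
    unfolding sobolev_norm_int_def by (rule if_P)
  show weak: "has_weak_deriv \<Omega> \<nu> u (weak_deriv \<Omega> \<nu> u)" if "mi_order \<nu> \<le> k" for \<nu>
    using ex that has_weak_deriv_weak_deriv by blast
  show "Ip p \<Omega> (weak_deriv \<Omega> \<nu> u) \<le> ennreal (r powr p)" if "mi_order \<nu> \<le> k"
  proof (rule le_powr_if_ennreal_powr_le)
    have "Lp_norm p \<Omega> (weak_deriv \<Omega> \<nu> u) \<le> ?I"
      using that by (intro member_le_sum finite_mi_order_le) auto
    also have "\<dots> \<le> ?I + ?G"
      by simp
    also have "\<dots> = ennreal r"
      using norm int by simp
    finally show "ennreal_powr (Ip p \<Omega> (weak_deriv \<Omega> \<nu> u)) (1 / p) \<le> ennreal r"
      by (simp add: Lp_norm_eq)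
  qed (use assms in auto)
  show "Gag \<theta> p \<Omega> (weak_deriv \<Omega> \<nu> u) \<le> ennreal (r powr p)" if "mi_order \<nu> = k"
  proof (rule le_powr_if_ennreal_powr_le)
    have "slobodeckij_seminorm \<theta> p \<Omega> (weak_deriv \<Omega> \<nu> u) \<le> ?G"
      using that by (intro member_le_sum finite_mi_order_eq) auto
    also have "\<dots> \<le> ?I + ?G"
      by simp
    also have "\<dots> = ennreal r"
      using norm int by simp
    finally show "ennreal_powr (Gag \<theta> p \<Omega> (weak_deriv \<Omega> \<nu> u)) (1 / p) \<le> ennreal r"
      using slobodeckij_seminorm_eq[OF \<open>open \<Omega>\<close> has_weak_deriv_measurable[OF \<open>open \<Omega>\<close> weak[of \<nu>]]] that by simp
  qed (use assms in auto)
qed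

context lipschitz_diffeo
begin

text \<open>The constant depends on the operator \<open>\<Phi>\<close> only, whose coefficients are functions of \<open>T\<close> alone.\<close>

lemma deriv_op_bounded:
  assumes "deriv_op m \<Phi>" and p: "0 < p" and \<theta>: "0 < \<theta>" "\<theta> < 1"
  shows "\<exists>C\<ge>0. \<forall>g R. 0 \<le> R \<longrightarrow> (\<forall>\<beta>. mi_order \<beta> \<le> k \<longrightarrow> g \<beta> \<in> borel_measurable (lebesgue_on V)
       \<and> Ip p V (g \<beta>) \<le> ennreal R \<and> Gag \<theta> p V (g \<beta>) \<le> ennreal R) \<longrightarrow>
     \<Phi> g \<in> borel_measurable (lebesgue_on U) \<and> Ip p U (\<Phi> g) \<le> ennreal (C * R) \<and> Gag \<theta> p U (\<Phi> g) \<le> ennreal (C * R)"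
  using assms(1)
proof induction
  case (monomial \<beta> m P)
  have U: "U \<in> sets lebesgue"
    using open_U by simp
  have "bdd_lip_deriv 0 U P"
    using bdd_lip_deriv_mono[OF monomial.hyps(3), of 0] by blast
  then obtain lip where P: "bounded (P ` U)" "lip-lipschitz_on U P"
    by auto
  obtain M where M: "\<And>x. x \<in> U \<Longrightarrow> \<bar>P x\<bar> \<le> M"
    using P(1) by (auto simp: bounded_iff)
  have Pm: "P \<in> borel_measurable (lebesgue_on U)"
    using continuous_imp_measurable_on_sets_lebesgue[OF lipschitz_on_continuous_on[OF P(2)] U] .
  obtain Cm where Cm: "\<And>f. f \<in> borel_measurable (lebesgue_on U) \<Longrightarrow> Gag \<theta> p U (\<lambda>x. f x * P x) \<le> ennreal Cm * (Gag \<theta> p U f + Ip p U f)"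
    using Gag_mult_le[OF p \<theta> U P] by blast
  obtain Jr where Jr: "Jr \<ge> 0" "J = ennreal Jr"
    using J_finite by (cases J) auto
  define La where "La = L powr (real CARD('n) + \<theta> * p)"
  have La: "La \<ge> 0"
    by (simp add: La_def)
  define C1 where "C1 = M powr p * Jr"
  define C2 where "C2 = \<bar>Cm\<bar> * (La * (Jr * Jr) + Jr)"
  have C12: "0 \<le> C1" "0 \<le> C2"
    using Jr La by (auto simp: C1_def C2_def)
  have bounds: "(\<lambda>x. g \<beta> (T x) * P x) \<in> borel_measurable (lebesgue_on U)"
    "Ip p U (\<lambda>x. g \<beta> (T x) * P x) \<le> ennreal (C1 * R)" "Gag \<theta> p U (\<lambda>x. g \<beta> (T x) * P x) \<le> ennreal (C2 * R)"
    if R: "0 \<le> R" and g: "g \<beta> \<in> borel_measurable (lebesgue_on V)" "Ip p V (g \<beta>) \<le> ennreal R" "Gag \<theta> p V (g \<beta>) \<le> ennreal R" for g R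
  proof -
    note [measurable] = g(1) Pm
    have gT[measurable]: "(\<lambda>x. g \<beta> (T x)) \<in> borel_measurable (lebesgue_on U)"
      by measurable
    show "(\<lambda>x. g \<beta> (T x) * P x) \<in> borel_measurable (lebesgue_on U)"
      by measurable
    have I: "Ip p U (\<lambda>x. g \<beta> (T x)) \<le> ennreal (Jr * R)"
    proof -
      have "Ip p U (\<lambda>x. g \<beta> (T x)) \<le> J * Ip p V (g \<beta>)"
        by (rule Ip_comp_le[OF g(1)])
      also have "\<dots> \<le> J * ennreal R"
        by (rule mult_left_mono[OF g(2)]) simp
      finally show ?thesis
        using Jr R by (simp add: ennreal_mult)
    qed
    have G: "Gag \<theta> p U (\<lambda>x. g \<beta> (T x)) \<le> ennreal (La * (Jr * Jr) * R)"
    proof -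
      have "Gag \<theta> p U (\<lambda>x. g \<beta> (T x)) \<le> ennreal La * (J * (J * Gag \<theta> p V (g \<beta>)))"
        unfolding La_def by (rule Gag_comp_le[OF p \<theta>(1) g(1)])
      also have "\<dots> \<le> ennreal La * (J * (J * ennreal R))"
        by (intro mult_left_mono g(3)) auto
      finally show ?thesis
        using Jr La R by (simp add: ennreal_mult mult.assoc)
    qed
    have "Ip p U (\<lambda>x. g \<beta> (T x) * P x) \<le> ennreal (M powr p) * Ip p U (\<lambda>x. g \<beta> (T x))"
      by (rule Ip_mult_le[OF p M gT])
    also have "\<dots> \<le> ennreal (M powr p) * ennreal (Jr * R)"
      by (rule mult_left_mono[OF I]) simp
    finally show "Ip p U (\<lambda>x. g \<beta> (T x) * P x) \<le> ennreal (C1 * R)"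
      using Jr R by (simp add: C1_def ennreal_mult mult.assoc)
    have "Gag \<theta> p U (\<lambda>x. g \<beta> (T x) * P x) \<le> ennreal Cm * (Gag \<theta> p U (\<lambda>x. g \<beta> (T x)) + Ip p U (\<lambda>x. g \<beta> (T x)))"
      by (rule Cm[OF gT])
    also have "\<dots> \<le> ennreal \<bar>Cm\<bar> * (ennreal (La * (Jr * Jr) * R) + ennreal (Jr * R))"
      by (intro mult_mono add_mono G I ennreal_leI) auto
    also have "\<dots> = ennreal (C2 * R)"
      using Jr La R by (simp add: C2_def distrib_right mult.assoc flip: ennreal_mult ennreal_plus)
    finally show "Gag \<theta> p U (\<lambda>x. g \<beta> (T x) * P x) \<le> ennreal (C2 * R)" .
  qed
  have "mi_order \<beta> \<le> k"
    using monomial.hyps by simp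
  have mono: "ennreal (C1 * R) \<le> ennreal ((C1 + C2) * R)" "ennreal (C2 * R) \<le> ennreal ((C1 + C2) * R)" if "0 \<le> R" for R
    using that C12 by (auto intro!: ennreal_leI mult_right_mono)
  show ?case
  proof (intro exI[of _ "C1 + C2"] conjI allI impI)
    show "0 \<le> C1 + C2"
      using C12 by simp
    fix g :: "('n \<Rightarrow> nat) \<Rightarrow> real^'n \<Rightarrow> real" and R
    assume R: "(0 :: real) \<le> R" and g: "\<forall>\<beta>. mi_order \<beta> \<le> k \<longrightarrow> g \<beta> \<in> borel_measurable (lebesgue_on V)
       \<and> Ip p V (g \<beta>) \<le> ennreal R \<and> Gag \<theta> p V (g \<beta>) \<le> ennreal R"
    then have g\<beta>: "g \<beta> \<in> borel_measurable (lebesgue_on V)" "Ip p V (g \<beta>) \<le> ennreal R" "Gag \<theta> p V (g \<beta>) \<le> ennreal R"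
      using \<open>mi_order \<beta> \<le> k\<close> by auto
    show "(\<lambda>x. g \<beta> (T x) * P x) \<in> borel_measurable (lebesgue_on U)"
      by (rule bounds(1)[where g = g, OF R g\<beta>])
    show "Ip p U (\<lambda>x. g \<beta> (T x) * P x) \<le> ennreal ((C1 + C2) * R)"
      by (rule order_trans[OF bounds(2)[where g = g, OF R g\<beta>] mono(1)[OF R]])
    show "Gag \<theta> p U (\<lambda>x. g \<beta> (T x) * P x) \<le> ennreal ((C1 + C2) * R)"
      by (rule order_trans[OF bounds(3)[where g = g, OF R g\<beta>] mono(2)[OF R]])
  qed
next
  case (add m \<Phi> \<Psi>)
  have U: "U \<in> sets lebesgue"
    using open_U by simp
  obtain C1 where C1: "C1 \<ge> 0" "\<And>g R. 0 \<le> R \<Longrightarrow> \<forall>\<beta>. mi_order \<beta> \<le> k \<longrightarrow> g \<beta> \<in> borel_measurable (lebesgue_on V)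
       \<and> Ip p V (g \<beta>) \<le> ennreal R \<and> Gag \<theta> p V (g \<beta>) \<le> ennreal R \<Longrightarrow>
     \<Phi> g \<in> borel_measurable (lebesgue_on U) \<and> Ip p U (\<Phi> g) \<le> ennreal (C1 * R) \<and> Gag \<theta> p U (\<Phi> g) \<le> ennreal (C1 * R)"
    using add.IH(1) by blast
  obtain C2 where C2: "C2 \<ge> 0" "\<And>g R. 0 \<le> R \<Longrightarrow> \<forall>\<beta>. mi_order \<beta> \<le> k \<longrightarrow> g \<beta> \<in> borel_measurable (lebesgue_on V)
       \<and> Ip p V (g \<beta>) \<le> ennreal R \<and> Gag \<theta> p V (g \<beta>) \<le> ennreal R \<Longrightarrow>
     \<Psi> g \<in> borel_measurable (lebesgue_on U) \<and> Ip p U (\<Psi> g) \<le> ennreal (C2 * R) \<and> Gag \<theta> p U (\<Psi> g) \<le> ennreal (C2 * R)"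
    using add.IH(2) by blast
  show ?case
  proof (intro exI[of _ "2 powr p * (C1 + C2)"] conjI allI impI)
    show "0 \<le> 2 powr p * (C1 + C2)"
      using C1(1) C2(1) by simp
    fix g :: "('n \<Rightarrow> nat) \<Rightarrow> real^'n \<Rightarrow> real" and R
    assume R: "(0 :: real) \<le> R" and g: "\<forall>\<beta>. mi_order \<beta> \<le> k \<longrightarrow> g \<beta> \<in> borel_measurable (lebesgue_on V)
       \<and> Ip p V (g \<beta>) \<le> ennreal R \<and> Gag \<theta> p V (g \<beta>) \<le> ennreal R"
    have 1: "\<Phi> g \<in> borel_measurable (lebesgue_on U)" "Ip p U (\<Phi> g) \<le> ennreal (C1 * R)" "Gag \<theta> p U (\<Phi> g) \<le> ennreal (C1 * R)"
      using C1(2)[OF R g] by auto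
    have 2: "\<Psi> g \<in> borel_measurable (lebesgue_on U)" "Ip p U (\<Psi> g) \<le> ennreal (C2 * R)" "Gag \<theta> p U (\<Psi> g) \<le> ennreal (C2 * R)"
      using C2(2)[OF R g] by auto
    have eq: "ennreal (2 powr p) * (ennreal (C1 * R) + ennreal (C2 * R)) = ennreal (2 powr p * (C1 + C2) * R)"
      using R C1(1) C2(1) by (simp add: distrib_right mult.assoc flip: ennreal_mult ennreal_plus)
    show "(\<lambda>x. \<Phi> g x + \<Psi> g x) \<in> borel_measurable (lebesgue_on U)"
      using 1(1) 2(1) by (rule borel_measurable_add)
    show "Ip p U (\<lambda>x. \<Phi> g x + \<Psi> g x) \<le> ennreal (2 powr p * (C1 + C2) * R)"
      using Ip_add_le[OF p 1(1) 2(1)] mult_left_mono[OF add_mono[OF 1(2) 2(2)], of "ennreal (2 powr p)"]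
      unfolding eq by (auto intro: order_trans)
    show "Gag \<theta> p U (\<lambda>x. \<Phi> g x + \<Psi> g x) \<le> ennreal (2 powr p * (C1 + C2) * R)"
      using Gag_add_le[OF p U 1(1) 2(1)] mult_left_mono[OF add_mono[OF 1(3) 2(3)], of "ennreal (2 powr p)"]
      unfolding eq by (auto intro: order_trans)
  qed
qed

text \<open>The fractional seminorm of \<open>u \<circ> T\<close> involves all derivatives of \<open>u\<close> of order at most \<open>k\<close>, also
  those whose fractional seminorm is not part of the norm of \<open>u\<close>; for these the embedding is used.\<close>

theorem sobolev_comp_bounded:
  fixes X :: "(real^'n \<Rightarrow> real) set"
  assumes p: "0 < p" and \<theta>: "0 < \<theta>" "\<theta> < 1" and s: "s = real k + \<theta>"
    and X: "X \<subseteq> sobolev_space s p V" and C0: "0 \<le> C0"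
    and emb: "\<And>u g \<beta>. u \<in> X \<Longrightarrow> weak_jet u g \<Longrightarrow> mi_order \<beta> < k \<Longrightarrow>
      Gag \<theta> p V (g \<beta>) \<le> ennreal C0 * (Ip p V (g \<beta>) + (\<Sum>i\<in>UNIV. Ip p V (g (\<lambda>j. \<beta> j + mi_unit i j))))"
  shows "\<exists>C. \<forall>u\<in>X. u \<circ> T \<in> sobolev_space s p U \<and> sobolev_norm s p U (u \<circ> T) \<le> ennreal C * sobolev_norm s p V u"
proof -
  let ?n = "real CARD('n)"
  define C1 where "C1 = 1 + C0 * (1 + ?n)"
  have C1: "1 \<le> C1"
    using C0 by (simp add: C1_def)
  have "\<forall>\<nu>. \<exists>\<Phi>. mi_order \<nu> \<le> k \<longrightarrow> deriv_op (mi_order \<nu>) \<Phi> \<and> (\<forall>u g. weak_jet u g \<longrightarrow> has_weak_deriv U \<nu> (u \<circ> T) (\<Phi> g))"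
    using weak_deriv_comp by blast
  from choice[OF this] obtain \<Phi> where \<Phi>: "\<And>\<nu>. mi_order \<nu> \<le> k \<Longrightarrow> deriv_op (mi_order \<nu>) (\<Phi> \<nu>)"
    "\<And>\<nu> u g. mi_order \<nu> \<le> k \<Longrightarrow> weak_jet u g \<Longrightarrow> has_weak_deriv U \<nu> (u \<circ> T) (\<Phi> \<nu> g)"
    by blast
  have "\<forall>\<nu>. \<exists>C. mi_order \<nu> \<le> k \<longrightarrow> C \<ge> 0 \<and> (\<forall>g R. 0 \<le> R \<longrightarrow> (\<forall>\<beta>. mi_order \<beta> \<le> k \<longrightarrow> g \<beta> \<in> borel_measurable (lebesgue_on V)
       \<and> Ip p V (g \<beta>) \<le> ennreal R \<and> Gag \<theta> p V (g \<beta>) \<le> ennreal R) \<longrightarrow>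
     \<Phi> \<nu> g \<in> borel_measurable (lebesgue_on U) \<and> Ip p U (\<Phi> \<nu> g) \<le> ennreal (C * R) \<and> Gag \<theta> p U (\<Phi> \<nu> g) \<le> ennreal (C * R))"
  proof
    fix \<nu> :: "'n \<Rightarrow> nat"
    show "\<exists>C. mi_order \<nu> \<le> k \<longrightarrow> C \<ge> 0 \<and> (\<forall>g R. 0 \<le> R \<longrightarrow> (\<forall>\<beta>. mi_order \<beta> \<le> k \<longrightarrow> g \<beta> \<in> borel_measurable (lebesgue_on V)
       \<and> Ip p V (g \<beta>) \<le> ennreal R \<and> Gag \<theta> p V (g \<beta>) \<le> ennreal R) \<longrightarrow>
     \<Phi> \<nu> g \<in> borel_measurable (lebesgue_on U) \<and> Ip p U (\<Phi> \<nu> g) \<le> ennreal (C * R) \<and> Gag \<theta> p U (\<Phi> \<nu> g) \<le> ennreal (C * R))"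
    proof (cases "mi_order \<nu> \<le> k")
      case True
      from deriv_op_bounded[OF \<Phi>(1)[OF True] p \<theta>] show ?thesis
        by (elim exE, intro exI impI)
    qed simp
  qed
  from choice[OF this] obtain c where c: "\<And>\<nu>. mi_order \<nu> \<le> k \<Longrightarrow> c \<nu> \<ge> 0"
    "\<And>\<nu> g R. mi_order \<nu> \<le> k \<Longrightarrow> 0 \<le> R \<Longrightarrow> \<forall>\<beta>. mi_order \<beta> \<le> k \<longrightarrow> g \<beta> \<in> borel_measurable (lebesgue_on V)
       \<and> Ip p V (g \<beta>) \<le> ennreal R \<and> Gag \<theta> p V (g \<beta>) \<le> ennreal R \<Longrightarrow>
     \<Phi> \<nu> g \<in> borel_measurable (lebesgue_on U) \<and> Ip p U (\<Phi> \<nu> g) \<le> ennreal (c \<nu> * R) \<and> Gag \<theta> p U (\<Phi> \<nu> g) \<le> ennreal (c \<nu> * R)"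
    by blast
  define d where "d \<nu> = (c \<nu> * C1) powr (1 / p)" for \<nu>
  define D where "D = (\<Sum>\<nu> | mi_order \<nu> \<le> k. d \<nu>) + (\<Sum>\<nu> | mi_order \<nu> = k. d \<nu>)"
  have d0: "0 \<le> d \<nu>" for \<nu>
    by (simp add: d_def)
  show ?thesis
  proof (intro exI[of _ D] ballI)
    fix u assume u: "u \<in> X"
    then have uV: "u \<in> Lp_space p V" "sobolev_norm s p V u < \<infinity>"
      using X by (auto simp: sobolev_space_def)
    then obtain r where r: "0 \<le> r" "sobolev_norm s p V u = ennreal r"
      by (cases "sobolev_norm s p V u") auto
    note nb = sobolev_norm_bounds[OF \<theta> p open_V r(2)[unfolded s] r(1)]
    \<comment> \<open>The representative that \<open>weak_deriv\<close> chooses for the derivative of order zero may differ from \<open>u\<close> on a null set.\<close>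
    define g where "g \<nu> = (if \<nu> = (\<lambda>_. 0) then u else weak_deriv V \<nu> u)" for \<nu>
    have zero: "mi_order (\<lambda>_ :: 'n. 0) \<le> k"
      by (simp add: mi_order_def)
    have u_loc: "u \<in> L1_loc V"
      using nb(1)[OF zero] by (simp add: has_weak_deriv_def)
    have ae0: "AE_eq_on V (weak_deriv V (\<lambda>_. 0) u) u"
      by (rule has_weak_deriv_unique[OF open_V nb(1)[OF zero] has_weak_deriv_zero[OF u_loc]])
    have jet: "weak_jet u g"
      unfolding weak_jet_def using nb(1) has_weak_deriv_zero[OF u_loc] by (auto simp: g_def)
    have gI: "Ip p V (g \<beta>) \<le> ennreal (r powr p)" if "mi_order \<beta> \<le> k" for \<beta>
      using nb(2)[OF that] Ip_cong_AE[OF ae0] by (auto simp: g_def)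
    have gG: "Gag \<theta> p V (g \<beta>) \<le> ennreal (C1 * r powr p)" if \<beta>: "mi_order \<beta> \<le> k" for \<beta>
    proof (cases "mi_order \<beta> = k")
      case True
      then have "\<beta> \<noteq> (\<lambda>_. 0)"
        using k_pos by (auto simp: mi_order_def)
      then have "Gag \<theta> p V (g \<beta>) \<le> ennreal (r powr p)"
        using nb(3)[OF True] by (simp add: g_def)
      also have "\<dots> \<le> ennreal (C1 * r powr p)"
        using mult_right_mono[OF C1, of "r powr p"] by (intro ennreal_leI) simp
      finally show ?thesis .
    next
      case False
      with \<beta> have "mi_order \<beta> < k"
        by simp
      from emb[OF u jet this]
      have "Gag \<theta> p V (g \<beta>) \<le> ennreal C0 * (Ip p V (g \<beta>) + (\<Sum>i\<in>UNIV. Ip p V (g (\<lambda>j. \<beta> j + mi_unit i j))))" .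
      also have "\<dots> \<le> ennreal C0 * (ennreal (r powr p) + (\<Sum>i\<in>(UNIV :: 'n set). ennreal (r powr p)))"
        using \<open>mi_order \<beta> < k\<close> by (intro mult_left_mono add_mono sum_mono gI) auto
      also have "\<dots> = ennreal (C0 * (1 + ?n) * r powr p)"
        using C0 by (simp add: distrib_right distrib_left ennreal_mult ennreal_of_nat_eq_real_of_nat mult.assoc
            flip: ennreal_plus ennreal_mult)
      also have "\<dots> \<le> ennreal (C1 * r powr p)"
        by (intro ennreal_leI mult_right_mono) (auto simp: C1_def)
      finally show ?thesis .
    qed
    have gI': "Ip p V (g \<beta>) \<le> ennreal (C1 * r powr p)" if "mi_order \<beta> \<le> k" for \<beta>
    proof -
      have "ennreal (r powr p) \<le> ennreal (C1 * r powr p)"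
        using mult_right_mono[OF C1, of "r powr p"] by (intro ennreal_leI) simp
      then show ?thesis
        using gI[OF that] by (rule order_trans[rotated])
    qed
    have gm: "g \<beta> \<in> borel_measurable (lebesgue_on V)" if "mi_order \<beta> \<le> k" for \<beta>
      using jet that has_weak_deriv_measurable[OF open_V] by (auto simp: weak_jet_def)
    have R: "0 \<le> C1 * r powr p"
      using C1 by simp
    have v: "\<Phi> \<nu> g \<in> borel_measurable (lebesgue_on U)" "Ip p U (\<Phi> \<nu> g) \<le> ennreal (c \<nu> * C1 * r powr p)"
      "Gag \<theta> p U (\<Phi> \<nu> g) \<le> ennreal (c \<nu> * C1 * r powr p)" if \<nu>: "mi_order \<nu> \<le> k" for \<nu>
      using c(2)[OF \<nu> R, of g] gm gI' gG by (auto simp: mult.assoc)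
    have w: "has_weak_deriv U \<nu> (u \<circ> T) (weak_deriv U \<nu> (u \<circ> T))"
      "AE_eq_on U (weak_deriv U \<nu> (u \<circ> T)) (\<Phi> \<nu> g)" if "mi_order \<nu> \<le> k" for \<nu>
    proof -
      note h = \<Phi>(2)[OF that jet]
      show w: "has_weak_deriv U \<nu> (u \<circ> T) (weak_deriv U \<nu> (u \<circ> T))"
        by (rule has_weak_deriv_weak_deriv[OF h])
      show "AE_eq_on U (weak_deriv U \<nu> (u \<circ> T)) (\<Phi> \<nu> g)"
        by (rule has_weak_deriv_unique[OF open_U w h])
    qed
    have Lp: "Lp_norm p U (weak_deriv U \<nu> (u \<circ> T)) \<le> ennreal (d \<nu> * r)" if "mi_order \<nu> \<le> k" for \<nu>
      unfolding Lp_norm_eq Ip_cong_AE[OF w(2)[OF that]] d_def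
      using v(2)[OF that] c(1)[OF that] C1 r(1) p by (intro ennreal_powr_le) auto
    have Sl: "slobodeckij_seminorm \<theta> p U (weak_deriv U \<nu> (u \<circ> T)) \<le> ennreal (d \<nu> * r)" if "mi_order \<nu> = k" for \<nu>
    proof -
      have \<nu>: "mi_order \<nu> \<le> k"
        using that by simp
      show ?thesis
        unfolding slobodeckij_seminorm_eq[OF open_U has_weak_deriv_measurable[OF open_U w(1)[OF \<nu>]]]
          Gag_cong_AE[OF w(2)[OF \<nu>]] d_def
        using v(3)[OF \<nu>] c(1)[OF \<nu>] C1 r(1) p by (intro ennreal_powr_le) auto
    qed
    have int: "sobolev_norm_int k p U (u \<circ> T) = (\<Sum>\<nu> | mi_order \<nu> \<le> k. Lp_norm p U (weak_deriv U \<nu> (u \<circ> T)))"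
      unfolding sobolev_norm_int_def using w(1) by (intro if_P) blast
    have "sobolev_norm s p U (u \<circ> T) \<le> (\<Sum>\<nu> | mi_order \<nu> \<le> k. ennreal (d \<nu> * r)) + (\<Sum>\<nu> | mi_order \<nu> = k. ennreal (d \<nu> * r))"
      unfolding s sobolev_norm_eq[OF \<theta>] int using Lp Sl by (intro add_mono sum_mono) auto
    also have "\<dots> = ennreal (D * r)"
      using d0 r(1) by (simp add: D_def distrib_right sum_distrib_right sum_nonneg flip: ennreal_plus)
    finally have norm: "sobolev_norm s p U (u \<circ> T) \<le> ennreal (D * r)" .
    have "u \<circ> T \<in> Lp_space p U"
    proof -
      have um: "u \<in> borel_measurable (lebesgue_on V)"
        using uV(1) by (simp add: Lp_space_def)
      have "(\<lambda>x. u (T x)) \<in> borel_measurable (lebesgue_on U)"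
        using um by measurable
      moreover have "Ip p U (\<lambda>x. u (T x)) < top"
      proof -
        have "Ip p V u < top"
          using gI[OF zero] by (simp add: g_def order_le_less_trans)
        then have "J * Ip p V u < top"
          using J_finite by (simp add: ennreal_mult_less_top)
        then show ?thesis
          using Ip_comp_le[OF um] by (rule order_le_less_trans[rotated])
      qed
      ultimately show ?thesis
        by (auto simp: Lp_space_def Lp_norm_eq comp_def ennreal_powr_def)
    qed
    moreover have "sobolev_norm s p U (u \<circ> T) < \<infinity>"
      using norm by (rule order_le_less_trans) simp
    moreover have "sobolev_norm s p U (u \<circ> T) \<le> ennreal D * sobolev_norm s p V u"
      using norm r by (simp add: ennreal_mult'')
    ultimately show "u \<circ> T \<in> sobolev_space s p U \<and> sobolev_norm s p U (u \<circ> T) \<le> ennreal D * sobolev_norm s p V u"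
      by (simp add: sobolev_space_def)
  qed
qed

lemma well_defined_bounded_linear_comp:
  assumes X: "\<And>u. u \<in> X \<Longrightarrow> u \<circ> T \<in> Y"
    and C: "\<And>u. u \<in> X \<Longrightarrow> normY (u \<circ> T) \<le> ennreal C * normX u"
  shows "well_defined_bounded_linear V X normX U Y normY (\<lambda>u. u \<circ> T)"
  unfolding well_defined_bounded_linear_def
proof (intro conjI ballI allI impI)
  fix u v assume "AE_eq_on V u v"
  then show "AE_eq_on U (u \<circ> T) (v \<circ> T)"
    using AE_comp[of "\<lambda>y. u y = v y"] by (simp add: AE_eq_on_def)
next
  show "AE_eq_on U ((\<lambda>x. a * u x + b * v x) \<circ> T) (\<lambda>x. a * (u \<circ> T) x + b * (v \<circ> T) x)" for u v a b
    by (simp add: AE_eq_on_def)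
qed (use assms in auto)

end

subsection \<open>Supports\<close>

text \<open>The union of all open sets on which \<open>u\<close> vanishes almost everywhere is by Lindelof's theorem a union of countably many
  of them, so that the exceptional null sets can be combined.\<close>

lemma AE_zero_outside_ess_support:
  assumes "open V" "ess_support V u \<subseteq> K"
  shows "AE x in lebesgue_on V. x \<notin> K \<longrightarrow> u x = 0"
proof -
  let ?F = "{W. open W \<and> W \<subseteq> V \<and> AE_eq_on W u (\<lambda>_. 0)}"
  obtain F where F: "F \<subseteq> ?F" "countable F" "\<Union> F = \<Union> ?F"
    using Lindelof[of ?F] by blast
  have "AE x in lebesgue. x \<in> W \<longrightarrow> u x = 0" if "W \<in> F" for W
  proof -
    have "open W" "AE_eq_on W u (\<lambda>_. 0)"
      using F(1) that by auto
    then show ?thesis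
      by (simp add: AE_eq_on_def AE_lebesgue_on_iff)
  qed
  then have "AE x in lebesgue. \<forall>W\<in>F. x \<in> W \<longrightarrow> u x = 0"
    using F(2) by (subst AE_ball_countable) auto
  then have "AE x in lebesgue. x \<in> V \<longrightarrow> x \<notin> K \<longrightarrow> u x = 0"
  proof (rule eventually_mono, intro impI)
    fix x assume *: "\<forall>W\<in>F. x \<in> W \<longrightarrow> u x = 0" and x: "x \<in> V" "x \<notin> K"
    then have "x \<in> \<Union> ?F"
      using assms(2) unfolding ess_support_def by blast
    then show "u x = 0"
      using * F(3) by blast
  qed
  then show ?thesis
    using assms(1) by (simp add: AE_lebesgue_on_iff)
qed

lemma test_fun_pderivs: "\<phi> \<in> test_fun \<Omega> \<Longrightarrow> pderivs xs \<phi> \<in> test_fun \<Omega>"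
  by (induction xs) (auto intro: test_fun_partial_deriv)

lemma test_fun_zero: "\<phi> \<in> test_fun \<Omega> \<Longrightarrow> x \<notin> \<Omega> \<Longrightarrow> \<phi> x = 0"
  using closure_subset[of "{x. \<phi> x \<noteq> 0}"] by (auto simp: test_fun_def)

text \<open>Test functions supported outside \<open>K\<close> cannot distinguish \<open>u\<close> from zero.\<close>

lemma weak_deriv_zero_outside:
  fixes V :: "(real^'n::finite) set"
  assumes "open V" "closed K" and weak: "has_weak_deriv V \<nu> u g"
    and zero: "AE x in lebesgue_on V. x \<notin> K \<longrightarrow> u x = 0"
  shows "AE x in lebesgue_on V. x \<notin> K \<longrightarrow> g x = 0"
proof -
  let ?W = "V - K"
  have W: "open ?W" "?W \<in> sets lebesgue" and V: "V \<in> sets lebesgue"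
    using assms by (auto simp: open_Diff)
  have "AE_eq_on ?W g (\<lambda>_. 0)"
  proof (rule AE_zero_if_integrals_zero[OF W(1)])
    show "g \<in> L1_loc ?W"
      using weak by (auto simp: has_weak_deriv_def L1_loc_def)
    fix \<phi> assume \<phi>: "\<phi> \<in> test_fun ?W"
    then have \<phi>V: "\<phi> \<in> test_fun V"
      by (rule test_fun_mono[rotated]) auto
    have \<phi>': "mi_deriv \<nu> \<phi> \<in> test_fun ?W"
      unfolding mi_deriv_eq_pderivs by (rule test_fun_pderivs[OF \<phi>])
    have "(LINT x|lebesgue_on ?W. g x * \<phi> x) = (LINT x|lebesgue_on V. g x * \<phi> x)"
      unfolding integral_lebesgue_on_eq[OF W(2)] integral_lebesgue_on_eq[OF V]
      by (intro Bochner_Integration.integral_cong) (use test_fun_zero[OF \<phi>] in \<open>auto simp: indicator_def\<close>)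
    moreover have "(LINT x|lebesgue_on V. u x * mi_deriv \<nu> \<phi> x) = (- 1) ^ mi_order \<nu> * (LINT x|lebesgue_on V. g x * \<phi> x)"
      using weak \<phi>V by (simp add: has_weak_deriv_def)
    moreover have "(LINT x|lebesgue_on V. u x * mi_deriv \<nu> \<phi> x) = 0"
    proof (rule integral_eq_zero_AE)
      show "AE x in lebesgue_on V. u x * mi_deriv \<nu> \<phi> x = 0"
        using zero by (rule eventually_mono) (use test_fun_zero[OF \<phi>'] in auto)
    qed
    ultimately show "(LINT x|lebesgue_on ?W. g x * \<phi> x) = 0"
      by simp
  qed
  then have "AE x in lebesgue. x \<in> ?W \<longrightarrow> g x = 0"
    using W(2) by (simp add: AE_eq_on_def AE_lebesgue_on_iff)
  then have "AE x in lebesgue. x \<in> V \<longrightarrow> x \<notin> K \<longrightarrow> g x = 0"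
    by (rule eventually_mono) auto
  then show ?thesis
    using V by (simp add: AE_lebesgue_on_iff)
qed

lemma (in lipschitz_diffeo) ess_support_comp:
  assumes "ess_support V u \<subseteq> K"
  shows "ess_support U (u \<circ> T) \<subseteq> T -` K \<inter> U"
proof
  fix x assume x: "x \<in> ess_support U (u \<circ> T)"
  then have xU: "x \<in> U"
    by (simp add: ess_support_def)
  have "T x \<in> K"
  proof (rule ccontr)
    assume "T x \<notin> K"
    then obtain W where W: "open W" "W \<subseteq> V" "AE_eq_on W u (\<lambda>_. 0)" "T x \<in> W"
      using assms T_in[OF xU] unfolding ess_support_def by blast
    let ?W = "T -` W \<inter> U"
    have oW: "open ?W"
      using continuous_open_preimage[OF T_continuous_on open_U W(1)] by (simp add: Int_commute)
    have "AE y in lebesgue. y \<in> W \<longrightarrow> u y = 0"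
      using W by (simp add: AE_eq_on_def AE_lebesgue_on_iff)
    then have "AE y in lebesgue_on V. y \<in> W \<longrightarrow> u y = 0"
      using open_V by (simp add: AE_lebesgue_on_iff eventually_mono)
    from AE_comp[OF this] have "AE x in lebesgue. x \<in> U \<longrightarrow> T x \<in> W \<longrightarrow> u (T x) = 0"
      using open_U by (simp add: AE_lebesgue_on_iff)
    then have "AE x in lebesgue. x \<in> ?W \<longrightarrow> u (T x) = 0"
      by (rule eventually_mono) auto
    then have "AE_eq_on ?W (u \<circ> T) (\<lambda>_. 0)"
      using oW by (simp add: AE_eq_on_def AE_lebesgue_on_iff)
    then show False
      using x oW xU W(4) unfolding ess_support_def by blast
  qed
  with xU show "x \<in> T -` K \<inter> U"
    by simp
qed

subsection \<open>Smooth maps with Lipschitz derivatives\<close>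

lemma lipschitz_diffeo_if_k_smooth:
  fixes U V :: "(real^'n::finite) set" and T :: "real^'n \<Rightarrow> real^'n"
  assumes "k \<ge> 1" "open U" "open V" "k_smooth k U V T" "\<exists>L. L-lipschitz_on U T"
    and lip: "\<forall>\<nu> j. mi_order \<nu> \<le> k \<longrightarrow> (\<exists>L. L-lipschitz_on U (mi_deriv \<nu> (\<lambda>x. T x $ j)))"
  obtains L B where "lipschitz_diffeo U V T (inv_into U T) k L B"
proof -
  have bij: "bij_betw T U V" and T: "\<And>j. BCk_on k U (\<lambda>x. T x $ j)" and S: "\<And>j. BCk_on k V (\<lambda>y. inv_into U T y $ j)"
    using assms(4) by (auto simp: k_smooth_def)
  obtain L where L: "L-lipschitz_on U T"
    using assms(5) by blast
  have "\<forall>i j. \<exists>b. \<forall>y\<in>V. \<bar>partial_deriv i (\<lambda>y. inv_into U T y $ j) y\<bar> \<le> b"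
  proof (intro allI)
    fix i j
    have "bounded (mi_deriv (mi_unit i) (\<lambda>y. inv_into U T y $ j) ` V)"
      using S[of j] \<open>k \<ge> 1\<close> by (simp add: BCk_on_def)
    then show "\<exists>b. \<forall>y\<in>V. \<bar>partial_deriv i (\<lambda>y. inv_into U T y $ j) y\<bar> \<le> b"
      by (auto simp: bounded_iff mi_deriv_unit)
  qed
  then obtain b where b: "\<And>i j y. y \<in> V \<Longrightarrow> \<bar>partial_deriv i (\<lambda>y. inv_into U T y $ j) y\<bar> \<le> b i j"
    by metis
  let ?B = "1 + (\<Sum>i\<in>UNIV. \<Sum>j\<in>UNIV. \<bar>b i j\<bar>)"
  have "lipschitz_diffeo U V T (inv_into U T) k (L + 1) ?B"
  proof
    show "T x \<in> V" if "x \<in> U" for x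
      using bij that by (auto simp: bij_betw_def)
    show "inv_into U T y \<in> U" if "y \<in> V" for y
      using bij that by (metis bij_betw_def inv_into_into)
    show "inv_into U T (T x) = x" if "x \<in> U" for x
      using bij that by (simp add: bij_betw_inv_into_left)
    show "T (inv_into U T y) = y" if "y \<in> V" for y
      using bij that by (simp add: bij_betw_inv_into_right)
    show "bdd_lip_deriv k U (\<lambda>x. T x $ j)" for j
      using T[of j] lip \<open>open U\<close> by (intro bdd_lip_deriv_if_mi_deriv) (auto simp: BCk_on_def)
    show "norm (T x - T y) \<le> (L + 1) * norm (x - y)" if "x \<in> U" "y \<in> U" for x y
    proof -
      have "norm (T x - T y) \<le> L * norm (x - y)"
        using lipschitz_onD[OF L that] by (simp add: dist_norm)
      also have "\<dots> \<le> (L + 1) * norm (x - y)"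
        by (intro mult_right_mono) auto
      finally show ?thesis .
    qed
    show "L + 1 > 0"
      using lipschitz_on_nonneg[OF L] by simp
    show "(\<lambda>y. inv_into U T y $ j) differentiable_on V" for j
    proof -
      have "Ck_on (Suc 0) V (\<lambda>y. inv_into U T y $ j)"
        using Ck_on_mono[of k V "\<lambda>y. inv_into U T y $ j" "Suc 0"] S[of j] \<open>k \<ge> 1\<close>
        unfolding BCk_on_def by linarith
      then show ?thesis
        by simp
    qed
    show "\<bar>partial_deriv i (\<lambda>y. inv_into U T y $ j) y\<bar> \<le> ?B" if "y \<in> V" for i j y
    proof -
      have "\<bar>b i j\<bar> \<le> (\<Sum>j\<in>UNIV. \<bar>b i j\<bar>)"
        by (rule member_le_sum) auto
      also have "\<dots> \<le> (\<Sum>i\<in>UNIV. \<Sum>j\<in>UNIV. \<bar>b i j\<bar>)"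
        by (rule member_le_sum) (auto intro: sum_nonneg)
      finally show ?thesis
        using b[OF that, of i j] by linarith
    qed
    show "?B > 0"
      by (simp add: add_pos_nonneg sum_nonneg)
  qed (use assms in auto)
  then show thesis
    by (rule that)
qed

text \<open>The components of the inverse are bounded, being derivatives of order zero.\<close>

lemma bounded_if_k_smooth:
  fixes U V :: "(real^'n::finite) set"
  assumes "k_smooth k U V T"
  shows "bounded U"
proof -
  have bij: "bij_betw T U V" and S: "\<And>j. BCk_on k V (\<lambda>y. inv_into U T y $ j)"
    using assms by (auto simp: k_smooth_def)
  have "\<forall>j. \<exists>b. \<forall>y\<in>V. \<bar>inv_into U T y $ j\<bar> \<le> b"
  proof
    fix j
    have "bounded (mi_deriv (\<lambda>_. 0) (\<lambda>y. inv_into U T y $ j) ` V)"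
      using S[of j] by (simp add: BCk_on_def mi_order_def del: mi_deriv_zero)
    then show "\<exists>b. \<forall>y\<in>V. \<bar>inv_into U T y $ j\<bar> \<le> b"
      by (auto simp: bounded_iff)
  qed
  then obtain b where b: "\<And>j y. y \<in> V \<Longrightarrow> \<bar>inv_into U T y $ j\<bar> \<le> b j"
    by metis
  have "norm x \<le> (\<Sum>j\<in>UNIV. b j)" if "x \<in> U" for x
  proof -
    have y: "T x \<in> V" "inv_into U T (T x) = x"
      using bij_betw_apply[OF bij that] bij_betw_inv_into_left[OF bij that] by auto
    have "norm x \<le> (\<Sum>j\<in>UNIV. \<bar>x $ j\<bar>)"
      by (rule norm_le_l1_cart)
    also have "\<dots> \<le> (\<Sum>j\<in>UNIV. b j)"
      using b[OF y(1)] by (intro sum_mono) (simp add: y(2))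
    finally show ?thesis .
  qed
  then show ?thesis
    by (auto simp: bounded_iff)
qed

theorem theorem7p60:
  fixes k :: nat and \<theta> s p :: real
    and U V :: "(real^'n::finite) set" and T :: "real^'n \<Rightarrow> real^'n"
  assumes "k \<ge> 1" and "0 < \<theta>" and "\<theta> < 1" and "s = real k + \<theta>" and "1 < p"
    and "open U" and "U \<noteq> {}" and "open V" and "V \<noteq> {}"
    and "k_smooth k U V T"
    and "\<exists>L. L-lipschitz_on U T"
    and "\<forall>\<nu> j. mi_order \<nu> \<le> k \<longrightarrow> (\<exists>L. L-lipschitz_on U (mi_deriv \<nu> (\<lambda>x. T x $ j)))"
  shows "(\<forall>K. compact K \<and> K \<subseteq> V \<longrightarrow>
            compact (T -` K \<inter> U) \<and>
            well_defined_bounded_linear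
              V (sobolev_space_supp s p V K) (sobolev_norm s p V)
              U (sobolev_space_supp s p U (T -` K \<inter> U)) (sobolev_norm s p U)
              (\<lambda>u. u \<circ> T))
       \<and> (lipschitz_domain V \<longrightarrow>
            lipschitz_domain U \<and>
            well_defined_bounded_linear
              V (sobolev_space s p V) (sobolev_norm s p V)
              U (sobolev_space s p U) (sobolev_norm s p U)
              (\<lambda>u. u \<circ> T))"
proof -
  obtain L B where "lipschitz_diffeo U V T (inv_into U T) k L B"
    using lipschitz_diffeo_if_k_smooth[OF assms(1,6,8,10,11,12)] by blast
  then interpret lipschitz_diffeo U V T "inv_into U T" k L B .
  have p: "0 < p" "1 \<le> p"
    using \<open>1 < p\<close> by auto
  show ?thesis
  proof (intro conjI allI impI)
    fix K assume K: "compact K \<and> K \<subseteq> V"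
    have "compact (inv_into U T ` K)"
      using K continuous_on_subset[OF S_continuous_on] by (blast intro: compact_continuous_image)
    then show "compact (T -` K \<inter> U)"
      using K vimage_T[of K] by simp
    obtain C0 where C0: "0 \<le> C0" "\<And>u g. (\<And>i. has_weak_deriv V (mi_unit i) u (g i)) \<Longrightarrow> (AE x in lebesgue_on V. x \<notin> K \<longrightarrow> u x = 0) \<Longrightarrow>
       Gag \<theta> p V u \<le> ennreal C0 * (Ip p V u + (\<Sum>i\<in>UNIV. Ip p V (g i)))"
      using Gag_embedding_compact_support[OF open_V _ _ assms(2,3) p(2), of K] K by blast
    have "\<exists>C. \<forall>u\<in>sobolev_space_supp s p V K. u \<circ> T \<in> sobolev_space s p U \<and> sobolev_norm s p U (u \<circ> T) \<le> ennreal C * sobolev_norm s p V u"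
    proof (rule sobolev_comp_bounded[OF p(1) assms(2,3,4) _ C0(1)])
      show "sobolev_space_supp s p V K \<subseteq> sobolev_space s p V"
        by (auto simp: sobolev_space_supp_def)
      fix u and g :: "('n \<Rightarrow> nat) \<Rightarrow> real^'n \<Rightarrow> real" and \<beta> :: "'n \<Rightarrow> nat" assume u: "u \<in> sobolev_space_supp s p V K" and jet: "weak_jet u g" and \<beta>: "mi_order \<beta> < k"
      have "AE x in lebesgue_on V. x \<notin> K \<longrightarrow> u x = 0"
        using u by (intro AE_zero_outside_ess_support[OF open_V]) (simp add: sobolev_space_supp_def)
      moreover have "has_weak_deriv V \<beta> u (g \<beta>)"
        using jet \<beta> by (simp add: weak_jet_def)
      \<comment> \<open>The embedding is applied to the derivatives of \<open>u\<close>, which also vanish outside \<open>K\<close>.\<close>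
      ultimately have "AE x in lebesgue_on V. x \<notin> K \<longrightarrow> g \<beta> x = 0"
        using K compact_imp_closed weak_deriv_zero_outside[OF open_V] by blast
      then show "Gag \<theta> p V (g \<beta>) \<le> ennreal C0 * (Ip p V (g \<beta>) + (\<Sum>i\<in>UNIV. Ip p V (g (\<lambda>j. \<beta> j + mi_unit i j))))"
        by (rule C0(2)[OF weak_jet_step[OF jet \<beta>]])
    qed
    then obtain C where C: "\<And>u. u \<in> sobolev_space_supp s p V K \<Longrightarrow> u \<circ> T \<in> sobolev_space s p U"
      "\<And>u. u \<in> sobolev_space_supp s p V K \<Longrightarrow> sobolev_norm s p U (u \<circ> T) \<le> ennreal C * sobolev_norm s p V u"
      by blast
    show "well_defined_bounded_linear V (sobolev_space_supp s p V K) (sobolev_norm s p V)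
        U (sobolev_space_supp s p U (T -` K \<inter> U)) (sobolev_norm s p U) (\<lambda>u. u \<circ> T)"
    proof (rule well_defined_bounded_linear_comp)
      show "u \<circ> T \<in> sobolev_space_supp s p U (T -` K \<inter> U)" if "u \<in> sobolev_space_supp s p V K" for u
        using C(1)[OF that] ess_support_comp that by (auto simp: sobolev_space_supp_def)
    qed (rule C(2))
  next
    assume V: "lipschitz_domain V"
    show "lipschitz_domain U"
      by (rule lipschitz_domain_pullback[OF V \<open>U \<noteq> {}\<close> bounded_if_k_smooth[OF assms(10)]])
    obtain C0 where C0: "0 \<le> C0" "\<And>u g. (\<And>i. has_weak_deriv V (mi_unit i) u (g i)) \<Longrightarrow>
       Gag \<theta> p V u \<le> ennreal C0 * (Ip p V u + (\<Sum>i\<in>UNIV. Ip p V (g i)))"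
      using Gag_embedding_lipschitz_domain[OF V assms(2,3) p(2)] by blast
    have "\<exists>C. \<forall>u\<in>sobolev_space s p V. u \<circ> T \<in> sobolev_space s p U \<and> sobolev_norm s p U (u \<circ> T) \<le> ennreal C * sobolev_norm s p V u"
      by (rule sobolev_comp_bounded[OF p(1) assms(2,3,4) order_refl C0(1)]) (rule C0(2)[OF weak_jet_step])
    then show "well_defined_bounded_linear V (sobolev_space s p V) (sobolev_norm s p V)
        U (sobolev_space s p U) (sobolev_norm s p U) (\<lambda>u. u \<circ> T)"
      by (blast intro: well_defined_bounded_linear_comp)
  qed
qed

end
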